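(* For every pointed derivator $\mathscr D$, $n\in\mathbb N$, and $1\le i<j\le n$ there is a canonical isomorphism $$C^{e_i}\circ C^{e_j}\cong C^{e_{j-1}}\circ C^{e_i}\colon\mathscr D^{\square^n}\to\mathscr D^{\square^{n-2}}.$$
   Context: Derivators. $\mathrm{Cat}$ is the 2-category of small categories, $\mathrm{CAT}$ that of not necessarily small categories, $\mathbb 1$ the terminal category. A prederivator is a strict 2-functor $\mathscr D\colon\mathrm{Cat}^{\mathrm{op}}\to\mathrm{CAT}$ (1-cells reversed); write $u^*=\mathscr D(u)$. It is a derivator if: (Der1) $\mathscr D(\coprod_i A_i)\to\prod_i\mathscr D(A_i)$ is an equivalence; (Der2) a morphism $f$ of $\mathscr D(A)$ is invertible iff $f_a:=a^*f$ is invertible for all objects $a\colon\mathbb 1\to A$; (Der3) every $u^*$ has a left adjoint $u_!$ and a right adjoint $u_*$; (Der4) for $u\colon A\to B$ and $b\in B$ the canonical maps $\operatorname{colim}_{(u/b)}p^*X\to (u_!X)_b$ and $(u_*X)_b\to\lim_{(b/u)}q^*X$ are isomorphisms, where $p\colon(u/b)\to A$, $q\colon (b/u)\to A$ are the projections and $\operatorname{colim}_A=\pi_!$, $\lim_A=\pi_*$ for $\pi\colon A\to\mathbb 1$. Morphisms of derivators are pseudo-natural transformations; natural transformations between them are modifications. For $A\in\mathrm{Cat}$, $\mathscr D^A$ is the derivator $B\mapsto\mathscr D(A\times B)$; a functor $u\colon A\to B$ induces morphisms of derivators $u^*\colon\mathscr D^B\to\mathscr D^A$ and $u_!,u_*\colon\mathscr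 D^A\to\mathscr D^B$. $\mathscr D$ is pointed if $\mathscr D(\mathbb 1)$ has a zero object. Cofibers and cones. Let $[1]=(0<1)$, $\square=[1]^2$, $\ulcorner=\square\setminus\{(1,1)\}$, $i_\ulcorner\colon\ulcorner\to\square$ the inclusion, and let $[1]\to\ulcorner$, denoted $\epsilon$, be the functor $0\mapsto(0,0)$, $1\mapsto(1,0)$. For $\mathscr D$ pointed, $\mathsf{cof}\colon\mathscr D^{[1]}\to\mathscr D^{[1]}$ is $(i_\ulcorner)_!\,\epsilon_*$ followed by restriction to the edge $(1,0)\to(1,1)$; it sends $f\colon x\to y$ to $y\to Cf$. The cone is $C=1^*\circ\mathsf{cof}\colon\mathscr D^{[1]}\to\mathscr D$. Cubes. $\square^n$ is the power set of $\{1,\dots,n\}$, identified with $[1]^n$. For $1\le i\le n$, $C^{e_i}\colon\mathscr D^{\square^n}\to\mathscr D^{\square^{n-1}}$ applies the cone $C$ in the $i$-th coordinate, treating the remaining $n-1$ copies of $[1]$ as parameters (in their given order). *)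

theory Defs
  imports Main "HOL-Library.FuncSet" "HOL-Library.Equipollence"
begin

section \<open>Categories, functors, natural transformations\<close>

record ('o, 'm) cat =
  Obj :: "'o set"
  Arr :: "'m set"
  Dom :: "'m \<Rightarrow> 'o"
  Cod :: "'m \<Rightarrow> 'o"
  Id :: "'o \<Rightarrow> 'm"
  Comp :: "'m \<Rightarrow> 'm \<Rightarrow> 'm"

text \<open>\<open>Comp C g f\<close> is \<open>g\<close> after \<open>f\<close>. The operations of a category are unconstrained outside
  the objects and (composable) arrows; two records that differ only there are two isomorphic
  objects of the 2-category of categories.\<close>

definition in_hom :: "('o, 'm) cat \<Rightarrow> 'm \<Rightarrow> 'o \<Rightarrow> 'o \<Rightarrow> bool" where
  "in_hom C f x y \<longleftrightarrow> f \<in> Arr C \<and> Dom C f = x \<and> Cod C f = y"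

definition is_cat :: "('o, 'm) cat \<Rightarrow> bool" where
  "is_cat C \<longleftrightarrow>
     (\<forall>f\<in>Arr C. Dom C f \<in> Obj C \<and> Cod C f \<in> Obj C) \<and>
     (\<forall>x\<in>Obj C. in_hom C (Id C x) x x) \<and>
     (\<forall>f\<in>Arr C. \<forall>g\<in>Arr C. Cod C f = Dom C g \<longrightarrow>
        in_hom C (Comp C g f) (Dom C f) (Cod C g)) \<and>
     (\<forall>f\<in>Arr C. Comp C f (Id C (Dom C f)) = f \<and> Comp C (Id C (Cod C f)) f = f) \<and>
     (\<forall>f\<in>Arr C. \<forall>g\<in>Arr C. \<forall>h\<in>Arr C. Cod C f = Dom C g \<and> Cod C g = Dom C h \<longrightarrow>
        Comp C h (Comp C g f) = Comp C (Comp C h g) f)"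

definition inverse_arrows :: "('o, 'm) cat \<Rightarrow> 'm \<Rightarrow> 'm \<Rightarrow> bool" where
  "inverse_arrows C f g \<longleftrightarrow>
     f \<in> Arr C \<and> in_hom C g (Cod C f) (Dom C f) \<and>
     Comp C g f = Id C (Dom C f) \<and> Comp C f g = Id C (Cod C f)"

definition is_iso :: "('o, 'm) cat \<Rightarrow> 'm \<Rightarrow> bool" where
  "is_iso C f \<longleftrightarrow> (\<exists>g. inverse_arrows C f g)"

definition inv_arr :: "('o, 'm) cat \<Rightarrow> 'm \<Rightarrow> 'm" where
  "inv_arr C f = (THE g. inverse_arrows C f g)"

definition initial_obj :: "('o, 'm) cat \<Rightarrow> 'o \<Rightarrow> bool" where
  "initial_obj C z \<longleftrightarrow> z \<in> Obj C \<and> (\<forall>x\<in>Obj C. \<exists>!f. in_hom C f z x)"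

definition terminal_obj :: "('o, 'm) cat \<Rightarrow> 'o \<Rightarrow> bool" where
  "terminal_obj C z \<longleftrightarrow> z \<in> Obj C \<and> (\<forall>x\<in>Obj C. \<exists>!f. in_hom C f x z)"

definition zero_obj :: "('o, 'm) cat \<Rightarrow> 'o \<Rightarrow> bool" where
  "zero_obj C z \<longleftrightarrow> initial_obj C z \<and> terminal_obj C z"

text \<open>Functors and natural transformations carry their source and target, and their underlying
  maps are required to be \<^term>\<open>undefined\<close> off the source category (\<^term>\<open>extensional\<close>). Hence
  equality of records is equality of functors resp. of natural transformations, which gives the
  strictness conditions below their literal meaning.\<close>

record ('a, 'b, 'c, 'd) func =
  Src :: "('a, 'b) cat"
  Tgt :: "('c, 'd) cat"
  FO :: "'a \<Rightarrow> 'c"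
  FM :: "'b \<Rightarrow> 'd"

definition mk_func ::
  "('a, 'b) cat \<Rightarrow> ('c, 'd) cat \<Rightarrow> ('a \<Rightarrow> 'c) \<Rightarrow> ('b \<Rightarrow> 'd) \<Rightarrow> ('a, 'b, 'c, 'd) func" where
  "mk_func A B fo fm =
     \<lparr>Src = A, Tgt = B, FO = restrict fo (Obj A), FM = restrict fm (Arr A)\<rparr>"

definition is_func :: "('a, 'b, 'c, 'd) func \<Rightarrow> bool" where
  "is_func F \<longleftrightarrow>
     is_cat (Src F) \<and> is_cat (Tgt F) \<and>
     FO F \<in> Obj (Src F) \<rightarrow>\<^sub>E Obj (Tgt F) \<and> FM F \<in> Arr (Src F) \<rightarrow>\<^sub>E Arr (Tgt F) \<and>
     (\<forall>f\<in>Arr (Src F). in_hom (Tgt F) (FM F f) (FO F (Dom (Src F) f)) (FO F (Cod (Src F) f))) \<and>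
     (\<forall>x\<in>Obj (Src F). FM F (Id (Src F) x) = Id (Tgt F) (FO F x)) \<and>
     (\<forall>f\<in>Arr (Src F). \<forall>g\<in>Arr (Src F). Cod (Src F) f = Dom (Src F) g \<longrightarrow>
        FM F (Comp (Src F) g f) = Comp (Tgt F) (FM F g) (FM F f))"

definition id_func :: "('a, 'b) cat \<Rightarrow> ('a, 'b, 'a, 'b) func" where
  "id_func A = mk_func A A (\<lambda>x. x) (\<lambda>f. f)"

definition comp_func ::
  "('c, 'd, 'e, 'f) func \<Rightarrow> ('a, 'b, 'c, 'd) func \<Rightarrow> ('a, 'b, 'e, 'f) func"
  (infixr \<open>\<circ>\<^sub>f\<close> 65) where
  "G \<circ>\<^sub>f F = mk_func (Src F) (Tgt G) (\<lambda>x. FO G (FO F x)) (\<lambda>f. FM G (FM F f))"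

record ('a, 'b, 'c, 'd) ntrans =
  NSrc :: "('a, 'b, 'c, 'd) func"
  NTgt :: "('a, 'b, 'c, 'd) func"
  Cmp :: "'a \<Rightarrow> 'd"

definition mk_ntrans ::
  "('a, 'b, 'c, 'd) func \<Rightarrow> ('a, 'b, 'c, 'd) func \<Rightarrow> ('a \<Rightarrow> 'd) \<Rightarrow> ('a, 'b, 'c, 'd) ntrans" where
  "mk_ntrans F G t = \<lparr>NSrc = F, NTgt = G, Cmp = restrict t (Obj (Src F))\<rparr>"

definition is_ntrans :: "('a, 'b, 'c, 'd) ntrans \<Rightarrow> bool" where
  "is_ntrans \<tau> \<longleftrightarrow>
     (let F = NSrc \<tau>; G = NTgt \<tau>; A = Src F; B = Tgt F in
       is_func F \<and> is_func G \<and> Src G = A \<and> Tgt G = B \<and>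
       Cmp \<tau> \<in> extensional (Obj A) \<and>
       (\<forall>x\<in>Obj A. in_hom B (Cmp \<tau> x) (FO F x) (FO G x)) \<and>
       (\<forall>f\<in>Arr A. Comp B (Cmp \<tau> (Cod A f)) (FM F f) = Comp B (FM G f) (Cmp \<tau> (Dom A f))))"

definition is_niso :: "('a, 'b, 'c, 'd) ntrans \<Rightarrow> bool" where
  "is_niso \<tau> \<longleftrightarrow>
     is_ntrans \<tau> \<and> (\<forall>x\<in>Obj (Src (NSrc \<tau>)). is_iso (Tgt (NSrc \<tau>)) (Cmp \<tau> x))"

definition id_nt :: "('a, 'b, 'c, 'd) func \<Rightarrow> ('a, 'b, 'c, 'd) ntrans" where
  "id_nt F = mk_ntrans F F (\<lambda>x. Id (Tgt F) (FO F x))"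

definition vcomp ::
  "('a, 'b, 'c, 'd) ntrans \<Rightarrow> ('a, 'b, 'c, 'd) ntrans \<Rightarrow> ('a, 'b, 'c, 'd) ntrans"
  (infixr \<open>\<bullet>\<close> 55) where
  "\<tau> \<bullet> \<sigma> = mk_ntrans (NSrc \<sigma>) (NTgt \<tau>) (\<lambda>x. Comp (Tgt (NTgt \<tau>)) (Cmp \<tau> x) (Cmp \<sigma> x))"

definition lwhisk ::
  "('c, 'd, 'e, 'f) func \<Rightarrow> ('a, 'b, 'c, 'd) ntrans \<Rightarrow> ('a, 'b, 'e, 'f) ntrans"
  (infixr \<open>\<lhd>\<close> 60) where
  "G \<lhd> \<sigma> = mk_ntrans (G \<circ>\<^sub>f NSrc \<sigma>) (G \<circ>\<^sub>f NTgt \<sigma>) (\<lambda>x. FM G (Cmp \<sigma> x))"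

definition rwhisk ::
  "('c, 'd, 'e, 'f) ntrans \<Rightarrow> ('a, 'b, 'c, 'd) func \<Rightarrow> ('a, 'b, 'e, 'f) ntrans"
  (infixl \<open>\<rhd>\<close> 60) where
  "\<sigma> \<rhd> F = mk_ntrans (NSrc \<sigma> \<circ>\<^sub>f F) (NTgt \<sigma> \<circ>\<^sub>f F) (\<lambda>x. Cmp \<sigma> (FO F x))"

definition inv_nt :: "('a, 'b, 'c, 'd) ntrans \<Rightarrow> ('a, 'b, 'c, 'd) ntrans" where
  "inv_nt \<tau> = mk_ntrans (NTgt \<tau>) (NSrc \<tau>) (\<lambda>x. inv_arr (Tgt (NSrc \<tau>)) (Cmp \<tau> x))"

definition is_equivalence :: "('a, 'b, 'c, 'd) func \<Rightarrow> bool" where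
  "is_equivalence F \<longleftrightarrow>
     is_func F \<and>
     (\<exists>G \<alpha> \<beta>. is_func G \<and> Src G = Tgt F \<and> Tgt G = Src F \<and>
        is_niso \<alpha> \<and> NSrc \<alpha> = G \<circ>\<^sub>f F \<and> NTgt \<alpha> = id_func (Src F) \<and>
        is_niso \<beta> \<and> NSrc \<beta> = F \<circ>\<^sub>f G \<and> NTgt \<beta> = id_func (Tgt F))"

definition adjunction ::
  "('a, 'b, 'c, 'd) func \<Rightarrow> ('c, 'd, 'a, 'b) func \<Rightarrow>
   ('a, 'b, 'a, 'b) ntrans \<Rightarrow> ('c, 'd, 'c, 'd) ntrans \<Rightarrow> bool" where
  "adjunction L R \<eta> \<epsilon> \<longleftrightarrow>
     is_func L \<and> is_func R \<and> Src R = Tgt L \<and> Tgt R = Src L \<and>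
     is_ntrans \<eta> \<and> NSrc \<eta> = id_func (Src L) \<and> NTgt \<eta> = R \<circ>\<^sub>f L \<and>
     is_ntrans \<epsilon> \<and> NSrc \<epsilon> = L \<circ>\<^sub>f R \<and> NTgt \<epsilon> = id_func (Tgt L) \<and>
     (\<epsilon> \<rhd> L) \<bullet> (L \<lhd> \<eta>) = id_nt L \<and>
     (R \<lhd> \<epsilon>) \<bullet> (\<eta> \<rhd> R) = id_nt R"

text \<open>For \<open>L1 \<stileturn> R1\<close> with unit \<open>\<eta>1\<close>, \<open>L2 \<stileturn> R2\<close> with counit \<open>\<epsilon>2\<close>, and
  \<open>\<alpha> : H R1 \<Rightarrow> R2 K\<close>, the mate \<open>L2 H \<Rightarrow> L2 H R1 L1 \<Rightarrow> L2 R2 K L1 \<Rightarrow> K L1\<close>.\<close>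

definition left_mate where
  "left_mate L1 \<eta>1 L2 \<epsilon>2 H K \<alpha> =
     (\<epsilon>2 \<rhd> (K \<circ>\<^sub>f L1)) \<bullet> (L2 \<lhd> (\<alpha> \<rhd> L1)) \<bullet> ((L2 \<circ>\<^sub>f H) \<lhd> \<eta>1)"

text \<open>For \<open>L1 \<stileturn> R1\<close> with counit \<open>\<epsilon>1\<close>, \<open>L2 \<stileturn> R2\<close> with unit \<open>\<eta>2\<close>, and
  \<open>\<beta> : L2 K \<Rightarrow> H L1\<close>, the mate \<open>K R1 \<Rightarrow> R2 L2 K R1 \<Rightarrow> R2 H L1 R1 \<Rightarrow> R2 H\<close>.\<close>

definition right_mate where
  "right_mate R1 \<epsilon>1 R2 \<eta>2 H K \<beta> =
     ((R2 \<circ>\<^sub>f H) \<lhd> \<epsilon>1) \<bullet> (R2 \<lhd> (\<beta> \<rhd> R1)) \<bullet> (\<eta>2 \<rhd> (K \<circ>\<^sub>f R1))"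

definition prod_family ::
  "'i set \<Rightarrow> ('i \<Rightarrow> ('o, 'm) cat) \<Rightarrow> ('i \<Rightarrow> 'o, 'i \<Rightarrow> 'm) cat" where
  "prod_family I C =
     \<lparr>Obj = (\<Pi>\<^sub>E i\<in>I. Obj (C i)), Arr = (\<Pi>\<^sub>E i\<in>I. Arr (C i)),
      Dom = (\<lambda>f. \<lambda>i\<in>I. Dom (C i) (f i)), Cod = (\<lambda>f. \<lambda>i\<in>I. Cod (C i) (f i)),
      Id = (\<lambda>x. \<lambda>i\<in>I. Id (C i) (x i)), Comp = (\<lambda>g f. \<lambda>i\<in>I. Comp (C i) (g i) (f i))\<rparr>"


section \<open>Small categories\<close>

text \<open>Smallness is relative to a type \<open>'k\<close> of infinite regular cardinality \<open>\<kappa>\<close>: a set is small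
  if it has fewer than \<open>\<kappa>\<close> elements. For \<open>\<kappa>\<close> inaccessible these are, up to bijection, the
  members of the Grothendieck universe of rank \<open>\<kappa>\<close>; being a strong limit is not demanded, so
  that everything below is a statement about each infinite regular \<open>\<kappa>\<close>.

  HOL has no type of all sets, so objects and arrows of small categories are drawn from the
  datatype \<open>'k el\<close>, which contains \<open>'k\<close> (so that every \<open>\<kappa>\<close>-small category is isomorphic to one
  on \<open>'k el\<close>) and is closed under pairing; the other constructors name the objects of the
  particular categories used below.\<close>

definition regular_universe :: "'k itself \<Rightarrow> bool" where
  "regular_universe _ \<longleftrightarrow>
     infinite (UNIV :: 'k set) \<and>
     (\<forall>(I :: 'k set) (X :: 'k \<Rightarrow> 'k set).
        I \<prec> (UNIV :: 'k set) \<and> (\<forall>i\<in>I. X i \<prec> (UNIV :: 'k set)) \<longrightarrow>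
        (\<Union>i\<in>I. X i) \<prec> (UNIV :: 'k set))"

datatype 'k el =
    Elem 'k
  | Star
  | Bit (the_bit: bool)
  | Vec (the_vec: "bool list")
  | Pair (pfst: "'k el") (psnd: "'k el")

definition small :: "'k el set \<Rightarrow> bool" where
  "small X \<longleftrightarrow> X \<prec> (UNIV :: 'k set)"

type_synonym 'k scat = "('k el, 'k el) cat"
type_synonym 'k sfunc = "('k el, 'k el, 'k el, 'k el) func"
type_synonym 'k sntrans = "('k el, 'k el, 'k el, 'k el) ntrans"

definition small_cat :: "'k scat \<Rightarrow> bool" where
  "small_cat A \<longleftrightarrow> is_cat A \<and> small (Obj A) \<and> small (Arr A)"

definition small_func :: "'k sfunc \<Rightarrow> bool" where
  "small_func u \<longleftrightarrow> is_func u \<and> small_cat (Src u) \<and> small_cat (Tgt u)"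

definition small_ntrans :: "'k sntrans \<Rightarrow> bool" where
  "small_ntrans \<alpha> \<longleftrightarrow> is_ntrans \<alpha> \<and> small_func (NSrc \<alpha>) \<and> small_func (NTgt \<alpha>)"

definition poset_cat :: "'k el set \<Rightarrow> ('k el \<Rightarrow> 'k el \<Rightarrow> bool) \<Rightarrow> 'k scat" where
  "poset_cat P le =
     \<lparr>Obj = P, Arr = {Pair x y |x y. x \<in> P \<and> y \<in> P \<and> le x y}, Dom = pfst, Cod = psnd,
      Id = (\<lambda>x. Pair x x), Comp = (\<lambda>g f. Pair (pfst f) (psnd g))\<rparr>"

definition full_subcat :: "('o, 'm) cat \<Rightarrow> 'o set \<Rightarrow> ('o, 'm) cat" where
  "full_subcat C S =
     C\<lparr>Obj := Obj C \<inter> S, Arr := {f \<in> Arr C. Dom C f \<in> S \<and> Cod C f \<in> S}\<rparr>"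

definition one :: "'k scat" where
  "one = poset_cat {Star} (=)"

definition bang :: "'k scat \<Rightarrow> 'k sfunc" where
  "bang A = mk_func A one (\<lambda>_. Star) (\<lambda>_. Id one Star)"

definition pt :: "'k scat \<Rightarrow> 'k el \<Rightarrow> 'k sfunc" where
  "pt A a = mk_func one A (\<lambda>_. a) (\<lambda>_. Id A a)"

definition prod_cat :: "'k scat \<Rightarrow> 'k scat \<Rightarrow> 'k scat" (infixr \<open>\<times>\<^sub>c\<close> 70) where
  "A \<times>\<^sub>c B =
     \<lparr>Obj = {Pair a b |a b. a \<in> Obj A \<and> b \<in> Obj B},
      Arr = {Pair f g |f g. f \<in> Arr A \<and> g \<in> Arr B},
      Dom = (\<lambda>f. Pair (Dom A (pfst f)) (Dom B (psnd f))),
      Cod = (\<lambda>f. Pair (Cod A (pfst f)) (Cod B (psnd f))),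
      Id = (\<lambda>x. Pair (Id A (pfst x)) (Id B (psnd x))),
      Comp = (\<lambda>g f. Pair (Comp A (pfst g) (pfst f)) (Comp B (psnd g) (psnd f)))\<rparr>"

definition prod_func :: "'k sfunc \<Rightarrow> 'k sfunc \<Rightarrow> 'k sfunc" (infixr \<open>\<times>\<^sub>f\<close> 70) where
  "u \<times>\<^sub>f v = mk_func (Src u \<times>\<^sub>c Src v) (Tgt u \<times>\<^sub>c Tgt v)
     (\<lambda>x. Pair (FO u (pfst x)) (FO v (psnd x))) (\<lambda>f. Pair (FM u (pfst f)) (FM v (psnd f)))"

definition cat_times_ntrans :: "'k scat \<Rightarrow> 'k sntrans \<Rightarrow> 'k sntrans" where
  "cat_times_ntrans A \<alpha> = mk_ntrans (id_func A \<times>\<^sub>f NSrc \<alpha>) (id_func A \<times>\<^sub>f NTgt \<alpha>)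
     (\<lambda>x. Pair (Id A (pfst x)) (Cmp \<alpha> (psnd x)))"

definition coprod_cat :: "'k el set \<Rightarrow> ('k el \<Rightarrow> 'k scat) \<Rightarrow> 'k scat" where
  "coprod_cat I A =
     \<lparr>Obj = {Pair i a |i a. i \<in> I \<and> a \<in> Obj (A i)},
      Arr = {Pair i f |i f. i \<in> I \<and> f \<in> Arr (A i)},
      Dom = (\<lambda>f. Pair (pfst f) (Dom (A (pfst f)) (psnd f))),
      Cod = (\<lambda>f. Pair (pfst f) (Cod (A (pfst f)) (psnd f))),
      Id = (\<lambda>x. Pair (pfst x) (Id (A (pfst x)) (psnd x))),
      Comp = (\<lambda>g f. Pair (pfst f) (Comp (A (pfst f)) (psnd g) (psnd f)))\<rparr>"

definition coprod_in :: "'k el set \<Rightarrow> ('k el \<Rightarrow> 'k scat) \<Rightarrow> 'k el \<Rightarrow> 'k sfunc" where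
  "coprod_in I A i = mk_func (A i) (coprod_cat I A) (Pair i) (Pair i)"

text \<open>The slice \<open>(u/b)\<close>: objects are pairs \<open>(a, f : u a \<rightarrow> b)\<close>; an arrow \<open>((x, y), g)\<close> is an arrow
  \<open>g\<close> of the source of \<open>u\<close>, together with its end points \<open>x\<close> and \<open>y\<close> in the slice. Similarly for
  \<open>(b/u)\<close>, with objects \<open>(a, f : b \<rightarrow> u a)\<close>.\<close>

definition over_cat :: "'k sfunc \<Rightarrow> 'k el \<Rightarrow> 'k scat" where
  "over_cat u b =
     (let A = Src u; B = Tgt u;
          Ob = {Pair a f |a f. a \<in> Obj A \<and> in_hom B f (FO u a) b} in
      \<lparr>Obj = Ob,
       Arr = {Pair (Pair x y) g |x y g. x \<in> Ob \<and> y \<in> Ob \<and> in_hom A g (pfst x) (pfst y) \<and>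
                Comp B (psnd y) (FM u g) = psnd x},
       Dom = (\<lambda>h. pfst (pfst h)), Cod = (\<lambda>h. psnd (pfst h)),
       Id = (\<lambda>x. Pair (Pair x x) (Id A (pfst x))),
       Comp = (\<lambda>k h. Pair (Pair (pfst (pfst h)) (psnd (pfst k))) (Comp A (psnd k) (psnd h)))\<rparr>)"

definition over_proj :: "'k sfunc \<Rightarrow> 'k el \<Rightarrow> 'k sfunc" where
  "over_proj u b = mk_func (over_cat u b) (Src u) pfst psnd"

definition over_cell :: "'k sfunc \<Rightarrow> 'k el \<Rightarrow> 'k sntrans" where
  "over_cell u b =
     mk_ntrans (u \<circ>\<^sub>f over_proj u b) (pt (Tgt u) b \<circ>\<^sub>f bang (over_cat u b)) psnd"

definition under_cat :: "'k sfunc \<Rightarrow> 'k el \<Rightarrow> 'k scat" where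
  "under_cat u b =
     (let A = Src u; B = Tgt u;
          Ob = {Pair a f |a f. a \<in> Obj A \<and> in_hom B f b (FO u a)} in
      \<lparr>Obj = Ob,
       Arr = {Pair (Pair x y) g |x y g. x \<in> Ob \<and> y \<in> Ob \<and> in_hom A g (pfst x) (pfst y) \<and>
                Comp B (FM u g) (psnd x) = psnd y},
       Dom = (\<lambda>h. pfst (pfst h)), Cod = (\<lambda>h. psnd (pfst h)),
       Id = (\<lambda>x. Pair (Pair x x) (Id A (pfst x))),
       Comp = (\<lambda>k h. Pair (Pair (pfst (pfst h)) (psnd (pfst k))) (Comp A (psnd k) (psnd h)))\<rparr>)"

definition under_proj :: "'k sfunc \<Rightarrow> 'k el \<Rightarrow> 'k sfunc" where
  "under_proj u b = mk_func (under_cat u b) (Src u) pfst psnd"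

definition under_cell :: "'k sfunc \<Rightarrow> 'k el \<Rightarrow> 'k sntrans" where
  "under_cell u b =
     mk_ntrans (pt (Tgt u) b \<circ>\<^sub>f bang (under_cat u b)) (u \<circ>\<^sub>f under_proj u b) psnd"


section \<open>Derivators\<close>

text \<open>For a prederivator \<open>\<D>\<close>, \<open>Val \<D> A\<close> is the category \<open>\<D>(A)\<close>, \<open>Res \<D> u\<close> is the functor \<open>u\<^sup>*\<close>
  and \<open>Res2 \<D> \<alpha>\<close> is the natural transformation \<open>\<alpha>\<^sup>* : u\<^sup>* \<Rightarrow> v\<^sup>*\<close> for \<open>\<alpha> : u \<Rightarrow> v\<close>. The values
  \<open>\<D>(A)\<close> are not subject to any size restriction.\<close>

record ('k, 'o, 'm) prederiv =
  Val :: "'k scat \<Rightarrow> ('o, 'm) cat"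
  Res :: "'k sfunc \<Rightarrow> ('o, 'm, 'o, 'm) func"
  Res2 :: "'k sntrans \<Rightarrow> ('o, 'm, 'o, 'm) ntrans"

definition prederivator :: "('k, 'o, 'm) prederiv \<Rightarrow> bool" where
  "prederivator D \<longleftrightarrow>
     (\<forall>A. small_cat A \<longrightarrow> is_cat (Val D A)) \<and>
     (\<forall>u. small_func u \<longrightarrow>
        is_func (Res D u) \<and> Src (Res D u) = Val D (Tgt u) \<and> Tgt (Res D u) = Val D (Src u)) \<and>
     (\<forall>\<alpha>. small_ntrans \<alpha> \<longrightarrow>
        is_ntrans (Res2 D \<alpha>) \<and> NSrc (Res2 D \<alpha>) = Res D (NSrc \<alpha>) \<and>
        NTgt (Res2 D \<alpha>) = Res D (NTgt \<alpha>)) \<and>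
     (\<forall>A. small_cat A \<longrightarrow> Res D (id_func A) = id_func (Val D A)) \<and>
     (\<forall>u v. small_func u \<and> small_func v \<and> Src v = Tgt u \<longrightarrow>
        Res D (v \<circ>\<^sub>f u) = Res D u \<circ>\<^sub>f Res D v) \<and>
     (\<forall>u. small_func u \<longrightarrow> Res2 D (id_nt u) = id_nt (Res D u)) \<and>
     (\<forall>\<alpha> \<beta>. small_ntrans \<alpha> \<and> small_ntrans \<beta> \<and> NSrc \<beta> = NTgt \<alpha> \<longrightarrow>
        Res2 D (\<beta> \<bullet> \<alpha>) = Res2 D \<beta> \<bullet> Res2 D \<alpha>) \<and>
     (\<forall>\<alpha> v. small_ntrans \<alpha> \<and> small_func v \<and> Src v = Tgt (NSrc \<alpha>) \<longrightarrow>
        Res2 D (v \<lhd> \<alpha>) = Res2 D \<alpha> \<rhd> Res D v) \<and>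
     (\<forall>\<alpha> w. small_ntrans \<alpha> \<and> small_func w \<and> Tgt w = Src (NSrc \<alpha>) \<longrightarrow>
        Res2 D (\<alpha> \<rhd> w) = Res D w \<lhd> Res2 D \<alpha>)"

text \<open>A choice of adjunctions \<open>u\<^sub>! \<stileturn> u\<^sup>*\<close> and \<open>u\<^sup>* \<stileturn> u\<^sub>*\<close>, each with unit and counit.\<close>

definition lkan_data ::
  "('k, 'o, 'm) prederiv \<Rightarrow> 'k sfunc \<Rightarrow>
   ('o, 'm, 'o, 'm) func \<times> ('o, 'm, 'o, 'm) ntrans \<times> ('o, 'm, 'o, 'm) ntrans" where
  "lkan_data D u = (SOME (L, \<eta>, \<epsilon>). adjunction L (Res D u) \<eta> \<epsilon>)"

definition rkan_data ::
  "('k, 'o, 'm) prederiv \<Rightarrow> 'k sfunc \<Rightarrow>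
   ('o, 'm, 'o, 'm) func \<times> ('o, 'm, 'o, 'm) ntrans \<times> ('o, 'm, 'o, 'm) ntrans" where
  "rkan_data D u = (SOME (R, \<eta>, \<epsilon>). adjunction (Res D u) R \<eta> \<epsilon>)"

definition "lkan D u = fst (lkan_data D u)"
definition "lkan_unit D u = fst (snd (lkan_data D u))"
definition "lkan_counit D u = snd (snd (lkan_data D u))"
definition "rkan D u = fst (rkan_data D u)"
definition "rkan_unit D u = fst (snd (rkan_data D u))"
definition "rkan_counit D u = snd (snd (rkan_data D u))"

definition Der1 :: "('k, 'o, 'm) prederiv \<Rightarrow> bool" where
  "Der1 D \<longleftrightarrow>
     (\<forall>I A. small I \<and> (\<forall>i\<in>I. small_cat (A i)) \<longrightarrow>
        is_equivalence
          (mk_func (Val D (coprod_cat I A)) (prod_family I (\<lambda>i. Val D (A i)))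
             (\<lambda>X. \<lambda>i\<in>I. FO (Res D (coprod_in I A i)) X)
             (\<lambda>f. \<lambda>i\<in>I. FM (Res D (coprod_in I A i)) f)))"

definition Der2 :: "('k, 'o, 'm) prederiv \<Rightarrow> bool" where
  "Der2 D \<longleftrightarrow>
     (\<forall>A. small_cat A \<longrightarrow> (\<forall>f\<in>Arr (Val D A).
        is_iso (Val D A) f \<longleftrightarrow> (\<forall>a\<in>Obj A. is_iso (Val D one) (FM (Res D (pt A a)) f))))"

definition Der3 :: "('k, 'o, 'm) prederiv \<Rightarrow> bool" where
  "Der3 D \<longleftrightarrow>
     (\<forall>u. small_func u \<longrightarrow>
        (\<exists>L \<eta> \<epsilon>. adjunction L (Res D u) \<eta> \<epsilon>) \<and> (\<exists>R \<eta> \<epsilon>. adjunction (Res D u) R \<eta> \<epsilon>))"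

text \<open>The canonical maps \<open>\<pi>\<^sub>! p\<^sup>* \<Rightarrow> b\<^sup>* u\<^sub>!\<close> and \<open>b\<^sup>* u\<^sub>* \<Rightarrow> \<pi>\<^sub>* q\<^sup>*\<close> are the mates of the
  images \<open>p\<^sup>* u\<^sup>* \<Rightarrow> \<pi>\<^sup>* b\<^sup>*\<close> and \<open>\<pi>\<^sup>* b\<^sup>* \<Rightarrow> q\<^sup>* u\<^sup>*\<close> of the 2-cells of the two slice squares.\<close>

definition Der4 :: "('k, 'o, 'm) prederiv \<Rightarrow> bool" where
  "Der4 D \<longleftrightarrow>
     (\<forall>u. small_func u \<longrightarrow> (\<forall>b\<in>Obj (Tgt u).
        is_niso (left_mate (lkan D u) (lkan_unit D u)
          (lkan D (bang (over_cat u b))) (lkan_counit D (bang (over_cat u b)))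
          (Res D (over_proj u b)) (Res D (pt (Tgt u) b)) (Res2 D (over_cell u b))) \<and>
        is_niso (right_mate (rkan D u) (rkan_counit D u)
          (rkan D (bang (under_cat u b))) (rkan_unit D (bang (under_cat u b)))
          (Res D (under_proj u b)) (Res D (pt (Tgt u) b)) (Res2 D (under_cell u b)))))"

definition derivator :: "('k, 'o, 'm) prederiv \<Rightarrow> bool" where
  "derivator D \<longleftrightarrow> prederivator D \<and> Der1 D \<and> Der2 D \<and> Der3 D \<and> Der4 D"

definition pointed :: "('k, 'o, 'm) prederiv \<Rightarrow> bool" where
  "pointed D \<longleftrightarrow> (\<exists>z. zero_obj (Val D one) z)"

text \<open>The shifted prederivator \<open>\<D>\<^sup>A : B \<mapsto> \<D>(A \<times> B)\<close>.\<close>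

definition shift :: "('k, 'o, 'm) prederiv \<Rightarrow> 'k scat \<Rightarrow> ('k, 'o, 'm) prederiv" where
  "shift D A =
     \<lparr>Val = (\<lambda>B. Val D (A \<times>\<^sub>c B)), Res = (\<lambda>u. Res D (id_func A \<times>\<^sub>f u)),
      Res2 = (\<lambda>\<alpha>. Res2 D (cat_times_ntrans A \<alpha>))\<rparr>"


section \<open>Morphisms of derivators\<close>

text \<open>A morphism \<open>F : \<D> \<rightarrow> \<E>\<close> has components \<open>F\<^sub>A : \<D>(A) \<rightarrow> \<E>(A)\<close> and, for \<open>u : A \<rightarrow> B\<close>, structure
  isomorphisms \<open>u\<^sup>* F\<^sub>B \<cong> F\<^sub>A u\<^sup>*\<close>, in this direction.\<close>

record ('k, 'o, 'm, 'p, 'n) dmor =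
  Cpt :: "'k scat \<Rightarrow> ('o, 'm, 'p, 'n) func"
  Str :: "'k sfunc \<Rightarrow> ('o, 'm, 'p, 'n) ntrans"

definition is_dmor ::
  "('k, 'o, 'm) prederiv \<Rightarrow> ('k, 'p, 'n) prederiv \<Rightarrow> ('k, 'o, 'm, 'p, 'n) dmor \<Rightarrow> bool" where
  "is_dmor D E F \<longleftrightarrow>
     (\<forall>A. small_cat A \<longrightarrow>
        is_func (Cpt F A) \<and> Src (Cpt F A) = Val D A \<and> Tgt (Cpt F A) = Val E A) \<and>
     (\<forall>u. small_func u \<longrightarrow>
        is_niso (Str F u) \<and> NSrc (Str F u) = Res E u \<circ>\<^sub>f Cpt F (Tgt u) \<and>
        NTgt (Str F u) = Cpt F (Src u) \<circ>\<^sub>f Res D u) \<and>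
     (\<forall>A. small_cat A \<longrightarrow> Str F (id_func A) = id_nt (Cpt F A)) \<and>
     (\<forall>u v. small_func u \<and> small_func v \<and> Src v = Tgt u \<longrightarrow>
        Str F (v \<circ>\<^sub>f u) = (Str F u \<rhd> Res D v) \<bullet> (Res E u \<lhd> Str F v)) \<and>
     (\<forall>\<alpha>. small_ntrans \<alpha> \<longrightarrow>
        Str F (NTgt \<alpha>) \<bullet> (Res2 E \<alpha> \<rhd> Cpt F (Tgt (NSrc \<alpha>))) =
        (Cpt F (Src (NSrc \<alpha>)) \<lhd> Res2 D \<alpha>) \<bullet> Str F (NSrc \<alpha>))"

definition comp_dmor ::
  "('k, 'p, 'n, 'q, 'l) dmor \<Rightarrow> ('k, 'o, 'm, 'p, 'n) dmor \<Rightarrow> ('k, 'o, 'm, 'q, 'l) dmor"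
  (infixr \<open>\<circ>\<^sub>d\<close> 65) where
  "G \<circ>\<^sub>d F =
     \<lparr>Cpt = (\<lambda>A. Cpt G A \<circ>\<^sub>f Cpt F A),
      Str = (\<lambda>u. (Cpt G (Src u) \<lhd> Str F u) \<bullet> (Str G u \<rhd> Cpt F (Tgt u)))\<rparr>"

definition is_modification ::
  "('k, 'o, 'm) prederiv \<Rightarrow> ('k, 'p, 'n) prederiv \<Rightarrow> ('k, 'o, 'm, 'p, 'n) dmor \<Rightarrow>
   ('k, 'o, 'm, 'p, 'n) dmor \<Rightarrow> ('k scat \<Rightarrow> ('o, 'm, 'p, 'n) ntrans) \<Rightarrow> bool" where
  "is_modification D E F G \<theta> \<longleftrightarrow>
     (\<forall>A. small_cat A \<longrightarrow>
        is_ntrans (\<theta> A) \<and> NSrc (\<theta> A) = Cpt F A \<and> NTgt (\<theta> A) = Cpt G A) \<and>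
     (\<forall>u. small_func u \<longrightarrow>
        Str G u \<bullet> (Res E u \<lhd> \<theta> (Tgt u)) = (\<theta> (Src u) \<rhd> Res D u) \<bullet> Str F u)"

definition isomorphic_dmor ::
  "('k, 'o, 'm) prederiv \<Rightarrow> ('k, 'p, 'n) prederiv \<Rightarrow> ('k, 'o, 'm, 'p, 'n) dmor \<Rightarrow>
   ('k, 'o, 'm, 'p, 'n) dmor \<Rightarrow> bool" where
  "isomorphic_dmor D E F G \<longleftrightarrow>
     is_dmor D E F \<and> is_dmor D E G \<and>
     (\<exists>\<theta>. is_modification D E F G \<theta> \<and> (\<forall>A. small_cat A \<longrightarrow> is_niso (\<theta> A)))"

text \<open>A family of functors commuting strictly with the restrictions of \<open>\<D>\<close>, as a morphism out
  of \<open>\<D>\<close>.\<close>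

definition strict_dmor ::
  "('k, 'o, 'm) prederiv \<Rightarrow> ('k scat \<Rightarrow> ('o, 'm, 'p, 'n) func) \<Rightarrow> ('k, 'o, 'm, 'p, 'n) dmor" where
  "strict_dmor D \<Phi> = \<lparr>Cpt = \<Phi>, Str = (\<lambda>u. id_nt (\<Phi> (Src u) \<circ>\<^sub>f Res D u))\<rparr>"

text \<open>For \<open>F : \<D> \<rightarrow> \<E>\<close> and a category \<open>A\<close> of parameters, the morphism \<open>F\<^sup>A : \<D>\<^sup>A \<rightarrow> \<E>\<^sup>A\<close>.\<close>

definition shift_dmor ::
  "('k, 'o, 'm, 'p, 'n) dmor \<Rightarrow> 'k scat \<Rightarrow> ('k, 'o, 'm, 'p, 'n) dmor" where
  "shift_dmor F A = \<lparr>Cpt = (\<lambda>K. Cpt F (A \<times>\<^sub>c K)), Str = (\<lambda>u. Str F (id_func A \<times>\<^sub>f u))\<rparr>"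

text \<open>For \<open>u : A \<rightarrow> B\<close>, the morphisms \<open>u\<^sup>* : \<D>\<^sup>B \<rightarrow> \<D>\<^sup>A\<close> and \<open>u\<^sub>!, u\<^sub>* : \<D>\<^sup>A \<rightarrow> \<D>\<^sup>B\<close>. For
  \<open>v : J \<rightarrow> K\<close> the structure isomorphisms of \<open>u\<^sub>!\<close> and \<open>u\<^sub>*\<close> come from the mates
  \<open>(u \<times> J)\<^sub>! (A \<times> v)\<^sup>* \<Rightarrow> (B \<times> v)\<^sup>* (u \<times> K)\<^sub>!\<close> and \<open>(B \<times> v)\<^sup>* (u \<times> K)\<^sub>* \<Rightarrow> (u \<times> J)\<^sub>* (A \<times> v)\<^sup>*\<close>
  of the identity of \<open>(A \<times> v)\<^sup>* (u \<times> K)\<^sup>* = (u \<times> J)\<^sup>* (B \<times> v)\<^sup>*\<close>. Only the first has to be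
  inverted to obtain the direction chosen for \<^const>\<open>Str\<close>.\<close>

definition res_dmor ::
  "('k, 'o, 'm) prederiv \<Rightarrow> 'k sfunc \<Rightarrow> ('k, 'o, 'm, 'o, 'm) dmor" where
  "res_dmor D u = strict_dmor (shift D (Tgt u)) (\<lambda>K. Res D (u \<times>\<^sub>f id_func K))"

definition lkan_dmor ::
  "('k, 'o, 'm) prederiv \<Rightarrow> 'k sfunc \<Rightarrow> ('k, 'o, 'm, 'o, 'm) dmor" where
  "lkan_dmor D u =
     \<lparr>Cpt = (\<lambda>K. lkan D (u \<times>\<^sub>f id_func K)),
      Str = (\<lambda>v.
        let uJ = u \<times>\<^sub>f id_func (Src v); uK = u \<times>\<^sub>f id_func (Tgt v);
            H = Res D (id_func (Src u) \<times>\<^sub>f v); K = Res D (id_func (Tgt u) \<times>\<^sub>f v) in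
        inv_nt (left_mate (lkan D uK) (lkan_unit D uK) (lkan D uJ) (lkan_counit D uJ) H K
          (id_nt (H \<circ>\<^sub>f Res D uK))))\<rparr>"

definition rkan_dmor ::
  "('k, 'o, 'm) prederiv \<Rightarrow> 'k sfunc \<Rightarrow> ('k, 'o, 'm, 'o, 'm) dmor" where
  "rkan_dmor D u =
     \<lparr>Cpt = (\<lambda>K. rkan D (u \<times>\<^sub>f id_func K)),
      Str = (\<lambda>v.
        let uJ = u \<times>\<^sub>f id_func (Src v); uK = u \<times>\<^sub>f id_func (Tgt v);
            H = Res D (id_func (Src u) \<times>\<^sub>f v); K = Res D (id_func (Tgt u) \<times>\<^sub>f v) in
        right_mate (rkan D uK) (rkan_counit D uK) (rkan D uJ) (rkan_unit D uJ) H K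
          (id_nt (Res D uJ \<circ>\<^sub>f K)))\<rparr>"

text \<open>Evaluation \<open>a\<^sup>* : \<D>\<^sup>A \<rightarrow> \<D>\<close> at an object \<open>a\<close>; it is restriction along \<open>K \<rightarrow> A \<times> K\<close>,
  \<open>k \<mapsto> (a, k)\<close>, which identifies \<open>\<D>\<^sup>\<one>\<close> with \<open>\<D>\<close>.\<close>

definition ev_dmor ::
  "('k, 'o, 'm) prederiv \<Rightarrow> 'k scat \<Rightarrow> 'k el \<Rightarrow> ('k, 'o, 'm, 'o, 'm) dmor" where
  "ev_dmor D A a =
     strict_dmor (shift D A) (\<lambda>K. Res D (mk_func K (A \<times>\<^sub>c K) (Pair a) (Pair (Id A a))))"


section \<open>Cones and cubes\<close>

definition interval :: "'k scat" where
  "interval = poset_cat {Bit False, Bit True} (\<lambda>x y. the_bit x \<le> the_bit y)"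

definition square :: "'k scat" where
  "square = interval \<times>\<^sub>c interval"

definition corner :: "'k scat" where
  "corner = full_subcat square (- {Pair (Bit True) (Bit True)})"

definition corner_incl :: "'k sfunc" where
  "corner_incl = mk_func corner square (\<lambda>x. x) (\<lambda>f. f)"

definition corner_edge :: "'k sfunc" where
  "corner_edge = mk_func interval corner
     (\<lambda>a. Pair a (Bit False)) (\<lambda>f. Pair f (Id interval (Bit False)))"

definition cof_edge :: "'k sfunc" where
  "cof_edge = mk_func interval square
     (\<lambda>a. Pair (Bit True) a) (\<lambda>f. Pair (Id interval (Bit True)) f)"

text \<open>\<open>rkan_dmor\<close> along the sieve \<open>corner_edge\<close> extends \<open>f : x \<rightarrow> y\<close> by zero to the span
  \<open>0 \<leftarrow> x \<rightarrow> y\<close> with \<open>y\<close> at \<open>(1,0)\<close>.\<close>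

definition cof :: "('k, 'o, 'm) prederiv \<Rightarrow> ('k, 'o, 'm, 'o, 'm) dmor" where
  "cof D = res_dmor D cof_edge \<circ>\<^sub>d lkan_dmor D corner_incl \<circ>\<^sub>d rkan_dmor D corner_edge"

definition cone :: "('k, 'o, 'm) prederiv \<Rightarrow> ('k, 'o, 'm, 'o, 'm) dmor" where
  "cone D = ev_dmor D interval (Bit True) \<circ>\<^sub>d cof D"

text \<open>The cube \<open>[1]\<^sup>n\<close>: a vertex is the indicator vector of a subset of \<open>{1..n}\<close>.\<close>

definition cube :: "nat \<Rightarrow> 'k scat" where
  "cube n = poset_cat (Vec ` {xs. length xs = n}) (\<lambda>x y. list_all2 (\<le>) (the_vec x) (the_vec y))"

definition insert_coord :: "nat \<Rightarrow> 'k el \<Rightarrow> 'k el \<Rightarrow> 'k el" where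
  "insert_coord i b x = Vec (take (i - 1) (the_vec x) @ the_bit b # drop (i - 1) (the_vec x))"

text \<open>The isomorphism \<open>[1] \<times> ([1]\<^sup>n\<^sup>-\<^sup>1 \<times> K) \<rightarrow> [1]\<^sup>n \<times> K\<close> that makes the first factor the \<open>i\<close>-th
  coordinate (\<open>1 \<le> i \<le> n\<close>).\<close>

definition coord_func :: "nat \<Rightarrow> nat \<Rightarrow> 'k scat \<Rightarrow> 'k sfunc" where
  "coord_func n i K = mk_func (interval \<times>\<^sub>c (cube (n - 1) \<times>\<^sub>c K)) (cube n \<times>\<^sub>c K)
     (\<lambda>p. Pair (insert_coord i (pfst p) (pfst (psnd p))) (psnd (psnd p)))
     (\<lambda>f. Pair (Pair (insert_coord i (pfst (pfst f)) (pfst (pfst (psnd f))))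
                     (insert_coord i (psnd (pfst f)) (psnd (pfst (psnd f)))))
               (psnd (psnd f)))"

text \<open>\<open>C\<close> applied to the \<open>i\<close>-th coordinate: the composite
  \<open>\<D>\<^bsup>[1]^n\<^esup> \<cong> (\<D>\<^bsup>[1]\<^esup>)\<^bsup>[1]^(n-1)\<^esup> \<rightarrow> \<D>\<^bsup>[1]^(n-1)\<^esup>\<close> of the reindexing and of \<open>C\<close> with
  parameters \<open>[1]^(n-1)\<close>.\<close>

definition cone_at ::
  "('k, 'o, 'm) prederiv \<Rightarrow> nat \<Rightarrow> nat \<Rightarrow> ('k, 'o, 'm, 'o, 'm) dmor" where
  "cone_at D n i =
     shift_dmor (cone D) (cube (n - 1)) \<circ>\<^sub>d
     strict_dmor (shift D (cube n)) (\<lambda>K. Res D (coord_func n i K))"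

end

theory Submission
  imports Defs
begin

text \<open>The cone is left adjoint to extension by zero along \<open>1 \<in> [1]\<close>, which sends \<open>z\<close> to \<open>0 \<rightarrow> z\<close>: since the
  cofiber square of \<open>f\<close> is cocartesian, a map from \<open>f\<close> to \<open>0 \<rightarrow> z\<close> extends uniquely over this square, and so
  amounts to a map \<open>C f \<rightarrow> z\<close>. Extension by zero is in turn left adjoint to evaluation at \<open>1\<close>. On cubes, the
  cone in coordinate \<open>i\<close> is therefore the left adjoint of a left adjoint of the restriction \<open>d\<^sub>i\<^sup>*\<close> along
  the face \<open>d\<^sub>i\<close> that inserts \<open>1\<close> as coordinate \<open>i\<close>. These restrictions commute strictly,
  \<open>d\<^sub>i\<^sup>* d\<^sub>j\<^sup>* = d\<^sub>j\<^sub>-\<^sub>1\<^sup>* d\<^sub>i\<^sup>*\<close> for \<open>i < j\<close>, so uniqueness of left adjoints of morphisms of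
  derivators, applied twice, gives the isomorphism.\<close>

text \<open>The composites of cones mix left and right Kan extensions, and comparing them directly
  would mean moving colimits past extensions by zero while tracking every structure isomorphism.
  Passing to adjoints trades this for one strict identity between functors of small categories,
  \<open>face_swap\<close>. The price is that adjoints must be unique as morphisms of derivators,
  compatibly with restriction in the parameter K. Hence adjunctions are handled as universal arrows,
  object by object, with a unit that is a modification (\<open>dadj\<close>), and Kan extensions
  along u are taken along u x K for every K, with base change in K derived from Der2 and Der4. The
  right adjoint of the cone meets two obstacles. The cone is read off the edge y -> Cf of the
  cofiber square, whereas the universal property belongs to the edge 0 -> Cf; both end in the vertex
  (1,1), so evaluation there agrees. And the unit f -> (0 -> Cf), a map between arrows, must be
  extracted from the square: it is the map between two parallel edges, carried to f along the
  isomorphism of f with the restriction of its extension by zero.\<close>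

abbreviation prod_id :: "'k sfunc \<Rightarrow> 'k scat \<Rightarrow> 'k sfunc" (infixr \<open>\<times>\<^sub>1\<close> 70) where
  "u \<times>\<^sub>1 K \<equiv> u \<times>\<^sub>f id_func K"
abbreviation "VObj D A \<equiv> Obj (Val D A)"
abbreviation "VHom D A \<equiv> in_hom (Val D A)"
abbreviation "VComp D A \<equiv> Comp (Val D A)"
abbreviation "VId D A \<equiv> Id (Val D A)"
abbreviation "VIso D A \<equiv> is_iso (Val D A)"
abbreviation "RO D u \<equiv> FO (Res D u)"
abbreviation "RM D u \<equiv> FM (Res D u)"
abbreviation "ST F u \<equiv> Cmp (Str F u)"
abbreviation "CO F A \<equiv> FO (Cpt F A)"
abbreviation "CM F A \<equiv> FM (Cpt F A)"

subsection \<open>Categories and functors\<close>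

lemma in_homD:
  assumes "in_hom C f x y"
  shows "f \<in> Arr C" "Dom C f = x" "Cod C f = y" using assms by (auto simp: in_hom_def)

lemma hom_obj:
  assumes "is_cat C" "in_hom C f x y"
  shows "x \<in> Obj C" "y \<in> Obj C" using assms by (auto simp: in_hom_def is_cat_def)

lemma arr_hom: "f \<in> Arr C \<Longrightarrow> in_hom C f (Dom C f) (Cod C f)" by (simp add: in_hom_def)

lemma id_hom: "is_cat C \<Longrightarrow> x \<in> Obj C \<Longrightarrow> in_hom C (Id C x) x x"
  by (simp add: is_cat_def)

lemma comp_hom:
  assumes "is_cat C" "in_hom C f x y" "in_hom C g y z"
  shows "in_hom C (Comp C g f) x z"
proof -
  have "f \<in> Arr C" "g \<in> Arr C" "Cod C f = Dom C g" using assms(2,3) by (auto simp: in_hom_def)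
  then have "in_hom C (Comp C g f) (Dom C f) (Cod C g)" using assms(1) unfolding is_cat_def by blast
  then show ?thesis using assms(2,3) by (simp add: in_hom_def)
qed

lemma comp_assoc:
  assumes "is_cat C" "in_hom C f x y" "in_hom C g y z" "in_hom C h z w"
  shows "Comp C (Comp C h g) f = Comp C h (Comp C g f)"
proof -
  have "f \<in> Arr C" "g \<in> Arr C" "h \<in> Arr C" "Cod C f = Dom C g" "Cod C g = Dom C h"
    using assms(2-4) by (auto simp: in_hom_def)
  moreover have "\<forall>f\<in>Arr C. \<forall>g\<in>Arr C. \<forall>h\<in>Arr C. Cod C f = Dom C g \<and> Cod C g = Dom C h \<longrightarrow>
      Comp C h (Comp C g f) = Comp C (Comp C h g) f" using assms(1) unfolding is_cat_def by blast
  ultimately show ?thesis by simp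
qed

lemma comp_id:
  assumes "is_cat C" "f \<in> Arr C"
  shows "Comp C f (Id C (Dom C f)) = f" "Comp C (Id C (Cod C f)) f = f" using assms unfolding is_cat_def by blast+

lemma comp_id_right: "is_cat C \<Longrightarrow> in_hom C f x y \<Longrightarrow> Comp C f (Id C x) = f"
  using comp_id(1) by (auto simp: in_hom_def)

lemma comp_id_left: "is_cat C \<Longrightarrow> in_hom C f x y \<Longrightarrow> Comp C (Id C y) f = f"
  using comp_id(2) by (auto simp: in_hom_def)

lemma iso_hom:
  assumes "is_iso C f" "in_hom C f x y"
  obtains g where "in_hom C g y x" "Comp C g f = Id C x" "Comp C f g = Id C y"
  using assms unfolding is_iso_def inverse_arrows_def in_hom_def by auto

lemma isoI:
  assumes "in_hom C f x y" "in_hom C g y x" "Comp C g f = Id C x" "Comp C f g = Id C y"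
  shows "is_iso C f" using assms unfolding is_iso_def inverse_arrows_def in_hom_def by auto

lemma inv_arr:
  assumes C: "is_cat C" and f: "is_iso C f" "in_hom C f x y"
  shows "in_hom C (inv_arr C f) y x" "Comp C (inv_arr C f) f = Id C x"
    "Comp C f (inv_arr C f) = Id C y"
proof -
  have "\<exists>!g. inverse_arrows C f g"
  proof (rule ex_ex1I)
    show "\<exists>g. inverse_arrows C f g" using f by (simp add: is_iso_def)
    fix g h assume "inverse_arrows C f g" "inverse_arrows C f h"
    then have g: "in_hom C g y x" "Comp C g f = Id C x" "Comp C f g = Id C y"
      and h: "in_hom C h y x" "Comp C h f = Id C x" "Comp C f h = Id C y"
      using f unfolding inverse_arrows_def in_hom_def by auto
    have "g = Comp C (Comp C h f) g" using g h comp_id_left[OF C g(1)] by simp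
    also have "\<dots> = h" using comp_assoc[OF C g(1) f(2) h(1)] g h comp_id_right[OF C h(1)] by simp
    finally show "g = h" .
  qed
  then have "inverse_arrows C f (inv_arr C f)" unfolding inv_arr_def by (rule theI')
  then show "in_hom C (inv_arr C f) y x" "Comp C (inv_arr C f) f = Id C x"
    "Comp C f (inv_arr C f) = Id C y" using f unfolding inverse_arrows_def in_hom_def by auto
qed

lemma iso_inv_arr:
  assumes C: "is_cat C" and f: "is_iso C f" "in_hom C f x y"
  shows "is_iso C (inv_arr C f)"
  by (rule isoI[OF inv_arr(1)[OF assms] f(2) inv_arr(3)[OF assms] inv_arr(2)[OF assms]])

lemma iso_id:
  assumes C: "is_cat C" "x \<in> Obj C"
  shows "is_iso C (Id C x)" using isoI[OF id_hom[OF C] id_hom[OF C]] comp_id_left[OF C(1) id_hom[OF C]] by simp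

lemma cat_simps:
  assumes "is_cat C"
  shows "f \<in> Arr C \<Longrightarrow> g \<in> Arr C \<Longrightarrow> Cod C f = Dom C g \<Longrightarrow> Comp C g f \<in> Arr C"
    "f \<in> Arr C \<Longrightarrow> g \<in> Arr C \<Longrightarrow> Cod C f = Dom C g \<Longrightarrow> Dom C (Comp C g f) = Dom C f"
    "f \<in> Arr C \<Longrightarrow> g \<in> Arr C \<Longrightarrow> Cod C f = Dom C g \<Longrightarrow> Cod C (Comp C g f) = Cod C g"
    "f \<in> Arr C \<Longrightarrow> g \<in> Arr C \<Longrightarrow> h \<in> Arr C \<Longrightarrow> Cod C f = Dom C g \<Longrightarrow> Cod C g = Dom C h \<Longrightarrow>
      Comp C (Comp C h g) f = Comp C h (Comp C g f)"
    "f \<in> Arr C \<Longrightarrow> Dom C f = x \<Longrightarrow> Comp C f (Id C x) = f"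
    "f \<in> Arr C \<Longrightarrow> Cod C f = x \<Longrightarrow> Comp C (Id C x) f = f"
  subgoal by (rule in_homD(1)[OF comp_hom[OF assms arr_hom]]) (auto simp: in_hom_def)
  subgoal by (rule in_homD(2)[OF comp_hom[OF assms arr_hom]]) (auto simp: in_hom_def)
  subgoal by (rule in_homD(3)[OF comp_hom[OF assms arr_hom]]) (auto simp: in_hom_def)
  subgoal by (rule comp_assoc[OF assms arr_hom]) (auto simp: in_hom_def)
  subgoal by (rule comp_id_right[OF assms, of _ x "Cod C f"]) (auto simp: in_hom_def)
  subgoal by (rule comp_id_left[OF assms, of _ "Dom C f" x]) (auto simp: in_hom_def)
  done

lemma comp_cancel:
  assumes C: "is_cat C" and "in_hom C f x y" "in_hom C g y z" "in_hom C h z y" "Comp C h g = Id C y"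
  shows "Comp C h (Comp C g f) = f" using comp_assoc[OF assms(1-4)] comp_id_left[OF C assms(2)] assms(5) by simp

lemma iso_comp:
  assumes C: "is_cat C" and f: "in_hom C f x y" "is_iso C f" and g: "in_hom C g y z" "is_iso C g"
  shows "is_iso C (Comp C g f)"
proof -
  obtain f' where f': "in_hom C f' y x" "Comp C f' f = Id C x" "Comp C f f' = Id C y"
    using iso_hom[OF f(2,1)] by blast
  obtain g' where g': "in_hom C g' z y" "Comp C g' g = Id C y" "Comp C g g' = Id C z"
    using iso_hom[OF g(2,1)] by blast
  have gf: "in_hom C (Comp C g f) x z" and fg': "in_hom C (Comp C f' g') z x"
    using C f g f' g' by (auto intro: comp_hom)
  have "Comp C (Comp C f' g') (Comp C g f) = Comp C f' (Comp C g' (Comp C g f))"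
    by (rule comp_assoc[OF C gf g'(1) f'(1)])
  also have "\<dots> = Id C x" using comp_cancel[OF C f(1) g(1) g'(1,2)] f' by simp
  finally have 1: "Comp C (Comp C f' g') (Comp C g f) = Id C x" .
  have "Comp C (Comp C g f) (Comp C f' g') = Comp C g (Comp C f (Comp C f' g'))"
    by (rule comp_assoc[OF C fg' f(1) g(1)])
  also have "\<dots> = Id C z" using comp_cancel[OF C g'(1) f'(1) f(1) f'(3)] g' by simp
  finally show ?thesis using isoI[OF gf fg' 1] by simp
qed

lemma iso_cancel_left:
  assumes C: "is_cat C" and f: "in_hom C f x y" and g: "in_hom C g x y"
    and m: "in_hom C m y z" "is_iso C m" and eq: "Comp C m f = Comp C m g"
  shows "f = g"
proof -
  obtain m' where m': "in_hom C m' z y" "Comp C m' m = Id C y" using iso_hom[OF m(2,1)] by blast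
  show ?thesis by (rule trans[OF comp_cancel[OF C f m(1) m', symmetric, unfolded eq] comp_cancel[OF C g m(1) m']])
qed

lemma iso_cancel_right:
  assumes C: "is_cat C" and f: "in_hom C f x y" and g: "in_hom C g x y"
    and m: "in_hom C m w x" "is_iso C m" and eq: "Comp C f m = Comp C g m"
  shows "f = g"
proof -
  obtain m' where m': "in_hom C m' x w" "Comp C m m' = Id C x" using iso_hom[OF m(2,1)] by blast
  have "f = Comp C (Comp C f m) m'" using comp_assoc[OF C m'(1) m(1) f] m' comp_id_right[OF C f] by simp
  also have "\<dots> = g" unfolding eq using comp_assoc[OF C m'(1) m(1) g] m' comp_id_right[OF C g] by simp
  finally show ?thesis .
qed

lemma iso_comp_left_cancel:
  assumes C: "is_cat C" and f: "in_hom C f x y" and g: "in_hom C g y z"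
    and "is_iso C (Comp C g f)" "is_iso C g"
  shows "is_iso C f"
proof -
  obtain g' where g': "in_hom C g' z y" "Comp C g' g = Id C y" "Comp C g g' = Id C z"
    using iso_hom[OF assms(5) g] by blast
  have "is_iso C g'" using isoI[OF g'(1) g] g' by simp
  then have "is_iso C (Comp C g' (Comp C g f))" using iso_comp[OF C comp_hom[OF C f g] assms(4) g'(1)] by simp
  then show ?thesis using comp_assoc[OF C f g g'(1)] g' comp_id_left[OF C f] by simp
qed

lemma iso_comp_right_cancel:
  assumes C: "is_cat C" and f: "in_hom C f x y" and g: "in_hom C g y z"
    and "is_iso C (Comp C g f)" "is_iso C f"
  shows "is_iso C g"
proof -
  obtain f' where f': "in_hom C f' y x" "Comp C f' f = Id C x" "Comp C f f' = Id C y"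
    using iso_hom[OF assms(5) f] by blast
  have "is_iso C f'" using isoI[OF f'(1) f] f' by simp
  then have "is_iso C (Comp C (Comp C g f) f')" using iso_comp[OF C f'(1) _ comp_hom[OF C f g] assms(4)] by simp
  then show ?thesis using comp_assoc[OF C f'(1) f g] f' comp_id_right[OF C g] by simp
qed

text \<open>A functor with its boundary named: typing facts then chain from one functor to the next
  without rewriting \<open>Src\<close> and \<open>Tgt\<close>. \<open>nt_on\<close> does the same
  for natural transformations.\<close>

definition fun_on ::
  "('a, 'b, 'c, 'd) func \<Rightarrow> ('a, 'b) cat \<Rightarrow> ('c, 'd) cat \<Rightarrow> bool" where
  "fun_on F A B \<longleftrightarrow> is_func F \<and> Src F = A \<and> Tgt F = B"

lemma fun_onD:
  assumes "fun_on F A B"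
  shows "is_func F" "Src F = A" "Tgt F = B" "is_cat A" "is_cat B" using assms by (auto simp: fun_on_def is_func_def)

lemma fun_obj: "fun_on F A B \<Longrightarrow> x \<in> Obj A \<Longrightarrow> FO F x \<in> Obj B"
  by (auto simp: fun_on_def is_func_def)

lemma fun_hom: "fun_on F A B \<Longrightarrow> in_hom A f x y \<Longrightarrow> in_hom B (FM F f) (FO F x) (FO F y)"
  by (auto simp: fun_on_def is_func_def in_hom_def)

lemma fun_id: "fun_on F A B \<Longrightarrow> x \<in> Obj A \<Longrightarrow> FM F (Id A x) = Id B (FO F x)"
  by (auto simp: fun_on_def is_func_def)

lemma fun_comp:
  "fun_on F A B \<Longrightarrow> in_hom A f x y \<Longrightarrow> in_hom A g y z \<Longrightarrow>
   FM F (Comp A g f) = Comp B (FM F g) (FM F f)" by (auto simp: fun_on_def is_func_def in_hom_def)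

lemma fun_iso: "fun_on F A B \<Longrightarrow> in_hom A f x y \<Longrightarrow> is_iso A f \<Longrightarrow> is_iso B (FM F f)"
proof -
  assume F: "fun_on F A B" and f: "in_hom A f x y" "is_iso A f"
  obtain g where g: "in_hom A g y x" "Comp A g f = Id A x" "Comp A f g = Id A y" using iso_hom[OF f(2,1)] by blast
  show ?thesis using isoI[OF fun_hom[OF F f(1)] fun_hom[OF F g(1)]] fun_comp[OF F f(1) g(1)]
      fun_comp[OF F g(1) f(1)] g hom_obj[OF fun_onD(4)[OF F] f(1)] fun_id[OF F] by simp
qed

lemma fun_onI:
  assumes "is_cat A" "is_cat B"
    and "\<And>x. x \<in> Obj A \<Longrightarrow> fo x \<in> Obj B"
    and "\<And>f x y. in_hom A f x y \<Longrightarrow> x \<in> Obj A \<Longrightarrow> y \<in> Obj A \<Longrightarrow> in_hom B (fm f) (fo x) (fo y)"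
    and "\<And>x. x \<in> Obj A \<Longrightarrow> fm (Id A x) = Id B (fo x)"
    and "\<And>f g x y z. in_hom A f x y \<Longrightarrow> in_hom A g y z \<Longrightarrow>
      fm (Comp A g f) = Comp B (fm g) (fm f)"
  shows "fun_on (mk_func A B fo fm) A B"
proof -
  have 1: "\<And>f. f \<in> Arr A \<Longrightarrow> Dom A f \<in> Obj A \<and> Cod A f \<in> Obj A"
    using assms(1) by (auto simp: is_cat_def)
  have 2: "\<And>x. x \<in> Obj A \<Longrightarrow> Id A x \<in> Arr A" using id_hom[OF assms(1)] in_homD by metis
  have 3: "\<And>f g. f \<in> Arr A \<Longrightarrow> g \<in> Arr A \<Longrightarrow> Cod A f = Dom A g \<Longrightarrow> Comp A g f \<in> Arr A"
    using comp_hom[OF assms(1)] in_homD arr_hom by metis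
  have 4: "\<And>f. f \<in> Arr A \<Longrightarrow> in_hom B (fm f) (fo (Dom A f)) (fo (Cod A f))"
    using assms(4) 1 arr_hom by metis
  then have 5: "\<And>f. f \<in> Arr A \<Longrightarrow> fm f \<in> Arr B" using in_homD by metis
  have 6: "\<And>f g. f \<in> Arr A \<Longrightarrow> g \<in> Arr A \<Longrightarrow> Cod A f = Dom A g \<Longrightarrow>
      fm (Comp A g f) = Comp B (fm g) (fm f)" using assms(6) arr_hom by metis
  show ?thesis unfolding fun_on_def is_func_def mk_func_def using assms(1-3) assms(5) 1 2 3 4 5 6 by auto
qed

lemma func_eqI:
  assumes "fun_on F A B" "fun_on G A B"
    and "\<And>x. x \<in> Obj A \<Longrightarrow> FO F x = FO G x" "\<And>f. f \<in> Arr A \<Longrightarrow> FM F f = FM G f"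
  shows "F = G"
proof -
  have "FO F = FO G" using assms unfolding fun_on_def is_func_def by (metis PiE_ext)
  moreover have "FM F = FM G" using assms unfolding fun_on_def is_func_def by (metis PiE_ext)
  ultimately show ?thesis using assms by (simp add: fun_on_def)
qed

lemma mk_func_sel [simp]:
  "Src (mk_func A B fo fm) = A" "Tgt (mk_func A B fo fm) = B"
  "x \<in> Obj A \<Longrightarrow> FO (mk_func A B fo fm) x = fo x"
  "f \<in> Arr A \<Longrightarrow> FM (mk_func A B fo fm) f = fm f" by (simp_all add: mk_func_def)

lemma id_func_sel [simp]:
  "Src (id_func A) = A" "Tgt (id_func A) = A"
  "x \<in> Obj A \<Longrightarrow> FO (id_func A) x = x" "f \<in> Arr A \<Longrightarrow> FM (id_func A) f = f"
  by (simp_all add: id_func_def)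

lemma comp_func_sel [simp]:
  "Src (G \<circ>\<^sub>f F) = Src F" "Tgt (G \<circ>\<^sub>f F) = Tgt G"
  "x \<in> Obj (Src F) \<Longrightarrow> FO (G \<circ>\<^sub>f F) x = FO G (FO F x)"
  "f \<in> Arr (Src F) \<Longrightarrow> FM (G \<circ>\<^sub>f F) f = FM G (FM F f)"
  by (simp_all add: comp_func_def)

lemma comp_func_app:
  assumes "fun_on F A B"
  shows "x \<in> Obj A \<Longrightarrow> FO (G \<circ>\<^sub>f F) x = FO G (FO F x)"
    "in_hom A f x y \<Longrightarrow> FM (G \<circ>\<^sub>f F) f = FM G (FM F f)"
  using assms by (auto simp: fun_on_def in_hom_def)

lemma fun_on_id: "is_cat A \<Longrightarrow> fun_on (id_func A) A A"
  unfolding id_func_def by (rule fun_onI) (auto simp: id_hom)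

lemma fun_on_comp:
  assumes F: "fun_on F A B" and G: "fun_on G B C"
  shows "fun_on (G \<circ>\<^sub>f F) A C"
proof -
  have st: "Src F = A" "Tgt G = C" using F G by (auto simp: fun_on_def)
  show ?thesis unfolding comp_func_def st
  proof (rule fun_onI)
    show "FM G (FM F (Comp A g f)) = Comp C (FM G (FM F g)) (FM G (FM F f))"
      if "in_hom A f x y" "in_hom A g y z" for f g x y z
      using fun_comp[OF F that] fun_comp[OF G fun_hom[OF F that(1)] fun_hom[OF F that(2)]] by simp
    show "in_hom C (FM G (FM F f)) (FO G (FO F x)) (FO G (FO F y))" if "in_hom A f x y" for f x y
      by (rule fun_hom[OF G fun_hom[OF F that]])
  qed (simp_all add: fun_onD[OF F] fun_onD[OF G] fun_obj[OF F] fun_obj[OF G] fun_id[OF F] fun_id[OF G])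
qed

lemma comp_func_assoc:
  assumes F: "fun_on F A B" and G: "fun_on G B C" and H: "fun_on H C E"
  shows "(H \<circ>\<^sub>f G) \<circ>\<^sub>f F = H \<circ>\<^sub>f (G \<circ>\<^sub>f F)"
proof (rule func_eqI)
  show "fun_on ((H \<circ>\<^sub>f G) \<circ>\<^sub>f F) A E" "fun_on (H \<circ>\<^sub>f G \<circ>\<^sub>f F) A E"
    using fun_on_comp assms by metis+
next
  fix x assume x: "x \<in> Obj A"
  then show "FO ((H \<circ>\<^sub>f G) \<circ>\<^sub>f F) x = FO (H \<circ>\<^sub>f G \<circ>\<^sub>f F) x"
    using fun_obj[OF F x] fun_onD[OF F] fun_onD[OF G] by simp
next
  fix f assume "f \<in> Arr A"
  then have f: "in_hom A f (Dom A f) (Cod A f)" by (rule arr_hom)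
  show "FM ((H \<circ>\<^sub>f G) \<circ>\<^sub>f F) f = FM (H \<circ>\<^sub>f G \<circ>\<^sub>f F) f"
    using fun_hom[OF F f] f fun_onD[OF F] fun_onD[OF G] by (simp add: in_hom_def)
qed

lemma comp_id_func:
  assumes F: "fun_on F A B"
  shows "F \<circ>\<^sub>f id_func A = F" "id_func B \<circ>\<^sub>f F = F"
proof -
  note * = fun_onD[OF F] fun_on_comp[OF F fun_on_id] fun_on_comp[OF fun_on_id F]
  have Arr: "f \<in> Arr A \<Longrightarrow> FM F f \<in> Arr B" for f using fun_hom[OF F arr_hom] in_homD by metis
  show "F \<circ>\<^sub>f id_func A = F" by (rule func_eqI[OF *(7)[OF *(4)] F]) auto
  show "id_func B \<circ>\<^sub>f F = F" by (rule func_eqI[OF *(6)[OF *(5)] F]) (auto simp: * fun_obj[OF F] Arr)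
qed

subsection \<open>Natural transformations\<close>

definition nt_on ::
  "('a, 'b, 'c, 'd) ntrans \<Rightarrow> ('a, 'b, 'c, 'd) func \<Rightarrow> ('a, 'b, 'c, 'd) func \<Rightarrow>
   ('a, 'b) cat \<Rightarrow> ('c, 'd) cat \<Rightarrow> bool" where
  "nt_on \<tau> F G A B \<longleftrightarrow>
     is_ntrans \<tau> \<and> NSrc \<tau> = F \<and> NTgt \<tau> = G \<and> fun_on F A B \<and> fun_on G A B"

lemma nt_hom: "nt_on \<tau> F G A B \<Longrightarrow> x \<in> Obj A \<Longrightarrow> in_hom B (Cmp \<tau> x) (FO F x) (FO G x)"
  by (auto simp: nt_on_def is_ntrans_def Let_def fun_on_def)

lemma nt_nat:
  "nt_on \<tau> F G A B \<Longrightarrow> in_hom A f x y \<Longrightarrow>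
   Comp B (Cmp \<tau> y) (FM F f) = Comp B (FM G f) (Cmp \<tau> x)"
  by (auto simp: nt_on_def is_ntrans_def Let_def fun_on_def in_hom_def)

lemma nt_ext: "nt_on \<tau> F G A B \<Longrightarrow> Cmp \<tau> \<in> extensional (Obj A)"
  by (auto simp: nt_on_def is_ntrans_def Let_def fun_on_def)

lemma nt_onI:
  assumes "fun_on F A B" "fun_on G A B" "NSrc \<tau> = F" "NTgt \<tau> = G"
    and "Cmp \<tau> \<in> extensional (Obj A)"
    and "\<And>x. x \<in> Obj A \<Longrightarrow> in_hom B (Cmp \<tau> x) (FO F x) (FO G x)"
    and "\<And>f x y. in_hom A f x y \<Longrightarrow>
      Comp B (Cmp \<tau> y) (FM F f) = Comp B (FM G f) (Cmp \<tau> x)"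
  shows "nt_on \<tau> F G A B" using assms(1-6) assms(7)[OF arr_hom]
  by (auto simp: nt_on_def is_ntrans_def Let_def fun_on_def)

lemma nt_eqI:
  fixes \<sigma> \<tau> :: "('a, 'b, 'c, 'd) ntrans"
  assumes "NSrc \<sigma> = NSrc \<tau>" "NTgt \<sigma> = NTgt \<tau>" "Cmp \<sigma> \<in> extensional S" "Cmp \<tau> \<in> extensional S"
    and "\<And>x. x \<in> S \<Longrightarrow> Cmp \<sigma> x = Cmp \<tau> x"
  shows "\<sigma> = \<tau>"
proof -
  have "Cmp \<sigma> = Cmp \<tau>" using assms extensionalityI by metis
  then show ?thesis using assms by (cases \<sigma>; cases \<tau>) simp
qed

lemma mk_ntrans_sel [simp]:
  "NSrc (mk_ntrans F G t) = F" "NTgt (mk_ntrans F G t) = G"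
  "x \<in> Obj (Src F) \<Longrightarrow> Cmp (mk_ntrans F G t) x = t x"
  "Cmp (mk_ntrans F G t) \<in> extensional (Obj (Src F))" by (simp_all add: mk_ntrans_def)

lemma id_nt_sel [simp]:
  "NSrc (id_nt F) = F" "NTgt (id_nt F) = F"
  "x \<in> Obj (Src F) \<Longrightarrow> Cmp (id_nt F) x = Id (Tgt F) (FO F x)"
  "Cmp (id_nt F) \<in> extensional (Obj (Src F))" by (simp_all add: id_nt_def)

lemma vcomp_sel [simp]:
  "NSrc (\<tau> \<bullet> \<sigma>) = NSrc \<sigma>" "NTgt (\<tau> \<bullet> \<sigma>) = NTgt \<tau>"
  "x \<in> Obj (Src (NSrc \<sigma>)) \<Longrightarrow> Cmp (\<tau> \<bullet> \<sigma>) x = Comp (Tgt (NTgt \<tau>)) (Cmp \<tau> x) (Cmp \<sigma> x)"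
  "Cmp (\<tau> \<bullet> \<sigma>) \<in> extensional (Obj (Src (NSrc \<sigma>)))" by (simp_all add: vcomp_def)

lemma lwhisk_sel [simp]:
  "NSrc (G \<lhd> \<sigma>) = G \<circ>\<^sub>f NSrc \<sigma>" "NTgt (G \<lhd> \<sigma>) = G \<circ>\<^sub>f NTgt \<sigma>"
  "x \<in> Obj (Src (NSrc \<sigma>)) \<Longrightarrow> Cmp (G \<lhd> \<sigma>) x = FM G (Cmp \<sigma> x)"
  "Cmp (G \<lhd> \<sigma>) \<in> extensional (Obj (Src (NSrc \<sigma>)))"
  by (simp_all add: lwhisk_def mk_ntrans_def)

lemma rwhisk_sel [simp]:
  "NSrc (\<sigma> \<rhd> F) = NSrc \<sigma> \<circ>\<^sub>f F" "NTgt (\<sigma> \<rhd> F) = NTgt \<sigma> \<circ>\<^sub>f F"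
  "x \<in> Obj (Src F) \<Longrightarrow> Cmp (\<sigma> \<rhd> F) x = Cmp \<sigma> (FO F x)"
  "Cmp (\<sigma> \<rhd> F) \<in> extensional (Obj (Src F))" by (simp_all add: rwhisk_def mk_ntrans_def)

lemma inv_nt_sel [simp]:
  "NSrc (inv_nt \<tau>) = NTgt \<tau>" "NTgt (inv_nt \<tau>) = NSrc \<tau>"
  "x \<in> Obj (Src (NTgt \<tau>)) \<Longrightarrow> Cmp (inv_nt \<tau>) x = inv_arr (Tgt (NSrc \<tau>)) (Cmp \<tau> x)"
  "Cmp (inv_nt \<tau>) \<in> extensional (Obj (Src (NTgt \<tau>)))" by (simp_all add: inv_nt_def)

lemma nt_on_id: 
  assumes F: "fun_on F A B"
  shows "nt_on (id_nt F) F F A B"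
proof (rule nt_onI)
  note * = fun_onD[OF F]
  show "Cmp (id_nt F) \<in> extensional (Obj A)" using id_nt_sel(4)[of F] * by simp
  show "in_hom B (Cmp (id_nt F) x) (FO F x) (FO F x)" if "x \<in> Obj A" for x
    using * id_hom[OF *(5) fun_obj[OF F that]] that by simp
  show "Comp B (Cmp (id_nt F) y) (FM F f) = Comp B (FM F f) (Cmp (id_nt F) x)"
    if f: "in_hom A f x y" for f x y using hom_obj[OF *(4) f] comp_id_left[OF *(5) fun_hom[OF F f]]
      comp_id_right[OF *(5) fun_hom[OF F f]] * by simp
qed (use F in auto)

subsection \<open>Universal arrows\<close>

text \<open>The pair (W, e) represents the functor Z |-> Hom(Y, F Z): W is the value at Y of a left
  adjoint of F, and e is the unit there. Nothing is chosen, so units of Kan extensions, their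
  restrictions and their composites with isomorphisms can all be compared as universal arrows out of
  the same object.\<close>

definition uarr ::
  "('a, 'b) cat \<Rightarrow> ('c, 'd) cat \<Rightarrow> ('a, 'b, 'c, 'd) func \<Rightarrow> 'c \<Rightarrow> 'a \<Rightarrow> 'd \<Rightarrow> bool" where
  "uarr E C F Y W e \<longleftrightarrow> fun_on F E C \<and> W \<in> Obj E \<and> in_hom C e Y (FO F W) \<and>
     (\<forall>Z\<in>Obj E. \<forall>h. in_hom C h Y (FO F Z) \<longrightarrow>
      (\<exists>!g. in_hom E g W Z \<and> Comp C (FM F g) e = h))"

text \<open>The dual notion: W is the value at Y of a right adjoint of F, and e is the counit
  there.\<close>

definition darr ::
  "('a, 'b) cat \<Rightarrow> ('c, 'd) cat \<Rightarrow> ('a, 'b, 'c, 'd) func \<Rightarrow> 'c \<Rightarrow> 'a \<Rightarrow> 'd \<Rightarrow> bool" where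
  "darr E C F Y W e \<longleftrightarrow> fun_on F E C \<and> W \<in> Obj E \<and> in_hom C e (FO F W) Y \<and>
     (\<forall>Z\<in>Obj E. \<forall>h. in_hom C h (FO F Z) Y \<longrightarrow>
      (\<exists>!g. in_hom E g Z W \<and> Comp C e (FM F g) = h))"

lemma uarrD:
  assumes "uarr E C F Y W e"
  shows "fun_on F E C" "W \<in> Obj E" "in_hom C e Y (FO F W)" "is_cat E" "is_cat C"
  using assms fun_onD by (auto simp: uarr_def)

lemma uarrE:
  assumes "uarr E C F Y W e" "Z \<in> Obj E" "in_hom C h Y (FO F Z)"
  obtains g where "in_hom E g W Z" "Comp C (FM F g) e = h" using assms unfolding uarr_def by blast

lemma uarr_eq:
  assumes e: "uarr E C F Y W e" and g: "in_hom E g W Z" "in_hom E g' W Z"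
    and eq: "Comp C (FM F g) e = Comp C (FM F g') e"
  shows "g = g'"
proof -
  note * = uarrD[OF e]
  have "Z \<in> Obj E" "in_hom C (Comp C (FM F g) e) Y (FO F Z)"
    using hom_obj[OF *(4) g(1)] comp_hom[OF *(5,3) fun_hom[OF *(1) g(1)]] by auto
  then have "\<exists>!g''. in_hom E g'' W Z \<and> Comp C (FM F g'') e = Comp C (FM F g) e"
    using e unfolding uarr_def by blast
  then show ?thesis using g eq[symmetric] by blast
qed

lemma uarrI:
  assumes "fun_on F E C" "W \<in> Obj E" "in_hom C e Y (FO F W)"
    and "\<And>Z h. Z \<in> Obj E \<Longrightarrow> in_hom C h Y (FO F Z) \<Longrightarrow> \<exists>g. in_hom E g W Z \<and> Comp C (FM F g) e = h"
    and "\<And>Z g g'. in_hom E g W Z \<Longrightarrow> in_hom E g' W Z \<Longrightarrow> Comp C (FM F g) e = Comp C (FM F g') e \<Longrightarrow>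
      g = g'"
  shows "uarr E C F Y W e" using assms(1-3) assms(4) assms(5) unfolding uarr_def by blast

lemma darrD:
  assumes "darr E C F Y W e"
  shows "fun_on F E C" "W \<in> Obj E" "in_hom C e (FO F W) Y" "is_cat E" "is_cat C"
  using assms fun_onD by (auto simp: darr_def)

lemma darrE:
  assumes "darr E C F Y W e" "Z \<in> Obj E" "in_hom C h (FO F Z) Y"
  obtains g where "in_hom E g Z W" "Comp C e (FM F g) = h" using assms unfolding darr_def by blast

lemma darr_eq:
  assumes e: "darr E C F Y W e" and g: "in_hom E g Z W" "in_hom E g' Z W"
    and eq: "Comp C e (FM F g) = Comp C e (FM F g')"
  shows "g = g'"
proof -
  note * = darrD[OF e]
  have "Z \<in> Obj E" "in_hom C (Comp C e (FM F g)) (FO F Z) Y"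
    using hom_obj[OF *(4) g(1)] comp_hom[OF *(5) fun_hom[OF *(1) g(1)] *(3)] by auto
  then have "\<exists>!g''. in_hom E g'' Z W \<and> Comp C e (FM F g'') = Comp C e (FM F g)"
    using e unfolding darr_def by blast
  then show ?thesis using g eq[symmetric] by blast
qed

lemma darrI:
  assumes "fun_on F E C" "W \<in> Obj E" "in_hom C e (FO F W) Y"
    and "\<And>Z h. Z \<in> Obj E \<Longrightarrow> in_hom C h (FO F Z) Y \<Longrightarrow> \<exists>g. in_hom E g Z W \<and> Comp C e (FM F g) = h"
    and "\<And>Z g g'. in_hom E g Z W \<Longrightarrow> in_hom E g' Z W \<Longrightarrow> Comp C e (FM F g) = Comp C e (FM F g') \<Longrightarrow>
      g = g'"
  shows "darr E C F Y W e" using assms(1-3) assms(4) assms(5) unfolding darr_def by blast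

text \<open>Left adjoints compose: Hom(V, Z) = Hom(W, G Z) = Hom(Y, F G Z), and \<open>key\<close>
  computes the composite bijection.\<close>

lemma uarr_comp:
  assumes e: "uarr E C F Y W e" and f: "uarr H E G W V f"
  shows "uarr H C (F \<circ>\<^sub>f G) Y V (Comp C (FM F f) e)"
proof (rule uarrI)
  note E = uarrD[OF e] and H = uarrD[OF f]
  note ap = comp_func_app[OF H(1)]
  have Ff: "in_hom C (FM F f) (FO F W) (FO F (FO G V))" by (rule fun_hom[OF E(1) H(3)])
  show "fun_on (F \<circ>\<^sub>f G) H C" "V \<in> Obj H" by (rule fun_on_comp[OF H(1) E(1)], rule H(2))
  show "in_hom C (Comp C (FM F f) e) Y (FO (F \<circ>\<^sub>f G) V)"
    using comp_hom[OF E(5,3) Ff] by (simp add: ap(1)[OF H(2)])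
  have key: "Comp C (FM (F \<circ>\<^sub>f G) k) (Comp C (FM F f) e) = Comp C (FM F (Comp E (FM G k) f)) e"
    if k: "in_hom H k V Z" for k Z using comp_assoc[OF E(5,3) Ff fun_hom[OF E(1) fun_hom[OF H(1) k]]]
      fun_comp[OF E(1) H(3) fun_hom[OF H(1) k]] by (simp add: ap(2)[OF k])
  {
    fix Z h assume Z: "Z \<in> Obj H" and h: "in_hom C h Y (FO (F \<circ>\<^sub>f G) Z)"
    have h: "in_hom C h Y (FO F (FO G Z))" using h by (simp add: ap(1)[OF Z])
    obtain g where g: "in_hom E g W (FO G Z)" "Comp C (FM F g) e = h"
      using uarrE[OF e fun_obj[OF H(1) Z] h] by blast
    obtain k where k: "in_hom H k V Z" "Comp E (FM G k) f = g" using uarrE[OF f Z g(1)] by blast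
    show "\<exists>k. in_hom H k V Z \<and> Comp C (FM (F \<circ>\<^sub>f G) k) (Comp C (FM F f) e) = h"
      using k g key[OF k(1)] by auto
  next
    fix Z k k' assume k: "in_hom H k V Z" "in_hom H k' V Z"
      and eq: "Comp C (FM (F \<circ>\<^sub>f G) k) (Comp C (FM F f) e) = Comp C (FM (F \<circ>\<^sub>f G) k') (Comp C (FM F f) e)"
    have "Comp E (FM G k) f = Comp E (FM G k') f" using uarr_eq[OF e comp_hom[OF E(4) H(3) fun_hom[OF H(1) k(1)]]
        comp_hom[OF E(4) H(3) fun_hom[OF H(1) k(2)]]] eq key[OF k(1)] key[OF k(2)] by simp
    then show "k = k'" by (rule uarr_eq[OF f k])
  }
qed

text \<open>In Hom(V, Z) -> Hom(W, G Z) -> Hom(Y, F G Z) the second map and the composite are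
  bijective, hence so is the first.\<close>

lemma uarr_cancel:
  assumes e: "uarr E C F Y W e" and fe: "uarr H C (F \<circ>\<^sub>f G) Y V (Comp C (FM F f) e)"
    and G: "fun_on G H E" and f: "in_hom E f W (FO G V)"
  shows "uarr H E G W V f"
proof (rule uarrI)
  note E = uarrD[OF e] and H = uarrD[OF fe]
  note ap = comp_func_app[OF G]
  have Ff: "in_hom C (FM F f) (FO F W) (FO F (FO G V))" by (rule fun_hom[OF E(1) f])
  show "fun_on G H E" "V \<in> Obj H" "in_hom E f W (FO G V)" by fact+
  have key: "Comp C (FM (F \<circ>\<^sub>f G) k) (Comp C (FM F f) e) = Comp C (FM F (Comp E (FM G k) f)) e"
    if k: "in_hom H k V Z" for k Z using comp_assoc[OF E(5,3) Ff fun_hom[OF E(1) fun_hom[OF G k]]]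
      fun_comp[OF E(1) f fun_hom[OF G k]] by (simp add: ap(2)[OF k])
  {
    fix Z h assume Z: "Z \<in> Obj H" and h: "in_hom E h W (FO G Z)"
    have "in_hom C (Comp C (FM F h) e) Y (FO (F \<circ>\<^sub>f G) Z)"
      using comp_hom[OF E(5,3) fun_hom[OF E(1) h]] by (simp add: ap(1)[OF Z])
    from uarrE[OF fe Z this] obtain k where k: "in_hom H k V Z"
      "Comp C (FM (F \<circ>\<^sub>f G) k) (Comp C (FM F f) e) = Comp C (FM F h) e" by blast
    have "Comp E (FM G k) f = h"
      by (rule uarr_eq[OF e comp_hom[OF E(4) f fun_hom[OF G k(1)]] h]) (use k key[OF k(1)] in simp)
    then show "\<exists>k. in_hom H k V Z \<and> Comp E (FM G k) f = h" using k by blast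
  next
    fix Z k k' assume k: "in_hom H k V Z" "in_hom H k' V Z"
      and eq: "Comp E (FM G k) f = Comp E (FM G k') f"
    show "k = k'" by (rule uarr_eq[OF fe k]) (simp add: key[OF k(1)] key[OF k(2)] eq)
  }
qed

lemma uarr_id: "is_cat C \<Longrightarrow> Y \<in> Obj C \<Longrightarrow> uarr C C (id_func C) Y Y (Id C Y)"
  using id_hom[of C Y] by (intro uarrI) (auto simp: fun_on_id in_hom_def cat_simps)

text \<open>An isomorphism is a universal arrow to the identity functor, so this is an instance of
  \<open>uarr_comp\<close>.\<close>

lemma uarr_iso_right:
  assumes e: "uarr E C F Y W e" and m: "in_hom E m W W'" "is_iso E m"
  shows "uarr E C F Y W' (Comp C (FM F m) e)"
proof -
  note E = uarrD[OF e]
  have W: "W \<in> Obj E" "W' \<in> Obj E" using hom_obj[OF E(4) m(1)] .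
  have "uarr E E (id_func E) W W' m"
  proof (rule uarrI)
    show "fun_on (id_func E) E E" "W' \<in> Obj E" "in_hom E m W (FO (id_func E) W')"
      using W m fun_on_id[OF E(4)] by auto
    obtain n where n: "in_hom E n W' W" "Comp E n m = Id E W" "Comp E m n = Id E W'"
      using iso_hom[OF m(2,1)] by blast
    {
      fix Z h assume "Z \<in> Obj E" and h: "in_hom E h W (FO (id_func E) Z)"
      then have h: "in_hom E h W Z" by simp
      have hn: "in_hom E (Comp E h n) W' Z" by (rule comp_hom[OF E(4) n(1) h])
      have "Comp E (Comp E h n) m = h" using comp_assoc[OF E(4) m(1) n(1) h] n comp_id_right[OF E(4) h] by simp
      then show "\<exists>g. in_hom E g W' Z \<and> Comp E (FM (id_func E) g) m = h"
        using hn by (auto simp: in_hom_def)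
    next
      fix Z g g' assume g: "in_hom E g W' Z" "in_hom E g' W' Z"
        "Comp E (FM (id_func E) g) m = Comp E (FM (id_func E) g') m"
      then show "g = g'" using iso_cancel_right[OF E(4) g(1,2) m] by (simp add: in_hom_def)
    }
  qed
  from uarr_comp[OF e this] show ?thesis using comp_id_func[OF E(1)] by simp
qed

text \<open>Most isomorphisms below arise from this (base change, mates, uniqueness of adjoints):
  the map back comes from the universality of \<open>e'\<close>, and both composites are identities
  because they fix a universal arrow.\<close>

lemma uarr_unique_iso:
  assumes e: "uarr E C F Y W e" and e': "uarr E C F Y W' e'"
    and m: "in_hom E m W W'" "Comp C (FM F m) e = e'"
  shows "is_iso E m"
proof -
  note E = uarrD[OF e] and E' = uarrD[OF e']
  obtain n where n: "in_hom E n W' W" "Comp C (FM F n) e' = e" using uarrE[OF e' E(2,3)] by blast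
  have nm: "in_hom E (Comp E n m) W W" and mn: "in_hom E (Comp E m n) W' W'" using comp_hom[OF E(4)] m n by blast+
  have "Comp C (FM F (Comp E n m)) e = e"
    using comp_assoc[OF E(5,3) fun_hom[OF E(1) m(1)] fun_hom[OF E(1) n(1)]] m n
      fun_comp[OF E(1) m(1) n(1)] by simp
  then have 1: "Comp E n m = Id E W"
    using uarr_eq[OF e nm id_hom[OF E(4,2)]] fun_id[OF E(1,2)] comp_id_left[OF E(5,3)] by simp
  have "Comp C (FM F (Comp E m n)) e' = e'"
    using comp_assoc[OF E(5) E'(3) fun_hom[OF E(1) n(1)] fun_hom[OF E(1) m(1)]] m n
      fun_comp[OF E(1) n(1) m(1)] by simp
  then have 2: "Comp E m n = Id E W'"
    using uarr_eq[OF e' mn id_hom[OF E(4) E'(2)]] fun_id[OF E(1) E'(2)] comp_id_left[OF E(5) E'(3)] by simp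
  show ?thesis by (rule isoI[OF m(1) n(1) 1 2])
qed

lemma uarr_id_iso:
  assumes e: "uarr C C (id_func C) Y W e"
  shows "is_iso C e"
proof -
  note E = uarrD[OF e]
  have e1: "in_hom C e Y W" using E by simp
  have Y: "Y \<in> Obj C" using hom_obj[OF E(5) e1] by simp
  show ?thesis by (rule uarr_unique_iso[OF uarr_id[OF E(5) Y] e e1])
      (use e1 comp_id_right[OF E(5) e1] in \<open>simp add: in_hom_def\<close>)
qed

text \<open>In an adjoint triple L -| F -| G with G fully faithful (invertible counit), L is fully
  faithful as well: precomposition with u identifies Hom(F L X, Z) with Hom(L X, G Z) = Hom(X, F G
  Z) = Hom(X, Z), so u is universal for the identity functor. In the application F is evaluation at
  1 of [1].\<close>

lemma darr_unit_iso:
  assumes ff: "\<And>Y. Y \<in> Obj C \<Longrightarrow> \<exists>W e. darr E C F Y W e \<and> is_iso C e"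
    and u: "uarr E C F X V u"
  shows "is_iso C u"
proof (rule uarr_id_iso, rule uarrI)
  note U = uarrD[OF u]
  have FV: "FO F V \<in> Obj C" by (rule fun_obj[OF U(1,2)])
  show "fun_on (id_func C) C C" "FO F V \<in> Obj C" "in_hom C u X (FO (id_func C) (FO F V))"
    using fun_on_id U FV by auto
  {
    fix Z h assume Z: "Z \<in> Obj C" and h: "in_hom C h X (FO (id_func C) Z)"
    then have h: "in_hom C h X Z" by simp
    obtain W e where e: "darr E C F Z W e" "is_iso C e" using ff[OF Z] by blast
    note D = darrD[OF e(1)]
    obtain e' where e': "in_hom C e' Z (FO F W)" "Comp C e' e = Id C (FO F W)" "Comp C e e' = Id C Z"
      using iso_hom[OF e(2) D(3)] by blast
    \<comment> \<open>h is lifted along the inverse of the counit and transposed; pushing the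
      transpose back along e gives the required factorisation.\<close>
    obtain g where g: "in_hom E g V W" "Comp C (FM F g) u = Comp C e' h"
      using uarrE[OF u D(2) comp_hom[OF D(5) h e'(1)]] by blast
    have Fg: "in_hom C (FM F g) (FO F V) (FO F W)" by (rule fun_hom[OF U(1) g(1)])
    have "Comp C (Comp C e (FM F g)) u = h"
      using comp_assoc[OF D(5) U(3) Fg D(3)] g comp_cancel[OF D(5) h e'(1) D(3) e'(3)] by simp
    then show "\<exists>g. in_hom C g (FO F V) Z \<and> Comp C (FM (id_func C) g) u = h"
      using comp_hom[OF D(5) Fg D(3)] by (auto simp: in_hom_def)
  next
    fix Z f f' assume f: "in_hom C f (FO F V) Z" "in_hom C f' (FO F V) Z"
      and "Comp C (FM (id_func C) f) u = Comp C (FM (id_func C) f') u"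
    then have eq: "Comp C f u = Comp C f' u" by (simp add: in_hom_def)
    have Z: "Z \<in> Obj C" using hom_obj[OF U(5) f(1)] by simp
    obtain W e where e: "darr E C F Z W e" "is_iso C e" using ff[OF Z] by blast
    note D = darrD[OF e(1)]
    obtain g where g: "in_hom E g V W" "Comp C e (FM F g) = f" using darrE[OF e(1) U(2) f(1)] by blast
    obtain g' where g': "in_hom E g' V W" "Comp C e (FM F g') = f'" using darrE[OF e(1) U(2) f(2)] by blast
    note Fg = fun_hom[OF U(1) g(1)] fun_hom[OF U(1) g'(1)]
    have "Comp C e (Comp C (FM F g) u) = Comp C e (Comp C (FM F g') u)"
      using comp_assoc[OF D(5) U(3) Fg(1) D(3)] comp_assoc[OF D(5) U(3) Fg(2) D(3)] g g' eq by simp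
    then have "Comp C (FM F g) u = Comp C (FM F g') u"
      by (rule iso_cancel_left[OF D(5) comp_hom[OF D(5) U(3) Fg(1)] comp_hom[OF D(5) U(3) Fg(2)]
        D(3) e(2)])
    then show "f = f'" using uarr_eq[OF u g(1) g'(1)] g g' by simp
  }
qed

lemma darr_id_iso:
  assumes e: "darr C C (id_func C) Y W e"
  shows "is_iso C e"
proof -
  note E = darrD[OF e]
  have e1: "in_hom C e W Y" using E by simp
  have Y: "Y \<in> Obj C" using hom_obj[OF E(5) e1] by simp
  obtain g where g: "in_hom C g Y W" "Comp C e (FM (id_func C) g) = Id C Y"
    using darrE[OF e Y] id_hom[OF E(5) Y] Y by auto
  then have g2: "Comp C e g = Id C Y" by (simp add: in_hom_def)
  have "Comp C g e = Id C W" by (rule darr_eq[OF e comp_hom[OF E(5) e1 g(1)] id_hom[OF E(5,2)]])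
      (use comp_hom[OF E(5) e1 g(1)] id_hom[OF E(5,2)] comp_cancel[OF E(5) e1 g(1) e1 g2]
        comp_id_right[OF E(5) e1] in \<open>simp add: in_hom_def\<close>)
  then show ?thesis using isoI[OF e1 g(1)] g2 by simp
qed

text \<open>Dual of \<open>darr_unit_iso\<close>: a functor with a fully faithful left adjoint has a
  fully faithful right adjoint. In the application F is restriction along the edge [1] -> corner,
  whose left adjoint is restriction along the projection back to [1].\<close>

lemma uarr_counit_iso:
  assumes ff: "\<And>Y. Y \<in> Obj C \<Longrightarrow> \<exists>W e. uarr E C F Y W e \<and> is_iso C e"
    and c: "darr E C F X V c"
  shows "is_iso C c"
proof (rule darr_id_iso, rule darrI)
  note D = darrD[OF c]
  have FV: "FO F V \<in> Obj C" by (rule fun_obj[OF D(1,2)])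
  show "fun_on (id_func C) C C" "FO F V \<in> Obj C" "in_hom C c (FO (id_func C) (FO F V)) X"
    using fun_on_id D FV by auto
  {
    fix Z h assume Z: "Z \<in> Obj C" and h: "in_hom C h (FO (id_func C) Z) X"
    then have h: "in_hom C h Z X" by simp
    obtain W e where e: "uarr E C F Z W e" "is_iso C e" using ff[OF Z] by blast
    note U = uarrD[OF e(1)]
    obtain e' where e': "in_hom C e' (FO F W) Z" "Comp C e' e = Id C Z" "Comp C e e' = Id C (FO F W)"
      using iso_hom[OF e(2) U(3)] by blast
    obtain g where g: "in_hom E g W V" "Comp C c (FM F g) = Comp C h e'"
      using darrE[OF c U(2) comp_hom[OF D(5) e'(1) h]] by blast
    have Fg: "in_hom C (FM F g) (FO F W) (FO F V)" by (rule fun_hom[OF U(1) g(1)])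
    have "Comp C c (Comp C (FM F g) e) = h"
      using comp_assoc[OF D(5) U(3) Fg D(3)] g comp_assoc[OF D(5) U(3) e'(1) h] e'(2)
        comp_id_right[OF D(5) h] by simp
    then show "\<exists>g. in_hom C g Z (FO F V) \<and> Comp C c (FM (id_func C) g) = h"
      using comp_hom[OF D(5) U(3) Fg] by (auto simp: in_hom_def)
  next
    fix Z f f' assume f: "in_hom C f Z (FO F V)" "in_hom C f' Z (FO F V)"
      and "Comp C c (FM (id_func C) f) = Comp C c (FM (id_func C) f')"
    then have eq: "Comp C c f = Comp C c f'" by (simp add: in_hom_def)
    have Z: "Z \<in> Obj C" using hom_obj[OF D(5) f(1)] by simp
    obtain W e where e: "uarr E C F Z W e" "is_iso C e" using ff[OF Z] by blast
    note U = uarrD[OF e(1)]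
    obtain g where g: "in_hom E g W V" "Comp C (FM F g) e = f" using uarrE[OF e(1) D(2) f(1)] by blast
    obtain g' where g': "in_hom E g' W V" "Comp C (FM F g') e = f'" using uarrE[OF e(1) D(2) f(2)] by blast
    note Fg = fun_hom[OF U(1) g(1)] fun_hom[OF U(1) g'(1)]
    have "Comp C (Comp C c (FM F g)) e = Comp C (Comp C c (FM F g')) e"
      using comp_assoc[OF D(5) U(3) Fg(1) D(3)] comp_assoc[OF D(5) U(3) Fg(2) D(3)] g g' eq by simp
    then have "Comp C c (FM F g) = Comp C c (FM F g')"
      by (rule iso_cancel_right[OF D(5) comp_hom[OF D(5) Fg(1) D(3)] comp_hom[OF D(5) Fg(2) D(3)]
        U(3) e(2)])
    then show "f = f'" using darr_eq[OF c g(1) g'(1)] g g' by simp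
  }
qed

subsection \<open>Adjunctions\<close>

text \<open>The equations of \<open>adjunction\<close>, which relate whole natural transformations,
  are evaluated at objects; units, counits and triangle identities are used only in this
  componentwise form.\<close>

lemma adjD:
  assumes adj: "adjunction L R \<eta> \<epsilon>" and R: "fun_on R E C"
  shows "fun_on L C E" "nt_on \<eta> (id_func C) (R \<circ>\<^sub>f L) C C" "nt_on \<epsilon> (L \<circ>\<^sub>f R) (id_func E) E E"
    "x \<in> Obj C \<Longrightarrow> in_hom C (Cmp \<eta> x) x (FO R (FO L x))"
    "y \<in> Obj E \<Longrightarrow> in_hom E (Cmp \<epsilon> y) (FO L (FO R y)) y"
    "in_hom C f x x' \<Longrightarrow> Comp C (Cmp \<eta> x') f = Comp C (FM R (FM L f)) (Cmp \<eta> x)"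
    "in_hom E g y y' \<Longrightarrow> Comp E (Cmp \<epsilon> y') (FM L (FM R g)) = Comp E g (Cmp \<epsilon> y)"
    "x \<in> Obj C \<Longrightarrow> Comp E (Cmp \<epsilon> (FO L x)) (FM L (Cmp \<eta> x)) = Id E (FO L x)"
    "y \<in> Obj E \<Longrightarrow> Comp C (FM R (Cmp \<epsilon> y)) (Cmp \<eta> (FO R y)) = Id C (FO R y)"
proof -
  note R' = fun_onD[OF R]
  show L: "fun_on L C E" using adj R' by (auto simp: adjunction_def fun_on_def)
  note L' = fun_onD[OF L]
  show e: "nt_on \<eta> (id_func C) (R \<circ>\<^sub>f L) C C" using adj fun_on_id[OF L'(4)] fun_on_comp[OF L R] L'
    by (auto simp: adjunction_def nt_on_def)
  show d: "nt_on \<epsilon> (L \<circ>\<^sub>f R) (id_func E) E E"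
    using adj fun_on_id[OF R'(4)] fun_on_comp[OF R L] L' by (auto simp: adjunction_def nt_on_def)
  show e1: "in_hom C (Cmp \<eta> x) x (FO R (FO L x))" if "x \<in> Obj C" for x
    using nt_hom[OF e that] that by (simp add: comp_func_app(1)[OF L that])
  show d1: "in_hom E (Cmp \<epsilon> y) (FO L (FO R y)) y" if "y \<in> Obj E" for y
    using nt_hom[OF d that] that by (simp add: comp_func_app(1)[OF R that])
  show "Comp C (Cmp \<eta> x') f = Comp C (FM R (FM L f)) (Cmp \<eta> x)" if "in_hom C f x x'" for f x x'
    using nt_nat[OF e that] that by (simp add: in_hom_def comp_func_app(2)[OF L that])
  show "Comp E (Cmp \<epsilon> y') (FM L (FM R g)) = Comp E g (Cmp \<epsilon> y)" if "in_hom E g y y'" for g y y'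
    using nt_nat[OF d that] that by (simp add: in_hom_def comp_func_app(2)[OF R that])
  have s: "NSrc \<eta> = id_func C" "NTgt \<epsilon> = id_func E" using e d by (auto simp: nt_on_def)
  show "Comp E (Cmp \<epsilon> (FO L x)) (FM L (Cmp \<eta> x)) = Id E (FO L x)" if x: "x \<in> Obj C"
  proof -
    have "Cmp ((\<epsilon> \<rhd> L) \<bullet> (L \<lhd> \<eta>)) x = Cmp (id_nt L) x" using adj by (simp add: adjunction_def)
    then show ?thesis using x L' s by simp
  qed
  show "Comp C (FM R (Cmp \<epsilon> y)) (Cmp \<eta> (FO R y)) = Id C (FO R y)" if y: "y \<in> Obj E"
  proof -
    have "NSrc \<eta> = id_func C" "NSrc \<epsilon> = L \<circ>\<^sub>f R" "NTgt \<eta> = R \<circ>\<^sub>f L"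
      using e d by (auto simp: nt_on_def)
    moreover have "Cmp ((R \<lhd> \<epsilon>) \<bullet> (\<eta> \<rhd> R)) y = Cmp (id_nt R) y" using adj by (simp add: adjunction_def)
    ultimately show ?thesis using y R' L' s by simp
  qed
qed

text \<open>The hypotheses are those that survive in components, so the lemma also applies to adjunctions
  obtained from adjunctions in the 2-category of small categories.\<close>

lemma uarr_of_unit_counit:
  assumes R: "fun_on R E C" and L: "fun_on L C E" and x: "x \<in> Obj C"
    and eta: "in_hom C e x (FO R (FO L x))"
    and eps: "\<And>y. y \<in> Obj E \<Longrightarrow> in_hom E (d y) (FO L (FO R y)) y"
    and etan: "\<And>f y. y \<in> Obj E \<Longrightarrow> in_hom C f x (FO R y) \<Longrightarrow>
      Comp C (FM R (FM L f)) e = Comp C (e' y) f"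
    and epsn: "\<And>g y. in_hom E g (FO L x) y \<Longrightarrow>
      Comp E (d y) (FM L (FM R g)) = Comp E g (d (FO L x))"
    and tri1: "Comp E (d (FO L x)) (FM L e) = Id E (FO L x)"
    and tri2: "\<And>y. y \<in> Obj E \<Longrightarrow> in_hom C (e' y) (FO R y) (FO R (FO L (FO R y))) \<and>
      Comp C (FM R (d y)) (e' y) = Id C (FO R y)"
  shows "uarr E C R x (FO L x) e"
proof (rule uarrI)
  note R' = fun_onD[OF R] and L' = fun_onD[OF L]
  show "fun_on R E C" "in_hom C e x (FO R (FO L x))" by fact+
  show Lx: "FO L x \<in> Obj E" by (rule fun_obj[OF L x])
  {
    fix Z h assume Z: "Z \<in> Obj E" and h: "in_hom C h x (FO R Z)"
    let ?g = "Comp E (d Z) (FM L h)"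
    have Lh: "in_hom E (FM L h) (FO L x) (FO L (FO R Z))" by (rule fun_hom[OF L h])
    have g: "in_hom E ?g (FO L x) Z" by (rule comp_hom[OF R'(4) Lh eps[OF Z]])
    have t: "in_hom C (e' Z) (FO R Z) (FO R (FO L (FO R Z)))" using tri2[OF Z] by blast
    have "Comp C (FM R ?g) e = Comp C (FM R (d Z)) (Comp C (FM R (FM L h)) e)" using fun_comp[OF R Lh eps[OF Z]]
        comp_assoc[OF R'(5) eta fun_hom[OF R Lh] fun_hom[OF R eps[OF Z]]] by simp
    also have "\<dots> = Comp C (FM R (d Z)) (Comp C (e' Z) h)" using etan[OF Z h] by simp
    also have "\<dots> = h" using comp_cancel[OF R'(5) h t fun_hom[OF R eps[OF Z]]] tri2[OF Z] by blast
    finally show "\<exists>g. in_hom E g (FO L x) Z \<and> Comp C (FM R g) e = h" using g by blast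
  next
    fix Z g g' assume g: "in_hom E g (FO L x) Z" "in_hom E g' (FO L x) Z"
      and eq: "Comp C (FM R g) e = Comp C (FM R g') e"
    have Z: "Z \<in> Obj E" using hom_obj[OF R'(4) g(1)] by simp
    \<comment> \<open>Every k is recovered from its transpose, which gives uniqueness.\<close>
    have *: "k = Comp E (d Z) (FM L (Comp C (FM R k) e))" if k: "in_hom E k (FO L x) Z" for k
    proof -
      note Rk = fun_hom[OF R k]
      have "Comp E (d Z) (FM L (Comp C (FM R k) e)) = Comp E (Comp E (d Z) (FM L (FM R k))) (FM L e)"
        using fun_comp[OF L eta Rk]
          comp_assoc[OF R'(4) fun_hom[OF L eta] fun_hom[OF L Rk] eps[OF Z]] by simp
      also have "\<dots> = Comp E (Comp E k (d (FO L x))) (FM L e)" using epsn[OF k] by simp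
      also have "\<dots> = k"
        using comp_assoc[OF R'(4) fun_hom[OF L eta] eps[OF Lx] k] tri1 comp_id_right[OF R'(4) k] by simp
      finally show ?thesis by simp
    qed
    show "g = g'" using *[OF g(1)] *[OF g(2)] eq by simp
  }
qed

lemma uarr_adj:
  assumes adj: "adjunction L R \<eta> \<epsilon>" and R: "fun_on R E C" and x: "x \<in> Obj C"
  shows "uarr E C R x (FO L x) (Cmp \<eta> x)"
proof -
  note A = adjD[OF adj R]
  show ?thesis
  proof (rule uarr_of_unit_counit[OF R A(1) x, where d = "Cmp \<epsilon>" and e' = "\<lambda>y. Cmp \<eta> (FO R y)"])
    show "Comp C (FM R (FM L f)) (Cmp \<eta> x) = Comp C (Cmp \<eta> (FO R y)) f"
      if "y \<in> Obj E" "in_hom C f x (FO R y)" for f y using A(6)[OF that(2)] by simp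
    show "Comp E (Cmp \<epsilon> y) (FM L (FM R g)) = Comp E g (Cmp \<epsilon> (FO L x))"
      if "in_hom E g (FO L x) y" for g y using A(7)[OF that] .
  qed (use A(4)[OF x] A(5) A(8)[OF x] A(9) A(4) fun_obj[OF R] in auto)
qed

text \<open>Dual of \<open>uarr_of_unit_counit\<close>; here \<open>d'\<close> stands for the counit
  at the objects \<open>FO L x\<close>, so that this counit may have another description than
  d.\<close>

lemma darr_of_unit_counit:
  assumes R: "fun_on R E C" and L: "fun_on L C E" and y: "y \<in> Obj E"
    and eps: "in_hom E d (FO L (FO R y)) y"
    and eta: "\<And>x. x \<in> Obj C \<Longrightarrow> in_hom C (e x) x (FO R (FO L x))"
    and epsn: "\<And>g x. x \<in> Obj C \<Longrightarrow> in_hom E g (FO L x) y \<Longrightarrow>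
      Comp E d (FM L (FM R g)) = Comp E g (d' x)"
    and etan: "\<And>f x. in_hom C f x (FO R y) \<Longrightarrow>
      Comp C (FM R (FM L f)) (e x) = Comp C (e (FO R y)) f"
    and tri2: "Comp C (FM R d) (e (FO R y)) = Id C (FO R y)"
    and tri1: "\<And>x. x \<in> Obj C \<Longrightarrow> in_hom E (d' x) (FO L (FO R (FO L x))) (FO L x) \<and>
      Comp E (d' x) (FM L (e x)) = Id E (FO L x)"
  shows "darr C E L y (FO R y) d"
proof (rule darrI)
  note R' = fun_onD[OF R] and L' = fun_onD[OF L]
  show "fun_on L C E" "in_hom E d (FO L (FO R y)) y" by fact+
  show Ry: "FO R y \<in> Obj C" by (rule fun_obj[OF R y])
  {
    fix Z h assume Z: "Z \<in> Obj C" and h: "in_hom E h (FO L Z) y"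
    let ?g = "Comp C (FM R h) (e Z)"
    note Rh = fun_hom[OF R h]
    have g: "in_hom C ?g Z (FO R y)" by (rule comp_hom[OF R'(5) eta[OF Z] Rh])
    have t: "in_hom E (d' Z) (FO L (FO R (FO L Z))) (FO L Z)" using tri1[OF Z] by blast
    have "Comp E d (FM L ?g) = Comp E (Comp E d (FM L (FM R h))) (FM L (e Z))" using fun_comp[OF L eta[OF Z] Rh]
        comp_assoc[OF R'(4) fun_hom[OF L eta[OF Z]] fun_hom[OF L Rh] eps] by simp
    also have "\<dots> = Comp E (Comp E h (d' Z)) (FM L (e Z))" using epsn[OF Z h] by simp
    also have "\<dots> = h"
      using comp_assoc[OF R'(4) fun_hom[OF L eta[OF Z]] t h] tri1[OF Z] comp_id_right[OF R'(4) h] by simp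
    finally show "\<exists>g. in_hom C g Z (FO R y) \<and> Comp E d (FM L g) = h" using g by blast
  next
    fix Z g g' assume g: "in_hom C g Z (FO R y)" "in_hom C g' Z (FO R y)"
      and eq: "Comp E d (FM L g) = Comp E d (FM L g')"
    have Z: "Z \<in> Obj C" using hom_obj[OF R'(5) g(1)] by simp
    have *: "k = Comp C (FM R (Comp E d (FM L k))) (e Z)" if k: "in_hom C k Z (FO R y)" for k
    proof -
      note Lk = fun_hom[OF L k]
      have "Comp C (FM R (Comp E d (FM L k))) (e Z) = Comp C (FM R d) (Comp C (FM R (FM L k)) (e Z))"
        using fun_comp[OF R Lk eps]
          comp_assoc[OF R'(5) eta[OF Z] fun_hom[OF R Lk] fun_hom[OF R eps]] by simp
      also have "\<dots> = Comp C (FM R d) (Comp C (e (FO R y)) k)" using etan[OF k] by simp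
      also have "\<dots> = k" by (rule comp_cancel[OF R'(5) k eta[OF Ry] fun_hom[OF R eps] tri2])
      finally show ?thesis by simp
    qed
    show "g = g'" using *[OF g(1)] *[OF g(2)] eq by simp
  }
qed

lemma darr_adj:
  assumes adj: "adjunction L R \<eta> \<epsilon>" and L: "fun_on L C E" and y: "y \<in> Obj E"
  shows "darr C E L y (FO R y) (Cmp \<epsilon> y)"
proof -
  have R: "fun_on R E C" using adj L by (auto simp: adjunction_def fun_on_def)
  note A = adjD[OF adj R]
  show ?thesis
  proof (rule darr_of_unit_counit[OF R A(1) y, where e = "Cmp \<eta>" and d' = "\<lambda>x. Cmp \<epsilon> (FO L x)"])
    show "Comp E (Cmp \<epsilon> y) (FM L (FM R g)) = Comp E g (Cmp \<epsilon> (FO L x))"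
      if "x \<in> Obj C" "in_hom E g (FO L x) y" for g x using A(7)[OF that(2)] by simp
    show "Comp C (FM R (FM L f)) (Cmp \<eta> x) = Comp C (Cmp \<eta> (FO R y)) f"
      if "in_hom C f x (FO R y)" for f x using A(6)[OF that] by simp
  qed (use A(4) A(5)[OF y] A(5) A(8) A(9)[OF y] fun_obj[OF L] in auto)
qed

subsection \<open>Small categories\<close>

lemma small_finite: "regular_universe TYPE('k) \<Longrightarrow> finite (X :: 'k el set) \<Longrightarrow> small X"
  unfolding small_def regular_universe_def by (rule finite_lesspoll_infinite) auto

lemma small_subset: "small X \<Longrightarrow> Y \<subseteq> X \<Longrightarrow> small Y"
  unfolding small_def by (rule lesspoll_trans1[OF subset_imp_lepoll])

text \<open>This is where regularity enters. If the set of pairs were not small, the universe would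
  inject into it and would thus be split into fibres over the first component. Each fibre embeds in
  Y through the second component and there are only as many fibres as elements of X, so regularity
  would make the universe smaller than itself.\<close>

lemma small_pairs:
  assumes reg: "regular_universe TYPE('k)" and X: "small (X :: 'k el set)" and Y: "small Y"
  shows "small {Pair a b |a b. a \<in> X \<and> b \<in> Y}"
proof (rule ccontr)
  let ?P = "{Pair a b |a b. a \<in> X \<and> b \<in> Y}"
  assume "\<not> small ?P"
  \<comment> \<open>Cardinals are comparable, so a set that is not strictly smaller than the
    universe admits an injection from it.\<close>
  then have "(UNIV :: 'k set) \<lesssim> ?P"
    using ordLeq_total[OF card_of_Well_order card_of_Well_order, of ?P "UNIV :: 'k set"]
      eqpoll_imp_lepoll[OF eqpoll_sym, of ?P "UNIV :: 'k set"]
    unfolding small_def lesspoll_def lepoll_def card_of_ordLeq[symmetric] by blast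
  then obtain e :: "'k \<Rightarrow> 'k el" where e: "inj e" "range e \<subseteq> ?P" unfolding lepoll_def by blast
  have eP: "\<exists>a b. e k = Pair a b \<and> a \<in> X \<and> b \<in> Y" for k
    using subsetD[OF e(2) rangeI[of e k]] by simp
  have "X \<lesssim> (UNIV :: 'k set)" using X unfolding small_def lesspoll_def by blast
  \<comment> \<open>The union in \<open>regular_universe\<close> is indexed by a subset of
    \<open>'k\<close>, so X is first carried there by g.\<close>
  then obtain g :: "'k el \<Rightarrow> 'k" where g: "inj_on g X" unfolding lepoll_def by blast
  let ?F = "\<lambda>i. {k. g (pfst (e k)) = i}"
  have I: "g ` X \<prec> (UNIV :: 'k set)" using X image_lepoll lesspoll_trans1 unfolding small_def by blast
  have "?F i \<prec> (UNIV :: 'k set)" if i: "i \<in> g ` X" for i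
  proof -
    have "inj_on (\<lambda>k. psnd (e k)) (?F i)"
    proof (rule inj_onI)
      fix k l assume kl: "k \<in> ?F i" "l \<in> ?F i" and eq: "psnd (e k) = psnd (e l)"
      obtain a b a' b' where p: "e k = Pair a b" "a \<in> X" "e l = Pair a' b'" "a' \<in> X"
      proof -
        show ?thesis using that eP[of k] eP[of l] by blast
      qed
      then have "a = a'" using kl g by (auto dest: inj_onD)
      then have "e k = e l" using p eq by simp
      then show "k = l" using e(1) by (simp add: inj_eq)
    qed
    moreover have "psnd (e k) \<in> Y" for k
    proof -
      show ?thesis using eP[of k] by auto
    qed
    ultimately have "?F i \<lesssim> Y" unfolding lepoll_def by auto
    then show ?thesis using Y lesspoll_trans1 unfolding small_def by blast
  qed
  then have "(\<Union>i\<in>g ` X. ?F i) \<prec> (UNIV :: 'k set)"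
    using reg[unfolded regular_universe_def, THEN conjunct2, rule_format, of "g ` X" ?F] I by simp
  moreover have "k \<in> (\<Union>i\<in>g ` X. ?F i)" for k
  proof -
    show ?thesis using eP[of k] by auto
  qed
  then have "(\<Union>i\<in>g ` X. ?F i) = UNIV" by blast
  ultimately show False by simp
qed

text \<open>\<open>sfun\<close> and \<open>snt\<close> are the 1-cells and 2-cells of the 2-category
  of small categories with their boundaries named; \<open>small_func_iff\<close> and
  \<open>small_ntrans_iff\<close> lead back to the predicates in the definition of a
  prederivator.\<close>

definition sfun :: "'k sfunc \<Rightarrow> 'k scat \<Rightarrow> 'k scat \<Rightarrow> bool" where
  "sfun u A B \<longleftrightarrow> fun_on u A B \<and> small_cat A \<and> small_cat B"

definition snt :: "'k sntrans \<Rightarrow> 'k sfunc \<Rightarrow> 'k sfunc \<Rightarrow> 'k scat \<Rightarrow> 'k scat \<Rightarrow> bool" where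
  "snt \<alpha> u v A B \<longleftrightarrow> nt_on \<alpha> u v A B \<and> small_cat A \<and> small_cat B"

lemma small_func_iff: "small_func u \<longleftrightarrow> sfun u (Src u) (Tgt u)"
  by (auto simp: small_func_def sfun_def fun_on_def)

lemma sfunD:
  assumes "sfun u A B"
  shows "fun_on u A B" "small_cat A" "small_cat B" "is_cat A" "is_cat B" "Src u = A" "Tgt u = B"
    "small_func u" using assms by (auto simp: sfun_def fun_on_def small_cat_def small_func_def)

lemma small_ntrans_iff:
  "small_ntrans \<alpha> \<longleftrightarrow> snt \<alpha> (NSrc \<alpha>) (NTgt \<alpha>) (Src (NSrc \<alpha>)) (Tgt (NSrc \<alpha>))"
  by (auto simp: small_ntrans_def small_func_def snt_def nt_on_def fun_on_def is_ntrans_def Let_def)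

lemma sntD:
  assumes "snt \<alpha> u v A B"
  shows "nt_on \<alpha> u v A B" "sfun u A B" "sfun v A B" "NSrc \<alpha> = u" "NTgt \<alpha> = v" "small_ntrans \<alpha>"
  using assms by (auto simp: snt_def nt_on_def sfun_def small_ntrans_def small_func_def fun_on_def)

lemma sfun_comp: "sfun u A B \<Longrightarrow> sfun v B C \<Longrightarrow> sfun (v \<circ>\<^sub>f u) A C"
  by (auto simp: sfun_def intro: fun_on_comp)

lemma sfun_id: "small_cat A \<Longrightarrow> sfun (id_func A) A A"
  by (auto simp: sfun_def small_cat_def intro: fun_on_id)

lemma small_cat_is_cat: "small_cat A \<Longrightarrow> is_cat A" by (simp add: small_cat_def)

subsubsection \<open>Products\<close>

lemma prod_cat_obj [simp]: "Pair a b \<in> Obj (A \<times>\<^sub>c B) \<longleftrightarrow> a \<in> Obj A \<and> b \<in> Obj B"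
  by (simp add: prod_cat_def)

lemma prod_cat_arr [simp]: "Pair a b \<in> Arr (A \<times>\<^sub>c B) \<longleftrightarrow> a \<in> Arr A \<and> b \<in> Arr B"
  by (simp add: prod_cat_def)

lemma prod_cat_objE:
  assumes "x \<in> Obj (A \<times>\<^sub>c B)"
  obtains a b where "x = Pair a b" "a \<in> Obj A" "b \<in> Obj B" using assms by (auto simp: prod_cat_def)

lemma prod_cat_arrE:
  assumes "x \<in> Arr (A \<times>\<^sub>c B)"
  obtains a b where "x = Pair a b" "a \<in> Arr A" "b \<in> Arr B" using assms by (auto simp: prod_cat_def)

lemma prod_cat_sel [simp]:
  "Dom (A \<times>\<^sub>c B) (Pair f g) = Pair (Dom A f) (Dom B g)"
  "Cod (A \<times>\<^sub>c B) (Pair f g) = Pair (Cod A f) (Cod B g)"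
  "Id (A \<times>\<^sub>c B) (Pair x y) = Pair (Id A x) (Id B y)"
  "Comp (A \<times>\<^sub>c B) (Pair f g) (Pair f' g') = Pair (Comp A f f') (Comp B g g')"
  by (simp_all add: prod_cat_def)

lemma prod_cat_hom [simp]:
  "in_hom (A \<times>\<^sub>c B) (Pair f g) (Pair a b) (Pair c d) \<longleftrightarrow> in_hom A f a c \<and> in_hom B g b d"
  by (auto simp: in_hom_def)

lemma prod_cat_homE:
  assumes "in_hom (A \<times>\<^sub>c B) h x y"
  obtains f g a b c d where "h = Pair f g" "x = Pair a b" "y = Pair c d" "in_hom A f a c" "in_hom B g b d"
proof -
  obtain f g where h: "h = Pair f g" using assms prod_cat_arrE by (metis in_homD(1))
  show ?thesis by (rule that[of f g "Dom A f" "Dom B g" "Cod A f" "Cod B g"])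
      (use assms h in \<open>auto simp: in_hom_def\<close>)
qed

lemma is_cat_prod:
  assumes A: "is_cat A" and B: "is_cat B"
  shows "is_cat (A \<times>\<^sub>c B)" unfolding is_cat_def
proof (intro conjI ballI impI)
  let ?C = "A \<times>\<^sub>c B"
  fix f assume "f \<in> Arr ?C"
  then obtain a b where f: "f = Pair a b" "a \<in> Arr A" "b \<in> Arr B" by (rule prod_cat_arrE)
  note a = arr_hom[OF f(2)] and b = arr_hom[OF f(3)]
  show "Dom ?C f \<in> Obj ?C" "Cod ?C f \<in> Obj ?C" using f hom_obj[OF A a] hom_obj[OF B b] by auto
  show "Comp ?C f (Id ?C (Dom ?C f)) = f" "Comp ?C (Id ?C (Cod ?C f)) f = f"
    using f comp_id[OF A f(2)] comp_id[OF B f(3)] by auto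
  fix g assume "g \<in> Arr ?C"
  then obtain a' b' where g: "g = Pair a' b'" "a' \<in> Arr A" "b' \<in> Arr B" by (rule prod_cat_arrE)
  {
    assume "Cod ?C f = Dom ?C g"
    then show "in_hom ?C (Comp ?C g f) (Dom ?C f) (Cod ?C g)"
      using f g comp_hom[OF A a] comp_hom[OF B b] by (auto simp: in_hom_def)
  }
  fix h assume "h \<in> Arr ?C"
  then obtain a'' b'' where h: "h = Pair a'' b''" "a'' \<in> Arr A" "b'' \<in> Arr B" by (rule prod_cat_arrE)
  assume "Cod ?C f = Dom ?C g \<and> Cod ?C g = Dom ?C h"
  then show "Comp ?C h (Comp ?C g f) = Comp ?C (Comp ?C h g) f"
    using f g h by (auto simp: cat_simps[OF A] cat_simps[OF B])
next
  fix x assume "x \<in> Obj (A \<times>\<^sub>c B)"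
  then show "in_hom (A \<times>\<^sub>c B) (Id (A \<times>\<^sub>c B) x) x x"
    by (rule prod_cat_objE) (auto simp: id_hom A B)
qed

lemma small_cat_prod:
  assumes "regular_universe TYPE('k)" "small_cat (A :: 'k scat)" "small_cat B"
  shows "small_cat (A \<times>\<^sub>c B)"
proof -
  have "Obj (A \<times>\<^sub>c B) = {Pair a b |a b. a \<in> Obj A \<and> b \<in> Obj B}"
    "Arr (A \<times>\<^sub>c B) = {Pair a b |a b. a \<in> Arr A \<and> b \<in> Arr B}" by (simp_all add: prod_cat_def)
  then show ?thesis using assms is_cat_prod small_pairs[OF assms(1), of "Obj A" "Obj B"]
      small_pairs[OF assms(1), of "Arr A" "Arr B"] unfolding small_cat_def by auto
qed

lemma prod_func_sel [simp]:
  "Src (u \<times>\<^sub>f v) = Src u \<times>\<^sub>c Src v" "Tgt (u \<times>\<^sub>f v) = Tgt u \<times>\<^sub>c Tgt v"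
  "a \<in> Obj (Src u) \<Longrightarrow> b \<in> Obj (Src v) \<Longrightarrow> FO (u \<times>\<^sub>f v) (Pair a b) = Pair (FO u a) (FO v b)"
  "f \<in> Arr (Src u) \<Longrightarrow> g \<in> Arr (Src v) \<Longrightarrow> FM (u \<times>\<^sub>f v) (Pair f g) = Pair (FM u f) (FM v g)"
  by (simp_all add: prod_func_def)

lemma fun_on_prod:
  assumes u: "fun_on u A A'" and v: "fun_on v B B'"
  shows "fun_on (u \<times>\<^sub>f v) (A \<times>\<^sub>c B) (A' \<times>\<^sub>c B')"
proof -
  note U = fun_onD[OF u] and V = fun_onD[OF v]
  show ?thesis unfolding prod_func_def U V
  proof (rule fun_onI)
    show "is_cat (A \<times>\<^sub>c B)" "is_cat (A' \<times>\<^sub>c B')" using is_cat_prod U V by auto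
  qed (auto elim!: prod_cat_objE prod_cat_homE simp: fun_obj[OF u] fun_obj[OF v] fun_hom[OF u]
      fun_hom[OF v] fun_id[OF u] fun_id[OF v] fun_comp[OF u] fun_comp[OF v])
qed

lemma sfun_prod:
  assumes "regular_universe TYPE('k)" "sfun (u :: 'k sfunc) A A'" "sfun v B B'"
  shows "sfun (u \<times>\<^sub>f v) (A \<times>\<^sub>c B) (A' \<times>\<^sub>c B')"
  using assms by (auto simp: sfun_def small_cat_prod intro: fun_on_prod)

lemma fun_arr: "fun_on F A B \<Longrightarrow> f \<in> Arr A \<Longrightarrow> FM F f \<in> Arr B"
  by (auto simp: fun_on_def is_func_def)

lemma prod_func_comp:
  assumes u: "fun_on u A A'" and v: "fun_on v B B'" and u': "fun_on u' A' A''" and v': "fun_on v' B' B''"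
  shows "(u' \<times>\<^sub>f v') \<circ>\<^sub>f (u \<times>\<^sub>f v) = (u' \<circ>\<^sub>f u) \<times>\<^sub>f (v' \<circ>\<^sub>f v)"
proof (rule func_eqI)
  show "fun_on ((u' \<times>\<^sub>f v') \<circ>\<^sub>f (u \<times>\<^sub>f v)) (A \<times>\<^sub>c B) (A'' \<times>\<^sub>c B'')"
    by (rule fun_on_comp[OF fun_on_prod[OF u v] fun_on_prod[OF u' v']])
  show "fun_on ((u' \<circ>\<^sub>f u) \<times>\<^sub>f (v' \<circ>\<^sub>f v)) (A \<times>\<^sub>c B) (A'' \<times>\<^sub>c B'')"
    by (rule fun_on_prod[OF fun_on_comp[OF u u'] fun_on_comp[OF v v']])
  note * = fun_onD[OF u] fun_onD[OF v] fun_onD[OF u'] fun_onD[OF v']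
  show "FO ((u' \<times>\<^sub>f v') \<circ>\<^sub>f (u \<times>\<^sub>f v)) x = FO ((u' \<circ>\<^sub>f u) \<times>\<^sub>f (v' \<circ>\<^sub>f v)) x"
    if "x \<in> Obj (A \<times>\<^sub>c B)" for x
    using that by (auto elim!: prod_cat_objE simp: * fun_obj[OF u] fun_obj[OF v])
  show "FM ((u' \<times>\<^sub>f v') \<circ>\<^sub>f (u \<times>\<^sub>f v)) x = FM ((u' \<circ>\<^sub>f u) \<times>\<^sub>f (v' \<circ>\<^sub>f v)) x"
    if "x \<in> Arr (A \<times>\<^sub>c B)" for x
    using that by (auto elim!: prod_cat_arrE simp: * fun_arr[OF u] fun_arr[OF v])
qed

lemma prod_func_id:
  assumes "is_cat A" "is_cat B"
  shows "id_func A \<times>\<^sub>f id_func B = id_func (A \<times>\<^sub>c B)"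
  by (rule func_eqI[OF fun_on_prod[OF fun_on_id fun_on_id] fun_on_id[OF is_cat_prod]])
    (use assms in \<open>auto elim!: prod_cat_objE prod_cat_arrE\<close>)

definition prod_nt :: "'k sntrans \<Rightarrow> 'k sntrans \<Rightarrow> 'k sntrans" (infixr \<open>\<times>\<^sub>n\<close> 70) where
  "\<alpha> \<times>\<^sub>n \<beta> = mk_ntrans (NSrc \<alpha> \<times>\<^sub>f NSrc \<beta>) (NTgt \<alpha> \<times>\<^sub>f NTgt \<beta>)
     (\<lambda>x. Pair (Cmp \<alpha> (pfst x)) (Cmp \<beta> (psnd x)))"

lemma nt_on_prod:
  assumes a: "nt_on \<alpha> u v A A'" and b: "nt_on \<beta> u' v' B B'"
  shows "nt_on (\<alpha> \<times>\<^sub>n \<beta>) (u \<times>\<^sub>f u') (v \<times>\<^sub>f v') (A \<times>\<^sub>c B) (A' \<times>\<^sub>c B')"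
proof -
  have s: "NSrc \<alpha> = u" "NTgt \<alpha> = v" "NSrc \<beta> = u'" "NTgt \<beta> = v'"
    and u: "fun_on u A A'" and v: "fun_on v A A'" and u': "fun_on u' B B'" and v': "fun_on v' B B'"
    using a b by (auto simp: nt_on_def)
  note U = fun_onD[OF u] fun_onD[OF v] fun_onD[OF u'] fun_onD[OF v']
  show ?thesis
  proof (rule nt_onI)
    show "fun_on (u \<times>\<^sub>f u') (A \<times>\<^sub>c B) (A' \<times>\<^sub>c B')" "fun_on (v \<times>\<^sub>f v') (A \<times>\<^sub>c B) (A' \<times>\<^sub>c B')"
      by (rule fun_on_prod[OF u u'], rule fun_on_prod[OF v v'])
    show "Cmp (\<alpha> \<times>\<^sub>n \<beta>) \<in> extensional (Obj (A \<times>\<^sub>c B))"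
      unfolding prod_nt_def s using mk_ntrans_sel(4)[of "u \<times>\<^sub>f u'"] by (simp add: U)
    show "in_hom (A' \<times>\<^sub>c B') (Cmp (\<alpha> \<times>\<^sub>n \<beta>) x) (FO (u \<times>\<^sub>f u') x) (FO (v \<times>\<^sub>f v') x)"
      if "x \<in> Obj (A \<times>\<^sub>c B)" for x
      using that by (auto elim!: prod_cat_objE simp: prod_nt_def s U nt_hom[OF a] nt_hom[OF b])
    show "Comp (A' \<times>\<^sub>c B') (Cmp (\<alpha> \<times>\<^sub>n \<beta>) y) (FM (u \<times>\<^sub>f u') f) =
        Comp (A' \<times>\<^sub>c B') (FM (v \<times>\<^sub>f v') f) (Cmp (\<alpha> \<times>\<^sub>n \<beta>) x)" if "in_hom (A \<times>\<^sub>c B) f x y" for f x y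
      using that
    proof (rule prod_cat_homE)
      fix g h a' b' c' d' assume *: "f = Pair g h" "x = Pair a' b'" "y = Pair c' d'"
        "in_hom A g a' c'" "in_hom B h b' d'"
      show ?thesis using * nt_nat[OF a *(4)] nt_nat[OF b *(5)] hom_obj[OF U(4) *(4)] hom_obj[OF U(14) *(5)]
          in_homD[OF *(4)] in_homD[OF *(5)] by (simp add: prod_nt_def s U)
    qed
  qed (simp_all add: prod_nt_def s)
qed

lemma snt_prod:
  assumes "regular_universe TYPE('k)" "snt (\<alpha> :: 'k sntrans) u v A A'" "snt \<beta> u' v' B B'"
  shows "snt (\<alpha> \<times>\<^sub>n \<beta>) (u \<times>\<^sub>f u') (v \<times>\<^sub>f v') (A \<times>\<^sub>c B) (A' \<times>\<^sub>c B')"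
  using assms by (auto simp: snt_def small_cat_prod intro: nt_on_prod)

lemma snt_id: "sfun u A B \<Longrightarrow> snt (id_nt u) u u A B" by (simp add: snt_def sfun_def nt_on_id)

text \<open>The 2-cells of a shifted prederivator become products with an identity, so the product
  calculus applies to \<open>shift\<close>.\<close>

lemma cat_times_ntrans_eq:
  assumes A: "is_cat A" and a: "nt_on \<alpha> u v B B'"
  shows "cat_times_ntrans A \<alpha> = id_nt (id_func A) \<times>\<^sub>n \<alpha>"
proof -
  have s: "NSrc \<alpha> = u" "NTgt \<alpha> = v" "Src u = B" using a by (auto simp: nt_on_def fun_on_def)
  show ?thesis by (rule nt_eqI[where S = "Obj (A \<times>\<^sub>c B)"])
      (auto simp: cat_times_ntrans_def prod_nt_def s mk_ntrans_def elim!: prod_cat_objE)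
qed

lemma cmp_prod_nt:
  assumes "nt_on \<alpha> u v A A'" "nt_on \<beta> u' v' B B'" "a \<in> Obj A" "b \<in> Obj B"
  shows "Cmp (\<alpha> \<times>\<^sub>n \<beta>) (Pair a b) = Pair (Cmp \<alpha> a) (Cmp \<beta> b)"
  using assms by (auto simp: prod_nt_def nt_on_def fun_on_def)

subsubsection \<open>Natural transformations between functors of small categories\<close>

lemma nt_on_vcomp:
  assumes a: "nt_on \<alpha> u v A B" and b: "nt_on \<beta> v w A B"
  shows "nt_on (\<beta> \<bullet> \<alpha>) u w A B"
    "x \<in> Obj A \<Longrightarrow> Cmp (\<beta> \<bullet> \<alpha>) x = Comp B (Cmp \<beta> x) (Cmp \<alpha> x)"
proof -
  have s: "NSrc \<alpha> = u" "NTgt \<beta> = w" and u: "fun_on u A B" and v: "fun_on v A B" and w: "fun_on w A B"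
    using a b by (auto simp: nt_on_def)
  note U = fun_onD[OF u] fun_onD[OF w]
  show *: "x \<in> Obj A \<Longrightarrow> Cmp (\<beta> \<bullet> \<alpha>) x = Comp B (Cmp \<beta> x) (Cmp \<alpha> x)" for x
    using s U by simp
  show "nt_on (\<beta> \<bullet> \<alpha>) u w A B"
  proof (rule nt_onI[OF u w])
    show "Cmp (\<beta> \<bullet> \<alpha>) \<in> extensional (Obj A)" using vcomp_sel(4)[of \<beta> \<alpha>] by (simp add: s U)
    show "in_hom B (Cmp (\<beta> \<bullet> \<alpha>) x) (FO u x) (FO w x)" if "x \<in> Obj A" for x
      using comp_hom[OF U(5) nt_hom[OF a that] nt_hom[OF b that]] *[OF that] by simp
    show "Comp B (Cmp (\<beta> \<bullet> \<alpha>) y) (FM u f) = Comp B (FM w f) (Cmp (\<beta> \<bullet> \<alpha>) x)"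
      if f: "in_hom A f x y" for f x y
    proof -
      note o = hom_obj[OF U(4) f]
      note ax = nt_hom[OF a o(1)] and ay = nt_hom[OF a o(2)] and bx = nt_hom[OF b o(1)]
        and by' = nt_hom[OF b o(2)]
      show ?thesis using comp_assoc[OF U(5) fun_hom[OF u f] ay by'] comp_assoc[OF U(5) ax fun_hom[OF v f] by']
          comp_assoc[OF U(5) ax bx fun_hom[OF w f]] nt_nat[OF a f] nt_nat[OF b f]
          *[OF o(1)] *[OF o(2)] by simp
    qed
  qed (use s in auto)
qed

lemma nt_on_lwhisk:
  assumes a: "nt_on \<alpha> u v A B" and w: "fun_on w B C"
  shows "nt_on (w \<lhd> \<alpha>) (w \<circ>\<^sub>f u) (w \<circ>\<^sub>f v) A C" "x \<in> Obj A \<Longrightarrow> Cmp (w \<lhd> \<alpha>) x = FM w (Cmp \<alpha> x)"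
proof -
  have s: "NSrc \<alpha> = u" "NTgt \<alpha> = v" and u: "fun_on u A B" and v: "fun_on v A B"
    using a by (auto simp: nt_on_def)
  note U = fun_onD[OF u] fun_onD[OF w]
  show *: "x \<in> Obj A \<Longrightarrow> Cmp (w \<lhd> \<alpha>) x = FM w (Cmp \<alpha> x)" for x using s U by simp
  show "nt_on (w \<lhd> \<alpha>) (w \<circ>\<^sub>f u) (w \<circ>\<^sub>f v) A C"
  proof (rule nt_onI[OF fun_on_comp[OF u w] fun_on_comp[OF v w]])
    show "Cmp (w \<lhd> \<alpha>) \<in> extensional (Obj A)" using lwhisk_sel(4)[of w \<alpha>] by (simp add: s U)
    show "in_hom C (Cmp (w \<lhd> \<alpha>) x) (FO (w \<circ>\<^sub>f u) x) (FO (w \<circ>\<^sub>f v) x)" if "x \<in> Obj A" for x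
      using fun_hom[OF w nt_hom[OF a that]] *[OF that]
      by (simp add: comp_func_app(1)[OF u that] comp_func_app(1)[OF v that])
    show "Comp C (Cmp (w \<lhd> \<alpha>) y) (FM (w \<circ>\<^sub>f u) f) = Comp C (FM (w \<circ>\<^sub>f v) f) (Cmp (w \<lhd> \<alpha>) x)"
      if f: "in_hom A f x y" for f x y
    proof -
      note o = hom_obj[OF U(4) f]
      show ?thesis
        using fun_comp[OF w fun_hom[OF u f] nt_hom[OF a o(2)]] fun_comp[OF w nt_hom[OF a o(1)] fun_hom[OF v f]]
          nt_nat[OF a f] *[OF o(1)] *[OF o(2)] by (simp add: comp_func_app(2)[OF u f] comp_func_app(2)[OF v f])
    qed
  qed (use s in auto)
qed

lemma nt_on_rwhisk:
  assumes a: "nt_on \<alpha> u v A B" and w: "fun_on w C A"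
  shows "nt_on (\<alpha> \<rhd> w) (u \<circ>\<^sub>f w) (v \<circ>\<^sub>f w) C B" "x \<in> Obj C \<Longrightarrow> Cmp (\<alpha> \<rhd> w) x = Cmp \<alpha> (FO w x)"
proof -
  have s: "NSrc \<alpha> = u" "NTgt \<alpha> = v" and u: "fun_on u A B" and v: "fun_on v A B"
    using a by (auto simp: nt_on_def)
  note U = fun_onD[OF u] fun_onD[OF w]
  show *: "x \<in> Obj C \<Longrightarrow> Cmp (\<alpha> \<rhd> w) x = Cmp \<alpha> (FO w x)" for x using s U by simp
  show "nt_on (\<alpha> \<rhd> w) (u \<circ>\<^sub>f w) (v \<circ>\<^sub>f w) C B"
  proof (rule nt_onI[OF fun_on_comp[OF w u] fun_on_comp[OF w v]])
    show "Cmp (\<alpha> \<rhd> w) \<in> extensional (Obj C)" using rwhisk_sel(4)[of \<alpha> w] by (simp add: s U)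
    show "in_hom B (Cmp (\<alpha> \<rhd> w) x) (FO (u \<circ>\<^sub>f w) x) (FO (v \<circ>\<^sub>f w) x)" if "x \<in> Obj C" for x
      using nt_hom[OF a fun_obj[OF w that]] *[OF that] by (simp add: comp_func_app(1)[OF w that])
    show "Comp B (Cmp (\<alpha> \<rhd> w) y) (FM (u \<circ>\<^sub>f w) f) = Comp B (FM (v \<circ>\<^sub>f w) f) (Cmp (\<alpha> \<rhd> w) x)"
      if f: "in_hom C f x y" for f x y
      using nt_nat[OF a fun_hom[OF w f]] *[OF hom_obj(1)[OF U(9) f]] *[OF hom_obj(2)[OF U(9) f]]
      by (simp add: comp_func_app(2)[OF w f])
  qed (use s in auto)
qed

lemma snt_vcomp: "snt \<alpha> u v A B \<Longrightarrow> snt \<beta> v w A B \<Longrightarrow> snt (\<beta> \<bullet> \<alpha>) u w A B"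
  by (auto simp: snt_def intro: nt_on_vcomp)

lemma snt_lwhisk: "snt \<alpha> u v A B \<Longrightarrow> sfun w B C \<Longrightarrow> snt (w \<lhd> \<alpha>) (w \<circ>\<^sub>f u) (w \<circ>\<^sub>f v) A C"
  by (auto simp: snt_def sfun_def intro: nt_on_lwhisk)

lemma snt_rwhisk: "snt \<alpha> u v A B \<Longrightarrow> sfun w C A \<Longrightarrow> snt (\<alpha> \<rhd> w) (u \<circ>\<^sub>f w) (v \<circ>\<^sub>f w) C B"
  by (auto simp: snt_def sfun_def intro: nt_on_rwhisk)

lemma nt_on_eqI:
  assumes "nt_on \<alpha> u v A B" "nt_on \<beta> u v A B" "\<And>x. x \<in> Obj A \<Longrightarrow> Cmp \<alpha> x = Cmp \<beta> x"
  shows "\<alpha> = \<beta>" by (rule nt_eqI[where S = "Obj A"])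
    (use assms nt_ext[OF assms(1)] nt_ext[OF assms(2)] in \<open>auto simp: nt_on_def\<close>)

subsubsection \<open>Slices\<close>

lemma over_cat_sel [simp]:
  "Dom (over_cat u b) (Pair (Pair x y) g) = x"
  "Cod (over_cat u b) (Pair (Pair x y) g) = y"
  "Id (over_cat u b) x = Pair (Pair x x) (Id (Src u) (pfst x))"
  "Comp (over_cat u b) (Pair (Pair x' y') g') (Pair (Pair x y) g) = Pair (Pair x y') (Comp (Src u) g' g)"
  by (simp_all add: over_cat_def Let_def)

lemma over_cat_obj [simp]:
  "Pair a f \<in> Obj (over_cat u b) \<longleftrightarrow> a \<in> Obj (Src u) \<and> in_hom (Tgt u) f (FO u a) b"
  by (simp add: over_cat_def Let_def)

lemma over_cat_objE:
  assumes "x \<in> Obj (over_cat u b)"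
  obtains a f where "x = Pair a f" "a \<in> Obj (Src u)" "in_hom (Tgt u) f (FO u a) b"
  using assms by (auto simp: over_cat_def Let_def)

lemma over_cat_arr [simp]:
  "Pair (Pair x y) g \<in> Arr (over_cat u b) \<longleftrightarrow>
     x \<in> Obj (over_cat u b) \<and> y \<in> Obj (over_cat u b) \<and> in_hom (Src u) g (pfst x) (pfst y) \<and>
     Comp (Tgt u) (psnd y) (FM u g) = psnd x" by (simp add: over_cat_def Let_def)

lemma over_cat_hom [simp]:
  "in_hom (over_cat u b) (Pair (Pair x y) g) x' y' \<longleftrightarrow>
     x' = x \<and> y' = y \<and> x \<in> Obj (over_cat u b) \<and> y \<in> Obj (over_cat u b) \<and>
     in_hom (Src u) g (pfst x) (pfst y) \<and> Comp (Tgt u) (psnd y) (FM u g) = psnd x"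
  unfolding in_hom_def[of "over_cat u b"] over_cat_arr over_cat_sel by blast

lemma over_cat_arrE:
  assumes "h \<in> Arr (over_cat u b)"
  obtains x y g where "h = Pair (Pair x y) g" "x \<in> Obj (over_cat u b)" "y \<in> Obj (over_cat u b)"
    "in_hom (Src u) g (pfst x) (pfst y)" "Comp (Tgt u) (psnd y) (FM u g) = psnd x"
proof -
  have "\<exists>x y g. h = Pair (Pair x y) g" using assms by (auto simp: over_cat_def Let_def)
  then show ?thesis using assms that by (metis over_cat_arr)
qed

lemma is_cat_over:
  assumes u: "fun_on u A B"
  shows "is_cat (over_cat u b)" unfolding is_cat_def
proof (intro conjI ballI impI)
  note U = fun_onD[OF u]
  let ?C = "over_cat u b"
  have Idh: "in_hom ?C (Id ?C x) x x" if "x \<in> Obj ?C" for x using that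
  proof (rule over_cat_objE)
    fix a f assume x: "x = Pair a f" "a \<in> Obj (Src u)" "in_hom (Tgt u) f (FO u a) b"
    then show ?thesis using comp_id_right[OF U(5), of f] id_hom[OF U(4), of a] by (simp add: U fun_id[OF u])
  qed
  {
    fix x assume "x \<in> Obj ?C"
    then show "in_hom ?C (Id ?C x) x x" by (rule Idh)
  }
  fix f assume "f \<in> Arr ?C"
  then show "Dom ?C f \<in> Obj ?C" "Cod ?C f \<in> Obj ?C" "Comp ?C f (Id ?C (Dom ?C f)) = f"
    "Comp ?C (Id ?C (Cod ?C f)) f = f"
    by (auto elim!: over_cat_arrE simp: U comp_id_right[OF U(4)] comp_id_left[OF U(4)])
  fix g assume "g \<in> Arr ?C"
  {
    assume c: "Cod ?C f = Dom ?C g"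
    show "in_hom ?C (Comp ?C g f) (Dom ?C f) (Cod ?C g)" using \<open>f \<in> Arr ?C\<close>
    proof (rule over_cat_arrE)
      fix x y h assume f: "f = Pair (Pair x y) h" "x \<in> Obj ?C" "y \<in> Obj ?C"
        "in_hom (Src u) h (pfst x) (pfst y)" "Comp (Tgt u) (psnd y) (FM u h) = psnd x"
      show ?thesis using \<open>g \<in> Arr ?C\<close>
      proof (rule over_cat_arrE)
        fix y' z k assume g: "g = Pair (Pair y' z) k" "y' \<in> Obj ?C" "z \<in> Obj ?C"
          "in_hom (Src u) k (pfst y') (pfst z)" "Comp (Tgt u) (psnd z) (FM u k) = psnd y'"
        have y: "y' = y" using c f g by simp
        obtain c d where z: "z = Pair c d" "in_hom (Tgt u) d (FO u c) b" using g(3) by (rule over_cat_objE)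
        have h: "in_hom A h (pfst x) (pfst y)" and k: "in_hom A k (pfst y) c" using f g y z U by auto
        have "Comp B d (FM u (Comp A k h)) = psnd x"
          using comp_assoc[OF U(5) fun_hom[OF u h] fun_hom[OF u k], of d b] z f g y
          by (simp add: U fun_comp[OF u h k])
        then show ?thesis using f g y z comp_hom[OF U(4) h k] by (simp add: U)
      qed
    qed
  }
  fix h assume "h \<in> Arr ?C"
  assume "Cod ?C f = Dom ?C g \<and> Cod ?C g = Dom ?C h"
  with \<open>f \<in> Arr ?C\<close> \<open>g \<in> Arr ?C\<close> \<open>h \<in> Arr ?C\<close>
  show "Comp ?C h (Comp ?C g f) = Comp ?C (Comp ?C h g) f"
    by (auto elim!: over_cat_arrE simp: U comp_assoc[OF U(4)])
qed

text \<open>Objects and arrows of the slice are nested pairs of objects and arrows of A and B, so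
  \<open>small_pairs\<close>, and through it regularity of the universe, bounds them.\<close>

lemma small_over:
  assumes reg: "regular_universe TYPE('k)" and u: "sfun (u :: 'k sfunc) A B"
  shows "small_cat (over_cat u b)"
proof -
  note U = sfunD[OF u]
  let ?O = "{Pair a f |a f. a \<in> Obj A \<and> f \<in> Arr B}"
  have O: "small ?O" using U small_pairs[OF reg, of "Obj A" "Arr B"] by (simp add: small_cat_def)
  have "Obj (over_cat u b) \<subseteq> ?O" using U by (auto elim!: over_cat_objE dest: in_homD)
  then have Ob: "small (Obj (over_cat u b))" using small_subset[OF O] by simp
  let ?OO = "{Pair a f |a f. a \<in> Obj (over_cat u b) \<and> f \<in> Obj (over_cat u b)}"
  have "Arr (over_cat u b) \<subseteq> {Pair p g |p g. p \<in> ?OO \<and> g \<in> Arr A}"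
    using U by (auto elim!: over_cat_arrE dest: in_homD)
  then have "small (Arr (over_cat u b))" using small_subset[OF small_pairs[OF reg small_pairs[OF reg Ob Ob]]] U(2)
    unfolding small_cat_def by blast
  then show ?thesis using Ob is_cat_over[OF U(1)] by (simp add: small_cat_def)
qed

lemma over_proj:
  assumes reg: "regular_universe TYPE('k)" and u: "sfun (u :: 'k sfunc) A B"
  shows "sfun (over_proj u b) (over_cat u b) A"
proof -
  note U = sfunD[OF u]
  have "fun_on (over_proj u b) (over_cat u b) A" unfolding over_proj_def U
  proof (rule fun_onI)
    show "is_cat (over_cat u b)" "is_cat A" by (rule is_cat_over[OF U(1)], rule U(4))
    fix f g x y z assume "in_hom (over_cat u b) f x y" "in_hom (over_cat u b) g y z"
    then have "f \<in> Arr (over_cat u b)" "g \<in> Arr (over_cat u b)" by (auto dest: in_homD)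
    then show "psnd (Comp (over_cat u b) g f) = Comp A (psnd g) (psnd f)" by (auto elim!: over_cat_arrE simp: U)
  next
    fix f x y assume f: "in_hom (over_cat u b) f x y"
    show "in_hom A (psnd f) (pfst x) (pfst y)" using in_homD(1)[OF f]
      by (rule over_cat_arrE) (use in_homD(2,3)[OF f] U in auto)
  qed (auto elim!: over_cat_objE simp: U)
  then show ?thesis using small_over[OF reg u] U by (simp add: sfun_def)
qed

lemma small_one: "regular_universe TYPE('k) \<Longrightarrow> small_cat (one :: 'k scat)"
  by (auto simp: small_cat_def one_def poset_cat_def is_cat_def in_hom_def intro!: small_finite)

lemma one_sel [simp]: "Obj one = {Star}" "Arr one = {Pair Star Star}" "Id one Star = Pair Star Star"
  "Dom one = pfst" "Cod one = psnd" "Comp one g f = Pair (pfst f) (psnd g)" by (auto simp: one_def poset_cat_def)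

lemma sfun_bang:
  assumes reg: "regular_universe TYPE('k)" and A: "small_cat (A :: 'k scat)"
  shows "sfun (bang A) A one" unfolding sfun_def bang_def
  using A small_one[OF reg] small_cat_is_cat[OF A] small_cat_is_cat[OF small_one[OF reg]]
  by (auto intro!: fun_onI simp: in_hom_def)

lemma sfun_pt:
  assumes reg: "regular_universe TYPE('k)" and A: "small_cat (A :: 'k scat)" and a: "a \<in> Obj A"
  shows "sfun (pt A a) one A"
proof -
  note C = small_cat_is_cat[OF A]
  show ?thesis unfolding sfun_def pt_def
    using A small_one[OF reg] C small_cat_is_cat[OF small_one[OF reg]] a id_hom[OF C a]
    by (auto intro!: fun_onI simp: comp_id_left[OF C id_hom[OF C a]])
qed

lemma over_cell:
  assumes reg: "regular_universe TYPE('k)" and u: "sfun (u :: 'k sfunc) A B" and b: "b \<in> Obj B"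
  shows "snt (over_cell u b) (u \<circ>\<^sub>f over_proj u b) (pt B b \<circ>\<^sub>f bang (over_cat u b)) (over_cat u b) B"
proof -
  note U = sfunD[OF u] and P = sfunD[OF over_proj[OF reg u, of b]]
  have pb: "fun_on (pt B b \<circ>\<^sub>f bang (over_cat u b)) (over_cat u b) B"
    using fun_on_comp sfunD(1)[OF sfun_bang[OF reg P(2)]] sfunD(1)[OF sfun_pt[OF reg U(3) b]] by blast
  have "nt_on (over_cell u b) (u \<circ>\<^sub>f over_proj u b) (pt B b \<circ>\<^sub>f bang (over_cat u b)) (over_cat u b) B"
  proof (rule nt_onI[OF fun_on_comp[OF P(1) U(1)] pb])
    show "Cmp (over_cell u b) \<in> extensional (Obj (over_cat u b))"
      using mk_ntrans_sel(4)[of "u \<circ>\<^sub>f over_proj u b"] by (simp add: over_cell_def P)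
    fix x assume x: "x \<in> Obj (over_cat u b)"
    then show "in_hom B (Cmp (over_cell u b) x) (FO (u \<circ>\<^sub>f over_proj u b) x)
       (FO (pt B b \<circ>\<^sub>f bang (over_cat u b)) x)"
      by (auto elim!: over_cat_objE simp: over_cell_def P U bang_def pt_def over_proj_def)
  next
    fix f x y assume f: "in_hom (over_cat u b) f x y"
    show "Comp B (Cmp (over_cell u b) y) (FM (u \<circ>\<^sub>f over_proj u b) f) =
       Comp B (FM (pt B b \<circ>\<^sub>f bang (over_cat u b)) f) (Cmp (over_cell u b) x)" using in_homD(1)[OF f]
    proof (rule over_cat_arrE)
      fix x' y' g assume *: "f = Pair (Pair x' y') g" "x' \<in> Obj (over_cat u b)" "y' \<in> Obj (over_cat u b)"
       "in_hom (Src u) g (pfst x') (pfst y')" "Comp (Tgt u) (psnd y') (FM u g) = psnd x'"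
      have "x' = x" "y' = y" using f * by auto
      moreover have "Comp B (Id B b) (psnd x) = psnd x"
        using *(2) \<open>x' = x\<close> U comp_id_left[OF U(5)] by (auto elim!: over_cat_objE)
      ultimately show ?thesis using * in_homD(1)[OF f]
        by (simp add: over_cell_def P U bang_def pt_def over_proj_def)
    qed
  qed (simp_all add: over_cell_def U)
  then show ?thesis using P(2) U(3) by (simp add: snt_def)
qed

subsection \<open>Prederivators\<close>

text \<open>Regularity is bundled in because smallness of products and slices rests on it.\<close>

definition pder :: "('k, 'o, 'm) prederiv \<Rightarrow> bool" where
  "pder D \<longleftrightarrow> regular_universe TYPE('k) \<and> prederivator D"

lemma pder_reg: "pder (D :: ('k, 'o, 'm) prederiv) \<Longrightarrow> regular_universe TYPE('k)"
  by (simp add: pder_def)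

lemma val_cat: "pder D \<Longrightarrow> small_cat A \<Longrightarrow> is_cat (Val D A)"
  by (simp add: pder_def prederivator_def)

lemma res_fun:
  assumes "pder D" "sfun u A B"
  shows "fun_on (Res D u) (Val D B) (Val D A)"
proof -
  have "\<forall>u. small_func u \<longrightarrow>
      is_func (Res D u) \<and> Src (Res D u) = Val D (Tgt u) \<and> Tgt (Res D u) = Val D (Src u)"
    using assms(1) by (simp add: pder_def prederivator_def)
  then show ?thesis using sfunD[OF assms(2)] by (simp add: fun_on_def)
qed

lemma res_comp:
  assumes "pder D" "sfun u A B" "sfun v B C"
  shows "Res D (v \<circ>\<^sub>f u) = Res D u \<circ>\<^sub>f Res D v"
proof -
  have "\<forall>u v. small_func u \<and> small_func v \<and> Src v = Tgt u \<longrightarrow>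
      Res D (v \<circ>\<^sub>f u) = Res D u \<circ>\<^sub>f Res D v"
    using assms(1) unfolding pder_def prederivator_def by (elim conjE)
  then show ?thesis using sfunD[OF assms(2)] sfunD[OF assms(3)] by simp
qed

lemma res_comp_app:
  assumes "pder D" "sfun u A B" "sfun v B C"
  shows "X \<in> VObj D C \<Longrightarrow> RO D (v \<circ>\<^sub>f u) X = RO D u (RO D v X)"
    "VHom D C f X Y \<Longrightarrow> RM D (v \<circ>\<^sub>f u) f = RM D u (RM D v f)"
  unfolding res_comp[OF assms] by (rule comp_func_app[OF res_fun[OF assms(1,3)]], assumption)+

lemma res_id:
  assumes "pder D" "small_cat A"
  shows "Res D (id_func A) = id_func (Val D A)" using assms by (simp add: pder_def prederivator_def)

lemma res_id_app:
  assumes "pder D" "small_cat A"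
  shows "X \<in> VObj D A \<Longrightarrow> RO D (id_func A) X = X"
    "VHom D A f X Y \<Longrightarrow> RM D (id_func A) f = f" by (simp_all add: res_id[OF assms] in_hom_def)

lemma res2_nt:
  assumes "pder D" "snt \<alpha> u v A B"
  shows "nt_on (Res2 D \<alpha>) (Res D u) (Res D v) (Val D B) (Val D A)"
proof -
  have "\<forall>\<alpha>. small_ntrans \<alpha> \<longrightarrow>
      is_ntrans (Res2 D \<alpha>) \<and> NSrc (Res2 D \<alpha>) = Res D (NSrc \<alpha>) \<and>
      NTgt (Res2 D \<alpha>) = Res D (NTgt \<alpha>)" using assms(1) by (simp add: pder_def prederivator_def)
  then show ?thesis using sntD[OF assms(2)] res_fun[OF assms(1)] by (simp add: nt_on_def)
qed

lemma res2_hom: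
  assumes "pder D" "snt \<alpha> u v A B" "X \<in> VObj D B"
  shows "VHom D A (Cmp (Res2 D \<alpha>) X) (RO D u X) (RO D v X)"
  using nt_hom[OF res2_nt[OF assms(1,2)] assms(3)] .

lemma res2_nat:
  assumes "pder D" "snt \<alpha> u v A B" "VHom D B f X Y"
  shows "VComp D A (Cmp (Res2 D \<alpha>) Y) (RM D u f) = VComp D A (RM D v f) (Cmp (Res2 D \<alpha>) X)"
  using nt_nat[OF res2_nt[OF assms(1,2)] assms(3)] .

lemma res2_id:
  assumes "pder D" "sfun u A B" "X \<in> VObj D B"
  shows "Cmp (Res2 D (id_nt u)) X = VId D A (RO D u X)"
proof -
  have "Res2 D (id_nt u) = id_nt (Res D u)"
    using assms(1) sfunD[OF assms(2)] by (simp add: pder_def prederivator_def)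
  then show ?thesis using fun_onD[OF res_fun[OF assms(1,2)]] assms(3) by simp
qed

lemma res2_vcomp:
  assumes "pder D" "snt \<alpha> u v A B" "snt \<beta> v w A B" "X \<in> VObj D B"
  shows "Cmp (Res2 D (\<beta> \<bullet> \<alpha>)) X = VComp D A (Cmp (Res2 D \<beta>) X) (Cmp (Res2 D \<alpha>) X)"
proof -
  have "\<forall>\<alpha> \<beta>. small_ntrans \<alpha> \<and> small_ntrans \<beta> \<and> NSrc \<beta> = NTgt \<alpha> \<longrightarrow>
      Res2 D (\<beta> \<bullet> \<alpha>) = Res2 D \<beta> \<bullet> Res2 D \<alpha>"
    using assms(1) unfolding pder_def prederivator_def by (elim conjE)
  then have "Res2 D (\<beta> \<bullet> \<alpha>) = Res2 D \<beta> \<bullet> Res2 D \<alpha>"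
    using sntD[OF assms(2)] sntD[OF assms(3)] by simp
  then show ?thesis using nt_on_vcomp(2)[OF res2_nt[OF assms(1,2)] res2_nt[OF assms(1,3)] assms(4)] by simp
qed

lemma res2_lwhisk:
  assumes "pder D" "snt \<alpha> u v A B" "sfun w B C" "X \<in> VObj D C"
  shows "Cmp (Res2 D (w \<lhd> \<alpha>)) X = Cmp (Res2 D \<alpha>) (RO D w X)"
proof -
  have "\<forall>\<alpha> v. small_ntrans \<alpha> \<and> small_func v \<and> Src v = Tgt (NSrc \<alpha>) \<longrightarrow>
      Res2 D (v \<lhd> \<alpha>) = Res2 D \<alpha> \<rhd> Res D v"
    using assms(1) unfolding pder_def prederivator_def by (elim conjE)
  then have "Res2 D (w \<lhd> \<alpha>) = Res2 D \<alpha> \<rhd> Res D w"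
    using sntD[OF assms(2)] sfunD[OF assms(3)] sfunD[OF sntD(2)[OF assms(2)]] by simp
  then show ?thesis using nt_on_rwhisk(2)[OF res2_nt[OF assms(1,2)] res_fun[OF assms(1,3)] assms(4)] by simp
qed

lemma res2_rwhisk:
  assumes "pder D" "snt \<alpha> u v A B" "sfun w C A" "X \<in> VObj D B"
  shows "Cmp (Res2 D (\<alpha> \<rhd> w)) X = RM D w (Cmp (Res2 D \<alpha>) X)"
proof -
  have "\<forall>\<alpha> w. small_ntrans \<alpha> \<and> small_func w \<and> Tgt w = Src (NSrc \<alpha>) \<longrightarrow>
      Res2 D (\<alpha> \<rhd> w) = Res D w \<lhd> Res2 D \<alpha>"
    using assms(1) unfolding pder_def prederivator_def by (elim conjE)
  then have "Res2 D (\<alpha> \<rhd> w) = Res D w \<lhd> Res2 D \<alpha>"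
    using sntD[OF assms(2)] sfunD[OF assms(3)] sfunD[OF sntD(2)[OF assms(2)]] by simp
  then show ?thesis using nt_on_lwhisk(2)[OF res2_nt[OF assms(1,2)] res_fun[OF assms(1,3)] assms(4)] by simp
qed

text \<open>A prederivator reverses 1-cells and keeps 2-cells, so it turns g -| t into an adjunction
  with left adjoint \<open>Res D t\<close>, right adjoint \<open>Res D g\<close>, unit
  \<open>Res2 D \<alpha>\<close> and counit \<open>Res2 D \<beta>\<close>.\<close>

lemma res_adjunction:
  assumes D: "pder D" and g: "sfun g P Q" and t: "sfun t Q P"
    and a: "snt \<alpha> (id_func P) (t \<circ>\<^sub>f g) P P" and b: "snt \<beta> (g \<circ>\<^sub>f t) (id_func Q) Q Q"
    and tri_g: "\<And>x. x \<in> Obj P \<Longrightarrow> Comp Q (Cmp \<beta> (FO g x)) (FM g (Cmp \<alpha> x)) = Id Q (FO g x)"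
    and tri_t: "\<And>y. y \<in> Obj Q \<Longrightarrow> Comp P (FM t (Cmp \<beta> y)) (Cmp \<alpha> (FO t y)) = Id P (FO t y)"
  shows "X \<in> VObj D P \<Longrightarrow>
      uarr (Val D Q) (Val D P) (Res D g) X (RO D t X) (Cmp (Res2 D \<alpha>) X)"
    "Y \<in> VObj D Q \<Longrightarrow> darr (Val D P) (Val D Q) (Res D t) Y (RO D g Y) (Cmp (Res2 D \<beta>) Y)"
proof -
  note G = sfunD[OF g] and T = sfunD[OF t]
  note Rg = res_fun[OF D g] and Rt = res_fun[OF D t]
  let ?r = "\<lambda>\<alpha> X. Cmp (Res2 D \<alpha>) X"
  \<comment> \<open>The whiskered cells are retyped by the unit and associativity laws so that they
    compose strictly; the triangle identities \<open>e1\<close> and \<open>e2\<close> can then be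
    stated between 2-cells, to which \<open>Res2\<close> applies.\<close>
  have ag: "snt (g \<lhd> \<alpha>) g (g \<circ>\<^sub>f (t \<circ>\<^sub>f g)) P Q"
    using snt_lwhisk[OF a g] by (simp add: comp_id_func[OF G(1)])
  have bg: "snt (\<beta> \<rhd> g) (g \<circ>\<^sub>f (t \<circ>\<^sub>f g)) g P Q"
    using snt_rwhisk[OF b g] by (simp add: comp_id_func[OF G(1)] comp_func_assoc[OF G(1) T(1) G(1)])
  have at: "snt (\<alpha> \<rhd> t) t (t \<circ>\<^sub>f (g \<circ>\<^sub>f t)) Q P"
    using snt_rwhisk[OF a t] by (simp add: comp_id_func[OF T(1)] comp_func_assoc[OF T(1) G(1) T(1)])
  have bt: "snt (t \<lhd> \<beta>) (t \<circ>\<^sub>f (g \<circ>\<^sub>f t)) t Q P"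
    using snt_lwhisk[OF b t] by (simp add: comp_id_func[OF T(1)])
  have e1: "(\<beta> \<rhd> g) \<bullet> (g \<lhd> \<alpha>) = id_nt g"
    by (rule nt_on_eqI[OF nt_on_vcomp(1)[OF sntD(1)[OF ag] sntD(1)[OF bg]] sntD(1)[OF snt_id[OF g]]])
      (simp add: nt_on_vcomp(2)[OF sntD(1)[OF ag] sntD(1)[OF bg]] G tri_g
        nt_on_lwhisk(2)[OF sntD(1)[OF a] G(1)] nt_on_rwhisk(2)[OF sntD(1)[OF b] G(1)])
  have e2: "(t \<lhd> \<beta>) \<bullet> (\<alpha> \<rhd> t) = id_nt t"
    by (rule nt_on_eqI[OF nt_on_vcomp(1)[OF sntD(1)[OF at] sntD(1)[OF bt]] sntD(1)[OF snt_id[OF t]]])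
      (simp add: nt_on_vcomp(2)[OF sntD(1)[OF at] sntD(1)[OF bt]] T tri_t
        nt_on_lwhisk(2)[OF sntD(1)[OF b] T(1)] nt_on_rwhisk(2)[OF sntD(1)[OF a] T(1)])
  have ah: "VHom D P (?r \<alpha> X) X (RO D g (RO D t X))" if X: "X \<in> VObj D P" for X
    using res2_hom[OF D a X] res_id_app(1)[OF D G(2) X] res_comp_app(1)[OF D g t X] by simp
  have bh: "VHom D Q (?r \<beta> Y) (RO D t (RO D g Y)) Y" if Y: "Y \<in> VObj D Q" for Y
    using res2_hom[OF D b Y] res_id_app(1)[OF D G(3) Y] res_comp_app(1)[OF D t g Y] by simp
  have an: "VComp D P (?r \<alpha> Y) f = VComp D P (RM D g (RM D t f)) (?r \<alpha> X)"
    if f: "VHom D P f X Y" for f X Y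
    using res2_nat[OF D a f] res_id_app(2)[OF D G(2) f] res_comp_app(2)[OF D g t f] by simp
  have bn: "VComp D Q (?r \<beta> Y) (RM D t (RM D g f)) = VComp D Q f (?r \<beta> X)"
    if f: "VHom D Q f X Y" for f X Y
    using res2_nat[OF D b f] res_id_app(2)[OF D G(3) f] res_comp_app(2)[OF D t g f] by simp
  \<comment> \<open>The roles are exchanged: the triangle identity of the left adjoint g becomes
    that of the right adjoint \<open>Res D g\<close>, and conversely for t.\<close>
  have t1: "VComp D P (RM D g (?r \<beta> Y)) (?r \<alpha> (RO D g Y)) = VId D P (RO D g Y)"
    if Y: "Y \<in> VObj D Q" for Y
    using res2_vcomp[OF D ag bg Y] res2_id[OF D g Y] res2_lwhisk[OF D a g Y] res2_rwhisk[OF D b g Y] e1 by simp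
  have t2: "VComp D Q (?r \<beta> (RO D t X)) (RM D t (?r \<alpha> X)) = VId D Q (RO D t X)"
    if X: "X \<in> VObj D P" for X
    using res2_vcomp[OF D at bt X] res2_id[OF D t X] res2_lwhisk[OF D b t X] res2_rwhisk[OF D a t X] e2 by simp
  show "uarr (Val D Q) (Val D P) (Res D g) X (RO D t X) (?r \<alpha> X)" if X: "X \<in> VObj D P"
  proof (rule uarr_of_unit_counit[OF Rg Rt X, where d = "?r \<beta>" and e' = "\<lambda>y. ?r \<alpha> (RO D g y)"])
    show "VComp D P (RM D g (RM D t f)) (?r \<alpha> X) = VComp D P (?r \<alpha> (RO D g y)) f"
      if "y \<in> VObj D Q" "VHom D P f X (RO D g y)" for f y using an[OF that(2)] by simp
    show "VComp D Q (?r \<beta> y) (RM D t (RM D g k)) = VComp D Q k (?r \<beta> (RO D t X))"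
      if "VHom D Q k (RO D t X) y" for k y using bn[OF that] .
  qed (use ah X bh t1 t2 fun_obj[OF Rg] in auto)
  show "darr (Val D P) (Val D Q) (Res D t) Y (RO D g Y) (?r \<beta> Y)" if Y: "Y \<in> VObj D Q"
  proof (rule darr_of_unit_counit[OF Rg Rt Y, where e = "?r \<alpha>" and d' = "\<lambda>x. ?r \<beta> (RO D t x)"])
    show "VComp D Q (?r \<beta> Y) (RM D t (RM D g k)) = VComp D Q k (?r \<beta> (RO D t x))"
      if "x \<in> VObj D P" "VHom D Q k (RO D t x) Y" for k x using bn[OF that(2)] .
    show "VComp D P (RM D g (RM D t f)) (?r \<alpha> x) = VComp D P (?r \<alpha> (RO D g Y)) f"
      if "VHom D P f x (RO D g Y)" for f x using an[OF that] by simp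
  qed (use ah Y bh t1 t2 fun_obj[OF Rt] in auto)
qed

section \<open>Reflections and final functors\<close>

text \<open>A reflection \<open>g\<close> with fully faithful right adjoint \<open>t\<close>; then \<open>t\<close> is final.\<close>

definition refl_adj where
  "refl_adj g t \<alpha> P Q \<longleftrightarrow> sfun g P Q \<and> sfun t Q P \<and> g \<circ>\<^sub>f t = id_func Q \<and>
     snt \<alpha> (id_func P) (t \<circ>\<^sub>f g) P P \<and> (\<forall>x\<in>Obj P. FM g (Cmp \<alpha> x) = Id Q (FO g x)) \<and>
     (\<forall>y\<in>Obj Q. Cmp \<alpha> (FO t y) = Id P (FO t y))"

lemma refl_adj_res:
  assumes D: "pder D" and r: "refl_adj g t \<alpha> P Q"
  shows "X \<in> VObj D P \<Longrightarrow>
      uarr (Val D Q) (Val D P) (Res D g) X (RO D t X) (Cmp (Res2 D \<alpha>) X)"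
    "Y \<in> VObj D Q \<Longrightarrow> darr (Val D P) (Val D Q) (Res D t) Y (RO D g Y) (VId D Q Y)"
proof -
  have g: "sfun g P Q" and t: "sfun t Q P" and gt: "g \<circ>\<^sub>f t = id_func Q"
    and a: "snt \<alpha> (id_func P) (t \<circ>\<^sub>f g) P P"
    and ga: "\<And>x. x \<in> Obj P \<Longrightarrow> FM g (Cmp \<alpha> x) = Id Q (FO g x)"
    and at: "\<And>y. y \<in> Obj Q \<Longrightarrow> Cmp \<alpha> (FO t y) = Id P (FO t y)"
    using r by (auto simp: refl_adj_def)
  note G = sfunD[OF g] and T = sfunD[OF t]
  have b: "snt (id_nt (id_func Q)) (g \<circ>\<^sub>f t) (id_func Q) Q Q"
    unfolding gt by (rule snt_id[OF sfun_id[OF G(3)]])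
  note * = res_adjunction[OF D g t a b]
  have 1: "Comp Q (Cmp (id_nt (id_func Q)) (FO g x)) (FM g (Cmp \<alpha> x)) = Id Q (FO g x)"
    if "x \<in> Obj P" for x using that ga fun_obj[OF G(1) that] comp_id_left[OF G(5) id_hom[OF G(5)]] by simp
  have 2: "Comp P (FM t (Cmp (id_nt (id_func Q)) y)) (Cmp \<alpha> (FO t y)) = Id P (FO t y)"
    if "y \<in> Obj Q" for y using that at fun_obj[OF T(1) that] comp_id_left[OF T(5) id_hom[OF T(5)]]
    by (simp add: fun_id[OF T(1)])
  show "X \<in> VObj D P \<Longrightarrow>
      uarr (Val D Q) (Val D P) (Res D g) X (RO D t X) (Cmp (Res2 D \<alpha>) X)" by (rule *(1)[OF 1 2])
  show "darr (Val D P) (Val D Q) (Res D t) Y (RO D g Y) (VId D Q Y)"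
    if Y: "Y \<in> VObj D Q" using *(2)[OF 1 2 Y] res2_id[OF D sfun_id[OF G(3)] Y] res_id_app[OF D G(3)] Y by simp
qed

text \<open>Colimits may be computed after restriction along the final functor t (take for w the
  functor to the point). The universal arrow a factors as the unit at Y followed by the image of
  \<open>RM D t a\<close> under \<open>Res D g\<close>; the unit is universal itself, so
  \<open>uarr_cancel\<close> leaves \<open>RM D t a\<close>.\<close>

lemma uarr_final:
  assumes D: "pder D" and r: "refl_adj g t \<alpha> P Q" and w: "sfun w Q R" and Y: "Y \<in> VObj D P"
    and a: "uarr (Val D R) (Val D P) (Res D (w \<circ>\<^sub>f g)) Y W a"
  shows "uarr (Val D R) (Val D Q) (Res D w) (RO D t Y) W (RM D t a)"
proof -
  have g: "sfun g P Q" and t: "sfun t Q P" and gt: "g \<circ>\<^sub>f t = id_func Q"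
    and n: "snt \<alpha> (id_func P) (t \<circ>\<^sub>f g) P P"
    and ga: "\<And>x. x \<in> Obj P \<Longrightarrow> FM g (Cmp \<alpha> x) = Id Q (FO g x)"
    using r by (auto simp: refl_adj_def)
  note G = sfunD[OF g] and A = uarrD[OF a]
  note Rw = res_fun[OF D w]
  let ?P = "Val D P" and ?Q = "Val D Q"
  have ww: "RO D w W \<in> Obj ?Q" by (rule fun_obj[OF Rw A(2)])
  have gw: "RO D (w \<circ>\<^sub>f g) W = RO D g (RO D w W)" by (rule res_comp_app(1)[OF D g w A(2)])
  have ah: "in_hom ?P a Y (RO D g (RO D w W))" using A(3) gw by simp
  have tgw: "RO D t (RO D g (RO D w W)) = RO D w W"
    using res_comp_app(1)[OF D t g ww] gt res_id_app(1)[OF D G(3) ww] by simp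
  have ta: "in_hom ?Q (RM D t a) (RO D t Y) (RO D w W)" using fun_hom[OF res_fun[OF D t] ah] tgw by simp
  \<comment> \<open>Since g sends the unit to identities, \<open>Res2 D \<alpha>\<close> is an
    identity at every object restricted along g. Naturality of \<open>Res2 D \<alpha>\<close> at a
    then yields the factorisation.\<close>
  have "g \<lhd> \<alpha> = id_nt g"
  proof (rule nt_on_eqI)
    have "g \<circ>\<^sub>f (t \<circ>\<^sub>f g) = g"
      using comp_func_assoc[OF G(1) sfunD(1)[OF t] G(1)] gt comp_id_func[OF G(1)] by simp
    then show "nt_on (g \<lhd> \<alpha>) g g P Q"
      using sntD(1)[OF snt_lwhisk[OF n g]] by (simp add: comp_id_func[OF G(1)])
    show "nt_on (id_nt g) g g P Q" by (rule nt_on_id[OF G(1)])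
    show "Cmp (g \<lhd> \<alpha>) x = Cmp (id_nt g) x" if "x \<in> Obj P" for x
      using that nt_on_lwhisk(2)[OF sntD(1)[OF n] G(1) that] ga G by simp
  qed
  then have n1: "Cmp (Res2 D \<alpha>) (RO D g (RO D w W)) = Id ?P (RO D g (RO D w W))"
    using res2_lwhisk[OF D n g ww] res2_id[OF D g ww] by simp
  have "a = Comp ?P (Cmp (Res2 D \<alpha>) (RO D g (RO D w W))) (RM D (id_func P) a)"
    using res_id_app(2)[OF D G(2) ah] n1 comp_id_left[OF A(5) ah] by simp
  also have "\<dots> = Comp ?P (RM D (t \<circ>\<^sub>f g) a) (Cmp (Res2 D \<alpha>) Y)"
    by (rule res2_nat[OF D n ah])
  also have "RM D (t \<circ>\<^sub>f g) a = RM D g (RM D t a)" by (rule res_comp_app(2)[OF D g t ah])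
  finally have *: "Comp ?P (RM D g (RM D t a)) (Cmp (Res2 D \<alpha>) Y) = a" by simp
  show ?thesis by (rule uarr_cancel[OF refl_adj_res(1)[OF D r Y] _ Rw ta]) (use a * res_comp[OF D g w] in simp)
qed

subsection \<open>Mates\<close>

lemma adj_transpose:
  assumes adj: "adjunction L R \<eta> \<epsilon>" and R: "fun_on R E C" and x: "x \<in> Obj C" and y: "y \<in> Obj E"
    and f: "in_hom C f x (FO R y)"
  shows "in_hom E (Comp E (Cmp \<epsilon> y) (FM L f)) (FO L x) y"
    "Comp C (FM R (Comp E (Cmp \<epsilon> y) (FM L f))) (Cmp \<eta> x) = f"
proof -
  note A = adjD[OF adj R] and R' = fun_onD[OF R]
  note Lf = fun_hom[OF A(1) f]
  show "in_hom E (Comp E (Cmp \<epsilon> y) (FM L f)) (FO L x) y" by (rule comp_hom[OF R'(4) Lf A(5)[OF y]])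
  have "Comp C (FM R (Comp E (Cmp \<epsilon> y) (FM L f))) (Cmp \<eta> x) =
      Comp C (FM R (Cmp \<epsilon> y)) (Comp C (FM R (FM L f)) (Cmp \<eta> x))" using fun_comp[OF R Lf A(5)[OF y]]
      comp_assoc[OF R'(5) A(4)[OF x] fun_hom[OF R Lf] fun_hom[OF R A(5)[OF y]]] by simp
  also have "\<dots> = Comp C (FM R (Cmp \<epsilon> y)) (Comp C (Cmp \<eta> (FO R y)) f)" using A(6)[OF f] by simp
  also have "\<dots> = f"
    by (rule comp_cancel[OF R'(5) f A(4)[OF fun_obj[OF R y]] fun_hom[OF R A(5)[OF y]] A(9)[OF y]])
  finally show "Comp C (FM R (Comp E (Cmp \<epsilon> y) (FM L f))) (Cmp \<eta> x) = f" .
qed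

lemma adj_transpose':
  assumes adj: "adjunction L R \<eta> \<epsilon>" and R: "fun_on R E C" and x: "x \<in> Obj C" and y: "y \<in> Obj E"
    and f: "in_hom E f (FO L x) y"
  shows "in_hom C (Comp C (FM R f) (Cmp \<eta> x)) x (FO R y)"
    "Comp E (Cmp \<epsilon> y) (FM L (Comp C (FM R f) (Cmp \<eta> x))) = f"
proof -
  note A = adjD[OF adj R] and R' = fun_onD[OF R]
  note Rf = fun_hom[OF R f]
  show "in_hom C (Comp C (FM R f) (Cmp \<eta> x)) x (FO R y)" by (rule comp_hom[OF R'(5) A(4)[OF x] Rf])
  have "Comp E (Cmp \<epsilon> y) (FM L (Comp C (FM R f) (Cmp \<eta> x))) =
      Comp E (Comp E (Cmp \<epsilon> y) (FM L (FM R f))) (FM L (Cmp \<eta> x))"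
    using fun_comp[OF A(1) A(4)[OF x] Rf]
      comp_assoc[OF R'(4) fun_hom[OF A(1) A(4)[OF x]] fun_hom[OF A(1) Rf] A(5)[OF y]] by simp
  also have "\<dots> = Comp E (Comp E f (Cmp \<epsilon> (FO L x))) (FM L (Cmp \<eta> x))" using A(7)[OF f] by simp
  also have "\<dots> = f"
    using comp_assoc[OF R'(4) fun_hom[OF A(1) A(4)[OF x]] A(5)[OF fun_obj[OF A(1) x]] f] A(8)[OF x]
      comp_id_right[OF R'(4) f] by simp
  finally show "Comp E (Cmp \<epsilon> y) (FM L (Comp C (FM R f) (Cmp \<eta> x))) = f" .
qed

text \<open>The last clause determines the mate, because the unit of \<open>L2\<close> is universal:
  the mate is the transpose of \<alpha> after the image of the first unit. Later arguments use this
  equation in place of the threefold composite.\<close>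

lemma left_mate:
  assumes a1: "adjunction L1 R1 \<eta>1 \<epsilon>1" and R1: "fun_on R1 E1 C1"
    and a2: "adjunction L2 R2 \<eta>2 \<epsilon>2" and R2: "fun_on R2 E2 C2"
    and H: "fun_on H C1 C2" and K: "fun_on K E1 E2" and n: "nt_on \<alpha> (H \<circ>\<^sub>f R1) (R2 \<circ>\<^sub>f K) E1 C2"
  defines "M \<equiv> left_mate L1 \<eta>1 L2 \<epsilon>2 H K \<alpha>"
  shows "NSrc M = L2 \<circ>\<^sub>f H" "NTgt M = K \<circ>\<^sub>f L1" "Cmp M \<in> extensional (Obj C1)"
    "x \<in> Obj C1 \<Longrightarrow> in_hom E2 (Cmp M x) (FO L2 (FO H x)) (FO K (FO L1 x))"
    "x \<in> Obj C1 \<Longrightarrow> Comp C2 (FM R2 (Cmp M x)) (Cmp \<eta>2 (FO H x)) =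
       Comp C2 (Cmp \<alpha> (FO L1 x)) (FM H (Cmp \<eta>1 x))"
proof -
  note A1 = adjD[OF a1 R1] and A2 = adjD[OF a2 R2]
  note L1' = fun_onD[OF A1(1)] and L2' = fun_onD[OF A2(1)] and H' = fun_onD[OF H] and K' = fun_onD[OF K]
  have s: "NSrc \<eta>1 = id_func C1" "NTgt \<eta>1 = R1 \<circ>\<^sub>f L1" "NSrc \<epsilon>2 = L2 \<circ>\<^sub>f R2" "NTgt \<epsilon>2 = id_func E2"
    "NSrc \<alpha> = H \<circ>\<^sub>f R1" "NTgt \<alpha> = R2 \<circ>\<^sub>f K"
    using A1(2) A2(3) n by (auto simp: nt_on_def)
  show "NSrc M = L2 \<circ>\<^sub>f H" "NTgt M = K \<circ>\<^sub>f L1" unfolding M_def left_mate_def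
    by (simp_all add: s comp_id_func[OF fun_on_comp[OF H A2(1)]] comp_id_func[OF fun_on_comp[OF A1(1) K]])
  show "Cmp M \<in> extensional (Obj C1)" unfolding M_def left_mate_def
    using vcomp_sel(4)[of "\<epsilon>2 \<rhd> K \<circ>\<^sub>f L1" "(L2 \<lhd> (\<alpha> \<rhd> L1)) \<bullet> ((L2 \<circ>\<^sub>f H) \<lhd> \<eta>1)"] by (simp add: s)
  assume x: "x \<in> Obj C1"
  note L1x = fun_obj[OF A1(1) x]
  let ?f = "Comp C2 (Cmp \<alpha> (FO L1 x)) (FM H (Cmp \<eta>1 x))"
  have Hx: "in_hom C2 (FM H (Cmp \<eta>1 x)) (FO H x) (FO H (FO R1 (FO L1 x)))" by (rule fun_hom[OF H A1(4)[OF x]])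
  have ax: "in_hom C2 (Cmp \<alpha> (FO L1 x)) (FO H (FO R1 (FO L1 x))) (FO R2 (FO K (FO L1 x)))"
    using nt_hom[OF n L1x] by (simp add: comp_func_app(1)[OF R1 L1x] comp_func_app(1)[OF K L1x])
  have f: "in_hom C2 ?f (FO H x) (FO R2 (FO K (FO L1 x)))" by (rule comp_hom[OF H'(5) Hx ax])
  have "Cmp M x = Comp E2 (Cmp \<epsilon>2 (FO K (FO L1 x)))
      (Comp E2 (FM L2 (Cmp \<alpha> (FO L1 x))) (FM L2 (FM H (Cmp \<eta>1 x))))" unfolding M_def left_mate_def
    using x A1(4)[OF x] by (simp add: s L1' L2' H' K' comp_func_app(2)[OF H])
  also have "\<dots> = Comp E2 (Cmp \<epsilon>2 (FO K (FO L1 x))) (FM L2 ?f)" using fun_comp[OF A2(1) Hx ax] by simp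
  finally have M: "Cmp M x = Comp E2 (Cmp \<epsilon>2 (FO K (FO L1 x))) (FM L2 ?f)" .
  show "in_hom E2 (Cmp M x) (FO L2 (FO H x)) (FO K (FO L1 x))"
    "Comp C2 (FM R2 (Cmp M x)) (Cmp \<eta>2 (FO H x)) = ?f"
    using adj_transpose[OF a2 R2 fun_obj[OF H x] fun_obj[OF K L1x] f] M by simp_all
qed

text \<open>Dual to \<open>left_mate\<close>: the mate is the transpose of the image of the first
  counit after \<beta>, and the last clause pins it down because the counit of the second adjunction
  is universal.\<close>

lemma right_mate:
  assumes a1: "adjunction L1 R1 \<eta>1 \<epsilon>1" and L1: "fun_on L1 E1 C1"
    and a2: "adjunction L2 R2 \<eta>2 \<epsilon>2" and L2: "fun_on L2 E2 C2"
    and H: "fun_on H C1 C2" and K: "fun_on K E1 E2" and n: "nt_on \<beta> (L2 \<circ>\<^sub>f K) (H \<circ>\<^sub>f L1) E1 C2"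
  defines "M \<equiv> right_mate R1 \<epsilon>1 R2 \<eta>2 H K \<beta>"
  shows "NSrc M = K \<circ>\<^sub>f R1" "NTgt M = R2 \<circ>\<^sub>f H" "Cmp M \<in> extensional (Obj C1)"
    "y \<in> Obj C1 \<Longrightarrow> in_hom E2 (Cmp M y) (FO K (FO R1 y)) (FO R2 (FO H y))"
    "y \<in> Obj C1 \<Longrightarrow> Comp C2 (Cmp \<epsilon>2 (FO H y)) (FM L2 (Cmp M y)) =
       Comp C2 (FM H (Cmp \<epsilon>1 y)) (Cmp \<beta> (FO R1 y))"
proof -
  have R1: "fun_on R1 C1 E1" "fun_on R2 C2 E2" using a1 a2 L1 L2 by (auto simp: adjunction_def fun_on_def)
  note A1 = adjD[OF a1 R1(1)] and A2 = adjD[OF a2 R1(2)]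
  note L1' = fun_onD[OF L1] and R1' = fun_onD[OF R1(1)] and R2' = fun_onD[OF R1(2)]
    and H' = fun_onD[OF H] and K' = fun_onD[OF K]
  have s: "NSrc \<eta>2 = id_func E2" "NTgt \<eta>2 = R2 \<circ>\<^sub>f L2" "NSrc \<epsilon>1 = L1 \<circ>\<^sub>f R1" "NTgt \<epsilon>1 = id_func C1"
    "NSrc \<beta> = L2 \<circ>\<^sub>f K" "NTgt \<beta> = H \<circ>\<^sub>f L1"
    using A1(3) A2(2) n by (auto simp: nt_on_def)
  show "NSrc M = K \<circ>\<^sub>f R1" "NTgt M = R2 \<circ>\<^sub>f H" unfolding M_def right_mate_def
    by (simp_all add: s comp_id_func[OF fun_on_comp[OF H R1(2)]] comp_id_func[OF fun_on_comp[OF R1(1) K]])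
  show "Cmp M \<in> extensional (Obj C1)" unfolding M_def right_mate_def
    using vcomp_sel(4)[of "(R2 \<circ>\<^sub>f H) \<lhd> \<epsilon>1" "(R2 \<lhd> (\<beta> \<rhd> R1)) \<bullet> (\<eta>2 \<rhd> K \<circ>\<^sub>f R1)"] by (simp add: s R1')
  assume y: "y \<in> Obj C1"
  note R1y = fun_obj[OF R1(1) y]
  let ?f = "Comp C2 (FM H (Cmp \<epsilon>1 y)) (Cmp \<beta> (FO R1 y))"
  have Hy: "in_hom C2 (FM H (Cmp \<epsilon>1 y)) (FO H (FO L1 (FO R1 y))) (FO H y)"
    by (rule fun_hom[OF H A1(5)[OF y]])
  have by': "in_hom C2 (Cmp \<beta> (FO R1 y)) (FO L2 (FO K (FO R1 y))) (FO H (FO L1 (FO R1 y)))"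
    using nt_hom[OF n R1y] by (simp add: comp_func_app(1)[OF L1 R1y] comp_func_app(1)[OF K R1y])
  have f: "in_hom C2 ?f (FO L2 (FO K (FO R1 y))) (FO H y)" by (rule comp_hom[OF H'(5) by' Hy])
  have KRy: "FO K (FO R1 y) \<in> Obj E2" by (rule fun_obj[OF K R1y])
  have "Cmp M y = Comp E2 (FM R2 (FM H (Cmp \<epsilon>1 y)))
      (Comp E2 (FM R2 (Cmp \<beta> (FO R1 y))) (Cmp \<eta>2 (FO K (FO R1 y))))" unfolding M_def right_mate_def
    using y A1(5)[OF y] by (simp add: s L1' R1' R2' H' K' comp_func_app(2)[OF H])
  also have "\<dots> = Comp E2 (FM R2 ?f) (Cmp \<eta>2 (FO K (FO R1 y)))" using fun_comp[OF R1(2) by' Hy]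
      comp_assoc[OF R2'(5) A2(4)[OF KRy] fun_hom[OF R1(2) by'] fun_hom[OF R1(2) Hy]] by simp
  finally have M: "Cmp M y = Comp E2 (FM R2 ?f) (Cmp \<eta>2 (FO K (FO R1 y)))" .
  show "in_hom E2 (Cmp M y) (FO K (FO R1 y)) (FO R2 (FO H y))"
    "Comp C2 (Cmp \<epsilon>2 (FO H y)) (FM L2 (Cmp M y)) = ?f"
    using adj_transpose'[OF a2 R1(2) KRy fun_obj[OF H y] f] M by simp_all
qed

subsection \<open>Kan extensions in a derivator\<close>

definition der :: "('k, 'o, 'm) prederiv \<Rightarrow> bool" where
  "der D \<longleftrightarrow> regular_universe TYPE('k) \<and> derivator D"

lemma derD:
  assumes "der (D :: ('k, 'o, 'm) prederiv)"
  shows "pder D" "regular_universe TYPE('k)" "Der1 D" "Der2 D" "Der3 D" "Der4 D"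
  using assms by (auto simp: der_def pder_def derivator_def)

text \<open>The data of \<open>lkan_data\<close> come from a choice operator; Der3 guarantees that
  there is something to choose.\<close>

lemma lkan_adj:
  assumes D: "der D" and u: "sfun u A B"
  shows "adjunction (lkan D u) (Res D u) (lkan_unit D u) (lkan_counit D u)"
proof -
  obtain L \<eta> \<epsilon> where "adjunction L (Res D u) \<eta> \<epsilon>"
    using derD(5)[OF D] sfunD(8)[OF u] unfolding Der3_def by blast
  then have "\<exists>x. case x of (L, \<eta>, \<epsilon>) \<Rightarrow> adjunction L (Res D u) \<eta> \<epsilon>" by auto
  then have "case lkan_data D u of (L, \<eta>, \<epsilon>) \<Rightarrow> adjunction L (Res D u) \<eta> \<epsilon>"
    unfolding lkan_data_def by (rule someI_ex)
  then show ?thesis by (auto simp: lkan_def lkan_unit_def lkan_counit_def split: prod.splits)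
qed

lemma rkan_adj:
  assumes D: "der D" and u: "sfun u A B"
  shows "adjunction (Res D u) (rkan D u) (rkan_unit D u) (rkan_counit D u)"
proof -
  obtain L \<eta> \<epsilon> where "adjunction (Res D u) L \<eta> \<epsilon>"
    using derD(5)[OF D] sfunD(8)[OF u] unfolding Der3_def by blast
  then have "\<exists>x. case x of (L, \<eta>, \<epsilon>) \<Rightarrow> adjunction (Res D u) L \<eta> \<epsilon>" by auto
  then have "case rkan_data D u of (L, \<eta>, \<epsilon>) \<Rightarrow> adjunction (Res D u) L \<eta> \<epsilon>"
    unfolding rkan_data_def by (rule someI_ex)
  then show ?thesis by (auto simp: rkan_def rkan_unit_def rkan_counit_def split: prod.splits)
qed

lemma lkan_fun: "der D \<Longrightarrow> sfun u A B \<Longrightarrow> fun_on (lkan D u) (Val D A) (Val D B)"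
  by (rule adjD(1)[OF lkan_adj res_fun[OF derD(1)]])

lemma rkan_fun: "der D \<Longrightarrow> sfun u A B \<Longrightarrow> fun_on (rkan D u) (Val D A) (Val D B)"
  using rkan_adj[of D u A B] fun_onD[OF res_fun[OF derD(1), of D u A B]] by (auto simp: adjunction_def fun_on_def)

lemma lkan_uarr:
  assumes "der D" "sfun u A B" "X \<in> VObj D A"
  shows "uarr (Val D B) (Val D A) (Res D u) X (FO (lkan D u) X) (Cmp (lkan_unit D u) X)"
  by (rule uarr_adj[OF lkan_adj[OF assms(1,2)] res_fun[OF derD(1)[OF assms(1)] assms(2)] assms(3)])

lemma rkan_darr:
  assumes "der D" "sfun u A B" "X \<in> VObj D A"
  shows "darr (Val D B) (Val D A) (Res D u) X (FO (rkan D u) X) (Cmp (rkan_counit D u) X)"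
  by (rule darr_adj[OF rkan_adj[OF assms(1,2)] res_fun[OF derD(1)[OF assms(1)] assms(2)] assms(3)])

lemma iso_pointwise:
  assumes D: "der D" and A: "small_cat A" and f: "VHom D A f X Y"
    and "\<And>a. a \<in> Obj A \<Longrightarrow> VIso D one (RM D (pt A a) f)"
  shows "VIso D A f" using derD(4)[OF D] A in_homD(1)[OF f] assms(4) unfolding Der2_def by blast

text \<open>Der4 says that the mate out of the chosen colimit is invertible. The unit of that
  colimit followed by this isomorphism is, by the equation for mates, the slice cell after the
  restricted unit, which is therefore universal. The formulation for an arbitrary universal e,
  instead of the chosen unit, is what later allows Kan extensions to be recognised up to
  isomorphism.\<close>

lemma lkan_pointwise:
  assumes D: "der D" and u: "sfun u A B" and b: "b \<in> Obj B"
    and e: "uarr (Val D B) (Val D A) (Res D u) X U e"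
  shows "uarr (Val D one) (Val D (over_cat u b)) (Res D (bang (over_cat u b)))
    (RO D (over_proj u b) X) (RO D (pt B b) U)
    (VComp D (over_cat u b) (Cmp (Res2 D (over_cell u b)) U) (RM D (over_proj u b) e))"
proof -
  note P = derD(1)[OF D] and reg = derD(2)[OF D] and U = sfunD[OF u] and E = uarrD[OF e]
  let ?S = "over_cat u b" and ?p = "over_proj u b" and ?c = "over_cell u b"
  have S: "small_cat ?S" by (rule small_over[OF reg u])
  note p = over_proj[OF reg u, of b] and pi = sfun_bang[OF reg S] and bb = sfun_pt[OF reg U(3) b]
    and c = over_cell[OF reg u b]
  note R = res_fun[OF P]
  have X: "X \<in> VObj D A" using hom_obj(1)[OF E(5,3)] .
  note l = lkan_uarr[OF D u X]
  note L = uarrD[OF l]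
  let ?V = "FO (lkan D u) X" and ?n = "Cmp (lkan_unit D u) X"
  have cn: "nt_on (Res2 D ?c) (Res D ?p \<circ>\<^sub>f Res D u) (Res D (bang ?S) \<circ>\<^sub>f Res D (pt B b)) (Val D B) (Val D ?S)"
    using res2_nt[OF P c] res_comp[OF P p u] res_comp[OF P pi bb] by simp
  have chom: "VHom D ?S (Cmp (Res2 D ?c) Z) (RO D ?p (RO D u Z))
      (RO D (bang ?S) (RO D (pt B b) Z))" if Z: "Z \<in> VObj D B" for Z
    using nt_hom[OF cn Z] by (simp add: comp_func_app(1)[OF R[OF u] Z] comp_func_app(1)[OF R[OF bb] Z])
  let ?M = "left_mate (lkan D u) (lkan_unit D u) (lkan D (bang ?S)) (lkan_counit D (bang ?S))
      (Res D ?p) (Res D (pt B b)) (Res2 D ?c)"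
  note M = left_mate[OF lkan_adj[OF D u] R[OF u] lkan_adj[OF D pi] R[OF pi] R[OF p] R[OF bb] cn]
  have niso: "is_niso ?M" using derD(6)[OF D] U b unfolding Der4_def by blast
  have "Src (NSrc ?M) = Val D A" "Tgt (NSrc ?M) = Val D one"
    using M(1) fun_onD[OF R[OF p]] fun_onD[OF lkan_fun[OF D pi]] by simp_all
  then have iso: "VIso D one (Cmp ?M X)" using niso X unfolding is_niso_def by auto
  have pX: "RO D ?p X \<in> VObj D ?S" by (rule fun_obj[OF R[OF p] X])
  \<comment> \<open>The case of the chosen Kan extension with its unit.\<close>
  have base: "uarr (Val D one) (Val D ?S) (Res D (bang ?S)) (RO D ?p X) (RO D (pt B b) ?V)
      (VComp D ?S (Cmp (Res2 D ?c) ?V) (RM D ?p ?n))"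
    using uarr_iso_right[OF lkan_uarr[OF D pi pX] M(4)[OF X] iso] M(5)[OF X] by simp
  \<comment> \<open>The chosen extension is compared with the given one; naturality of the slice
    cell carries the universal arrow along the value of m at b.\<close>
  obtain m where m: "VHom D B m ?V U" "VComp D A (RM D u m) ?n = e" using uarrE[OF l E(2,3)] by blast
  have mi: "VIso D B m" by (rule uarr_unique_iso[OF l e m])
  note pn = fun_hom[OF R[OF p] L(3)] and pum = fun_hom[OF R[OF p] fun_hom[OF R[OF u] m(1)]]
  note bm = fun_hom[OF R[OF bb] m(1)]
  note C = val_cat[OF P S]
  have "VComp D ?S (RM D (bang ?S) (RM D (pt B b) m)) (VComp D ?S (Cmp (Res2 D ?c) ?V) (RM D ?p ?n)) =
    VComp D ?S (VComp D ?S (RM D (bang ?S) (RM D (pt B b) m)) (Cmp (Res2 D ?c) ?V)) (RM D ?p ?n)"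
    using comp_assoc[OF C pn chom[OF L(2)] fun_hom[OF R[OF pi] bm]] by simp
  also have "VComp D ?S (RM D (bang ?S) (RM D (pt B b) m)) (Cmp (Res2 D ?c) ?V) =
      VComp D ?S (Cmp (Res2 D ?c) U) (RM D ?p (RM D u m))"
    using nt_nat[OF cn m(1)] by (simp add: comp_func_app(2)[OF R[OF u] m(1)] comp_func_app(2)[OF R[OF bb] m(1)])
  also have "VComp D ?S \<dots> (RM D ?p ?n) = VComp D ?S (Cmp (Res2 D ?c) U) (RM D ?p e)"
    using comp_assoc[OF C pn pum chom[OF E(2)]]
      fun_comp[OF R[OF p] L(3) fun_hom[OF R[OF u] m(1)]] m(2) by simp
  finally have eq: "VComp D ?S (RM D (bang ?S) (RM D (pt B b) m)) (VComp D ?S (Cmp (Res2 D ?c) ?V) (RM D ?p ?n)) =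
    VComp D ?S (Cmp (Res2 D ?c) U) (RM D ?p e)" .
  show ?thesis using uarr_iso_right[OF base bm fun_iso[OF R[OF bb] m(1) mi]] eq by simp
qed

section \<open>The pointwise formula with parameters, and base change\<close>

text \<open>\<open>(u/b)\<close> is a reflective subcategory of the slice of \<open>u \<times> K\<close> over \<open>(b, k)\<close>, so the latter may
  be replaced by the former in the pointwise formula.\<close>

definition slice_incl :: "'k sfunc \<Rightarrow> 'k el \<Rightarrow> 'k scat \<Rightarrow> 'k el \<Rightarrow> 'k sfunc" where
  "slice_incl u b K k = mk_func (over_cat u b) (Src u \<times>\<^sub>c K)
     (\<lambda>x. Pair (pfst x) k) (\<lambda>f. Pair (psnd f) (Id K k))"

definition slice_cell :: "'k sfunc \<Rightarrow> 'k el \<Rightarrow> 'k scat \<Rightarrow> 'k el \<Rightarrow> 'k sntrans" where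
  "slice_cell u b K k = mk_ntrans ((u \<times>\<^sub>f id_func K) \<circ>\<^sub>f slice_incl u b K k)
     (pt (Tgt u \<times>\<^sub>c K) (Pair b k) \<circ>\<^sub>f bang (over_cat u b)) (\<lambda>x. Pair (psnd x) (Id K k))"

text \<open>An object of the slice of u x K over (b, k) consists of (a, k') with f : u a -> b and h
  : k' -> k. The reflection g forgets k' and h, its right adjoint t inserts k with its identity, and
  the unit is h together with the identity of a. The remaining clauses identify the slice data after
  restriction along t.\<close>

lemma slice_refl:
  assumes reg: "regular_universe TYPE('k)" and u: "sfun (u :: 'k sfunc) A B" and K: "small_cat K"
    and b: "b \<in> Obj B" and k: "k \<in> Obj K"
  defines "S \<equiv> over_cat u b" and "T \<equiv> over_cat (u \<times>\<^sub>f id_func K) (Pair b k)"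
  defines "g \<equiv> mk_func T S (\<lambda>x. Pair (pfst (pfst x)) (pfst (psnd x)))
      (\<lambda>f. Pair (Pair (Pair (pfst (pfst (pfst (pfst f)))) (pfst (psnd (pfst (pfst f)))))
      (Pair (pfst (pfst (psnd (pfst f)))) (pfst (psnd (psnd (pfst f)))))) (pfst (psnd f)))"
    and "to \<equiv> (\<lambda>x. Pair (Pair (pfst x) k) (Pair (psnd x) (Id K k)))"
  defines "t \<equiv> mk_func S T to
      (\<lambda>f. Pair (Pair (to (pfst (pfst f))) (to (psnd (pfst f)))) (Pair (psnd f) (Id K k)))"
  defines "\<alpha> \<equiv> mk_ntrans (id_func T) (t \<circ>\<^sub>f g)
      (\<lambda>x. Pair (Pair x (to (Pair (pfst (pfst x)) (pfst (psnd x)))))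
      (Pair (Id A (pfst (pfst x))) (psnd (psnd x))))"
  shows "refl_adj g t \<alpha> T S"
    "over_proj (u \<times>\<^sub>f id_func K) (Pair b k) \<circ>\<^sub>f t = slice_incl u b K k"
    "over_cell (u \<times>\<^sub>f id_func K) (Pair b k) \<rhd> t = slice_cell u b K k"
    "bang S \<circ>\<^sub>f g = bang T"
proof -
  \<comment> \<open>\<open>?gm\<close> and \<open>?tm\<close> are the arrow parts of g and t with
    \<open>to\<close> expanded, in the form in which they appear once the definitions are
    unfolded.\<close>
  let ?gm = "\<lambda>f. Pair (Pair (Pair (pfst (pfst (pfst (pfst f)))) (pfst (psnd (pfst (pfst f))))) (Pair (pfst (pfst (psnd (pfst f)))) (pfst (psnd (psnd (pfst f)))))) (pfst (psnd f))"
    and ?tm = "\<lambda>f. Pair (Pair (Pair (Pair (pfst (pfst (pfst f))) k) (Pair (psnd (pfst (pfst f))) (Id K k))) (Pair (Pair (pfst (psnd (pfst f))) k) (Pair (psnd (psnd (pfst f))) (Id K k)))) (Pair (psnd f) (Id K k))"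
  note U = sfunD[OF u] and K' = small_cat_is_cat[OF K]
  let ?u = "u \<times>\<^sub>f id_func K"
  have uK: "sfun ?u (A \<times>\<^sub>c K) (B \<times>\<^sub>c K)" by (rule sfun_prod[OF reg u sfun_id[OF K]])
  note UK = sfunD[OF uK]
  have bk: "Pair b k \<in> Obj (B \<times>\<^sub>c K)" using b k by simp
  have S: "small_cat S" "is_cat S" and T: "small_cat T" "is_cat T"
    using small_over[OF reg u] small_over[OF reg uK] is_cat_over[OF U(1)] is_cat_over[OF UK(1)]
    unfolding S_def T_def by auto
  have TO: "\<exists>a k' f h. x = Pair (Pair a k') (Pair f h) \<and> a \<in> Obj A \<and> k' \<in> Obj K \<and>
      in_hom B f (FO u a) b \<and> in_hom K h k' k" if "x \<in> Obj T" for x using that unfolding T_def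
    by (auto elim!: over_cat_objE prod_cat_objE prod_cat_homE simp: U)
  have TO': "Pair (Pair a k') (Pair f h) \<in> Obj T \<longleftrightarrow> a \<in> Obj A \<and> k' \<in> Obj K \<and>
      in_hom B f (FO u a) b \<and> in_hom K h k' k" for a k' f h unfolding T_def by (auto simp: U)
  have SO: "\<exists>a f. x = Pair a f \<and> a \<in> Obj A \<and> in_hom B f (FO u a) b" if "x \<in> Obj S" for x
    using that unfolding S_def by (auto elim!: over_cat_objE simp: U)
  have SO': "Pair a f \<in> Obj S \<longleftrightarrow> a \<in> Obj A \<and> in_hom B f (FO u a) b" for a f
    unfolding S_def by (simp add: U)
  have SA': "in_hom S (Pair (Pair (Pair a f) (Pair a' f')) p) x y \<longleftrightarrow>
      x = Pair a f \<and> y = Pair a' f' \<and> Pair a f \<in> Obj S \<and> Pair a' f' \<in> Obj S \<and>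
      in_hom A p a a' \<and> Comp B f' (FM u p) = f" for a f a' f' p x y unfolding S_def by (simp add: U)
  have SA: "\<exists>a f a' f' p. q = Pair (Pair (Pair a f) (Pair a' f')) p" if "in_hom S q x y" for q x y
    using in_homD(1)[OF that] unfolding S_def by (auto elim!: over_cat_arrE over_cat_objE)
  have TA': "in_hom T (Pair (Pair (Pair (Pair a i) (Pair f h)) (Pair (Pair a' i') (Pair f' h')))
      (Pair p q)) x y \<longleftrightarrow>
      x = Pair (Pair a i) (Pair f h) \<and> y = Pair (Pair a' i') (Pair f' h') \<and>
      x \<in> Obj T \<and> y \<in> Obj T \<and>
      in_hom A p a a' \<and> in_hom K q i i' \<and> Comp B f' (FM u p) = f \<and> Comp K h' q = h"
    for a i f h a' i' f' h' p q x y unfolding T_def by (auto simp: U in_hom_def)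
  have TA: "\<exists>a i f h a' i' f' h' p q.
      r = Pair (Pair (Pair (Pair a i) (Pair f h)) (Pair (Pair a' i') (Pair f' h'))) (Pair p q)"
    if "in_hom T r x y" for r x y using in_homD(1)[OF that] unfolding T_def
    by (auto elim!: over_cat_arrE over_cat_objE prod_cat_objE prod_cat_homE)
  have Sc: "Id S x = Pair (Pair x x) (Id A (pfst x))"
    "Comp S (Pair (Pair x' y') g') (Pair (Pair x y) p) = Pair (Pair x y') (Comp A g' p)" for x x' y' g' y p
    unfolding S_def by (simp_all add: U)
  have Tc: "Id T x = Pair (Pair x x) (Id (A \<times>\<^sub>c K) (pfst x))"
    "Comp T (Pair (Pair x' y') g') (Pair (Pair x y) p) = Pair (Pair x y') (Comp (A \<times>\<^sub>c K) g' p)"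
    for x x' y' g' y p unfolding T_def by (simp_all add: U)
  have g: "fun_on g T S" unfolding g_def
  proof (rule fun_onI[OF T(2) S(2)])
    fix x assume "x \<in> Obj T"
    then obtain a k' f h where "x = Pair (Pair a k') (Pair f h)" "x \<in> Obj T" using TO by blast
    then show "Pair (pfst (pfst x)) (pfst (psnd x)) \<in> Obj S" by (simp add: TO' SO')
  next
    fix r x y assume r: "in_hom T r x y"
    then obtain a i f h a' i' f' h' p q where
      *: "r = Pair (Pair (Pair (Pair a i) (Pair f h)) (Pair (Pair a' i') (Pair f' h'))) (Pair p q)"
      using TA[OF r] by (elim exE) (rule that)
    show "in_hom S (?gm r) (Pair (pfst (pfst x)) (pfst (psnd x))) (Pair (pfst (pfst y)) (pfst (psnd y)))"
      using r unfolding * TA' by (auto simp: SA' TO' SO')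
  next
    fix x assume "x \<in> Obj T"
    then obtain a k' f h where "x = Pair (Pair a k') (Pair f h)" using TO by blast
    then show "?gm (Id T x) = Id S (Pair (pfst (pfst x)) (pfst (psnd x)))" by (simp add: Sc Tc)
  next
    fix r s x y z assume r: "in_hom T r x y" and s: "in_hom T s y z"
    show "?gm (Comp T s r) = Comp S (?gm s) (?gm r)" using TA[OF r] TA[OF s] by (elim exE) (simp add: Sc Tc)
  qed
  have t: "fun_on t S T" unfolding t_def to_def
  proof (rule fun_onI[OF S(2) T(2)])
    fix x assume "x \<in> Obj S"
    then show "Pair (Pair (pfst x) k) (Pair (psnd x) (Id K k)) \<in> Obj T"
      using SO[of x] k id_hom[OF K' k] by (auto simp: SO' TO')
  next
    fix r x y assume r: "in_hom S r x y"
    then obtain a f a' f' p where *: "r = Pair (Pair (Pair a f) (Pair a' f')) p"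
      using SA[OF r] by (elim exE) (rule that)
    show "in_hom T (?tm r)
       (Pair (Pair (pfst x) k) (Pair (psnd x) (Id K k))) (Pair (Pair (pfst y) k) (Pair (psnd y) (Id K k)))"
      using r k id_hom[OF K' k] comp_id_left[OF K' id_hom[OF K' k]] unfolding * SA' by (auto simp: TA' SO' TO')
  next
    fix x assume "x \<in> Obj S"
    then show "?tm (Id S x) = Id T (Pair (Pair (pfst x) k) (Pair (psnd x) (Id K k)))"
      using SO[of x] by (auto simp: Sc Tc)
  next
    fix r s x y z assume r: "in_hom S r x y" and s: "in_hom S s y z"
    show "?tm (Comp S s r) = Comp T (?tm s) (?tm r)"
      using SA[OF r] SA[OF s] comp_id_left[OF K' id_hom[OF K' k]] by (elim exE) (simp add: Sc Tc)
  qed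
  have gs: "sfun g T S" and ts: "sfun t S T" using g t S T by (auto simp: sfun_def)
  note G = fun_onD[OF g] and T' = fun_onD[OF t]
  have gx: "FO g (Pair (Pair a i) (Pair f h)) = Pair a f" if "Pair (Pair a i) (Pair f h) \<in> Obj T" for a i f h
    using that by (simp add: g_def)
  have gr: "FM g (Pair (Pair (Pair (Pair a i) (Pair f h)) (Pair (Pair a' i') (Pair f' h'))) (Pair p q)) =
      Pair (Pair (Pair a f) (Pair a' f')) p"
    if "in_hom T (Pair (Pair (Pair (Pair a i) (Pair f h)) (Pair (Pair a' i') (Pair f' h'))) (Pair p q)) x y"
    for a i f h a' i' f' h' p q x y using in_homD(1)[OF that] by (simp add: g_def)
  have tx: "FO t (Pair a f) = Pair (Pair a k) (Pair f (Id K k))" if "Pair a f \<in> Obj S" for a f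
    using that by (simp add: t_def to_def)
  have tr: "FM t (Pair (Pair (Pair a f) (Pair a' f')) p) =
      Pair (Pair (Pair (Pair a k) (Pair f (Id K k))) (Pair (Pair a' k) (Pair f' (Id K k)))) (Pair p (Id K k))"
    if "in_hom S (Pair (Pair (Pair a f) (Pair a' f')) p) x y" for a f a' f' p x y
    using in_homD(1)[OF that] by (simp add: t_def to_def)
  have gt: "g \<circ>\<^sub>f t = id_func S"
  proof (rule func_eqI[OF fun_on_comp[OF t g] fun_on_id[OF S(2)]])
    show "FO (g \<circ>\<^sub>f t) x = FO (id_func S) x" if x: "x \<in> Obj S" for x
      using SO[OF x] x fun_obj[OF t x] by (auto simp: comp_func_app(1)[OF t x] tx gx)
    show "FM (g \<circ>\<^sub>f t) r = FM (id_func S) r" if r: "r \<in> Arr S" for r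
    proof -
      have r': "in_hom S r (Dom S r) (Cod S r)" by (rule arr_hom[OF r])
      obtain a f a' f' p where *: "r = Pair (Pair (Pair a f) (Pair a' f')) p" using SA[OF r'] by (elim exE) (rule that)
      show ?thesis using gr[OF fun_hom[OF t r', unfolded * tr[OF r'[unfolded *]]]] r
        by (simp add: T'(2) * tr[OF r'[unfolded *]])
    qed
  qed
  have tg: "fun_on (t \<circ>\<^sub>f g) T T" by (rule fun_on_comp[OF g t])
  have a: "nt_on \<alpha> (id_func T) (t \<circ>\<^sub>f g) T T"
  proof (rule nt_onI[OF fun_on_id[OF T(2)] tg])
    show "Cmp \<alpha> \<in> extensional (Obj T)" unfolding \<alpha>_def using mk_ntrans_sel(4)[of "id_func T"] by simp
    show "in_hom T (Cmp \<alpha> x) (FO (id_func T) x) (FO (t \<circ>\<^sub>f g) x)" if x: "x \<in> Obj T" for x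
    proof -
      obtain a i f h where *: "x = Pair (Pair a i) (Pair f h)" "a \<in> Obj A" "i \<in> Obj K"
        "in_hom B f (FO u a) b" "in_hom K h i k" using TO[OF x] by blast
      have "Pair a f \<in> Obj S" using * by (simp add: SO')
      then show ?thesis using * x id_hom[OF U(4) *(2)] comp_id_left[OF K' *(5)] comp_id_right[OF U(5) *(4)]
          hom_obj[OF K' *(5)] id_hom[OF K' k] by (simp add: G(2) gx tx \<alpha>_def to_def TA' TO' fun_id[OF U(1)])
    qed
    show "Comp T (Cmp \<alpha> y) (FM (id_func T) r) = Comp T (FM (t \<circ>\<^sub>f g) r) (Cmp \<alpha> x)"
      if r: "in_hom T r x y" for r x y
    proof -
      obtain a i f h a' i' f' h' p q where
        *: "r = Pair (Pair (Pair (Pair a i) (Pair f h)) (Pair (Pair a' i') (Pair f' h'))) (Pair p q)"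
        using TA[OF r] by (elim exE) (rule that)
      note r' = r[unfolded *]
      have **: "x = Pair (Pair a i) (Pair f h)" "y = Pair (Pair a' i') (Pair f' h')" "x \<in> Obj T" "y \<in> Obj T"
        "in_hom A p a a'" "in_hom K q i i'" "Comp B f' (FM u p) = f" "Comp K h' q = h"
        using r' unfolding TA' by auto
      have h: "in_hom K h i k" "in_hom K h' i' k" using **(1-4) by (auto simp: TO')
      have gr': "FM g r = Pair (Pair (Pair a f) (Pair a' f')) p" unfolding * by (rule gr[OF r'])
      show ?thesis using ** in_homD(1)[OF r] tr[OF fun_hom[OF g r, unfolded gr']]
          comp_id_left[OF U(4) **(5)] comp_id_right[OF U(4) **(5)] comp_id_left[OF K' h(1)]
        by (simp add: comp_func_app(2)[OF g r] gr' \<alpha>_def to_def Tc) (simp add: * Tc)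
    qed
  qed (simp_all add: \<alpha>_def)
  show "refl_adj g t \<alpha> T S" unfolding refl_adj_def snt_def
  proof (intro conjI ballI)
    show "FM g (Cmp \<alpha> x) = Id S (FO g x)" if x: "x \<in> Obj T" for x
    proof -
      obtain a i f h where *: "x = Pair (Pair a i) (Pair f h)" using TO[OF x] by blast
      have al: "Cmp \<alpha> x = Pair (Pair (Pair (Pair a i) (Pair f h)) (Pair (Pair a k) (Pair f (Id K k))))
          (Pair (Id A a) h)" using x * by (simp add: \<alpha>_def to_def)
      show ?thesis unfolding al using gr[OF nt_hom[OF a x, unfolded al]] x * gx by (simp add: Sc)
    qed
    show "Cmp \<alpha> (FO t y) = Id T (FO t y)" if y: "y \<in> Obj S" for y
      using SO[OF y] y fun_obj[OF t y] by (auto simp: \<alpha>_def tx to_def Tc)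
  qed (use gs ts gt a T in auto)
  have incl: "fun_on (slice_incl u b K k) S (A \<times>\<^sub>c K)" unfolding slice_incl_def S_def[symmetric] U
  proof (rule fun_onI[OF S(2) is_cat_prod[OF U(4) K']])
    fix r x y assume r: "in_hom S r x y"
    show "in_hom (A \<times>\<^sub>c K) (Pair (psnd r) (Id K k)) (Pair (pfst x) k) (Pair (pfst y) k)"
      using SA[OF r] r id_hom[OF K' k] by (auto simp: SA')
  next
    fix r s x y z assume r: "in_hom S r x y" and s: "in_hom S s y z"
    show "Pair (psnd (Comp S s r)) (Id K k) =
        Comp (A \<times>\<^sub>c K) (Pair (psnd s) (Id K k)) (Pair (psnd r) (Id K k))"
      using SA[OF r] SA[OF s] comp_id_left[OF K' id_hom[OF K' k]] by (elim exE) (simp add: Sc)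
  next
    fix x assume "x \<in> Obj S"
    then show "Pair (pfst x) k \<in> Obj (A \<times>\<^sub>c K)" using SO[of x] k by auto
  qed (simp add: Sc)
  note p = over_proj[OF reg uK, of "Pair b k", folded T_def]
  have pT: "over_proj ?u (Pair b k) = mk_func T (A \<times>\<^sub>c K) pfst psnd"
    by (simp add: over_proj_def T_def U)
  show pt: "over_proj ?u (Pair b k) \<circ>\<^sub>f t = slice_incl u b K k"
  proof (rule func_eqI[OF fun_on_comp[OF t sfunD(1)[OF p]] incl])
    show "FO (over_proj ?u (Pair b k) \<circ>\<^sub>f t) x = FO (slice_incl u b K k) x" if x: "x \<in> Obj S" for x
      using SO[OF x] x fun_obj[OF t x]
      by (auto simp: comp_func_app(1)[OF t x] pT tx slice_incl_def S_def[symmetric])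
    show "FM (over_proj ?u (Pair b k) \<circ>\<^sub>f t) r = FM (slice_incl u b K k) r" if r: "r \<in> Arr S" for r
    proof -
      have r': "in_hom S r (Dom S r) (Cod S r)" by (rule arr_hom[OF r])
      obtain a f a' f' q where *: "r = Pair (Pair (Pair a f) (Pair a' f')) q" using SA[OF r'] by (elim exE) (rule that)
      show ?thesis using fun_arr[OF t r] r tr[OF r'[unfolded *]]
        by (simp add: T'(2) pT slice_incl_def S_def[symmetric] * T'(2))
    qed
  qed
  note bs = sfunD(1)[OF sfun_bang[OF reg S(1)]] and bt = sfunD(1)[OF sfun_bang[OF reg T(1)]]
  have bg: "fun_on (bang S \<circ>\<^sub>f g) T one" by (rule fun_on_comp[OF g bs])
  show "bang S \<circ>\<^sub>f g = bang T" by (rule func_eqI[OF bg bt])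
      (use fun_obj[OF g] fun_arr[OF g] in \<open>auto simp: G bang_def\<close>)
  have bT: "bang T \<circ>\<^sub>f t = bang S" by (rule func_eqI[OF fun_on_comp[OF t bt] bs])
      (use fun_obj[OF t] fun_arr[OF t] in \<open>auto simp: T' bang_def\<close>)
  note pbk = sfunD(1)[OF sfun_pt[OF reg UK(3) bk]]
  have cell: "over_cell ?u (Pair b k) = mk_ntrans (?u \<circ>\<^sub>f over_proj ?u (Pair b k))
      (pt (B \<times>\<^sub>c K) (Pair b k) \<circ>\<^sub>f bang T) psnd" by (simp add: over_cell_def T_def U)
  show "over_cell ?u (Pair b k) \<rhd> t = slice_cell u b K k"
  proof (rule nt_eqI[where S = "Obj S"])
    show "NSrc (over_cell ?u (Pair b k) \<rhd> t) = NSrc (slice_cell u b K k)"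
      using comp_func_assoc[OF t sfunD(1)[OF p] UK(1)] pt by (simp add: cell slice_cell_def)
    show "NTgt (over_cell ?u (Pair b k) \<rhd> t) = NTgt (slice_cell u b K k)"
      using comp_func_assoc[OF t bt pbk] bT by (simp add: cell slice_cell_def S_def[symmetric] U)
    show "Cmp (over_cell ?u (Pair b k) \<rhd> t) \<in> extensional (Obj S)"
      using rwhisk_sel(4)[of "over_cell ?u (Pair b k)" t] by (simp add: T')
    have src: "Src (slice_incl u b K k) = S" by (simp add: slice_incl_def S_def)
    show "Cmp (slice_cell u b K k) \<in> extensional (Obj S)"
      unfolding slice_cell_def using mk_ntrans_sel(4)[of "?u \<circ>\<^sub>f slice_incl u b K k"] by (simp add: src)
    fix x assume x: "x \<in> Obj S"
    show "Cmp (over_cell ?u (Pair b k) \<rhd> t) x = Cmp (slice_cell u b K k) x"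
      using SO[OF x] x fun_obj[OF t x] sfunD(6)[OF p] by (auto simp: T' cell slice_cell_def src tx)
  qed
qed

text \<open>The pointwise formula for u x K at (b, k), restricted along the final functor of
  \<open>slice_refl\<close>. The indexing category (u/b) no longer depends on k, which is what base
  change requires.\<close>

lemma lkan_pointwise_param:
  assumes D: "der D" and u: "sfun u A B" and K: "small_cat K" and b: "b \<in> Obj B" and k: "k \<in> Obj K"
    and e: "uarr (Val D (B \<times>\<^sub>c K)) (Val D (A \<times>\<^sub>c K)) (Res D (u \<times>\<^sub>f id_func K)) X U e"
  defines "S \<equiv> over_cat u b"
  shows "uarr (Val D one) (Val D S) (Res D (bang S)) (RO D (slice_incl u b K k) X)
      (RO D (pt (B \<times>\<^sub>c K) (Pair b k)) U)
      (VComp D S (Cmp (Res2 D (slice_cell u b K k)) U) (RM D (slice_incl u b K k) e))"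
    "sfun (slice_incl u b K k) S (A \<times>\<^sub>c K)"
    "snt (slice_cell u b K k) ((u \<times>\<^sub>f id_func K) \<circ>\<^sub>f slice_incl u b K k)
       (pt (B \<times>\<^sub>c K) (Pair b k) \<circ>\<^sub>f bang S) S (B \<times>\<^sub>c K)"
proof -
  note P = derD(1)[OF D] and reg = derD(2)[OF D] and U = sfunD[OF u] and E = uarrD[OF e]
  let ?u = "u \<times>\<^sub>f id_func K"
  have uK: "sfun ?u (A \<times>\<^sub>c K) (B \<times>\<^sub>c K)" by (rule sfun_prod[OF reg u sfun_id[OF K]])
  have bk: "Pair b k \<in> Obj (B \<times>\<^sub>c K)" using b k by simp
  let ?T = "over_cat ?u (Pair b k)"
  let ?p = "over_proj ?u (Pair b k)" and ?c = "over_cell ?u (Pair b k)"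
  obtain g t \<alpha> where r: "refl_adj g t \<alpha> ?T S" and pt: "?p \<circ>\<^sub>f t = slice_incl u b K k"
    and ct: "?c \<rhd> t = slice_cell u b K k" and bg: "bang S \<circ>\<^sub>f g = bang ?T"
    by (rule that[OF slice_refl[OF reg u K b k, folded S_def]])
  have t: "sfun t S ?T" and g: "sfun g ?T S" using r by (auto simp: refl_adj_def)
  note p = over_proj[OF reg uK, of "Pair b k"] and c = over_cell[OF reg uK bk]
  have bb: "sfun (bang ?T) ?T one" by (rule sfun_bang[OF reg sfunD(3)[OF t]])
  have bS: "sfun (bang S) S one" by (rule sfun_bang[OF reg sfunD(2)[OF t]])
  note ptbk = sfun_pt[OF reg sfunD(3)[OF uK] bk]
  show incl: "sfun (slice_incl u b K k) S (A \<times>\<^sub>c K)" using sfun_comp[OF t p] pt by simp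
  have "bang ?T \<circ>\<^sub>f t = bang S"
  proof -
    have "g \<circ>\<^sub>f t = id_func S" using r by (simp add: refl_adj_def)
    then show ?thesis using comp_func_assoc[OF sfunD(1)[OF t] sfunD(1)[OF g] sfunD(1)[OF bS]] bg
        comp_id_func(1)[OF sfunD(1)[OF bS]] by simp
  qed
  then show cell: "snt (slice_cell u b K k) (?u \<circ>\<^sub>f slice_incl u b K k)
      (pt (B \<times>\<^sub>c K) (Pair b k) \<circ>\<^sub>f bang S) S (B \<times>\<^sub>c K)"
    using snt_rwhisk[OF c t] ct pt
      comp_func_assoc[OF sfunD(1)[OF t] sfunD(1)[OF p] sfunD(1)[OF uK]]
      comp_func_assoc[OF sfunD(1)[OF t] sfunD(1)[OF bb] sfunD(1)[OF ptbk]] by simp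
  have X: "X \<in> VObj D (A \<times>\<^sub>c K)" using hom_obj(1)[OF E(5,3)] .
  note pe = fun_hom[OF res_fun[OF P p] E(3)]
  have "VHom D ?T (Cmp (Res2 D ?c) U) (RO D ?p (RO D ?u U))
      (RO D (pt (B \<times>\<^sub>c K) (Pair b k) \<circ>\<^sub>f bang ?T) U)"
    using res2_hom[OF P c E(2)] res_comp_app(1)[OF P p uK E(2)] by simp
  note cc = fun_comp[OF res_fun[OF P t] pe this]
  have pX: "RO D ?p X \<in> VObj D ?T" by (rule fun_obj[OF res_fun[OF P p] X])
  have "uarr (Val D one) (Val D ?T) (Res D (bang S \<circ>\<^sub>f g)) (RO D ?p X)
      (RO D (pt (B \<times>\<^sub>c K) (Pair b k)) U) (VComp D ?T (Cmp (Res2 D ?c) U) (RM D ?p e))"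
    using lkan_pointwise[OF D uK bk e] bg by simp
  from uarr_final[OF P r bS pX this]
  show "uarr (Val D one) (Val D S) (Res D (bang S)) (RO D (slice_incl u b K k) X)
      (RO D (pt (B \<times>\<^sub>c K) (Pair b k)) U)
      (VComp D S (Cmp (Res2 D (slice_cell u b K k)) U) (RM D (slice_incl u b K k) e))"
    using cc res_comp_app(1)[OF P t p X] res_comp_app(2)[OF P t p E(3)] pt ct
      res2_rwhisk[OF P c t E(2)] by simp
qed

lemma comp_pt:
  assumes reg: "regular_universe TYPE('k)" and w: "sfun (w :: 'k sfunc) A B" and a: "a \<in> Obj A"
  shows "w \<circ>\<^sub>f pt A a = pt B (FO w a)"
proof -
  note W = sfunD[OF w]
  note pa = sfun_pt[OF reg W(2) a] and pb = sfun_pt[OF reg W(3) fun_obj[OF W(1) a]]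
  show ?thesis by (rule func_eqI[OF sfunD(1)[OF sfun_comp[OF pa w]] sfunD(1)[OF pb]])
      (simp_all add: pt_def fun_id[OF W(1) a])
qed

text \<open>By Der2 the comparison map may be tested at each point (b, j). There both sides are
  colimits over the same slice (u/b), one with parameter j and the other with parameter v j, and the
  slice data for v j are the images of those for j. So two universal arrows out of one object are
  being compared.\<close>

lemma base_change:
  assumes D: "der D" and u: "sfun u A B" and v: "sfun v J K"
    and e: "uarr (Val D (B \<times>\<^sub>c K)) (Val D (A \<times>\<^sub>c K)) (Res D (u \<times>\<^sub>f id_func K)) X U e"
  shows "uarr (Val D (B \<times>\<^sub>c J)) (Val D (A \<times>\<^sub>c J)) (Res D (u \<times>\<^sub>f id_func J))
    (RO D (id_func A \<times>\<^sub>f v) X) (RO D (id_func B \<times>\<^sub>f v) U) (RM D (id_func A \<times>\<^sub>f v) e)"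
proof -
  note P = derD(1)[OF D] and reg = derD(2)[OF D] and U = sfunD[OF u] and V = sfunD[OF v] and E = uarrD[OF e]
  let ?uK = "u \<times>\<^sub>f id_func K" and ?uJ = "u \<times>\<^sub>f id_func J"
  let ?Av = "id_func A \<times>\<^sub>f v" and ?Bv = "id_func B \<times>\<^sub>f v"
  note iA = sfun_id[OF U(2)] and iB = sfun_id[OF U(3)] and iJ = sfun_id[OF V(2)] and iK = sfun_id[OF V(3)]
  have uK: "sfun ?uK (A \<times>\<^sub>c K) (B \<times>\<^sub>c K)" and uJ: "sfun ?uJ (A \<times>\<^sub>c J) (B \<times>\<^sub>c J)"
    and Av: "sfun ?Av (A \<times>\<^sub>c J) (A \<times>\<^sub>c K)" and Bv: "sfun ?Bv (B \<times>\<^sub>c J) (B \<times>\<^sub>c K)"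
    using sfun_prod[OF reg] u v iA iB iJ iK by blast+
  note R = res_fun[OF P]
  have sq: "?uK \<circ>\<^sub>f ?Av = ?Bv \<circ>\<^sub>f ?uJ"
    using prod_func_comp[OF sfunD(1)[OF iA] V(1) U(1) sfunD(1)[OF iK]]
      prod_func_comp[OF U(1) sfunD(1)[OF iJ] sfunD(1)[OF iB] V(1)]
    by (simp add: comp_id_func[OF U(1)] comp_id_func[OF V(1)])
  have X: "X \<in> VObj D (A \<times>\<^sub>c K)" using hom_obj(1)[OF E(5,3)] .
  let ?X = "RO D ?Av X" and ?U = "RO D ?Bv U" and ?f = "RM D ?Av e"
  have X': "?X \<in> VObj D (A \<times>\<^sub>c J)" and U': "?U \<in> VObj D (B \<times>\<^sub>c J)"
    by (rule fun_obj[OF R[OF Av] X], rule fun_obj[OF R[OF Bv] E(2)])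
  have f: "VHom D (A \<times>\<^sub>c J) ?f ?X (RO D ?uJ ?U)"
    using fun_hom[OF R[OF Av] E(3)] res_comp_app(1)[OF P Av uK E(2)] res_comp_app(1)[OF P uJ Bv E(2)] sq by simp
  note l = lkan_uarr[OF D uJ X']
  note L = uarrD[OF l]
  let ?U' = "FO (lkan D ?uJ) ?X" and ?e' = "Cmp (lkan_unit D ?uJ) ?X"
  \<comment> \<open>m goes from the chosen extension over J to the restriction of the given one;
    once m is invertible, universality passes along it.\<close>
  obtain m where m: "VHom D (B \<times>\<^sub>c J) m ?U' ?U" "VComp D (A \<times>\<^sub>c J) (RM D ?uJ m) ?e' = ?f"
    using uarrE[OF l U' f] by blast
  have "VIso D (B \<times>\<^sub>c J) m"
  proof (rule iso_pointwise[OF D sfunD(3)[OF uJ] m(1)])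
    fix x assume "x \<in> Obj (B \<times>\<^sub>c J)"
    then obtain b j where x: "x = Pair b j" and b: "b \<in> Obj B" and j: "j \<in> Obj J" by (rule prod_cat_objE)
    let ?k = "FO v j"
    have k: "?k \<in> Obj K" by (rule fun_obj[OF V(1) j])
    let ?S = "over_cat u b"
    let ?ij = "slice_incl u b J j" and ?ik = "slice_incl u b K ?k"
    let ?cj = "slice_cell u b J j" and ?ck = "slice_cell u b K ?k"
    let ?pj = "pt (B \<times>\<^sub>c J) (Pair b j)" and ?pk = "pt (B \<times>\<^sub>c K) (Pair b ?k)"
    note pj = lkan_pointwise_param[OF D u V(2) b j l] and pk = lkan_pointwise_param[OF D u V(3) b k e]
    have S: "small_cat ?S" by (rule small_over[OF reg u])
    note bS = sfun_bang[OF reg S]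
    have bj: "Pair b j \<in> Obj (B \<times>\<^sub>c J)" using b j by simp
    have bk: "Pair b ?k \<in> Obj (B \<times>\<^sub>c K)" using b k by simp
    note ptj = sfun_pt[OF reg sfunD(3)[OF uJ] bj] and ptk = sfun_pt[OF reg sfunD(3)[OF uK] bk]
    have pteq: "?Bv \<circ>\<^sub>f ?pj = ?pk" using comp_pt[OF reg Bv bj] U V b j by simp
    \<comment> \<open>Inclusion and cell for the parameter v j come from those for j by composition
      with v.\<close>
    have ieq: "?Av \<circ>\<^sub>f ?ij = ?ik"
    proof (rule func_eqI[OF sfunD(1)[OF sfun_comp[OF pj(2) Av]] sfunD(1)[OF pk(2)]])
      show "FO (?Av \<circ>\<^sub>f ?ij) x = FO ?ik x" if "x \<in> Obj ?S" for x
        using that by (auto elim!: over_cat_objE simp: slice_incl_def U V j)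
      show "FM (?Av \<circ>\<^sub>f ?ij) r = FM ?ik r" if r: "r \<in> Arr ?S" for r
      proof -
        have "psnd r \<in> Arr A" using r by (rule over_cat_arrE) (auto simp: U in_hom_def)
        then show ?thesis
          using r in_homD(1)[OF id_hom[OF V(4) j]] by (simp add: slice_incl_def U V j fun_id[OF V(1) j])
      qed
    qed
    have Bc: "snt (?Bv \<lhd> ?cj) (?uK \<circ>\<^sub>f ?ik) (?pk \<circ>\<^sub>f bang ?S) ?S (B \<times>\<^sub>c K)"
    proof -
      have "?Bv \<circ>\<^sub>f (?uJ \<circ>\<^sub>f ?ij) = ?uK \<circ>\<^sub>f ?ik"
        using comp_func_assoc[OF sfunD(1)[OF pj(2)] sfunD(1)[OF uJ] sfunD(1)[OF Bv]]
          comp_func_assoc[OF sfunD(1)[OF pj(2)] sfunD(1)[OF Av] sfunD(1)[OF uK]] sq ieq by simp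
      moreover have "?Bv \<circ>\<^sub>f (?pj \<circ>\<^sub>f bang ?S) = ?pk \<circ>\<^sub>f bang ?S"
        using comp_func_assoc[OF sfunD(1)[OF bS] sfunD(1)[OF ptj] sfunD(1)[OF Bv]] pteq by simp
      ultimately show ?thesis using snt_lwhisk[OF pj(3) Bv] by simp
    qed
    have ceq: "?Bv \<lhd> ?cj = ?ck"
    proof (rule nt_on_eqI[OF sntD(1)[OF Bc] sntD(1)[OF pk(3)]])
      fix x assume x: "x \<in> Obj ?S"
      have 1: "psnd x \<in> Arr B" using x by (auto elim!: over_cat_objE simp: U in_hom_def)
      have s: "Src ?ij = ?S" "Src ?ik = ?S" by (simp_all add: slice_incl_def)
      show "Cmp (?Bv \<lhd> ?cj) x = Cmp ?ck x" unfolding nt_on_lwhisk(2)[OF sntD(1)[OF pj(3)] sfunD(1)[OF Bv] x]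
        using x 1 in_homD(1)[OF id_hom[OF V(4) j]] by (simp add: slice_cell_def s U V fun_id[OF V(1) j])
    qed
    let ?C = "Val D ?S"
    have C: "is_cat ?C" by (rule val_cat[OF P S])
    have iX: "RO D ?ij ?X = RO D ?ik X" using res_comp_app(1)[OF P pj(2) Av X] ieq by simp
    have pU: "RO D ?pj ?U = RO D ?pk U" using res_comp_app(1)[OF P ptj Bv E(2)] pteq by simp
    have pm: "VHom D one (RM D ?pj m) (RO D ?pj ?U') (RO D ?pk U)" using fun_hom[OF R[OF ptj] m(1)] pU by simp
    have chom: "in_hom ?C (Cmp (Res2 D ?cj) Z) (RO D ?ij (RO D ?uJ Z))
        (RO D (bang ?S) (RO D ?pj Z))" if Z: "Z \<in> VObj D (B \<times>\<^sub>c J)" for Z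
      using res2_hom[OF P pj(3) Z] res_comp_app(1)[OF P pj(2) uJ Z] res_comp_app(1)[OF P bS ptj Z] by simp
    have cnat: "Comp ?C (RM D (bang ?S) (RM D ?pj m)) (Cmp (Res2 D ?cj) ?U') =
        Comp ?C (Cmp (Res2 D ?cj) ?U) (RM D ?ij (RM D ?uJ m))"
      using res2_nat[OF P pj(3) m(1)] res_comp_app(2)[OF P pj(2) uJ m(1)]
        res_comp_app(2)[OF P bS ptj m(1)] by simp
    note ie = fun_hom[OF R[OF pj(2)] L(3)]
    note bpm = fun_hom[OF R[OF bS] fun_hom[OF R[OF ptj] m(1)]]
    note ium = fun_hom[OF R[OF pj(2)] fun_hom[OF R[OF uJ] m(1)]]
    have "Comp ?C (RM D (bang ?S) (RM D ?pj m)) (Comp ?C (Cmp (Res2 D ?cj) ?U') (RM D ?ij ?e')) =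
      Comp ?C (Comp ?C (Cmp (Res2 D ?cj) ?U) (RM D ?ij (RM D ?uJ m))) (RM D ?ij ?e')"
      using comp_assoc[OF C ie chom[OF L(2)] bpm] cnat by simp
    also have "\<dots> = Comp ?C (Cmp (Res2 D ?cj) ?U) (RM D ?ij ?f)"
      using comp_assoc[OF C ie ium chom[OF U']] fun_comp[OF R[OF pj(2)] L(3) fun_hom[OF R[OF uJ] m(1)]]
        m(2) by simp
    also have "\<dots> = Comp ?C (Cmp (Res2 D ?ck) U) (RM D ?ik e)"
      using res2_lwhisk[OF P pj(3) Bv E(2)] ceq res_comp_app(2)[OF P pj(2) Av E(3)] ieq by simp
    finally have eq: "Comp ?C (RM D (bang ?S) (RM D ?pj m)) (Comp ?C (Cmp (Res2 D ?cj) ?U') (RM D ?ij ?e')) =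
      Comp ?C (Cmp (Res2 D ?ck) U) (RM D ?ik e)" .
    show "VIso D one (RM D (pt (B \<times>\<^sub>c J) x) m)"
      unfolding x by (rule uarr_unique_iso[OF pj(1)[unfolded iX] pk(1) pm eq])
  qed
  from uarr_iso_right[OF l m(1) this] m(2) show ?thesis by simp
qed

subsection \<open>Zero objects\<close>

text \<open>Every f : X -> Y is forced: naturality of \<alpha> expresses f \<circ> \<alpha>_X
  through the only arrow q of the target, and \<alpha>_X is invertible.\<close>

lemma equivalence_to_point:
  assumes F: "is_equivalence F" and p: "Obj (Tgt F) = {p}" "Arr (Tgt F) = {q}"
    and X: "X \<in> Obj (Src F)" and Y: "Y \<in> Obj (Src F)"
  shows "\<exists>!f. in_hom (Src F) f X Y"
proof -
  let ?C = "Src F" and ?P = "Tgt F"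
  obtain G \<alpha> where G: "is_func G" "Src G = ?P" "Tgt G = ?C"
    and a: "is_niso \<alpha>" "NSrc \<alpha> = G \<circ>\<^sub>f F" "NTgt \<alpha> = id_func ?C"
    using F unfolding is_equivalence_def by blast
  have F': "fun_on F ?C ?P" using F by (simp add: is_equivalence_def fun_on_def)
  have G': "fun_on G ?P ?C" using G by (simp add: fun_on_def)
  note C = fun_onD(4)[OF F'] and P = fun_onD(5)[OF F']
  have an: "nt_on \<alpha> (G \<circ>\<^sub>f F) (id_func ?C) ?C ?C"
    using a fun_on_comp[OF F' G'] fun_on_id[OF C] by (simp add: is_niso_def nt_on_def)
  have ah: "in_hom ?C (Cmp \<alpha> Z) (FO G (FO F Z)) Z" and ai: "is_iso ?C (Cmp \<alpha> Z)"
    if "Z \<in> Obj ?C" for Z using nt_hom[OF an that] a that G by (simp_all add: is_niso_def)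
  have FX: "FO F X = p" "FO F Y = p" using fun_obj[OF F'] X Y p by auto
  obtain b where b: "in_hom ?C b X (FO G p)" using iso_hom[OF ai[OF X] ah[OF X]] FX by auto
  show ?thesis
  proof (rule ex1I)
    show "in_hom ?C (Comp ?C (Cmp \<alpha> Y) b) X Y" using comp_hom[OF C b] ah[OF Y] FX by simp
    have *: "Comp ?C f (Cmp \<alpha> X) = Comp ?C (Cmp \<alpha> Y) (FM G q)" if f: "in_hom ?C f X Y" for f
    proof -
      have "FM F f = q" using in_homD(1)[OF fun_hom[OF F' f]] p by simp
      then show ?thesis using nt_nat[OF an f] f by (simp add: in_hom_def)
    qed
    fix f assume f: "in_hom ?C f X Y"
    show "f = Comp ?C (Cmp \<alpha> Y) b"
      by (rule iso_cancel_right[OF C f \<open>in_hom ?C (Comp ?C (Cmp \<alpha> Y) b) X Y\<close> ah[OF X] ai[OF X]])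
        (simp add: *[OF f] *[OF \<open>in_hom ?C (Comp ?C (Cmp \<alpha> Y) b) X Y\<close>])
  qed
qed

lemma empty_cat:
  assumes "Obj A = {}" "is_cat A"
  shows "Arr A = {}" using assms arr_hom hom_obj(1)[OF assms(2)] by fastforce

text \<open>The empty product of categories is a point, so Der1 for the empty index set makes the
  value at the empty coproduct trivial. A given empty category may differ from that coproduct as a
  record, because the operations are unconstrained off objects and arrows; the result is carried
  over along the functors u and v.\<close>

lemma val_empty:
  assumes D: "der D" and A: "small_cat A" "Obj A = {}"
    and X: "X \<in> VObj D A" and Y: "Y \<in> VObj D A"
  shows "\<exists>!f. VHom D A f X Y"
proof -
  note P = derD(1)[OF D] and reg = derD(2)[OF D]
  let ?E = "coprod_cat {} (\<lambda>_. one) :: 'a scat"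
  let ?F = "mk_func (Val D ?E) (prod_family {} (\<lambda>i. Val D one))
      (\<lambda>X. \<lambda>i\<in>{}. RO D (coprod_in {} (\<lambda>_. one) i) X)
      (\<lambda>f. \<lambda>i\<in>{}. RM D (coprod_in {} (\<lambda>_. one) i) f)"
  have se: "small ({} :: 'a el set)" by (rule small_finite[OF reg]) simp
  have eq: "is_equivalence ?F"
    using derD(3)[OF D, unfolded Der1_def, rule_format, of "{}" "\<lambda>_. one"] se by simp
  have E0: "Obj ?E = {}" "Arr ?E = {}" by (simp_all add: coprod_cat_def)
  have E: "small_cat ?E" using E0 se by (simp add: small_cat_def is_cat_def)
  have A0: "Arr A = {}" by (rule empty_cat[OF A(2) small_cat_is_cat[OF A(1)]])
  note EC = small_cat_is_cat[OF E] and AC = small_cat_is_cat[OF A(1)]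
  have hom0: "\<not> in_hom A f x y" "\<not> in_hom ?E f x y" for f x y using A0 E0 by (auto simp: in_hom_def)
  let ?u = "mk_func A ?E id id" and ?v = "mk_func ?E A id id"
  have u: "sfun ?u A ?E" and v: "sfun ?v ?E A"
    unfolding sfun_def using E A by (auto intro!: fun_onI simp: EC AC E0 hom0)
  have vu: "?v \<circ>\<^sub>f ?u = id_func A"
    by (rule func_eqI[OF sfunD(1)[OF sfun_comp[OF u v]] fun_on_id[OF AC]]) (simp_all add: A A0)
  note Ru = res_fun[OF P u] and Rv = res_fun[OF P v]
  have X': "RO D ?v X \<in> VObj D ?E" and Y': "RO D ?v Y \<in> VObj D ?E" using fun_obj[OF Rv] X Y by auto
  \<comment> \<open>The only extensional function on the empty set is constantly
    \<open>undefined\<close>.\<close>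
  have PE: "Obj (prod_family {} (\<lambda>i. Val D one)) = {\<lambda>_. undefined}"
    "Arr (prod_family {} (\<lambda>i. Val D one)) = {\<lambda>_. undefined}" by (simp_all add: prod_family_def)
  have "\<exists>!f. VHom D ?E f (RO D ?v X) (RO D ?v Y)" using equivalence_to_point[OF eq] PE X' Y' by simp
  then obtain f where f: "VHom D ?E f (RO D ?v X) (RO D ?v Y)"
    and fu: "\<And>g. VHom D ?E g (RO D ?v X) (RO D ?v Y) \<Longrightarrow> g = f" by blast
  have uvX: "RO D ?u (RO D ?v Z) = Z" if "Z \<in> VObj D A" for Z
    using res_comp_app(1)[OF P u v that] vu res_id_app(1)[OF P A(1) that] by simp
  show ?thesis
  proof (rule ex1I)
    show "VHom D A (RM D ?u f) X Y" using fun_hom[OF Ru f] uvX X Y by simp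
    fix g assume g: "VHom D A g X Y"
    have "RM D ?u (RM D ?v g) = g" using res_comp_app(2)[OF P u v g] vu res_id_app(2)[OF P A(1) g] by simp
    then show "g = RM D ?u f" using fu[OF fun_hom[OF Rv g]] by simp
  qed
qed

section \<open>Zero objects, and Kan extensions at points with empty or terminal slice\<close>

lemma zero_ex1:
  assumes "zero_obj C z" "y \<in> Obj C"
  shows "\<exists>!f. in_hom C f z y" "\<exists>!f. in_hom C f y z"
  using assms unfolding zero_obj_def initial_obj_def terminal_obj_def by blast+

lemma zero_iso:
  assumes C: "is_cat C" and x: "zero_obj C x" and y: "zero_obj C y" and f: "in_hom C f x y"
  shows "is_iso C f"
proof -
  have o: "x \<in> Obj C" "y \<in> Obj C" using x y by (auto simp: zero_obj_def initial_obj_def)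
  obtain g where g: "in_hom C g y x" using y o by (auto simp: zero_obj_def initial_obj_def)
  have "Comp C g f = Id C x" "Comp C f g = Id C y" using x y o comp_hom[OF C f g] comp_hom[OF C g f] id_hom[OF C]
    unfolding zero_obj_def initial_obj_def by blast+
  then show ?thesis by (rule isoI[OF f g])
qed

lemma zero_transfer:
  assumes C: "is_cat C" and z: "zero_obj C z" and f: "in_hom C f z x" "is_iso C f"
  shows "zero_obj C x"
proof -
  obtain g where g: "in_hom C g x z" "Comp C g f = Id C z" "Comp C f g = Id C x" using iso_hom[OF f(2,1)] by blast
  have o: "x \<in> Obj C" "z \<in> Obj C" using hom_obj[OF C f(1)] by auto
  have "\<exists>!h. in_hom C h x y" if y: "y \<in> Obj C" for y
  proof -
    obtain h where h: "in_hom C h z y" and hu: "\<And>h'. in_hom C h' z y \<Longrightarrow> h' = h"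
      using zero_ex1(1)[OF z y] by blast
    show ?thesis
    proof (rule ex1I)
      show "in_hom C (Comp C h g) x y" by (rule comp_hom[OF C g(1) h])
      fix k assume k: "in_hom C k x y"
      have "k = Comp C (Comp C k f) g" using comp_assoc[OF C g(1) f(1) k] g(3) comp_id_right[OF C k] by simp
      then show "k = Comp C h g" using hu[OF comp_hom[OF C f(1) k]] by simp
    qed
  qed
  moreover have "\<exists>!h. in_hom C h y x" if y: "y \<in> Obj C" for y
  proof -
    obtain h where h: "in_hom C h y z" and hu: "\<And>h'. in_hom C h' y z \<Longrightarrow> h' = h"
      using zero_ex1(2)[OF z y] by blast
    show ?thesis
    proof (rule ex1I)
      show "in_hom C (Comp C f h) y x" by (rule comp_hom[OF C h f(1)])
      fix k assume k: "in_hom C k y x"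
      have "k = Comp C f (Comp C g k)" using comp_cancel[OF C k g(1) f(1) g(3)] by simp
      then show "k = Comp C f h" using hu[OF comp_hom[OF C k g(1)]] by simp
    qed
  qed
  ultimately show ?thesis using o by (simp add: zero_obj_def initial_obj_def terminal_obj_def)
qed

text \<open>The maps z -> x and x -> z are mutually inverse by uniqueness. Through this, pointedness
  turns an empty colimit into a zero object.\<close>

lemma initial_zero:
  assumes C: "is_cat C" and z: "zero_obj C z" and x: "initial_obj C x"
  shows "zero_obj C x"
proof -
  have o: "x \<in> Obj C" "z \<in> Obj C" using x z by (auto simp: zero_obj_def initial_obj_def)
  obtain f where f: "in_hom C f z x" using z o by (auto simp: zero_obj_def initial_obj_def)
  obtain g where g: "in_hom C g x z" using x o by (auto simp: initial_obj_def)
  have "Comp C g f = Id C z" "Comp C f g = Id C x" using x z o comp_hom[OF C f g] comp_hom[OF C g f] id_hom[OF C]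
    unfolding zero_obj_def initial_obj_def by blast+
  then show ?thesis using zero_transfer[OF C z f] isoI[OF f g] by simp
qed

lemma terminal_zero:
  assumes C: "is_cat C" and z: "zero_obj C z" and x: "terminal_obj C x"
  shows "zero_obj C x"
proof -
  have o: "x \<in> Obj C" "z \<in> Obj C" using x z by (auto simp: zero_obj_def initial_obj_def terminal_obj_def)
  obtain f where f: "in_hom C f z x" using z o by (auto simp: zero_obj_def initial_obj_def)
  obtain g where g: "in_hom C g x z" using z o by (auto simp: zero_obj_def terminal_obj_def)
  have "Comp C g f = Id C z" "Comp C f g = Id C x" using x z o comp_hom[OF C f g] comp_hom[OF C g f] id_hom[OF C]
    unfolding zero_obj_def terminal_obj_def by blast+
  then show ?thesis using zero_transfer[OF C z f] isoI[OF f g] by simp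
qed

text \<open>The pointwise formula presents the value at b as a colimit of the empty diagram: maps
  out of it correspond to maps in the value of D at the empty slice, where exactly one map
  exists.\<close>

lemma lkan_empty_slice:
  assumes D: "der D" and u: "sfun u A B" and b: "b \<in> Obj B" and empty: "Obj (over_cat u b) = {}"
    and e: "uarr (Val D B) (Val D A) (Res D u) X U e"
  shows "initial_obj (Val D one) (RO D (pt B b) U)"
proof -
  note P = derD(1)[OF D] and reg = derD(2)[OF D]
  let ?S = "over_cat u b"
  have S: "small_cat ?S" by (rule small_over[OF reg u])
  note R = res_fun[OF P sfun_bang[OF reg S]]
  note pw = lkan_pointwise[OF D u b e]
  note W = uarrD[OF pw]
  let ?Y = "RO D (over_proj u b) X" and ?W = "RO D (pt B b) U"
  have Y: "?Y \<in> VObj D ?S" using hom_obj(1)[OF W(5,3)] .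
  have "\<exists>!f. VHom D one f ?W Z" if Z: "Z \<in> VObj D one" for Z
  proof -
    note un = val_empty[OF D S empty Y fun_obj[OF R Z]]
    obtain h where h: "VHom D ?S h ?Y (RO D (bang ?S) Z)" using un by blast
    obtain g where g: "VHom D one g ?W Z" using uarrE[OF pw Z h] by blast
    show ?thesis
    proof (rule ex1I)
      show "VHom D one g ?W Z" by (rule g)
      fix g' assume g': "VHom D one g' ?W Z"
      show "g' = g" by (rule uarr_eq[OF pw g' g])
          (use un comp_hom[OF W(5,3) fun_hom[OF R g]] comp_hom[OF W(5,3) fun_hom[OF R g']] in blast)
    qed
  qed
  then show ?thesis using W(2) by (simp add: initial_obj_def)
qed

text \<open>Dual to \<open>lkan_empty_slice\<close>, read off from Der4 directly: as (b/u) has no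
  objects, functoriality of its projection and naturality of its cell hold vacuously.\<close>

lemma rkan_empty_slice:
  assumes D: "der D" and u: "sfun u A B" and b: "b \<in> Obj B" and empty: "Obj (under_cat u b) = {}"
    and X: "X \<in> VObj D A"
  shows "terminal_obj (Val D one) (RO D (pt B b) (FO (rkan D u) X))"
proof -
  note P = derD(1)[OF D] and reg = derD(2)[OF D] and U = sfunD[OF u]
  let ?S = "under_cat u b" and ?p = "under_proj u b" and ?c = "under_cell u b"
  have arr: "Arr ?S = {}" using empty by (auto simp: under_cat_def Let_def)
  have hom0: "\<not> in_hom ?S f x y" for f x y using arr by (auto simp: in_hom_def)
  have S: "small_cat ?S" using empty arr small_finite[OF reg] by (simp add: small_cat_def is_cat_def)
  have p: "sfun ?p ?S A" unfolding sfun_def under_proj_def using S U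
    by (auto intro!: fun_onI simp: small_cat_is_cat empty hom0)
  note q = sfun_bang[OF reg S] and bb = sfun_pt[OF reg U(3) b]
  note R = res_fun[OF P]
  have c: "snt ?c (pt B b \<circ>\<^sub>f bang ?S) (u \<circ>\<^sub>f ?p) ?S B"
  proof -
    have "nt_on ?c (pt B b \<circ>\<^sub>f bang ?S) (u \<circ>\<^sub>f ?p) ?S B"
    proof (rule nt_onI)
      show "Cmp ?c \<in> extensional (Obj ?S)"
        using mk_ntrans_sel(4)[of "pt B b \<circ>\<^sub>f bang ?S"] sfunD[OF q] by (simp add: under_cell_def U)
    qed (use sfun_comp[OF q bb] sfun_comp[OF p u] in
        \<open>auto simp: sfun_def under_cell_def U empty hom0\<close>)
    then show ?thesis using S U by (simp add: snt_def)
  qed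
  have cn: "nt_on (Res2 D ?c) (Res D (bang ?S) \<circ>\<^sub>f Res D (pt B b)) (Res D ?p \<circ>\<^sub>f Res D u) (Val D B) (Val D ?S)"
    using res2_nt[OF P c] res_comp[OF P p u] res_comp[OF P q bb] by simp
  let ?M = "right_mate (rkan D u) (rkan_counit D u) (rkan D (bang ?S)) (rkan_unit D (bang ?S))
      (Res D ?p) (Res D (pt B b)) (Res2 D ?c)"
  note M = right_mate[OF rkan_adj[OF D u] R[OF u] rkan_adj[OF D q] R[OF q] R[OF p] R[OF bb] cn]
  have niso: "is_niso ?M" using derD(6)[OF D] U b unfolding Der4_def by blast
  have "Src (NSrc ?M) = Val D A" "Tgt (NSrc ?M) = Val D one"
    using M(1) fun_onD[OF rkan_fun[OF D u]] fun_onD[OF R[OF bb]] by simp_all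
  then have iso: "VIso D one (Cmp ?M X)" using niso X unfolding is_niso_def by auto
  note C = val_cat[OF P small_one[OF reg]]
  let ?V = "RO D (pt B b) (FO (rkan D u) X)"
  have V: "?V \<in> VObj D one" by (rule fun_obj[OF R[OF bb] fun_obj[OF rkan_fun[OF D u] X]])
  have pX: "RO D ?p X \<in> VObj D ?S" by (rule fun_obj[OF R[OF p] X])
  let ?W = "FO (rkan D (bang ?S)) (RO D ?p X)"
  note d = rkan_darr[OF D q pX]
  note dd = darrD[OF d]
  \<comment> \<open>Maps into the value at b are produced through n, and their uniqueness is
    transported back through the invertible mate.\<close>
  obtain n where n: "VHom D one n ?W ?V" using iso_hom[OF iso M(4)[OF X]] by blast
  have "\<exists>!f. VHom D one f Z ?V" if Z: "Z \<in> VObj D one" for Z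
  proof -
    note un = val_empty[OF D S empty fun_obj[OF R[OF q] Z] pX]
    obtain h where h: "VHom D ?S h (RO D (bang ?S) Z) (RO D ?p X)" using un by blast
    obtain g where g: "VHom D one g Z ?W" using darrE[OF d Z h] by blast
    show ?thesis
    proof (rule ex1I)
      show "VHom D one (VComp D one n g) Z ?V" by (rule comp_hom[OF C g n])
      fix f assume f: "VHom D one f Z ?V"
      note f' = comp_hom[OF C f M(4)[OF X]] and g' = comp_hom[OF C comp_hom[OF C g n] M(4)[OF X]]
      have "VComp D one (Cmp ?M X) f = VComp D one (Cmp ?M X) (VComp D one n g)" by (rule darr_eq[OF d f' g'])
          (use un comp_hom[OF dd(5) fun_hom[OF R[OF q] f'] dd(3)]
            comp_hom[OF dd(5) fun_hom[OF R[OF q] g'] dd(3)] in blast)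
      then show "f = VComp D one n g" by (rule iso_cancel_left[OF C f comp_hom[OF C g n] M(4)[OF X] iso])
    qed
  qed
  then show ?thesis using V by (simp add: terminal_obj_def)
qed

text \<open>A terminal object (a, f) makes the functor from the point to (u/b) final, with the
  functor to the point as reflection, so the colimit over the slice is the value of the diagram at
  a. In the application u is the inclusion of the corner, b a vertex in it and f an
  identity.\<close>

lemma lkan_terminal_slice:
  assumes D: "der D" and u: "sfun u A B" and K: "small_cat K" and b: "b \<in> Obj B" and k: "k \<in> Obj K"
    and e: "uarr (Val D (B \<times>\<^sub>c K)) (Val D (A \<times>\<^sub>c K)) (Res D (u \<times>\<^sub>f id_func K)) X U e"
    and t0: "Pair a f \<in> Obj (over_cat u b)"
    and fin: "\<And>x. x \<in> Obj (over_cat u b) \<Longrightarrow> \<exists>!h. in_hom (over_cat u b) h x (Pair a f)"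
  shows "\<exists>m. VHom D one m (RO D (pt (A \<times>\<^sub>c K) (Pair a k)) X)
      (RO D (pt (B \<times>\<^sub>c K) (Pair b k)) U) \<and> VIso D one m"
proof -
  note P = derD(1)[OF D] and reg = derD(2)[OF D]
  let ?S = "over_cat u b" and ?t = "pt (over_cat u b) (Pair a f)"
  have S: "small_cat ?S" by (rule small_over[OF reg u])
  note SC = small_cat_is_cat[OF S]
  note g = sfun_bang[OF reg S] and t = sfun_pt[OF reg S t0] and o1 = small_one[OF reg]
  note pw = lkan_pointwise_param[OF D u K b k e]
  \<comment> \<open>The unit of the reflection consists of the unique arrows to the terminal
    object.\<close>
  define \<alpha> where "\<alpha> = mk_ntrans (id_func ?S) (?t \<circ>\<^sub>f bang ?S) (\<lambda>x. THE h. in_hom ?S h x (Pair a f))"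
  have al: "in_hom ?S (Cmp \<alpha> x) x (Pair a f)" if x: "x \<in> Obj ?S" for x
    using theI'[OF fin[OF x]] x by (simp add: \<alpha>_def)
  have tb: "FO (?t \<circ>\<^sub>f bang ?S) x = Pair a f" if "x \<in> Obj ?S" for x
    using that by (simp add: pt_def bang_def)
  have an: "nt_on \<alpha> (id_func ?S) (?t \<circ>\<^sub>f bang ?S) ?S ?S"
  proof (rule nt_onI)
    show tbf: "fun_on (id_func ?S) ?S ?S" "fun_on (?t \<circ>\<^sub>f bang ?S) ?S ?S"
      using sfunD(1)[OF sfun_comp[OF g t]] fun_on_id[OF SC] by auto
    show "Cmp \<alpha> \<in> extensional (Obj ?S)" unfolding \<alpha>_def using mk_ntrans_sel(4)[of "id_func ?S"] by simp
    show "in_hom ?S (Cmp \<alpha> x) (FO (id_func ?S) x) (FO (?t \<circ>\<^sub>f bang ?S) x)" if "x \<in> Obj ?S" for x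
      using al[OF that] tb[OF that] that by simp
    show "Comp ?S (Cmp \<alpha> y) (FM (id_func ?S) r) = Comp ?S (FM (?t \<circ>\<^sub>f bang ?S) r) (Cmp \<alpha> x)"
      if r: "in_hom ?S r x y" for r x y
    proof -
      note o = hom_obj[OF SC r]
      have r': "in_hom ?S (FM (id_func ?S) r) x y" using r by (simp add: in_hom_def)
      have "in_hom ?S (FM (?t \<circ>\<^sub>f bang ?S) r) (Pair a f) (Pair a f)"
        using fun_hom[OF tbf(2) r] tb o by simp
      from comp_hom[OF SC al[OF o(1)] this] comp_hom[OF SC r' al[OF o(2)]] fin[OF o(1)]
      show ?thesis by blast
    qed
  qed (simp_all add: \<alpha>_def)
  have r: "refl_adj (bang ?S) ?t \<alpha> ?S one" unfolding refl_adj_def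
  proof (intro conjI ballI)
    show "bang ?S \<circ>\<^sub>f ?t = id_func one"
      by (rule func_eqI[OF sfunD(1)[OF sfun_comp[OF t g]] sfunD(1)[OF sfun_id[OF o1]]])
        (use t0 in_homD(1)[OF id_hom[OF SC t0]] in \<open>auto simp: pt_def bang_def simp del: over_cat_sel\<close>)
    show "FM (bang ?S) (Cmp \<alpha> x) = Id one (FO (bang ?S) x)" if "x \<in> Obj ?S" for x
      using al[OF that] that by (simp add: bang_def in_hom_def del: over_cat_sel)
    show "Cmp \<alpha> (FO ?t y) = Id ?S (FO ?t y)" if "y \<in> Obj one" for y
    proof -
      have "FO ?t y = Pair a f" using that by (simp add: pt_def)
      moreover have "Cmp \<alpha> (Pair a f) = Id ?S (Pair a f)"
        using fin[OF t0] al[OF t0] id_hom[OF SC t0] by blast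
      ultimately show ?thesis by simp
    qed
  qed (use g t an S in \<open>auto simp: snt_def\<close>)
  let ?i = "slice_incl u b K k"
  have X: "X \<in> VObj D (A \<times>\<^sub>c K)" using hom_obj(1)[OF uarrD(5,3)[OF e]] .
  note iX = fun_obj[OF res_fun[OF P pw(2)] X]
  \<comment> \<open>The functor to the point is written as the identity of the point after the
    reflection, the shape required by \<open>uarr_final\<close>; the resulting arrow is universal
    for an identity functor, hence invertible.\<close>
  have "id_func one \<circ>\<^sub>f bang ?S = bang ?S" by (simp add: comp_id_func[OF sfunD(1)[OF g]])
  then have pw1: "uarr (Val D one) (Val D ?S) (Res D (id_func one \<circ>\<^sub>f bang ?S)) (RO D ?i X)
      (RO D (pt (B \<times>\<^sub>c K) (Pair b k)) U)
      (VComp D ?S (Cmp (Res2 D (slice_cell u b K k)) U) (RM D ?i e))" using pw(1) by simp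
  note uf = uarr_final[OF P r sfun_id[OF o1] iX pw1]
  have "?i \<circ>\<^sub>f ?t = pt (A \<times>\<^sub>c K) (Pair a k)"
    using comp_pt[OF reg pw(2) t0] t0 by (simp add: slice_incl_def sfunD[OF u])
  then have "RO D ?t (RO D ?i X) = RO D (pt (A \<times>\<^sub>c K) (Pair a k)) X"
    using res_comp_app(1)[OF P t pw(2) X] by simp
  with uf have uf: "uarr (Val D one) (Val D one) (id_func (Val D one)) (RO D (pt (A \<times>\<^sub>c K) (Pair a k)) X)
      (RO D (pt (B \<times>\<^sub>c K) (Pair b k)) U)
      (RM D ?t (VComp D ?S (Cmp (Res2 D (slice_cell u b K k)) U) (RM D ?i e)))" by (simp add: res_id[OF P o1])
  show ?thesis using uarr_id_iso[OF uf] uarrD(2,3)[OF uf] by auto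
qed

subsection \<open>Morphisms of prederivators in components\<close>

text \<open>\<open>is_dmor\<close> equates whole natural transformations. Here each law is an
  equation at an object, where universal arrows can be applied; \<open>dm_is_dmor\<close> translates
  back.\<close>

definition dm ::
  "('k, 'o, 'm) prederiv \<Rightarrow> ('k, 'p, 'n) prederiv \<Rightarrow> ('k, 'o, 'm, 'p, 'n) dmor \<Rightarrow> bool" where
  "dm D E F \<longleftrightarrow>
     (\<forall>A. small_cat A \<longrightarrow> fun_on (Cpt F A) (Val D A) (Val E A)) \<and>
     (\<forall>u A B. sfun u A B \<longrightarrow>
      NSrc (Str F u) = Res E u \<circ>\<^sub>f Cpt F B \<and> NTgt (Str F u) = Cpt F A \<circ>\<^sub>f Res D u \<and>
      ST F u \<in> extensional (VObj D B)) \<and>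
     (\<forall>u A B X. sfun u A B \<longrightarrow> X \<in> VObj D B \<longrightarrow>
      VHom E A (ST F u X) (RO E u (CO F B X)) (CO F A (RO D u X)) \<and> VIso E A (ST F u X)) \<and>
     (\<forall>u A B f X Y. sfun u A B \<longrightarrow> VHom D B f X Y \<longrightarrow>
      VComp E A (ST F u Y) (RM E u (CM F B f)) = VComp E A (CM F A (RM D u f)) (ST F u X)) \<and>
     (\<forall>A X. small_cat A \<longrightarrow> X \<in> VObj D A \<longrightarrow>
      ST F (id_func A) X = VId E A (CO F A X)) \<and>
     (\<forall>u v A B C X. sfun u A B \<longrightarrow> sfun v B C \<longrightarrow> X \<in> VObj D C \<longrightarrow>
      ST F (v \<circ>\<^sub>f u) X = VComp E A (ST F u (RO D v X)) (RM E u (ST F v X))) \<and>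
     (\<forall>\<alpha> u v A B X. snt \<alpha> u v A B \<longrightarrow> X \<in> VObj D B \<longrightarrow>
      VComp E A (ST F v X) (Cmp (Res2 E \<alpha>) (CO F B X)) =
      VComp E A (CM F A (Cmp (Res2 D \<alpha>) X)) (ST F u X))"

lemma dm_fun:
  assumes "dm D E F" "small_cat A"
  shows "fun_on (Cpt F A) (Val D A) (Val E A)"
  by (rule assms(1)[unfolded dm_def, THEN conjunct1, rule_format, OF assms(2)])

lemma dm_str:
  assumes "dm D E F" "sfun u A B"
  shows "NSrc (Str F u) = Res E u \<circ>\<^sub>f Cpt F B" "NTgt (Str F u) = Cpt F A \<circ>\<^sub>f Res D u"
    "ST F u \<in> extensional (VObj D B)"
  using assms(1)[unfolded dm_def, THEN conjunct2, THEN conjunct1, rule_format, OF assms(2)] by simp_all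

lemma dm_hom:
  assumes "dm D E F" "sfun u A B" "X \<in> VObj D B"
  shows "VHom E A (ST F u X) (RO E u (CO F B X)) (CO F A (RO D u X))"
    "VIso E A (ST F u X)"
  using assms(1)[unfolded dm_def, THEN conjunct2, THEN conjunct2, THEN conjunct1, rule_format, OF assms(2,3)] by simp_all

lemma dm_nat:
  assumes "dm D E F" "sfun u A B" "VHom D B f X Y"
  shows "VComp E A (ST F u Y) (RM E u (CM F B f)) = VComp E A (CM F A (RM D u f)) (ST F u X)"
  by (rule assms(1)[unfolded dm_def, THEN conjunct2, THEN conjunct2, THEN conjunct2, THEN conjunct1, rule_format, OF assms(2,3)])

lemma dm_id:
  assumes "dm D E F" "small_cat A" "X \<in> VObj D A"
  shows "ST F (id_func A) X = VId E A (CO F A X)"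
  by (rule assms(1)[unfolded dm_def, THEN conjunct2, THEN conjunct2, THEN conjunct2, THEN conjunct2, THEN conjunct1, rule_format, OF assms(2,3)])

lemma dm_func_comp:
  assumes "dm D E F" "sfun u A B" "sfun v B C" "X \<in> VObj D C"
  shows "ST F (v \<circ>\<^sub>f u) X = VComp E A (ST F u (RO D v X)) (RM E u (ST F v X))"
  by (rule assms(1)[unfolded dm_def, THEN conjunct2, THEN conjunct2, THEN conjunct2, THEN conjunct2, THEN conjunct2, THEN conjunct1, rule_format, OF assms(2-4)])

lemma dm_cell:
  assumes "dm D E F" "snt \<alpha> u v A B" "X \<in> VObj D B"
  shows "VComp E A (ST F v X) (Cmp (Res2 E \<alpha>) (CO F B X)) =
      VComp E A (CM F A (Cmp (Res2 D \<alpha>) X)) (ST F u X)"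
  by (rule assms(1)[unfolded dm_def, THEN conjunct2, THEN conjunct2, THEN conjunct2, THEN conjunct2, THEN conjunct2, THEN conjunct2, rule_format, OF assms(2,3)])

lemma dmI:
  assumes "\<And>A. small_cat A \<Longrightarrow> fun_on (Cpt F A) (Val D A) (Val E A)"
    and "\<And>u A B. sfun u A B \<Longrightarrow> NSrc (Str F u) = Res E u \<circ>\<^sub>f Cpt F B"
    and "\<And>u A B. sfun u A B \<Longrightarrow> NTgt (Str F u) = Cpt F A \<circ>\<^sub>f Res D u"
    and "\<And>u A B. sfun u A B \<Longrightarrow> ST F u \<in> extensional (VObj D B)"
    and "\<And>u A B X. sfun u A B \<Longrightarrow> X \<in> VObj D B \<Longrightarrow>
        VHom E A (ST F u X) (RO E u (CO F B X)) (CO F A (RO D u X))"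
    and "\<And>u A B X. sfun u A B \<Longrightarrow> X \<in> VObj D B \<Longrightarrow> VIso E A (ST F u X)"
    and "\<And>u A B f X Y. sfun u A B \<Longrightarrow> VHom D B f X Y \<Longrightarrow>
        VComp E A (ST F u Y) (RM E u (CM F B f)) = VComp E A (CM F A (RM D u f)) (ST F u X)"
    and "\<And>A X. small_cat A \<Longrightarrow> X \<in> VObj D A \<Longrightarrow>
        ST F (id_func A) X = VId E A (CO F A X)"
    and "\<And>u v A B C X. sfun u A B \<Longrightarrow> sfun v B C \<Longrightarrow> X \<in> VObj D C \<Longrightarrow>
        ST F (v \<circ>\<^sub>f u) X = VComp E A (ST F u (RO D v X)) (RM E u (ST F v X))"
    and "\<And>\<alpha> u v A B X. snt \<alpha> u v A B \<Longrightarrow> X \<in> VObj D B \<Longrightarrow>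
        VComp E A (ST F v X) (Cmp (Res2 E \<alpha>) (CO F B X)) =
        VComp E A (CM F A (Cmp (Res2 D \<alpha>) X)) (ST F u X)"
  shows "dm D E F" unfolding dm_def
  apply (intro conjI allI impI)
  subgoal by (rule assms(1))
  subgoal by (rule assms(2))
  subgoal by (rule assms(3))
  subgoal by (rule assms(4))
  subgoal by (rule assms(5))
  subgoal by (rule assms(6))
  subgoal by (rule assms(7))
  subgoal by (rule assms(8))
  subgoal by (rule assms(9))
  subgoal by (rule assms(10))
  done

lemma dm_is_dmor:
  fixes D :: "('k, 'o, 'm) prederiv"
  assumes D: "pder D" and E: "pder E" and F: "dm D E F"
  shows "is_dmor D E F" unfolding is_dmor_def
proof (intro conjI allI impI)
  fix A :: "'k scat" assume A: "small_cat A"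
  note FA = dm_fun[OF F A]
  show "is_func (Cpt F A)" "Src (Cpt F A) = Val D A" "Tgt (Cpt F A) = Val E A" using fun_onD[OF FA] by auto
  show "Str F (id_func A) = id_nt (Cpt F A)"
  proof (rule nt_eqI[where S = "VObj D A"])
    note i = sfun_id[OF A]
    show "NSrc (Str F (id_func A)) = NSrc (id_nt (Cpt F A))"
      using dm_str[OF F i] by (simp add: res_id[OF E A] comp_id_func[OF FA])
    show "NTgt (Str F (id_func A)) = NTgt (id_nt (Cpt F A))"
      using dm_str[OF F i] by (simp add: res_id[OF D A] comp_id_func[OF FA])
    show "ST F (id_func A) \<in> extensional (VObj D A)" by (rule dm_str(3)[OF F i])
    show "Cmp (id_nt (Cpt F A)) \<in> extensional (VObj D A)"
      using id_nt_sel(4)[of "Cpt F A"] fun_onD[OF FA] by simp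
    show "ST F (id_func A) x = Cmp (id_nt (Cpt F A)) x" if "x \<in> VObj D A" for x
      using dm_id[OF F A that] that fun_onD[OF FA] by simp
  qed
next
  fix u :: "'k sfunc" assume "small_func u"
  then have u: "sfun u (Src u) (Tgt u)" by (simp add: small_func_iff)
  note U = sfunD[OF u]
  show s: "NSrc (Str F u) = Res E u \<circ>\<^sub>f Cpt F (Tgt u)" "NTgt (Str F u) = Cpt F (Src u) \<circ>\<^sub>f Res D u"
    by (rule dm_str[OF F u])+
  note FA = dm_fun[OF F U(2)] and FB = dm_fun[OF F U(3)]
  note RD = res_fun[OF D u] and RE = res_fun[OF E u]
  have "nt_on (Str F u) (Res E u \<circ>\<^sub>f Cpt F (Tgt u)) (Cpt F (Src u) \<circ>\<^sub>f Res D u) (Val D (Tgt u)) (Val E (Src u))"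
  proof (rule nt_onI[OF fun_on_comp[OF FB RE] fun_on_comp[OF RD FA] s dm_str(3)[OF F u]])
    show "VHom E (Src u) (ST F u x) (FO (Res E u \<circ>\<^sub>f Cpt F (Tgt u)) x)
        (FO (Cpt F (Src u) \<circ>\<^sub>f Res D u) x)" if "x \<in> VObj D (Tgt u)" for x
      using dm_hom(1)[OF F u that] by (simp add: comp_func_app(1)[OF FB that] comp_func_app(1)[OF RD that])
    show "VComp E (Src u) (ST F u y) (FM (Res E u \<circ>\<^sub>f Cpt F (Tgt u)) f) =
       VComp E (Src u) (FM (Cpt F (Src u) \<circ>\<^sub>f Res D u) f) (ST F u x)"
      if "VHom D (Tgt u) f x y" for f x y
      using dm_nat[OF F u that] by (simp add: comp_func_app(2)[OF FB that] comp_func_app(2)[OF RD that])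
  qed
  moreover have "Src (Res E u \<circ>\<^sub>f Cpt F (Tgt u)) = Val D (Tgt u)" "Tgt (Res E u \<circ>\<^sub>f Cpt F (Tgt u)) = Val E (Src u)"
    using fun_onD[OF FB] fun_onD[OF RE] by simp_all
  ultimately show "is_niso (Str F u)" using dm_hom(2)[OF F u] s by (simp add: is_niso_def nt_on_def)
next
  fix u v :: "'k sfunc" assume "small_func u \<and> small_func v \<and> Src v = Tgt u"
  then have u: "sfun u (Src u) (Tgt u)" and v: "sfun v (Tgt u) (Tgt v)" by (auto simp: small_func_iff)
  note U = sfunD[OF u] and V = sfunD[OF v]
  note uv = sfun_comp[OF u v]
  note FA = dm_fun[OF F U(2)] and FB = dm_fun[OF F U(3)] and FC = dm_fun[OF F V(3)]
  note Ru = res_fun[OF D u] res_fun[OF E u] and Rv = res_fun[OF D v] res_fun[OF E v]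
  note T = fun_onD[OF FA] fun_onD[OF FB] fun_onD[OF FC] fun_onD[OF Ru(1)] fun_onD[OF Ru(2)]
    fun_onD[OF Rv(1)] fun_onD[OF Rv(2)]
  show "Str F (v \<circ>\<^sub>f u) = (Str F u \<rhd> Res D v) \<bullet> (Res E u \<lhd> Str F v)"
  proof (rule nt_eqI[where S = "VObj D (Tgt v)"])
    show "NSrc (Str F (v \<circ>\<^sub>f u)) = NSrc ((Str F u \<rhd> Res D v) \<bullet> (Res E u \<lhd> Str F v))"
      using dm_str[OF F uv] dm_str[OF F v] comp_func_assoc[OF FC Rv(2) Ru(2)] by (simp add: res_comp[OF E u v])
    show "NTgt (Str F (v \<circ>\<^sub>f u)) = NTgt ((Str F u \<rhd> Res D v) \<bullet> (Res E u \<lhd> Str F v))"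
      using dm_str[OF F uv] dm_str[OF F u] comp_func_assoc[OF Rv(1) Ru(1) FA] by (simp add: res_comp[OF D u v])
    show "ST F (v \<circ>\<^sub>f u) \<in> extensional (VObj D (Tgt v))" by (rule dm_str(3)[OF F uv])
    show "Cmp ((Str F u \<rhd> Res D v) \<bullet> (Res E u \<lhd> Str F v)) \<in> extensional (VObj D (Tgt v))"
      using vcomp_sel(4)[of "Str F u \<rhd> Res D v" "Res E u \<lhd> Str F v"] dm_str[OF F v] T by simp
    show "ST F (v \<circ>\<^sub>f u) x = Cmp ((Str F u \<rhd> Res D v) \<bullet> (Res E u \<lhd> Str F v)) x"
      if x: "x \<in> VObj D (Tgt v)" for x using dm_func_comp[OF F u v x] dm_str[OF F v] dm_str[OF F u] T x by simp
  qed
next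
  fix \<alpha> :: "'k sntrans" assume "small_ntrans \<alpha>"
  then have a: "snt \<alpha> (NSrc \<alpha>) (NTgt \<alpha>) (Src (NSrc \<alpha>)) (Tgt (NSrc \<alpha>))" by (simp add: small_ntrans_iff)
  let ?u = "NSrc \<alpha>" and ?v = "NTgt \<alpha>" and ?A = "Src (NSrc \<alpha>)" and ?B = "Tgt (NSrc \<alpha>)"
  note u = sntD(2)[OF a] and v = sntD(3)[OF a]
  note U = sfunD[OF u]
  note FA = dm_fun[OF F U(2)] and FB = dm_fun[OF F U(3)]
  note nE = res2_nt[OF E a] and nD = res2_nt[OF D a]
  note T = fun_onD[OF FA] fun_onD[OF FB] fun_onD[OF res_fun[OF D u]] fun_onD[OF res_fun[OF E u]]
   fun_onD[OF res_fun[OF D v]] fun_onD[OF res_fun[OF E v]]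
  have s: "NSrc (Res2 D \<alpha>) = Res D ?u" "NTgt (Res2 D \<alpha>) = Res D ?v" "NSrc (Res2 E \<alpha>) = Res E ?u"
    "NTgt (Res2 E \<alpha>) = Res E ?v" using nD nE by (auto simp: nt_on_def)
  let ?l = "Str F ?v \<bullet> (Res2 E \<alpha> \<rhd> Cpt F ?B)" and ?r = "(Cpt F ?A \<lhd> Res2 D \<alpha>) \<bullet> Str F ?u"
  show "?l = ?r"
  proof (rule nt_eqI[where S = "VObj D ?B"])
    show "NSrc ?l = NSrc ?r" "NTgt ?l = NTgt ?r" using dm_str[OF F u] dm_str[OF F v] s by simp_all
    show "Cmp ?l \<in> extensional (VObj D ?B)"
      using vcomp_sel(4)[of "Str F ?v" "Res2 E \<alpha> \<rhd> Cpt F ?B"] T s by simp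
    show "Cmp ?r \<in> extensional (VObj D ?B)"
      using vcomp_sel(4)[of "Cpt F ?A \<lhd> Res2 D \<alpha>" "Str F ?u"] dm_str[OF F u] T s by simp
    show "Cmp ?l x = Cmp ?r x" if x: "x \<in> VObj D ?B" for x
      using dm_cell[OF F a x] dm_str[OF F u] dm_str[OF F v] T s x by simp
  qed
qed

text \<open>The components of an invertible modification, again object by object;
  \<open>modi_isomorphic\<close> packs them into natural transformations.\<close>

definition modi where
  "modi D E F G \<theta> \<longleftrightarrow>
     (\<forall>A X. small_cat A \<longrightarrow> X \<in> VObj D A \<longrightarrow>
      VHom E A (\<theta> A X) (CO F A X) (CO G A X) \<and> VIso E A (\<theta> A X)) \<and>
     (\<forall>A X Y f. small_cat A \<longrightarrow> VHom D A f X Y \<longrightarrow>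
      VComp E A (\<theta> A Y) (CM F A f) = VComp E A (CM G A f) (\<theta> A X)) \<and>
     (\<forall>u A B X. sfun u A B \<longrightarrow> X \<in> VObj D B \<longrightarrow>
      VComp E A (ST G u X) (RM E u (\<theta> B X)) = VComp E A (\<theta> A (RO D u X)) (ST F u X))"

lemma modi_isomorphic:
  fixes D :: "('k, 'o, 'm) prederiv"
  assumes D: "pder D" and E: "pder E" and F: "dm D E F" and G: "dm D E G" and t: "modi D E F G \<theta>"
  shows "isomorphic_dmor D E F G" unfolding isomorphic_dmor_def
proof (intro conjI exI[of _ "\<lambda>A. mk_ntrans (Cpt F A) (Cpt G A) (\<theta> A)"])
  let ?t = "\<lambda>A. mk_ntrans (Cpt F A) (Cpt G A) (\<theta> A)"
  show "is_dmor D E F" "is_dmor D E G" using dm_is_dmor[OF D E] F G by auto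
  have nt: "nt_on (?t A) (Cpt F A) (Cpt G A) (Val D A) (Val E A)" if A: "small_cat A" for A
  proof (rule nt_onI[OF dm_fun[OF F A] dm_fun[OF G A]])
    note T = fun_onD[OF dm_fun[OF F A]]
    show "Cmp (?t A) \<in> extensional (VObj D A)" using mk_ntrans_sel(4)[of "Cpt F A"] T by simp
    show "VHom E A (Cmp (?t A) x) (CO F A x) (CO G A x)" if "x \<in> VObj D A" for x
      using t A that T unfolding modi_def by simp
    show "VComp E A (Cmp (?t A) y) (CM F A f) = VComp E A (CM G A f) (Cmp (?t A) x)"
      if f: "VHom D A f x y" for f x y using t A f T hom_obj[OF T(4) f] unfolding modi_def by simp
  qed simp_all
  show "\<forall>A. small_cat A \<longrightarrow> is_niso (?t A)"
  proof (intro allI impI)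
    fix A :: "'k scat" assume A: "small_cat A"
    show "is_niso (?t A)" using nt[OF A] t A fun_onD[OF dm_fun[OF F A]]
      unfolding modi_def is_niso_def by (simp add: nt_on_def)
  qed
  show "is_modification D E F G ?t" unfolding is_modification_def
  proof (intro conjI allI impI)
    fix A :: "'k scat" assume "small_cat A"
    then show "is_ntrans (?t A)" "NSrc (?t A) = Cpt F A" "NTgt (?t A) = Cpt G A"
      using nt[of A] by (simp_all add: nt_on_def)
  next
    fix u :: "'k sfunc" assume "small_func u"
    then have u: "sfun u (Src u) (Tgt u)" by (simp add: small_func_iff)
    note U = sfunD[OF u]
    note FA = dm_fun[OF F U(2)] and FB = dm_fun[OF F U(3)] and GA = dm_fun[OF G U(2)] and GB = dm_fun[OF G U(3)]
    note T = fun_onD[OF FA] fun_onD[OF FB] fun_onD[OF GA] fun_onD[OF GB] fun_onD[OF res_fun[OF D u]]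
     fun_onD[OF res_fun[OF E u]]
    let ?l = "Str G u \<bullet> (Res E u \<lhd> ?t (Tgt u))" and ?r = "(?t (Src u) \<rhd> Res D u) \<bullet> Str F u"
    show "?l = ?r"
    proof (rule nt_eqI[where S = "VObj D (Tgt u)"])
      show "NSrc ?l = NSrc ?r" "NTgt ?l = NTgt ?r" using dm_str[OF F u] dm_str[OF G u] by simp_all
      show "Cmp ?l \<in> extensional (VObj D (Tgt u))"
        using vcomp_sel(4)[of "Str G u" "Res E u \<lhd> ?t (Tgt u)"] T by simp
      show "Cmp ?r \<in> extensional (VObj D (Tgt u))"
        using vcomp_sel(4)[of "?t (Src u) \<rhd> Res D u" "Str F u"] dm_str[OF F u] T by simp
      show "Cmp ?l x = Cmp ?r x" if x: "x \<in> VObj D (Tgt u)" for x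
        using t u x T dm_str[OF F u] dm_str[OF G u] fun_obj[OF res_fun[OF D u] x] unfolding modi_def by simp
    qed
  qed
qed

lemma comp_dmor_cpt [simp]: "Cpt (G \<circ>\<^sub>d F) A = Cpt G A \<circ>\<^sub>f Cpt F A"
  by (simp add: comp_dmor_def)

lemma comp_dmor_str:
  assumes F: "dm D E F" and G: "dm E H G" and u: "sfun u A B"
    and D: "pder D" and E: "pder E" and H: "pder H"
  shows "NSrc (Str (G \<circ>\<^sub>d F) u) = Res H u \<circ>\<^sub>f (Cpt G B \<circ>\<^sub>f Cpt F B)"
    "NTgt (Str (G \<circ>\<^sub>d F) u) = (Cpt G A \<circ>\<^sub>f Cpt F A) \<circ>\<^sub>f Res D u"
    "ST (G \<circ>\<^sub>d F) u \<in> extensional (VObj D B)"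
    "X \<in> VObj D B \<Longrightarrow> ST (G \<circ>\<^sub>d F) u X =
      VComp H A (CM G A (ST F u X)) (ST G u (CO F B X))"
proof -
  note U = sfunD[OF u]
  note FA = dm_fun[OF F U(2)] and FB = dm_fun[OF F U(3)] and GA = dm_fun[OF G U(2)] and GB = dm_fun[OF G U(3)]
  note T = fun_onD[OF FA] fun_onD[OF FB] fun_onD[OF GA] fun_onD[OF GB] fun_onD[OF res_fun[OF D u]]
     fun_onD[OF res_fun[OF E u]] fun_onD[OF res_fun[OF H u]]
  have S: "Str (G \<circ>\<^sub>d F) u = (Cpt G A \<lhd> Str F u) \<bullet> (Str G u \<rhd> Cpt F B)"
    by (simp add: comp_dmor_def U)
  show "NSrc (Str (G \<circ>\<^sub>d F) u) = Res H u \<circ>\<^sub>f (Cpt G B \<circ>\<^sub>f Cpt F B)"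
    using dm_str[OF G u] comp_func_assoc[OF FB GB res_fun[OF H u]] by (simp add: S)
  show "NTgt (Str (G \<circ>\<^sub>d F) u) = (Cpt G A \<circ>\<^sub>f Cpt F A) \<circ>\<^sub>f Res D u"
    using dm_str[OF F u] comp_func_assoc[OF res_fun[OF D u] FA GA] by (simp add: S)
  show "ST (G \<circ>\<^sub>d F) u \<in> extensional (VObj D B)"
    using vcomp_sel(4)[of "Cpt G A \<lhd> Str F u" "Str G u \<rhd> Cpt F B"] dm_str[OF G u] T by (simp add: S)
  show "X \<in> VObj D B \<Longrightarrow> ST (G \<circ>\<^sub>d F) u X =
      VComp H A (CM G A (ST F u X)) (ST G u (CO F B X))" using dm_str[OF F u] dm_str[OF G u] T by (simp add: S)
qed

lemma dm_comp:
  fixes D :: "('k, 'o, 'm) prederiv"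
  assumes D: "pder D" and E: "pder E" and H: "pder H" and F: "dm D E F" and G: "dm E H G"
  shows "dm D H (G \<circ>\<^sub>d F)"
proof (rule dmI)
  note str = comp_dmor_str[OF F G _ D E H]
  fix A :: "'k scat" assume A: "small_cat A"
  note FA = dm_fun[OF F A] and GA = dm_fun[OF G A]
  show "fun_on (Cpt (G \<circ>\<^sub>d F) A) (Val D A) (Val H A)" using fun_on_comp[OF FA GA] by simp
  show "ST (G \<circ>\<^sub>d F) (id_func A) X = VId H A (CO (G \<circ>\<^sub>d F) A X)"
    if X: "X \<in> VObj D A" for X
    using dm_id[OF F A X] dm_id[OF G A fun_obj[OF FA X]] fun_id[OF GA fun_obj[OF FA X]]
      comp_id_left[OF val_cat[OF H A] id_hom[OF val_cat[OF H A] fun_obj[OF GA fun_obj[OF FA X]]]]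
    by (simp add: str(4)[OF sfun_id[OF A] X] comp_func_app(1)[OF FA X])
next
  note str = comp_dmor_str[OF F G _ D E H]
  fix u :: "'k sfunc" and A B assume u: "sfun u A B"
  note U = sfunD[OF u]
  note FA = dm_fun[OF F U(2)] and FB = dm_fun[OF F U(3)] and GA = dm_fun[OF G U(2)] and GB = dm_fun[OF G U(3)]
  show "NSrc (Str (G \<circ>\<^sub>d F) u) = Res H u \<circ>\<^sub>f Cpt (G \<circ>\<^sub>d F) B"
   "NTgt (Str (G \<circ>\<^sub>d F) u) = Cpt (G \<circ>\<^sub>d F) A \<circ>\<^sub>f Res D u"
   "ST (G \<circ>\<^sub>d F) u \<in> extensional (VObj D B)" using str[OF u] by simp_all
  note Ru = res_fun[OF D u] and REu = res_fun[OF E u] and RHu = res_fun[OF H u]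
  note C = val_cat[OF H U(2)]
  have h1: "VHom H A (CM G A (ST F u X)) (CO G A (RO E u (CO F B X)))
      (CO G A (CO F A (RO D u X)))" if X: "X \<in> VObj D B" for X by (rule fun_hom[OF GA dm_hom(1)[OF F u X]])
  note h2 = dm_hom(1)[OF G u fun_obj[OF FB]]
  {
    fix X assume X: "X \<in> VObj D B"
    show "VHom H A (ST (G \<circ>\<^sub>d F) u X) (RO H u (CO (G \<circ>\<^sub>d F) B X))
        (CO (G \<circ>\<^sub>d F) A (RO D u X))" using comp_hom[OF C h2[OF X] h1[OF X]]
      by (simp add: str(4)[OF u X] comp_func_app(1)[OF FB X] comp_func_app(1)[OF FA fun_obj[OF Ru X]])
    show "VIso H A (ST (G \<circ>\<^sub>d F) u X)" unfolding str(4)[OF u X]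
      by (rule iso_comp[OF C h2[OF X] dm_hom(2)[OF G u fun_obj[OF FB X]] h1[OF X]
          fun_iso[OF GA dm_hom[OF F u X]]])
  }
  {
    fix f X Y assume f: "VHom D B f X Y"
    note X = hom_obj(1)[OF val_cat[OF D U(3)] f] and Y = hom_obj(2)[OF val_cat[OF D U(3)] f]
    note Ff = fun_hom[OF FB f]
    have "VComp H A (ST (G \<circ>\<^sub>d F) u Y) (RM H u (CM (G \<circ>\<^sub>d F) B f)) =
      VComp H A (CM G A (ST F u Y)) (VComp H A (ST G u (CO F B Y)) (RM H u (CM G B (CM F B f))))"
      using comp_assoc[OF C fun_hom[OF RHu fun_hom[OF GB Ff]] h2[OF Y] h1[OF Y]]
      by (simp add: str(4)[OF u Y] comp_func_app(2)[OF FB f])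
    also have "\<dots> = VComp H A (CM G A (ST F u Y)) (VComp H A (CM G A (RM E u (CM F B f))) (ST G u (CO F B X)))"
      using dm_nat[OF G u Ff] by simp
    also have "\<dots> = VComp H A (CM G A (VComp E A (ST F u Y) (RM E u (CM F B f)))) (ST G u (CO F B X))"
      using comp_assoc[OF C h2[OF X] fun_hom[OF GA fun_hom[OF REu Ff]] h1[OF Y]]
        fun_comp[OF GA fun_hom[OF REu Ff] dm_hom(1)[OF F u Y]] by simp
    also have "\<dots> = VComp H A (CM G A (VComp E A (CM F A (RM D u f)) (ST F u X))) (ST G u (CO F B X))"
      using dm_nat[OF F u f] by simp
    also have "\<dots> = VComp H A (CM (G \<circ>\<^sub>d F) A (RM D u f)) (ST (G \<circ>\<^sub>d F) u X)"
      using comp_assoc[OF C h2[OF X] h1[OF X] fun_hom[OF GA fun_hom[OF FA fun_hom[OF Ru f]]]]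
        fun_comp[OF GA dm_hom(1)[OF F u X] fun_hom[OF FA fun_hom[OF Ru f]]]
      by (simp add: str(4)[OF u X] comp_func_app(2)[OF FA fun_hom[OF Ru f]])
    finally show "VComp H A (ST (G \<circ>\<^sub>d F) u Y) (RM H u (CM (G \<circ>\<^sub>d F) B f)) =
      VComp H A (CM (G \<circ>\<^sub>d F) A (RM D u f)) (ST (G \<circ>\<^sub>d F) u X)" .
  }
  fix v K X assume v: "sfun v B K" and X: "X \<in> VObj D K"
  note V = sfunD[OF v]
  note FC = dm_fun[OF F V(3)] and GC = dm_fun[OF G V(3)]
  note X' = fun_obj[OF res_fun[OF D v] X]
  note a1 = fun_hom[OF GA dm_hom(1)[OF F u X']]
    and a2 = fun_hom[OF GA fun_hom[OF REu dm_hom(1)[OF F v X]]]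
    and a3 = dm_hom(1)[OF G u fun_obj[OF res_fun[OF E v] fun_obj[OF FC X]]]
    and a4 = fun_hom[OF RHu dm_hom(1)[OF G v fun_obj[OF FC X]]]
    and a5 = fun_hom[OF RHu fun_hom[OF GB dm_hom(1)[OF F v X]]]
    and a6 = h2[OF X']
  have "ST (G \<circ>\<^sub>d F) (v \<circ>\<^sub>f u) X =
    VComp H A (CM G A (VComp E A (ST F u (RO D v X)) (RM E u (ST F v X))))
      (VComp H A (ST G u (RO E v (CO F K X))) (RM H u (ST G v (CO F K X))))"
    using str(4)[OF sfun_comp[OF u v] X] dm_func_comp[OF F u v X] dm_func_comp[OF G u v fun_obj[OF FC X]] by simp
  also have "\<dots> = VComp H A (CM G A (ST F u (RO D v X))) (VComp H A (VComp H A (CM G A (RM E u (ST F v X)))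
      (ST G u (RO E v (CO F K X)))) (RM H u (ST G v (CO F K X))))"
    using fun_comp[OF GA fun_hom[OF REu dm_hom(1)[OF F v X]] dm_hom(1)[OF F u X']]
      comp_assoc[OF C comp_hom[OF C a4 a3] a2 a1] comp_assoc[OF C a4 a3 a2] by simp
  \<comment> \<open>The structure cell of G along u is natural with respect to the structure cell of
    F along v; this exchange lets the four cells regroup by u and v.\<close>
  also have "\<dots> = VComp H A (CM G A (ST F u (RO D v X))) (VComp H A (VComp H A (ST G u (CO F B (RO D v X)))
      (RM H u (CM G B (ST F v X)))) (RM H u (ST G v (CO F K X))))" using dm_nat[OF G u dm_hom(1)[OF F v X]] by simp
  also have "\<dots> = VComp H A (VComp H A (CM G A (ST F u (RO D v X))) (ST G u (CO F B (RO D v X))))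
     (VComp H A (RM H u (CM G B (ST F v X))) (RM H u (ST G v (CO F K X))))"
    using comp_assoc[OF C a4 a5 a6] comp_assoc[OF C comp_hom[OF C a4 a5] a6 a1] by simp
  also have "\<dots> = VComp H A (ST (G \<circ>\<^sub>d F) u (RO D v X)) (RM H u (ST (G \<circ>\<^sub>d F) v X))"
    using fun_comp[OF RHu dm_hom(1)[OF G v fun_obj[OF FC X]] fun_hom[OF GB dm_hom(1)[OF F v X]]]
    by (simp add: str(4)[OF u X'] str(4)[OF v X])
  finally show "ST (G \<circ>\<^sub>d F) (v \<circ>\<^sub>f u) X =
    VComp H A (ST (G \<circ>\<^sub>d F) u (RO D v X)) (RM H u (ST (G \<circ>\<^sub>d F) v X))" .
next
  note str = comp_dmor_str[OF F G _ D E H]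
  fix \<alpha> :: "'k sntrans" and u v A B X assume a: "snt \<alpha> u v A B" and X: "X \<in> VObj D B"
  note u = sntD(2)[OF a] and v = sntD(3)[OF a]
  note U = sfunD[OF u]
  note FA = dm_fun[OF F U(2)] and FB = dm_fun[OF F U(3)] and GA = dm_fun[OF G U(2)] and GB = dm_fun[OF G U(3)]
  note C = val_cat[OF H U(2)]
  note FX = fun_obj[OF FB X]
  note GFX = fun_obj[OF GB FX]
  note av = fun_hom[OF GA dm_hom(1)[OF F v X]] and au = fun_hom[OF GA dm_hom(1)[OF F u X]]
  note bv = dm_hom(1)[OF G v FX] and bu = dm_hom(1)[OF G u FX]
  note cF = fun_hom[OF GA res2_hom[OF E a FX]] and cH = res2_hom[OF H a GFX]
  note cD = fun_hom[OF GA fun_hom[OF FA res2_hom[OF D a X]]]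
  have "VComp H A (ST (G \<circ>\<^sub>d F) v X) (Cmp (Res2 H \<alpha>) (CO (G \<circ>\<^sub>d F) B X)) =
     VComp H A (CM G A (ST F v X)) (VComp H A (ST G v (CO F B X)) (Cmp (Res2 H \<alpha>) (CO G B (CO F B X))))"
    using comp_assoc[OF C cH bv av] by (simp add: str(4)[OF v X] comp_func_app(1)[OF FB X])
  also have "\<dots> = VComp H A (VComp H A (CM G A (ST F v X))
      (CM G A (Cmp (Res2 E \<alpha>) (CO F B X)))) (ST G u (CO F B X))"
    using dm_cell[OF G a FX] comp_assoc[OF C bu cF av] by simp
  also have "\<dots> = VComp H A (VComp H A (CM G A (CM F A (Cmp (Res2 D \<alpha>) X)))
      (CM G A (ST F u X))) (ST G u (CO F B X))"
    using fun_comp[OF GA res2_hom[OF E a FX] dm_hom(1)[OF F v X]] dm_cell[OF F a X]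
      fun_comp[OF GA dm_hom(1)[OF F u X] fun_hom[OF FA res2_hom[OF D a X]]] by simp
  also have "\<dots> = VComp H A (CM (G \<circ>\<^sub>d F) A (Cmp (Res2 D \<alpha>) X)) (ST (G \<circ>\<^sub>d F) u X)"
    using comp_assoc[OF C bu au cD] by (simp add: str(4)[OF u X] comp_func_app(2)[OF FA res2_hom[OF D a X]])
  finally show "VComp H A (ST (G \<circ>\<^sub>d F) v X) (Cmp (Res2 H \<alpha>) (CO (G \<circ>\<^sub>d F) B X)) =
     VComp H A (CM (G \<circ>\<^sub>d F) A (Cmp (Res2 D \<alpha>) X)) (ST (G \<circ>\<^sub>d F) u X)" .
qed

subsection \<open>Shifted prederivators\<close>

lemma shift_sel [simp]:
  "Val (shift D P) K = Val D (P \<times>\<^sub>c K)" "Res (shift D P) u = Res D (id_func P \<times>\<^sub>f u)"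
  "Res2 (shift D P) \<alpha> = Res2 D (cat_times_ntrans P \<alpha>)" by (simp_all add: shift_def)

lemma shift_dmor_sel [simp]:
  "Cpt (shift_dmor F P) K = Cpt F (P \<times>\<^sub>c K)" "Str (shift_dmor F P) u = Str F (id_func P \<times>\<^sub>f u)"
  by (simp_all add: shift_dmor_def)

lemma shift_sfun:
  assumes "regular_universe TYPE('k)" "small_cat (P :: 'k scat)" "sfun u A B"
  shows "sfun (id_func P \<times>\<^sub>f u) (P \<times>\<^sub>c A) (P \<times>\<^sub>c B)"
  by (rule sfun_prod[OF assms(1) sfun_id[OF assms(2)] assms(3)])

lemma shift_snt:
  assumes "regular_universe TYPE('k)" "small_cat (P :: 'k scat)" "snt \<alpha> u v A B"
  shows "snt (cat_times_ntrans P \<alpha>) (id_func P \<times>\<^sub>f u) (id_func P \<times>\<^sub>f v) (P \<times>\<^sub>c A) (P \<times>\<^sub>c B)"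
    "p \<in> Obj P \<Longrightarrow> a \<in> Obj A \<Longrightarrow> Cmp (cat_times_ntrans P \<alpha>) (Pair p a) = Pair (Id P p) (Cmp \<alpha> a)"
proof -
  note i = snt_id[OF sfun_id[OF assms(2)]]
  have eq: "cat_times_ntrans P \<alpha> = id_nt (id_func P) \<times>\<^sub>n \<alpha>"
    by (rule cat_times_ntrans_eq[OF small_cat_is_cat[OF assms(2)] sntD(1)[OF assms(3)]])
  show "snt (cat_times_ntrans P \<alpha>) (id_func P \<times>\<^sub>f u) (id_func P \<times>\<^sub>f v) (P \<times>\<^sub>c A) (P \<times>\<^sub>c B)"
    unfolding eq by (rule snt_prod[OF assms(1) i assms(3)])
  show "p \<in> Obj P \<Longrightarrow> a \<in> Obj A \<Longrightarrow> Cmp (cat_times_ntrans P \<alpha>) (Pair p a) = Pair (Id P p) (Cmp \<alpha> a)"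
    unfolding eq using cmp_prod_nt[OF sntD(1)[OF i] sntD(1)[OF assms(3)]] by simp
qed

lemma shift_func_comp:
  assumes "small_cat P" "sfun u A B" "sfun v B C"
  shows "id_func P \<times>\<^sub>f (v \<circ>\<^sub>f u) = (id_func P \<times>\<^sub>f v) \<circ>\<^sub>f (id_func P \<times>\<^sub>f u)"
proof -
  note i = fun_on_id[OF small_cat_is_cat[OF assms(1)]]
  show ?thesis
    using prod_func_comp[OF i sfunD(1)[OF assms(2)] i sfunD(1)[OF assms(3)]] comp_id_func(1)[OF i] by simp
qed

lemma shift_id: "small_cat P \<Longrightarrow> small_cat A \<Longrightarrow> id_func P \<times>\<^sub>f id_func A = id_func (P \<times>\<^sub>c A)"
  by (rule prod_func_id) (simp_all add: small_cat_is_cat)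

lemma shift_vcomp:
  assumes reg: "regular_universe TYPE('k)" and P: "small_cat (P :: 'k scat)"
    and a: "snt \<alpha> u v A B" and b: "snt \<beta> v w A B"
  shows "cat_times_ntrans P (\<beta> \<bullet> \<alpha>) = cat_times_ntrans P \<beta> \<bullet> cat_times_ntrans P \<alpha>"
proof (rule nt_on_eqI)
  note PC = small_cat_is_cat[OF P] and sn = shift_snt[OF reg P]
  note sa = sn(1)[OF a] and sb = sn(1)[OF b] and ab = snt_vcomp[OF a b]
  show "nt_on (cat_times_ntrans P (\<beta> \<bullet> \<alpha>)) (id_func P \<times>\<^sub>f u) (id_func P \<times>\<^sub>f w) (P \<times>\<^sub>c A) (P \<times>\<^sub>c B)"
    by (rule sntD(1)[OF sn(1)[OF ab]])
  show "nt_on (cat_times_ntrans P \<beta> \<bullet> cat_times_ntrans P \<alpha>) (id_func P \<times>\<^sub>f u) (id_func P \<times>\<^sub>f w)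
      (P \<times>\<^sub>c A) (P \<times>\<^sub>c B)" by (rule sntD(1)[OF snt_vcomp[OF sa sb]])
  fix x assume x: "x \<in> Obj (P \<times>\<^sub>c A)"
  then obtain p y where x': "x = Pair p y" "p \<in> Obj P" "y \<in> Obj A" by (rule prod_cat_objE)
  show "Cmp (cat_times_ntrans P (\<beta> \<bullet> \<alpha>)) x = Cmp (cat_times_ntrans P \<beta> \<bullet> cat_times_ntrans P \<alpha>) x"
    unfolding nt_on_vcomp(2)[OF sntD(1)[OF sa] sntD(1)[OF sb] x]
    unfolding x'(1) sn(2)[OF ab x'(2,3)] sn(2)[OF a x'(2,3)] sn(2)[OF b x'(2,3)]
      nt_on_vcomp(2)[OF sntD(1)[OF a] sntD(1)[OF b] x'(3)] prod_cat_sel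
      comp_id_left[OF PC id_hom[OF PC x'(2)]] by (rule refl)
qed

lemma shift_lwhisk:
  assumes reg: "regular_universe TYPE('k)" and P: "small_cat (P :: 'k scat)"
    and a: "snt \<alpha> u v A B" and w: "sfun w B C"
  shows "cat_times_ntrans P (w \<lhd> \<alpha>) = (id_func P \<times>\<^sub>f w) \<lhd> cat_times_ntrans P \<alpha>"
proof (rule nt_on_eqI)
  note PC = small_cat_is_cat[OF P] and sn = shift_snt[OF reg P]
  note sa = sn(1)[OF a] and sw = shift_sfun[OF reg P w] and aw = snt_lwhisk[OF a w]
  note eq = shift_func_comp[OF P sntD(2)[OF a] w] shift_func_comp[OF P sntD(3)[OF a] w]
  show "nt_on (cat_times_ntrans P (w \<lhd> \<alpha>)) (id_func P \<times>\<^sub>f (w \<circ>\<^sub>f u)) (id_func P \<times>\<^sub>f (w \<circ>\<^sub>f v))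
      (P \<times>\<^sub>c A) (P \<times>\<^sub>c C)" by (rule sntD(1)[OF sn(1)[OF aw]])
  show "nt_on ((id_func P \<times>\<^sub>f w) \<lhd> cat_times_ntrans P \<alpha>) (id_func P \<times>\<^sub>f (w \<circ>\<^sub>f u))
      (id_func P \<times>\<^sub>f (w \<circ>\<^sub>f v)) (P \<times>\<^sub>c A) (P \<times>\<^sub>c C)"
    unfolding eq by (rule sntD(1)[OF snt_lwhisk[OF sa sw]])
  fix x assume x: "x \<in> Obj (P \<times>\<^sub>c A)"
  then obtain p y where x': "x = Pair p y" "p \<in> Obj P" "y \<in> Obj A" by (rule prod_cat_objE)
  have "Cmp \<alpha> y \<in> Arr B" by (rule in_homD(1)[OF nt_hom[OF sntD(1)[OF a] x'(3)]])
  then have "FM (id_func P \<times>\<^sub>f w) (Pair (Id P p) (Cmp \<alpha> y)) = Pair (Id P p) (FM w (Cmp \<alpha> y))"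
    using in_homD(1)[OF id_hom[OF PC x'(2)]] by (simp add: sfunD(6)[OF w])
  then show "Cmp (cat_times_ntrans P (w \<lhd> \<alpha>)) x = Cmp ((id_func P \<times>\<^sub>f w) \<lhd> cat_times_ntrans P \<alpha>) x"
    unfolding nt_on_lwhisk(2)[OF sntD(1)[OF sa] sfunD(1)[OF sw] x]
    unfolding x'(1) sn(2)[OF aw x'(2,3)] sn(2)[OF a x'(2,3)]
      nt_on_lwhisk(2)[OF sntD(1)[OF a] sfunD(1)[OF w] x'(3)] by (rule sym)
qed

lemma shift_rwhisk:
  assumes reg: "regular_universe TYPE('k)" and P: "small_cat (P :: 'k scat)"
    and a: "snt \<alpha> u v A B" and w: "sfun w C A"
  shows "cat_times_ntrans P (\<alpha> \<rhd> w) = cat_times_ntrans P \<alpha> \<rhd> (id_func P \<times>\<^sub>f w)"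
proof (rule nt_on_eqI)
  note sn = shift_snt[OF reg P]
  note sa = sn(1)[OF a] and sw = shift_sfun[OF reg P w] and aw = snt_rwhisk[OF a w]
  note eq = shift_func_comp[OF P w sntD(2)[OF a]] shift_func_comp[OF P w sntD(3)[OF a]]
  show "nt_on (cat_times_ntrans P (\<alpha> \<rhd> w)) (id_func P \<times>\<^sub>f (u \<circ>\<^sub>f w)) (id_func P \<times>\<^sub>f (v \<circ>\<^sub>f w))
      (P \<times>\<^sub>c C) (P \<times>\<^sub>c B)" by (rule sntD(1)[OF sn(1)[OF aw]])
  show "nt_on (cat_times_ntrans P \<alpha> \<rhd> (id_func P \<times>\<^sub>f w)) (id_func P \<times>\<^sub>f (u \<circ>\<^sub>f w))
      (id_func P \<times>\<^sub>f (v \<circ>\<^sub>f w)) (P \<times>\<^sub>c C) (P \<times>\<^sub>c B)"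
    unfolding eq by (rule sntD(1)[OF snt_rwhisk[OF sa sw]])
  fix x assume x: "x \<in> Obj (P \<times>\<^sub>c C)"
  then obtain p y where x': "x = Pair p y" "p \<in> Obj P" "y \<in> Obj C" by (rule prod_cat_objE)
  have "FO (id_func P \<times>\<^sub>f w) (Pair p y) = Pair p (FO w y)" using x' by (simp add: sfunD(6)[OF w])
  then show "Cmp (cat_times_ntrans P (\<alpha> \<rhd> w)) x = Cmp (cat_times_ntrans P \<alpha> \<rhd> (id_func P \<times>\<^sub>f w)) x"
    unfolding nt_on_rwhisk(2)[OF sntD(1)[OF sa] sfunD(1)[OF sw] x]
    unfolding x'(1) sn(2)[OF aw x'(2,3)] nt_on_rwhisk(2)[OF sntD(1)[OF a] sfunD(1)[OF w] x'(3)]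
    by (simp add: sn(2)[OF a x'(2) fun_obj[OF sfunD(1)[OF w] x'(3)]])
qed

text \<open>Taking the product with P is a strict 2-functor on small categories, so each law of D
  pulls back along it.\<close>

lemma pder_shift:
  fixes D :: "('k, 'o, 'm) prederiv"
  assumes D: "pder D" and P: "small_cat P"
  shows "pder (shift D P)"
proof -
  note reg = pder_reg[OF D] and PC = small_cat_is_cat[OF P]
  note sp = small_cat_prod[OF reg P] and sf = shift_sfun[OF reg P] and sn = shift_snt[OF reg P]
  have "prederivator (shift D P)" unfolding prederivator_def shift_sel
  proof (intro conjI allI impI)
    fix A :: "'k scat" assume A: "small_cat A"
    show "is_cat (Val D (P \<times>\<^sub>c A))" by (rule val_cat[OF D sp[OF A]])
    show "Res D (id_func P \<times>\<^sub>f id_func A) = id_func (Val D (P \<times>\<^sub>c A))"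
      by (simp add: shift_id[OF P A] res_id[OF D sp[OF A]])
  next
    fix u :: "'k sfunc" assume "small_func u"
    then have u: "sfun u (Src u) (Tgt u)" by (simp add: small_func_iff)
    note R = res_fun[OF D sf[OF u]]
    show "is_func (Res D (id_func P \<times>\<^sub>f u))" "Src (Res D (id_func P \<times>\<^sub>f u)) = Val D (P \<times>\<^sub>c Tgt u)"
      "Tgt (Res D (id_func P \<times>\<^sub>f u)) = Val D (P \<times>\<^sub>c Src u)" using fun_onD[OF R] by auto
    note iu = sf[OF u]
    have "cat_times_ntrans P (id_nt u) = id_nt (id_func P \<times>\<^sub>f u)"
      by (rule nt_on_eqI[OF sntD(1)[OF sn(1)[OF snt_id[OF u]]] sntD(1)[OF snt_id[OF iu]]])
        (auto elim!: prod_cat_objE simp: sn(2)[OF snt_id[OF u]])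
    then show "Res2 D (cat_times_ntrans P (id_nt u)) = id_nt (Res D (id_func P \<times>\<^sub>f u))"
      using D sfunD(8)[OF iu] by (simp add: pder_def prederivator_def)
  next
    fix \<alpha> :: "'k sntrans" assume "small_ntrans \<alpha>"
    then have a: "snt \<alpha> (NSrc \<alpha>) (NTgt \<alpha>) (Src (NSrc \<alpha>)) (Tgt (NSrc \<alpha>))" by (simp add: small_ntrans_iff)
    from res2_nt[OF D sn(1)[OF a]]
    show "is_ntrans (Res2 D (cat_times_ntrans P \<alpha>))"
      "NSrc (Res2 D (cat_times_ntrans P \<alpha>)) = Res D (id_func P \<times>\<^sub>f NSrc \<alpha>)"
      "NTgt (Res2 D (cat_times_ntrans P \<alpha>)) = Res D (id_func P \<times>\<^sub>f NTgt \<alpha>)" by (auto simp: nt_on_def)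
  next
    fix u v :: "'k sfunc" assume "small_func u \<and> small_func v \<and> Src v = Tgt u"
    then have u: "sfun u (Src u) (Tgt u)" and v: "sfun v (Tgt u) (Tgt v)" by (auto simp: small_func_iff)
    show "Res D (id_func P \<times>\<^sub>f (v \<circ>\<^sub>f u)) = Res D (id_func P \<times>\<^sub>f u) \<circ>\<^sub>f Res D (id_func P \<times>\<^sub>f v)"
      by (simp add: shift_func_comp[OF P u v] res_comp[OF D sf[OF u] sf[OF v]])
  next
    fix \<alpha> \<beta> :: "'k sntrans" assume ab: "small_ntrans \<alpha> \<and> small_ntrans \<beta> \<and> NSrc \<beta> = NTgt \<alpha>"
    let ?u = "NSrc \<alpha>" and ?v = "NTgt \<alpha>" and ?A = "Src (NSrc \<alpha>)" and ?B = "Tgt (NSrc \<alpha>)"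
    have a: "snt \<alpha> ?u ?v ?A ?B" using ab by (simp add: small_ntrans_iff)
    have e: "NSrc \<beta> = ?v" using ab by simp
    have "snt \<beta> (NSrc \<beta>) (NTgt \<beta>) (Src (NSrc \<beta>)) (Tgt (NSrc \<beta>))"
      using ab small_ntrans_iff by blast
    then have "snt \<beta> ?v (NTgt \<beta>) (Src ?v) (Tgt ?v)" unfolding e .
    then have b: "snt \<beta> ?v (NTgt \<beta>) ?A ?B" using sfunD(6,7)[OF sntD(3)[OF a]] by simp
    note eq = shift_vcomp[OF reg P a b]
    have "\<forall>\<alpha> \<beta>. small_ntrans \<alpha> \<and> small_ntrans \<beta> \<and> NSrc \<beta> = NTgt \<alpha> \<longrightarrow>
        Res2 D (\<beta> \<bullet> \<alpha>) = Res2 D \<beta> \<bullet> Res2 D \<alpha>"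
      using D unfolding pder_def prederivator_def by (elim conjE)
    then show "Res2 D (cat_times_ntrans P (\<beta> \<bullet> \<alpha>)) =
        Res2 D (cat_times_ntrans P \<beta>) \<bullet> Res2 D (cat_times_ntrans P \<alpha>)"
      using sntD(5,6)[OF sn(1)[OF a]] sntD(4,6)[OF sn(1)[OF b]] unfolding eq by simp
  next
    fix \<alpha> :: "'k sntrans" and w assume aw: "small_ntrans \<alpha> \<and> small_func w \<and> Src w = Tgt (NSrc \<alpha>)"
    let ?u = "NSrc \<alpha>" and ?v = "NTgt \<alpha>" and ?A = "Src (NSrc \<alpha>)" and ?B = "Tgt (NSrc \<alpha>)"
    have a: "snt \<alpha> ?u ?v ?A ?B" and w: "sfun w ?B (Tgt w)"
      using aw by (auto simp: small_ntrans_iff small_func_iff)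
    note eq = shift_lwhisk[OF reg P a w]
    have "\<forall>\<alpha> v. small_ntrans \<alpha> \<and> small_func v \<and> Src v = Tgt (NSrc \<alpha>) \<longrightarrow>
        Res2 D (v \<lhd> \<alpha>) = Res2 D \<alpha> \<rhd> Res D v"
      using D unfolding pder_def prederivator_def by (elim conjE)
    then show "Res2 D (cat_times_ntrans P (w \<lhd> \<alpha>)) =
        Res2 D (cat_times_ntrans P \<alpha>) \<rhd> Res D (id_func P \<times>\<^sub>f w)"
      using sntD(4,6)[OF sn(1)[OF a]] sfunD(6,7,8)[OF sf[OF w]] unfolding eq by simp
  next
    fix \<alpha> :: "'k sntrans" and w assume aw: "small_ntrans \<alpha> \<and> small_func w \<and> Tgt w = Src (NSrc \<alpha>)"
    let ?u = "NSrc \<alpha>" and ?v = "NTgt \<alpha>" and ?A = "Src (NSrc \<alpha>)" and ?B = "Tgt (NSrc \<alpha>)"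
    have a: "snt \<alpha> ?u ?v ?A ?B" and w: "sfun w (Src w) ?A"
      using aw by (auto simp: small_ntrans_iff small_func_iff)
    note eq = shift_rwhisk[OF reg P a w]
    have "\<forall>\<alpha> w. small_ntrans \<alpha> \<and> small_func w \<and> Tgt w = Src (NSrc \<alpha>) \<longrightarrow>
        Res2 D (\<alpha> \<rhd> w) = Res D w \<lhd> Res2 D \<alpha>"
      using D unfolding pder_def prederivator_def by (elim conjE)
    then show "Res2 D (cat_times_ntrans P (\<alpha> \<rhd> w)) =
        Res D (id_func P \<times>\<^sub>f w) \<lhd> Res2 D (cat_times_ntrans P \<alpha>)"
      using sntD(4,6)[OF sn(1)[OF a]] sfunD(6,7,8)[OF sf[OF w]] unfolding eq by simp
  qed
  then show ?thesis using reg by (simp add: pder_def)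
qed

lemma dm_shift:
  assumes D: "pder D" and F: "dm D E F" and P: "small_cat P"
  shows "dm (shift D P) (shift E P) (shift_dmor F P)"
proof -
  note reg = pder_reg[OF D]
  note sp = small_cat_prod[OF reg P] and sf = shift_sfun[OF reg P] and sn = shift_snt(1)[OF reg P]
  show ?thesis
  proof (rule dmI; unfold shift_sel shift_dmor_sel)
    show "ST F (id_func P \<times>\<^sub>f (v \<circ>\<^sub>f u)) X = VComp E (P \<times>\<^sub>c A)
        (ST F (id_func P \<times>\<^sub>f u) (RO D (id_func P \<times>\<^sub>f v) X))
        (RM E (id_func P \<times>\<^sub>f u) (ST F (id_func P \<times>\<^sub>f v) X))"
      if u: "sfun u A B" and v: "sfun v B C" and X: "X \<in> VObj D (P \<times>\<^sub>c C)" for u v A B C X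
      unfolding shift_func_comp[OF P u v] by (rule dm_func_comp[OF F sf[OF u] sf[OF v] X])
    show "ST F (id_func P \<times>\<^sub>f id_func A) X = VId E (P \<times>\<^sub>c A) (CO F (P \<times>\<^sub>c A) X)"
      if A: "small_cat A" and X: "X \<in> VObj D (P \<times>\<^sub>c A)" for A X
      unfolding shift_id[OF P A] by (rule dm_id[OF F sp[OF A] X])
  qed ((erule dm_fun[OF F sp] dm_str[OF F sf] dm_hom[OF F sf] dm_nat[OF F sf] dm_cell[OF F sn],
      assumption?)+)
qed

subsection \<open>Strict morphisms and their adjoints\<close>

text \<open>A strict 2-natural transformation. The clause on 2-cells is what \<open>dm_cell\<close>
  becomes when all structure isomorphisms are identities.\<close>

definition strict_sys ::
  "('k, 'o, 'm) prederiv \<Rightarrow> ('k, 'p, 'n) prederiv \<Rightarrow> ('k scat \<Rightarrow> ('o, 'm, 'p, 'n) func) \<Rightarrow> bool" where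
  "strict_sys D E \<Phi> \<longleftrightarrow>
     (\<forall>A. small_cat A \<longrightarrow> fun_on (\<Phi> A) (Val D A) (Val E A)) \<and>
     (\<forall>u A B. sfun u A B \<longrightarrow> Res E u \<circ>\<^sub>f \<Phi> B = \<Phi> A \<circ>\<^sub>f Res D u) \<and>
     (\<forall>\<alpha> u v A B X. snt \<alpha> u v A B \<longrightarrow> X \<in> VObj D B \<longrightarrow>
      Cmp (Res2 E \<alpha>) (FO (\<Phi> B) X) = FM (\<Phi> A) (Cmp (Res2 D \<alpha>) X))"

lemma strict_fun:
  assumes "strict_sys D E \<Phi>" "small_cat A"
  shows "fun_on (\<Phi> A) (Val D A) (Val E A)"
  by (rule assms(1)[unfolded strict_sys_def, THEN conjunct1, rule_format, OF assms(2)])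

lemma strict_comm:
  assumes "strict_sys D E \<Phi>" "sfun u A B"
  shows "Res E u \<circ>\<^sub>f \<Phi> B = \<Phi> A \<circ>\<^sub>f Res D u"
  by (rule assms(1)[unfolded strict_sys_def, THEN conjunct2, THEN conjunct1, rule_format, OF assms(2)])

lemma strict_cell:
  assumes "strict_sys D E \<Phi>" "snt \<alpha> u v A B" "X \<in> VObj D B"
  shows "Cmp (Res2 E \<alpha>) (FO (\<Phi> B) X) = FM (\<Phi> A) (Cmp (Res2 D \<alpha>) X)"
  by (rule assms(1)[unfolded strict_sys_def, THEN conjunct2, THEN conjunct2, rule_format, OF assms(2,3)])

lemma strict_app:
  assumes D: "pder D" and S: "strict_sys D E \<Phi>" and u: "sfun u A B"
  shows "X \<in> VObj D B \<Longrightarrow> RO E u (FO (\<Phi> B) X) = FO (\<Phi> A) (RO D u X)"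
    "VHom D B f X Y \<Longrightarrow> RM E u (FM (\<Phi> B) f) = FM (\<Phi> A) (RM D u f)"
proof -
  note FB = strict_fun[OF S sfunD(3)[OF u]] and R = res_fun[OF D u]
  show "RO E u (FO (\<Phi> B) X) = FO (\<Phi> A) (RO D u X)" if "X \<in> VObj D B"
    using arg_cong[OF strict_comm[OF S u], of "\<lambda>F. FO F X"]
    by (simp add: comp_func_app(1)[OF FB that] comp_func_app(1)[OF R that])
  show "RM E u (FM (\<Phi> B) f) = FM (\<Phi> A) (RM D u f)" if "VHom D B f X Y"
    using arg_cong[OF strict_comm[OF S u], of "\<lambda>F. FM F f"]
    by (simp add: comp_func_app(2)[OF FB that] comp_func_app(2)[OF R that])
qed

lemma strict_dmor_sel [simp]:
  "Cpt (strict_dmor D \<Phi>) = \<Phi>" "Str (strict_dmor D \<Phi>) u = id_nt (\<Phi> (Src u) \<circ>\<^sub>f Res D u)"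
  by (simp_all add: strict_dmor_def)

lemma strict_str:
  assumes D: "pder D" and S: "strict_sys D E \<Phi>" and u: "sfun u A B" and X: "X \<in> VObj D B"
  shows "ST (strict_dmor D \<Phi>) u X = VId E A (FO (\<Phi> A) (RO D u X))"
  using X sfunD[OF u] fun_onD[OF strict_fun[OF S sfunD(2)[OF u]]] fun_onD[OF res_fun[OF D u]]
  by (simp add: comp_func_app(1)[OF res_fun[OF D u] X])

lemma dm_strict:
  fixes D :: "('k, 'o, 'm) prederiv"
  assumes D: "pder D" and E: "pder E" and S: "strict_sys D E \<Phi>"
  shows "dm D E (strict_dmor D \<Phi>)"
proof (rule dmI)
  show "fun_on (Cpt (strict_dmor D \<Phi>) A) (Val D A) (Val E A)" if "small_cat A" for A
    using strict_fun[OF S that] by simp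
  show "ST (strict_dmor D \<Phi>) (id_func A) X = VId E A (CO (strict_dmor D \<Phi>) A X)"
    if A: "small_cat A" and X: "X \<in> VObj D A" for A X
    using strict_str[OF D S sfun_id[OF A] X] res_id_app(1)[OF D A X] by simp
next
  fix u :: "'k sfunc" and A B assume u: "sfun u A B"
  note U = sfunD[OF u]
  note FA = strict_fun[OF S U(2)] and FB = strict_fun[OF S U(3)] and R = res_fun[OF D u] and RE = res_fun[OF E u]
  note C = val_cat[OF E U(2)]
  show "NSrc (Str (strict_dmor D \<Phi>) u) = Res E u \<circ>\<^sub>f Cpt (strict_dmor D \<Phi>) B"
    "NTgt (Str (strict_dmor D \<Phi>) u) = Cpt (strict_dmor D \<Phi>) A \<circ>\<^sub>f Res D u"
    using strict_comm[OF S u] by (simp_all add: U)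
  show "ST (strict_dmor D \<Phi>) u \<in> extensional (VObj D B)"
    using id_nt_sel(4)[of "\<Phi> A \<circ>\<^sub>f Res D u"] fun_onD[OF R] by (simp add: U)
  {
    fix X assume X: "X \<in> VObj D B"
    note o = fun_obj[OF FA fun_obj[OF R X]]
    show "VHom E A (ST (strict_dmor D \<Phi>) u X) (RO E u (CO (strict_dmor D \<Phi>) B X))
        (CO (strict_dmor D \<Phi>) A (RO D u X))"
      using id_hom[OF C o] strict_app(1)[OF D S u X] by (simp add: strict_str[OF D S u X] del: strict_dmor_sel(2))
    show "VIso E A (ST (strict_dmor D \<Phi>) u X)" unfolding strict_str[OF D S u X] by (rule iso_id[OF C o])
  }
  show "VComp E A (ST (strict_dmor D \<Phi>) u Y) (RM E u (CM (strict_dmor D \<Phi>) B f)) =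
      VComp E A (CM (strict_dmor D \<Phi>) A (RM D u f)) (ST (strict_dmor D \<Phi>) u X)"
    if f: "VHom D B f X Y" for f X Y using strict_app(2)[OF D S u f] hom_obj[OF val_cat[OF D U(3)] f]
      comp_id_left[OF C fun_hom[OF FA fun_hom[OF R f]]] comp_id_right[OF C fun_hom[OF FA fun_hom[OF R f]]]
    by (simp add: strict_str[OF D S u] del: strict_dmor_sel(2))
  fix v K X assume v: "sfun v B K" and X: "X \<in> VObj D K"
  note V = sfunD[OF v]
  note vX = fun_obj[OF res_fun[OF D v] X]
  note PvX = fun_obj[OF FB vX] and PuvX = fun_obj[OF FA fun_obj[OF R vX]]
  show "ST (strict_dmor D \<Phi>) (v \<circ>\<^sub>f u) X = VComp E A
      (ST (strict_dmor D \<Phi>) u (RO D v X)) (RM E u (ST (strict_dmor D \<Phi>) v X))"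
    using comp_id_left[OF C id_hom[OF C PuvX]] fun_id[OF RE PvX] strict_app(1)[OF D S u vX] res_comp_app(1)[OF D u v X]
    by (simp add: strict_str[OF D S u vX] strict_str[OF D S v X] strict_str[OF D S sfun_comp[OF u v] X]
        del: strict_dmor_sel(2))
next
  fix \<alpha> u v A B X assume a: "snt \<alpha> u v A B" and X: "X \<in> VObj D B"
  note u = sntD(2)[OF a] and v = sntD(3)[OF a]
  note U = sfunD[OF u]
  note FA = strict_fun[OF S U(2)]
  note h = fun_hom[OF FA res2_hom[OF D a X]]
  show "VComp E A (ST (strict_dmor D \<Phi>) v X) (Cmp (Res2 E \<alpha>) (CO (strict_dmor D \<Phi>) B X)) =
     VComp E A (CM (strict_dmor D \<Phi>) A (Cmp (Res2 D \<alpha>) X)) (ST (strict_dmor D \<Phi>) u X)"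
    using strict_cell[OF S a X] comp_id_left[OF val_cat[OF E U(2)] h] comp_id_right[OF val_cat[OF E U(2)] h]
    by (simp add: strict_str[OF D S u X] strict_str[OF D S v X] del: strict_dmor_sel(2))
qed

section \<open>Adjunctions between morphisms: uniqueness, transport, composition\<close>

text \<open>\<open>\<theta>\<close> is the unit of an adjunction \<open>F \<stileturn> G\<close> of morphisms; the last clause makes it a modification.\<close>

definition dadj where
  "dadj D E F G \<theta> \<longleftrightarrow> dm D E F \<and> dm E D G \<and>
     (\<forall>A X. small_cat A \<longrightarrow> X \<in> VObj D A \<longrightarrow>
      uarr (Val E A) (Val D A) (Cpt G A) X (CO F A X) (\<theta> A X)) \<and>
     (\<forall>A X Y f. small_cat A \<longrightarrow> VHom D A f X Y \<longrightarrow>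
      VComp D A (\<theta> A Y) f = VComp D A (CM G A (CM F A f)) (\<theta> A X)) \<and>
     (\<forall>u A B X. sfun u A B \<longrightarrow> X \<in> VObj D B \<longrightarrow>
      VComp D A (CM G A (ST F u X)) (VComp D A (ST G u (CO F B X)) (RM D u (\<theta> B X))) =
      \<theta> A (RO D u X))"

lemma dadjD:
  assumes "dadj D E F G \<theta>"
  shows "dm D E F" "dm E D G"
    "small_cat A \<Longrightarrow> X \<in> VObj D A \<Longrightarrow>
       uarr (Val E A) (Val D A) (Cpt G A) X (CO F A X) (\<theta> A X)"
    "small_cat A \<Longrightarrow> VHom D A f X Y \<Longrightarrow>
        VComp D A (\<theta> A Y) f = VComp D A (CM G A (CM F A f)) (\<theta> A X)"
    "sfun u A B \<Longrightarrow> X \<in> VObj D B \<Longrightarrow> VComp D A (CM G A (ST F u X))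
        (VComp D A (ST G u (CO F B X)) (RM D u (\<theta> B X))) = \<theta> A (RO D u X)"
proof -
  note * = assms[unfolded dadj_def]
  show "dm D E F" "dm E D G" using * by simp_all
  show "uarr (Val E A) (Val D A) (Cpt G A) X (CO F A X) (\<theta> A X)"
    if "small_cat A" "X \<in> VObj D A"
    by (rule *[THEN conjunct2, THEN conjunct2, THEN conjunct1, rule_format, OF that])
  show "VComp D A (\<theta> A Y) f = VComp D A (CM G A (CM F A f)) (\<theta> A X)"
    if "small_cat A" "VHom D A f X Y"
    by (rule *[THEN conjunct2, THEN conjunct2, THEN conjunct2, THEN conjunct1, rule_format, OF that])
  show "VComp D A (CM G A (ST F u X)) (VComp D A (ST G u (CO F B X)) (RM D u (\<theta> B X))) =
      \<theta> A (RO D u X)"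
    if "sfun u A B" "X \<in> VObj D B"
    by (rule *[THEN conjunct2, THEN conjunct2, THEN conjunct2, THEN conjunct2, rule_format, OF that])
qed

lemma dadjI:
  assumes "dm D E F" "dm E D G"
    and "\<And>A X. small_cat A \<Longrightarrow> X \<in> VObj D A \<Longrightarrow>
       uarr (Val E A) (Val D A) (Cpt G A) X (CO F A X) (\<theta> A X)"
    and "\<And>A f X Y. small_cat A \<Longrightarrow> VHom D A f X Y \<Longrightarrow>
        VComp D A (\<theta> A Y) f = VComp D A (CM G A (CM F A f)) (\<theta> A X)"
    and "\<And>u A B X. sfun u A B \<Longrightarrow> X \<in> VObj D B \<Longrightarrow>
        VComp D A (CM G A (ST F u X)) (VComp D A (ST G u (CO F B X)) (RM D u (\<theta> B X))) =
        \<theta> A (RO D u X)"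
  shows "dadj D E F G \<theta>" unfolding dadj_def
  apply (intro conjI allI impI)
  subgoal by (rule assms(1))
  subgoal by (rule assms(2))
  subgoal by (rule assms(3))
  subgoal by (rule assms(4))
  subgoal by (rule assms(5))
  done

text \<open>Each component of \<psi> is the unique map carrying one unit to the other. Naturality
  and compatibility with restriction are equations between maps out of an object with a universal
  arrow, so both are tested after applying G and composing with that arrow.\<close>

lemma dadj_unique:
  assumes D: "pder D" and E: "pder E" and F: "dadj D E F G \<theta>" and F': "dadj D E F' G \<theta>'"
  shows "\<exists>\<psi>. modi D E F F' \<psi>"
proof -
  note F1 = dadjD[OF F] and F2 = dadjD[OF F']
  define \<psi> where "\<psi> = (\<lambda>A X. THE g. VHom E A g (CO F A X) (CO F' A X) \<and>
      VComp D A (CM G A g) (\<theta> A X) = \<theta>' A X)"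
  have psi: "VHom E A (\<psi> A X) (CO F A X) (CO F' A X)"
    "VComp D A (CM G A (\<psi> A X)) (\<theta> A X) = \<theta>' A X"
    if A: "small_cat A" and X: "X \<in> VObj D A" for A X
  proof -
    note u1 = F1(3)[OF A X] and u2 = F2(3)[OF A X]
    obtain g where g: "VHom E A g (CO F A X) (CO F' A X)"
      "VComp D A (CM G A g) (\<theta> A X) = \<theta>' A X" using uarrE[OF u1 uarrD(2,3)[OF u2]] by blast
    have "\<exists>!g. VHom E A g (CO F A X) (CO F' A X) \<and> VComp D A (CM G A g) (\<theta> A X) = \<theta>' A X"
    proof (rule ex1I)
      show "VHom E A g (CO F A X) (CO F' A X) \<and>
        VComp D A (CM G A g) (\<theta> A X) = \<theta>' A X" using g by simp
      show "h = g" if h: "VHom E A h (CO F A X) (CO F' A X) \<and>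
        VComp D A (CM G A h) (\<theta> A X) = \<theta>' A X" for h
        by (rule uarr_eq[OF u1 conjunct1[OF h] g(1)]) (use h g in simp)
    qed
    from theI'[OF this] show "VHom E A (\<psi> A X) (CO F A X) (CO F' A X)"
      "VComp D A (CM G A (\<psi> A X)) (\<theta> A X) = \<theta>' A X" unfolding \<psi>_def by simp_all
  qed
  have "modi D E F F' \<psi>" unfolding modi_def
  proof (intro conjI allI impI)
    fix A X assume A: "small_cat A" and X: "X \<in> VObj D A"
    show "VHom E A (\<psi> A X) (CO F A X) (CO F' A X)" by (rule psi(1)[OF A X])
    show "VIso E A (\<psi> A X)" by (rule uarr_unique_iso[OF F1(3)[OF A X] F2(3)[OF A X] psi[OF A X]])
  next
    fix A X Y f assume A: "small_cat A" and f: "VHom D A f X Y"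
    note C = val_cat[OF D A] and CE = val_cat[OF E A]
    note X = hom_obj(1)[OF C f] and Y = hom_obj(2)[OF C f]
    note FA = dm_fun[OF F1(1) A] and FA' = dm_fun[OF F2(1) A] and GA = dm_fun[OF F1(2) A]
    note tX = uarrD(3)[OF F1(3)[OF A X]] and tY = uarrD(3)[OF F1(3)[OF A Y]]
    note Ff = fun_hom[OF FA f] and Ff' = fun_hom[OF FA' f]
    have "VComp D A (CM G A (VComp E A (\<psi> A Y) (CM F A f))) (\<theta> A X) =
        VComp D A (CM G A (\<psi> A Y)) (VComp D A (\<theta> A Y) f)"
      using fun_comp[OF GA Ff psi(1)[OF A Y]] F1(4)[OF A f]
        comp_assoc[OF C tX fun_hom[OF GA Ff] fun_hom[OF GA psi(1)[OF A Y]]] by simp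
    also have "\<dots> = VComp D A (\<theta>' A Y) f"
      using comp_assoc[OF C f tY fun_hom[OF GA psi(1)[OF A Y]]] psi(2)[OF A Y] by simp
    also have "\<dots> = VComp D A (CM G A (CM F' A f)) (VComp D A (CM G A (\<psi> A X)) (\<theta> A X))"
      using F2(4)[OF A f] psi(2)[OF A X] by simp
    also have "\<dots> = VComp D A (CM G A (VComp E A (CM F' A f) (\<psi> A X))) (\<theta> A X)"
      using fun_comp[OF GA psi(1)[OF A X] Ff']
        comp_assoc[OF C tX fun_hom[OF GA psi(1)[OF A X]] fun_hom[OF GA Ff']] by simp
    finally show "VComp E A (\<psi> A Y) (CM F A f) = VComp E A (CM F' A f) (\<psi> A X)"
      by (rule uarr_eq[OF F1(3)[OF A X] comp_hom[OF CE Ff psi(1)[OF A Y]] comp_hom[OF CE psi(1)[OF A X] Ff']])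
  next
    fix u A B X assume u: "sfun u A B" and X: "X \<in> VObj D B"
    note U = sfunD[OF u]
    note C = val_cat[OF D U(2)] and CE = val_cat[OF E U(2)]
    note uX = fun_obj[OF res_fun[OF D u] X]
    note GA = dm_fun[OF F1(2) U(2)] and GB = dm_fun[OF F1(2) U(3)]
    note R = res_fun[OF D u] and RE = res_fun[OF E u]
    note FX = fun_obj[OF dm_fun[OF F1(1) U(3)] X] and FX' = fun_obj[OF dm_fun[OF F2(1) U(3)] X]
    note s = dm_hom[OF F1(1) u X] and s' = dm_hom[OF F2(1) u X]
    note g = dm_hom(1)[OF F1(2) u FX] and g' = dm_hom(1)[OF F1(2) u FX']
    note t = fun_hom[OF R uarrD(3)[OF F1(3)[OF U(3) X]]] and t' = fun_hom[OF R uarrD(3)[OF F2(3)[OF U(3) X]]]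
    note p = psi(1)[OF U(3) X] and q = psi(1)[OF U(2) uX]
    let ?e = "VComp D A (ST G u (CO F B X)) (RM D u (\<theta> B X))"
    note e = comp_hom[OF C t g]
    obtain r where r: "VHom E A r (CO F A (RO D u X)) (RO E u (CO F B X))"
      "VComp E A r (ST F u X) = VId E A (RO E u (CO F B X))"
      "VComp E A (ST F u X) r = VId E A (CO F A (RO D u X))" using iso_hom[OF s(2,1)] by blast
    have ri: "VIso E A r" by (rule isoI[OF r(1) s(1) r(3,2)])
    have "VComp D A (CM G A r) (\<theta> A (RO D u X)) = VComp D A (CM G A (VComp E A r (ST F u X))) ?e"
      using F1(5)[OF u X] fun_comp[OF GA s(1) r(1)]
        comp_assoc[OF C e fun_hom[OF GA s(1)] fun_hom[OF GA r(1)]] by simp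
    also have "\<dots> = ?e" using r(2) fun_id[OF GA fun_obj[OF RE FX]] comp_id_left[OF C e] by simp
    \<comment> \<open>The restricted unit followed by the structure cell of G is still universal: it
      differs from \<theta> at the restricted object only by the isomorphism r, the inverse of the
      structure cell of F.\<close>
    finally have ue: "uarr (Val E A) (Val D A) (Cpt G A) (RO D u X) (RO E u (CO F B X)) ?e"
      using uarr_iso_right[OF F1(3)[OF U(2) uX] r(1) ri] by simp
    note up = fun_hom[OF RE p]
    have "VComp D A (CM G A (VComp E A (ST F' u X) (RM E u (\<psi> B X)))) ?e =
        VComp D A (CM G A (ST F' u X)) (VComp D A (CM G A (RM E u (\<psi> B X))) ?e)"
      using fun_comp[OF GA up s'(1)] comp_assoc[OF C e fun_hom[OF GA up] fun_hom[OF GA s'(1)]] by simp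
    also have "VComp D A (CM G A (RM E u (\<psi> B X))) ?e =
        VComp D A (VComp D A (ST G u (CO F' B X)) (RM D u (CM G B (\<psi> B X)))) (RM D u (\<theta> B X))"
      using dm_nat[OF F1(2) u p] comp_assoc[OF C t g fun_hom[OF GA up]] by simp
    also have "\<dots> = VComp D A (ST G u (CO F' B X)) (RM D u (\<theta>' B X))"
      using comp_assoc[OF C t fun_hom[OF R fun_hom[OF GB p]] g']
        fun_comp[OF R uarrD(3)[OF F1(3)[OF U(3) X]] fun_hom[OF GB p]] psi(2)[OF U(3) X] by simp
    also have "VComp D A (CM G A (ST F' u X)) \<dots> = \<theta>' A (RO D u X)" by (rule F2(5)[OF u X])
    also have "\<dots> = VComp D A (CM G A (\<psi> A (RO D u X))) (VComp D A (CM G A (ST F u X)) ?e)"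
      using psi(2)[OF U(2) uX] F1(5)[OF u X] by simp
    also have "\<dots> = VComp D A (CM G A (VComp E A (\<psi> A (RO D u X)) (ST F u X))) ?e"
      using fun_comp[OF GA s(1) q] comp_assoc[OF C e fun_hom[OF GA s(1)] fun_hom[OF GA q]] by simp
    finally show "VComp E A (ST F' u X) (RM E u (\<psi> B X)) = VComp E A (\<psi> A (RO D u X)) (ST F u X)"
      by (rule uarr_eq[OF ue comp_hom[OF CE up s'(1)] comp_hom[OF CE s(1) q]])
  qed
  then show ?thesis by blast
qed

text \<open>\<open>dadj_unique\<close> compares left adjoints of literally the same morphism; this
  absorbs an isomorphism of right adjoints into the unit so that it can be applied.\<close>

lemma dadj_iso_right:
  assumes D: "pder D" and E: "pder E" and F: "dadj D E F G \<theta>" and G': "dm E D G'" and m: "modi E D G G' \<phi>"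
  shows "dadj D E F G' (\<lambda>A X. VComp D A (\<phi> A (CO F A X)) (\<theta> A X))"
proof -
  note F1 = dadjD[OF F]
  have ph: "VHom D A (\<phi> A Z) (CO G A Z) (CO G' A Z)" "VIso D A (\<phi> A Z)"
    if "small_cat A" "Z \<in> VObj E A" for A Z
    using m[unfolded modi_def, THEN conjunct1, rule_format, OF that] by simp_all
  have pn: "VComp D A (\<phi> A Y) (CM G A f) = VComp D A (CM G' A f) (\<phi> A X)"
    if "small_cat A" "VHom E A f X Y" for A X Y f
    by (rule m[unfolded modi_def, THEN conjunct2, THEN conjunct1, rule_format, OF that])
  have pm: "VComp D A (ST G' u X) (RM D u (\<phi> B X)) = VComp D A (\<phi> A (RO E u X)) (ST G u X)"
    if "sfun u A B" "X \<in> VObj E B" for u A B X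
    by (rule m[unfolded modi_def, THEN conjunct2, THEN conjunct2, rule_format, OF that])
  show ?thesis
  proof (rule dadjI[OF F1(1) G'])
    fix A X assume A: "small_cat A" and X: "X \<in> VObj D A"
    note u = F1(3)[OF A X]
    note W = uarrD[OF u]
    note GA = dm_fun[OF F1(2) A] and GA' = dm_fun[OF G' A]
    note p = ph[OF A W(2)]
    show "uarr (Val E A) (Val D A) (Cpt G' A) X (CO F A X) (VComp D A (\<phi> A (CO F A X)) (\<theta> A X))"
    proof (rule uarrI[OF GA' W(2) comp_hom[OF W(5,3) p(1)]])
      have key: "VComp D A (CM G' A g) (VComp D A (\<phi> A (CO F A X)) (\<theta> A X)) =
          VComp D A (\<phi> A Z) (VComp D A (CM G A g) (\<theta> A X))"
        if g: "VHom E A g (CO F A X) Z" for g Z using comp_assoc[OF W(5,3) p(1) fun_hom[OF GA' g]] pn[OF A g]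
          comp_assoc[OF W(5,3) fun_hom[OF GA g] ph(1)[OF A hom_obj(2)[OF W(4) g]]] by simp
      {
        fix Z h assume Z: "Z \<in> VObj E A" and h: "VHom D A h X (CO G' A Z)"
        note pZ = ph[OF A Z]
        obtain r where r: "VHom D A r (CO G' A Z) (CO G A Z)"
          "VComp D A (\<phi> A Z) r = VId D A (CO G' A Z)" using iso_hom[OF pZ(2,1)] by blast
        obtain g where g: "VHom E A g (CO F A X) Z"
          "VComp D A (CM G A g) (\<theta> A X) = VComp D A r h"
          using uarrE[OF u Z comp_hom[OF W(5) h r(1)]] by blast
        show "\<exists>g. VHom E A g (CO F A X) Z \<and> VComp D A (CM G' A g)
            (VComp D A (\<phi> A (CO F A X)) (\<theta> A X)) = h"
          using g key[OF g(1)] comp_cancel[OF W(5) h r(1) pZ(1) r(2)] by auto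
      next
        fix Z g g' assume g: "VHom E A g (CO F A X) Z" "VHom E A g' (CO F A X) Z"
          and eq: "VComp D A (CM G' A g) (VComp D A (\<phi> A (CO F A X)) (\<theta> A X)) =
           VComp D A (CM G' A g') (VComp D A (\<phi> A (CO F A X)) (\<theta> A X))"
        note pZ = ph[OF A hom_obj(2)[OF W(4) g(1)]]
        show "g = g'"
        proof (rule uarr_eq[OF u g])
          show "VComp D A (CM G A g) (\<theta> A X) = VComp D A (CM G A g') (\<theta> A X)"
            by (rule iso_cancel_left[OF W(5) comp_hom[OF W(5,3) fun_hom[OF GA g(1)]]
                comp_hom[OF W(5,3) fun_hom[OF GA g(2)]] pZ])
              (use eq key[OF g(1)] key[OF g(2)] in simp)
        qed
      }
    qed
  next
    fix A f X Y assume A: "small_cat A" and f: "VHom D A f X Y"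
    note C = val_cat[OF D A]
    note X = hom_obj(1)[OF C f] and Y = hom_obj(2)[OF C f]
    note wX = uarrD[OF F1(3)[OF A X]] and wY = uarrD[OF F1(3)[OF A Y]]
    note Ff = fun_hom[OF dm_fun[OF F1(1) A] f]
    note GA = dm_fun[OF F1(2) A] and GA' = dm_fun[OF G' A]
    show "VComp D A (VComp D A (\<phi> A (CO F A Y)) (\<theta> A Y)) f =
       VComp D A (CM G' A (CM F A f)) (VComp D A (\<phi> A (CO F A X)) (\<theta> A X))"
      using comp_assoc[OF C f wY(3) ph(1)[OF A wY(2)]] F1(4)[OF A f]
        comp_assoc[OF C wX(3) fun_hom[OF GA Ff] ph(1)[OF A wY(2)]] pn[OF A Ff]
        comp_assoc[OF C wX(3) ph(1)[OF A wX(2)] fun_hom[OF GA' Ff]] by simp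
  next
    fix u A B X assume u: "sfun u A B" and X: "X \<in> VObj D B"
    note U = sfunD[OF u]
    note C = val_cat[OF D U(2)] and R = res_fun[OF D u] and RE = res_fun[OF E u]
    note wX = uarrD[OF F1(3)[OF U(3) X]]
    note GA = dm_fun[OF F1(2) U(2)] and GA' = dm_fun[OF G' U(2)]
    note uX = fun_obj[OF R X]
    note s = dm_hom(1)[OF F1(1) u X] and g = dm_hom(1)[OF F1(2) u wX(2)] and g' = dm_hom(1)[OF G' u wX(2)]
    note t = fun_hom[OF R wX(3)] and p = fun_hom[OF R ph(1)[OF U(3) wX(2)]]
    note uFX = fun_obj[OF RE wX(2)]
    note q = ph(1)[OF U(2) uFX] and q' = ph(1)[OF U(2) uarrD(2)[OF F1(3)[OF U(2) uX]]]
    have "VComp D A (ST G' u (CO F B X)) (RM D u (VComp D B (\<phi> B (CO F B X)) (\<theta> B X))) =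
      VComp D A (VComp D A (ST G' u (CO F B X)) (RM D u (\<phi> B (CO F B X)))) (RM D u (\<theta> B X))"
      using fun_comp[OF R wX(3) ph(1)[OF U(3) wX(2)]] comp_assoc[OF C t p g'] by simp
    also have "\<dots> = VComp D A (\<phi> A (RO E u (CO F B X)))
        (VComp D A (ST G u (CO F B X)) (RM D u (\<theta> B X)))" using pm[OF u wX(2)] comp_assoc[OF C t g q] by simp
    finally have 1: "VComp D A (CM G' A (ST F u X)) (VComp D A (ST G' u (CO F B X))
        (RM D u (VComp D B (\<phi> B (CO F B X)) (\<theta> B X)))) =
      VComp D A (VComp D A (CM G' A (ST F u X)) (\<phi> A (RO E u (CO F B X))))
        (VComp D A (ST G u (CO F B X)) (RM D u (\<theta> B X)))"
      using comp_assoc[OF C comp_hom[OF C t g] q fun_hom[OF GA' s]] by simp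
    also have "\<dots> = VComp D A (\<phi> A (CO F A (RO D u X))) (VComp D A (CM G A (ST F u X))
        (VComp D A (ST G u (CO F B X)) (RM D u (\<theta> B X))))"
      using pn[OF U(2) s] comp_assoc[OF C comp_hom[OF C t g] fun_hom[OF GA s] q'] by simp
    finally show "VComp D A (CM G' A (ST F u X)) (VComp D A (ST G' u (CO F B X))
        (RM D u (VComp D B (\<phi> B (CO F B X)) (\<theta> B X)))) =
        VComp D A (\<phi> A (CO F A (RO D u X))) (\<theta> A (RO D u X))" using F1(5)[OF u X] by simp
  qed
qed

text \<open>Universality of the composite unit is \<open>uarr_comp\<close>. For the modification
  law, \<open>1\<close> moves the structure cell of G past the second unit and \<open>2\<close>
  collapses the result by the laws of the two units.\<close>

lemma dadj_comp:
  assumes D: "pder D" and E: "pder E" and H: "pder H" and F: "dadj D E F G \<theta>" and F': "dadj E H F' G' \<theta>'"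
  shows "dadj D H (F' \<circ>\<^sub>d F) (G \<circ>\<^sub>d G')
    (\<lambda>A X. VComp D A (CM G A (\<theta>' A (CO F A X))) (\<theta> A X))"
proof -
  note F1 = dadjD[OF F] and F2 = dadjD[OF F']
  show ?thesis
  proof (rule dadjI)
    show "dm D H (F' \<circ>\<^sub>d F)" "dm H D (G \<circ>\<^sub>d G')"
      using dm_comp[OF D E H F1(1) F2(1)] dm_comp[OF H E D F2(2) F1(2)] by auto
  next
    fix A X assume A: "small_cat A" and X: "X \<in> VObj D A"
    note u = F1(3)[OF A X]
    show "uarr (Val H A) (Val D A) (Cpt (G \<circ>\<^sub>d G') A) X (CO (F' \<circ>\<^sub>d F) A X)
      (VComp D A (CM G A (\<theta>' A (CO F A X))) (\<theta> A X))" using uarr_comp[OF u F2(3)[OF A uarrD(2)[OF u]]]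
      by (simp add: comp_func_app(1)[OF dm_fun[OF F1(1) A] X])
  next
    fix A f X Y assume A: "small_cat A" and f: "VHom D A f X Y"
    note C = val_cat[OF D A]
    note X = hom_obj(1)[OF C f] and Y = hom_obj(2)[OF C f]
    note wX = uarrD[OF F1(3)[OF A X]] and wY = uarrD[OF F1(3)[OF A Y]]
    note zX = uarrD[OF F2(3)[OF A wX(2)]] and zY = uarrD[OF F2(3)[OF A wY(2)]]
    note FA = dm_fun[OF F1(1) A] and FA' = dm_fun[OF F2(1) A]
    note Ff = fun_hom[OF FA f]
    note GA = dm_fun[OF F1(2) A] and GA' = dm_fun[OF F2(2) A]
    note k = fun_hom[OF GA' fun_hom[OF FA' Ff]]
    show "VComp D A (VComp D A (CM G A (\<theta>' A (CO F A Y))) (\<theta> A Y)) f =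
       VComp D A (CM (G \<circ>\<^sub>d G') A (CM (F' \<circ>\<^sub>d F) A f))
        (VComp D A (CM G A (\<theta>' A (CO F A X))) (\<theta> A X))"
      using comp_assoc[OF C f wY(3) fun_hom[OF GA zY(3)]] F1(4)[OF A f]
        comp_assoc[OF C wX(3) fun_hom[OF GA Ff] fun_hom[OF GA zY(3)]] F2(4)[OF A Ff]
        fun_comp[OF GA Ff zY(3)] fun_comp[OF GA zX(3) k]
        comp_assoc[OF C wX(3) fun_hom[OF GA zX(3)] fun_hom[OF GA k]]
      by (simp add: comp_func_app(2)[OF FA f] comp_func_app(2)[OF GA' fun_hom[OF FA' Ff]])
  next
    fix u A B X assume u: "sfun u A B" and X: "X \<in> VObj D B"
    note U = sfunD[OF u]
    note C = val_cat[OF D U(2)] and CE = val_cat[OF E U(2)] and R = res_fun[OF D u] and RE = res_fun[OF E u]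
    note FA = dm_fun[OF F1(1) U(2)] and FB = dm_fun[OF F1(1) U(3)]
      and FA' = dm_fun[OF F2(1) U(2)] and FB' = dm_fun[OF F2(1) U(3)]
      and GA = dm_fun[OF F1(2) U(2)] and GB = dm_fun[OF F1(2) U(3)]
      and GA' = dm_fun[OF F2(2) U(2)] and GB' = dm_fun[OF F2(2) U(3)]
    note FX = fun_obj[OF FB X]
    note FFX = fun_obj[OF FB' FX]
    note GFX = fun_obj[OF GB' FFX]
    note uX = fun_obj[OF R X] and uFX = fun_obj[OF RE FX]
    note t = uarrD(3)[OF F1(3)[OF U(3) X]] and t' = uarrD(3)[OF F2(3)[OF U(3) FX]]
    note sF = dm_hom(1)[OF F1(1) u X] and sF' = dm_hom(1)[OF F2(1) u FX]
    note sG = dm_hom(1)[OF F1(2) u FX] and sG' = dm_hom(1)[OF F2(2) u FFX] and sG2 = dm_hom(1)[OF F1(2) u GFX]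
    note ut = fun_hom[OF R t] and uGt' = fun_hom[OF R fun_hom[OF GB t']] and ut' = fun_hom[OF RE t']
    note c5 = F2(5)[OF u FX]
    let ?a = "CM G' A (CM F' A (ST F u X))"
    let ?b = "CM G' A (ST F' u (CO F B X))"
    let ?g' = "ST G' u (CO F' B (CO F B X))"
    let ?g = "ST G u (CO F B X)"
    let ?g2 = "ST G u (CO G' B (CO F' B (CO F B X)))"
    let ?t' = "\<theta>' B (CO F B X)"
    let ?D = "VComp D A" and ?E = "VComp E A"
    note a = fun_hom[OF GA' fun_hom[OF FA' sF]] and b = fun_hom[OF GA' sF']
    have "?D ?g2 (RM D u (VComp D B (CM G B ?t') (\<theta> B X))) =
        ?D (?D ?g2 (RM D u (CM G B ?t'))) (RM D u (\<theta> B X))"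
      using fun_comp[OF R t fun_hom[OF GB t']] comp_assoc[OF C ut uGt' sG2] by simp
    also have "\<dots> = ?D (CM G A (RM E u ?t')) (?D ?g (RM D u (\<theta> B X)))"
      using dm_nat[OF F1(2) u t'] comp_assoc[OF C ut sG fun_hom[OF GA ut']] by simp
    finally have 1: "?D ?g2 (RM D u (VComp D B (CM G B ?t') (\<theta> B X))) =
        ?D (CM G A (RM E u ?t')) (?D ?g (RM D u (\<theta> B X)))" .
    let ?w = "?D ?g (RM D u (\<theta> B X))"
    note w = comp_hom[OF C ut sG]
    have "?D (CM G A (?E ?a (?E ?b (?E ?g' (RM E u ?t'))))) ?w =
      ?D (CM G A (?E ?a (\<theta>' A (RO E u (CO F B X))))) ?w" using c5 by simp
    also have "\<dots> = ?D (CM G A (?E (\<theta>' A (CO F A (RO D u X))) (ST F u X))) ?w"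
      using F2(4)[OF U(2) sF] by simp
    also have "\<dots> = ?D (CM G A (\<theta>' A (CO F A (RO D u X)))) (\<theta> A (RO D u X))"
    proof -
      note q = uarrD(3)[OF F2(3)[OF U(2) fun_obj[OF FA uX]]]
      show ?thesis
        using fun_comp[OF GA sF q] comp_assoc[OF C w fun_hom[OF GA sF] fun_hom[OF GA q]] F1(5)[OF u X] by simp
    qed
    finally have 2: "?D (CM G A (?E ?a (?E ?b (?E ?g' (RM E u ?t'))))) ?w =
        ?D (CM G A (\<theta>' A (CO F A (RO D u X)))) (\<theta> A (RO D u X))" .
    have strF: "ST (F' \<circ>\<^sub>d F) u X = VComp H A (CM F' A (ST F u X)) (ST F' u (CO F B X))"
      by (rule comp_dmor_str(4)[OF F1(1) F2(1) u D E H X])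
    have strG: "ST (G \<circ>\<^sub>d G') u (CO (F' \<circ>\<^sub>d F) B X) = ?D (CM G A ?g') ?g2"
      using comp_dmor_str(4)[OF F2(2) F1(2) u H E D FFX] by (simp add: comp_func_app(1)[OF FB X])
    note FsF = fun_hom[OF FA' sF]
    note gt = comp_hom[OF CE ut' sG']
    have "?D (CM (G \<circ>\<^sub>d G') A (ST (F' \<circ>\<^sub>d F) u X))
        (?D (ST (G \<circ>\<^sub>d G') u (CO (F' \<circ>\<^sub>d F) B X))
        (RM D u (VComp D B (CM G B ?t') (\<theta> B X)))) =
       ?D (CM G A (?E ?a ?b)) (?D (CM G A ?g') (?D (CM G A (RM E u ?t')) ?w))" unfolding strF strG
      using 1 fun_comp[OF GA' sF' FsF]
        comp_assoc[OF C fun_hom[OF R comp_hom[OF val_cat[OF D U(3)] t fun_hom[OF GB t']]] sG2 fun_hom[OF GA sG']]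
      by (simp add: comp_func_app(2)[OF GA' comp_hom[OF val_cat[OF H U(2)] sF' FsF]])
    also have "\<dots> = ?D (CM G A (?E ?a (?E ?b (?E ?g' (RM E u ?t'))))) ?w"
      using fun_comp[OF GA ut' sG'] comp_assoc[OF C w fun_hom[OF GA ut'] fun_hom[OF GA sG']]
        fun_comp[OF GA gt comp_hom[OF CE b a]] comp_assoc[OF C w fun_hom[OF GA gt] fun_hom[OF GA comp_hom[OF CE b a]]]
        comp_assoc[OF CE gt b a] by simp
    finally show "?D (CM (G \<circ>\<^sub>d G') A (ST (F' \<circ>\<^sub>d F) u X))
        (?D (ST (G \<circ>\<^sub>d G') u (CO (F' \<circ>\<^sub>d F) B X))
        (RM D u (VComp D B (CM G B ?t') (\<theta> B X)))) =
       ?D (CM G A (\<theta>' A (CO F A (RO D u X)))) (\<theta> A (RO D u X))" using 2 by simp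
  qed
qed

lemma dadj_shift:
  assumes D: "pder D" and F: "dadj D E F G \<theta>" and E: "pder E" and P: "small_cat P"
  shows "dadj (shift D P) (shift E P) (shift_dmor F P) (shift_dmor G P) (\<lambda>K. \<theta> (P \<times>\<^sub>c K))"
proof -
  note F1 = dadjD[OF F]
  note sp = small_cat_prod[OF pder_reg[OF D] P] and sf = shift_sfun[OF pder_reg[OF D] P]
  show ?thesis by (rule dadjI[OF dm_shift[OF D F1(1) P] dm_shift[OF E F1(2) P]]; unfold shift_sel shift_dmor_sel)
      ((rule F1(3)[OF sp] F1(4)[OF sp] F1(5)[OF sf]; assumption)+)
qed

section \<open>Adjoints of strict morphisms\<close>

text \<open>The structure isomorphisms of an adjoint of a strict morphism are determined by the units.\<close>

lemma left_dm:
  assumes D: "pder D" and E: "pder E" and S: "strict_sys E D \<Phi>"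
    and F: "\<And>A. small_cat A \<Longrightarrow> fun_on (Cpt F A) (Val D A) (Val E A)"
    and src: "\<And>u A B. sfun u A B \<Longrightarrow> NSrc (Str F u) = Res E u \<circ>\<^sub>f Cpt F B"
    and tgt: "\<And>u A B. sfun u A B \<Longrightarrow> NTgt (Str F u) = Cpt F A \<circ>\<^sub>f Res D u"
    and ext: "\<And>u A B. sfun u A B \<Longrightarrow> ST F u \<in> extensional (VObj D B)"
    and sty: "\<And>u A B X. sfun u A B \<Longrightarrow> X \<in> VObj D B \<Longrightarrow>
        VHom E A (ST F u X) (RO E u (CO F B X)) (CO F A (RO D u X))"
    and iso: "\<And>u A B X. sfun u A B \<Longrightarrow> X \<in> VObj D B \<Longrightarrow> VIso E A (ST F u X)"
    and un: "\<And>A X. small_cat A \<Longrightarrow> X \<in> VObj D A \<Longrightarrow>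
        uarr (Val E A) (Val D A) (\<Phi> A) X (CO F A X) (\<eta> A X)"
    and nat: "\<And>A f X Y. small_cat A \<Longrightarrow> VHom D A f X Y \<Longrightarrow>
        VComp D A (\<eta> A Y) f = VComp D A (FM (\<Phi> A) (CM F A f)) (\<eta> A X)"
    and bc: "\<And>u A B X. sfun u A B \<Longrightarrow> X \<in> VObj D B \<Longrightarrow>
        uarr (Val E A) (Val D A) (\<Phi> A) (RO D u X) (RO E u (CO F B X)) (RM D u (\<eta> B X))"
    and st: "\<And>u A B X. sfun u A B \<Longrightarrow> X \<in> VObj D B \<Longrightarrow>
        VComp D A (FM (\<Phi> A) (ST F u X)) (RM D u (\<eta> B X)) = \<eta> A (RO D u X)"
  shows "dadj D E F (strict_dmor E \<Phi>) \<eta>"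
proof -
  have dmF: "dm D E F"
  proof (rule dmI[OF F src tgt ext sty iso]; (assumption)?)
    fix u A B f X Y assume u: "sfun u A B" and f: "VHom D B f X Y"
    note U = sfunD[OF u]
    note C = val_cat[OF D U(2)] and CB = val_cat[OF D U(3)] and CE = val_cat[OF E U(2)]
    note X = hom_obj(1)[OF CB f] and Y = hom_obj(2)[OF CB f]
    note R = res_fun[OF D u] and RE = res_fun[OF E u]
    note PA = strict_fun[OF S U(2)] and PB = strict_fun[OF S U(3)]
    note wX = uarrD[OF un[OF U(3) X]] and wY = uarrD[OF un[OF U(3) Y]]
    note b = bc[OF u X]
    note bX = uarrD(3)[OF b] and bY = uarrD(3)[OF bc[OF u Y]]
    note Ff = fun_hom[OF F[OF U(3)] f]
    note uFf = fun_hom[OF RE Ff] and Fuf = fun_hom[OF F[OF U(2)] fun_hom[OF R f]]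
    have "VComp D A (FM (\<Phi> A) (VComp E A (ST F u Y) (RM E u (CM F B f)))) (RM D u (\<eta> B X)) =
        VComp D A (FM (\<Phi> A) (ST F u Y)) (VComp D A (RM D u (FM (\<Phi> B) (CM F B f))) (RM D u (\<eta> B X)))"
      using fun_comp[OF PA uFf sty[OF u Y]] strict_app(2)[OF E S u Ff]
        comp_assoc[OF C bX fun_hom[OF PA uFf] fun_hom[OF PA sty[OF u Y]]] by simp
    also have "\<dots> = VComp D A (FM (\<Phi> A) (ST F u Y)) (VComp D A (RM D u (\<eta> B Y)) (RM D u f))"
      using fun_comp[OF R wX(3) fun_hom[OF PB Ff]] nat[OF U(3) f] fun_comp[OF R f wY(3)] by simp
    also have "\<dots> = VComp D A (\<eta> A (RO D u Y)) (RM D u f)"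
      using comp_assoc[OF C fun_hom[OF R f] bY fun_hom[OF PA sty[OF u Y]]] st[OF u Y] by simp
    also have "\<dots> = VComp D A (FM (\<Phi> A) (CM F A (RM D u f)))
        (VComp D A (FM (\<Phi> A) (ST F u X)) (RM D u (\<eta> B X)))"
      using nat[OF U(2) fun_hom[OF R f]] st[OF u X] by simp
    also have "\<dots> = VComp D A (FM (\<Phi> A) (VComp E A (CM F A (RM D u f)) (ST F u X))) (RM D u (\<eta> B X))"
      using fun_comp[OF PA sty[OF u X] Fuf] comp_assoc[OF C bX fun_hom[OF PA sty[OF u X]] fun_hom[OF PA Fuf]] by simp
    finally show "VComp E A (ST F u Y) (RM E u (CM F B f)) = VComp E A (CM F A (RM D u f)) (ST F u X)"
      by (rule uarr_eq[OF b comp_hom[OF CE uFf sty[OF u Y]] comp_hom[OF CE sty[OF u X] Fuf]])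
  next
    fix A X assume A: "small_cat A" and X: "X \<in> VObj D A"
    note i = sfun_id[OF A]
    note w = uarrD[OF un[OF A X]]
    note h = sty[OF i X, unfolded res_id_app(1)[OF D A X] res_id_app(1)[OF E A w(2)]]
    show "ST F (id_func A) X = VId E A (CO F A X)" by (rule uarr_eq[OF un[OF A X] h id_hom[OF w(4,2)]])
        (use st[OF i X] res_id_app(1)[OF D A X] res_id_app(2)[OF D A w(3)]
          fun_id[OF strict_fun[OF S A] w(2)] comp_id_left[OF w(5,3)] in simp)
  next
    fix u v A B K X assume u: "sfun u A B" and v: "sfun v B K" and X: "X \<in> VObj D K"
    note uv = sfun_comp[OF u v]
    note U = sfunD[OF u] and V = sfunD[OF v]
    note C = val_cat[OF D U(2)] and CE = val_cat[OF E U(2)]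
    note R = res_fun[OF D u] and RE = res_fun[OF E u] and Rv = res_fun[OF D v]
    note PA = strict_fun[OF S U(2)] and PB = strict_fun[OF S U(3)]
    note w = uarrD[OF un[OF V(3) X]]
    note vX = fun_obj[OF Rv X]
    note e1 = res_comp_app(1)[OF D u v X] and e2 = res_comp_app(1)[OF E u v w(2)]
      and e3 = res_comp_app(2)[OF D u v w(3)]
    note b = bc[OF uv X, unfolded e1 e2 e3]
    note bh = uarrD(3)[OF b]
    note sv = sty[OF v X] and su = sty[OF u vX]
    note usv = fun_hom[OF RE sv]
    have "VComp D A (FM (\<Phi> A) (VComp E A (ST F u (RO D v X)) (RM E u (ST F v X))))
        (RM D u (RM D v (\<eta> K X))) = VComp D A (FM (\<Phi> A) (ST F u (RO D v X)))
        (VComp D A (RM D u (FM (\<Phi> B) (ST F v X))) (RM D u (RM D v (\<eta> K X))))"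
      using fun_comp[OF PA usv su] strict_app(2)[OF E S u sv]
        comp_assoc[OF C bh fun_hom[OF PA usv] fun_hom[OF PA su]] by simp
    also have "\<dots> = VComp D A (FM (\<Phi> A) (ST F u (RO D v X))) (RM D u (\<eta> B (RO D v X)))"
      using fun_comp[OF R uarrD(3)[OF bc[OF v X]] fun_hom[OF PB sv]] st[OF v X] by simp
    also have "\<dots> = \<eta> A (RO D u (RO D v X))" by (rule st[OF u vX])
    also have "\<dots> = VComp D A (FM (\<Phi> A) (ST F (v \<circ>\<^sub>f u) X)) (RM D u (RM D v (\<eta> K X)))"
      using st[OF uv X] by (simp only: e1 e3)
    finally show "ST F (v \<circ>\<^sub>f u) X = VComp E A (ST F u (RO D v X)) (RM E u (ST F v X))"
      using uarr_eq[OF b comp_hom[OF CE usv su] sty[OF uv X, unfolded e1 e2]] by simp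
  next
    fix \<alpha> u v A B X assume a: "snt \<alpha> u v A B" and X: "X \<in> VObj D B"
    note u = sntD(2)[OF a] and v = sntD(3)[OF a]
    note U = sfunD[OF u]
    note C = val_cat[OF D U(2)] and CE = val_cat[OF E U(2)]
    note R = res_fun[OF D u] and RE = res_fun[OF E u] and Rv = res_fun[OF D v]
    note PA = strict_fun[OF S U(2)] and PB = strict_fun[OF S U(3)]
    note w = uarrD[OF un[OF U(3) X]]
    note b = bc[OF u X]
    note bu = uarrD(3)[OF b] and bv = uarrD(3)[OF bc[OF v X]]
    note sv = sty[OF v X] and su = sty[OF u X]
    note aF = res2_hom[OF E a w(2)] and aX = res2_hom[OF D a X]
    note FaX = fun_hom[OF F[OF U(2)] aX]
    have "VComp D A (FM (\<Phi> A) (VComp E A (ST F v X) (Cmp (Res2 E \<alpha>) (CO F B X)))) (RM D u (\<eta> B X)) =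
       VComp D A (FM (\<Phi> A) (ST F v X))
        (VComp D A (Cmp (Res2 D \<alpha>) (FO (\<Phi> B) (CO F B X))) (RM D u (\<eta> B X)))"
      using fun_comp[OF PA aF sv] strict_cell[OF S a w(2)] comp_assoc[OF C bu fun_hom[OF PA aF] fun_hom[OF PA sv]] by simp
    also have "\<dots> = VComp D A (FM (\<Phi> A) (ST F v X)) (VComp D A (RM D v (\<eta> B X)) (Cmp (Res2 D \<alpha>) X))"
      using res2_nat[OF D a w(3)] by simp
    also have "\<dots> = VComp D A (\<eta> A (RO D v X)) (Cmp (Res2 D \<alpha>) X)"
      using comp_assoc[OF C aX bv fun_hom[OF PA sv]] st[OF v X] by simp
    also have "\<dots> = VComp D A (FM (\<Phi> A) (CM F A (Cmp (Res2 D \<alpha>) X)))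
        (VComp D A (FM (\<Phi> A) (ST F u X)) (RM D u (\<eta> B X)))" using nat[OF U(2) aX] st[OF u X] by simp
    also have "\<dots> = VComp D A (FM (\<Phi> A) (VComp E A (CM F A (Cmp (Res2 D \<alpha>) X)) (ST F u X)))
        (RM D u (\<eta> B X))"
      using fun_comp[OF PA su FaX] comp_assoc[OF C bu fun_hom[OF PA su] fun_hom[OF PA FaX]] by simp
    finally show "VComp E A (ST F v X) (Cmp (Res2 E \<alpha>) (CO F B X)) =
        VComp E A (CM F A (Cmp (Res2 D \<alpha>) X)) (ST F u X)"
      by (rule uarr_eq[OF b comp_hom[OF CE aF sv] comp_hom[OF CE su FaX]])
  qed
  show ?thesis
  proof (rule dadjI[OF dmF dm_strict[OF E D S]]; unfold strict_dmor_sel(1))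
    fix u A B X assume u: "sfun u A B" and X: "X \<in> VObj D B"
    note w = uarrD[OF un[OF sfunD(3)[OF u] X]]
    note b = uarrD[OF bc[OF u X]]
    show "VComp D A (FM (\<Phi> A) (ST F u X))
        (VComp D A (ST (strict_dmor E \<Phi>) u (CO F B X)) (RM D u (\<eta> B X))) = \<eta> A (RO D u X)"
      using st[OF u X] comp_id_left[OF b(5,3)] by (simp add: strict_str[OF E S u w(2)] del: strict_dmor_sel(2))
  qed (rule un nat; assumption)+
qed

text \<open>The laws are equations between maps into values of F, where the counit c is universal
  already. In \<open>left_dm\<close> the maps leave a restricted value of F instead, and its
  universality is the separate hypothesis \<open>bc\<close>.\<close>

lemma right_dm:
  assumes D: "pder D" and E: "pder E" and S: "strict_sys E D \<Phi>"
    and F: "\<And>A. small_cat A \<Longrightarrow> fun_on (Cpt F A) (Val D A) (Val E A)"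
    and src: "\<And>u A B. sfun u A B \<Longrightarrow> NSrc (Str F u) = Res E u \<circ>\<^sub>f Cpt F B"
    and tgt: "\<And>u A B. sfun u A B \<Longrightarrow> NTgt (Str F u) = Cpt F A \<circ>\<^sub>f Res D u"
    and ext: "\<And>u A B. sfun u A B \<Longrightarrow> ST F u \<in> extensional (VObj D B)"
    and sty: "\<And>u A B X. sfun u A B \<Longrightarrow> X \<in> VObj D B \<Longrightarrow>
        VHom E A (ST F u X) (RO E u (CO F B X)) (CO F A (RO D u X))"
    and iso: "\<And>u A B X. sfun u A B \<Longrightarrow> X \<in> VObj D B \<Longrightarrow> VIso E A (ST F u X)"
    and un: "\<And>A X. small_cat A \<Longrightarrow> X \<in> VObj D A \<Longrightarrow>
        darr (Val E A) (Val D A) (\<Phi> A) X (CO F A X) (c A X)"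
    and nat: "\<And>A f X Y. small_cat A \<Longrightarrow> VHom D A f X Y \<Longrightarrow>
        VComp D A (c A Y) (FM (\<Phi> A) (CM F A f)) = VComp D A f (c A X)"
    and st: "\<And>u A B X. sfun u A B \<Longrightarrow> X \<in> VObj D B \<Longrightarrow>
        VComp D A (c A (RO D u X)) (FM (\<Phi> A) (ST F u X)) = RM D u (c B X)"
  shows "dm D E F"
proof (rule dmI[OF F src tgt ext sty iso]; (assumption)?)
  fix u A B f X Y assume u: "sfun u A B" and f: "VHom D B f X Y"
  note U = sfunD[OF u]
  note C = val_cat[OF D U(2)] and CB = val_cat[OF D U(3)] and CE = val_cat[OF E U(2)]
  note X = hom_obj(1)[OF CB f] and Y = hom_obj(2)[OF CB f]
  note R = res_fun[OF D u] and RE = res_fun[OF E u]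
  note uX = fun_obj[OF R X] and uY = fun_obj[OF R Y]
  note PA = strict_fun[OF S U(2)] and PB = strict_fun[OF S U(3)]
  note wX = darrD[OF un[OF U(3) X]] and wY = darrD[OF un[OF U(3) Y]]
  note b = un[OF U(2) uY]
  note cX = darrD(3)[OF un[OF U(2) uX]] and cY = darrD(3)[OF b]
  note Ff = fun_hom[OF F[OF U(3)] f]
  note uFf = fun_hom[OF RE Ff] and Fuf = fun_hom[OF F[OF U(2)] fun_hom[OF R f]]
  note sX = sty[OF u X] and sY = sty[OF u Y]
  have "VComp D A (c A (RO D u Y)) (FM (\<Phi> A) (VComp E A (ST F u Y) (RM E u (CM F B f)))) =
      VComp D A (RM D u (c B Y)) (RM D u (FM (\<Phi> B) (CM F B f)))"
    using fun_comp[OF PA uFf sY] comp_assoc[OF C fun_hom[OF PA uFf] fun_hom[OF PA sY] cY] st[OF u Y]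
      strict_app(2)[OF E S u Ff] by simp
  also have "\<dots> = VComp D A (RM D u f) (RM D u (c B X))"
    using fun_comp[OF R fun_hom[OF PB Ff] wY(3)] nat[OF U(3) f] fun_comp[OF R wX(3) f] by simp
  also have "\<dots> = VComp D A (VComp D A (RM D u f) (c A (RO D u X))) (FM (\<Phi> A) (ST F u X))"
    using st[OF u X] comp_assoc[OF C fun_hom[OF PA sX] cX fun_hom[OF R f]] by simp
  also have "\<dots> = VComp D A (c A (RO D u Y)) (FM (\<Phi> A) (VComp E A (CM F A (RM D u f)) (ST F u X)))"
    using nat[OF U(2) fun_hom[OF R f]] comp_assoc[OF C fun_hom[OF PA sX] fun_hom[OF PA Fuf] cY]
      fun_comp[OF PA sX Fuf] by simp
  finally show "VComp E A (ST F u Y) (RM E u (CM F B f)) = VComp E A (CM F A (RM D u f)) (ST F u X)"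
    by (rule darr_eq[OF b comp_hom[OF CE uFf sY] comp_hom[OF CE sX Fuf]])
next
  fix A X assume A: "small_cat A" and X: "X \<in> VObj D A"
  note i = sfun_id[OF A]
  note w = darrD[OF un[OF A X]]
  note h = sty[OF i X, unfolded res_id_app(1)[OF D A X] res_id_app(1)[OF E A w(2)]]
  show "ST F (id_func A) X = VId E A (CO F A X)" by (rule darr_eq[OF un[OF A X] h id_hom[OF w(4,2)]])
      (use st[OF i X] res_id_app(1)[OF D A X] res_id_app(2)[OF D A w(3)]
        fun_id[OF strict_fun[OF S A] w(2)] comp_id_right[OF w(5,3)] in simp)
next
  fix u v A B K X assume u: "sfun u A B" and v: "sfun v B K" and X: "X \<in> VObj D K"
  note uv = sfun_comp[OF u v]
  note U = sfunD[OF u] and V = sfunD[OF v]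
  note C = val_cat[OF D U(2)] and CE = val_cat[OF E U(2)]
  note R = res_fun[OF D u] and RE = res_fun[OF E u] and Rv = res_fun[OF D v]
  note PA = strict_fun[OF S U(2)] and PB = strict_fun[OF S U(3)]
  note w = darrD[OF un[OF V(3) X]]
  note vX = fun_obj[OF Rv X]
  note uvX = fun_obj[OF R vX]
  note e1 = res_comp_app(1)[OF D u v X] and e2 = res_comp_app(1)[OF E u v w(2)]
    and e3 = res_comp_app(2)[OF D u v w(3)]
  note b = un[OF U(2) uvX]
  note sv = sty[OF v X] and su = sty[OF u vX]
  note usv = fun_hom[OF RE sv]
  note cv = darrD[OF un[OF U(3) vX]]
  have "VComp D A (c A (RO D u (RO D v X))) (FM (\<Phi> A) (VComp E A (ST F u (RO D v X)) (RM E u (ST F v X)))) =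
    VComp D A (RM D u (c B (RO D v X))) (RM D u (FM (\<Phi> B) (ST F v X)))"
    using fun_comp[OF PA usv su] comp_assoc[OF C fun_hom[OF PA usv] fun_hom[OF PA su] darrD(3)[OF b]]
      st[OF u vX] strict_app(2)[OF E S u sv] by simp
  also have "\<dots> = RM D u (RM D v (c K X))" using fun_comp[OF R fun_hom[OF PB sv] cv(3)] st[OF v X] by simp
  also have "\<dots> = VComp D A (c A (RO D u (RO D v X))) (FM (\<Phi> A) (ST F (v \<circ>\<^sub>f u) X))"
    using st[OF uv X] by (simp only: e1 e3)
  finally show "ST F (v \<circ>\<^sub>f u) X = VComp E A (ST F u (RO D v X)) (RM E u (ST F v X))"
    using darr_eq[OF b comp_hom[OF CE usv su] sty[OF uv X, unfolded e1 e2]] by simp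
next
  fix \<alpha> u v A B X assume a: "snt \<alpha> u v A B" and X: "X \<in> VObj D B"
  note u = sntD(2)[OF a] and v = sntD(3)[OF a]
  note U = sfunD[OF u]
  note C = val_cat[OF D U(2)] and CE = val_cat[OF E U(2)]
  note Ru = res_fun[OF D u] and Rv = res_fun[OF D v]
  note PA = strict_fun[OF S U(2)] and PB = strict_fun[OF S U(3)]
  note w = darrD[OF un[OF U(3) X]]
  note b = un[OF U(2) fun_obj[OF Rv X]]
  note cu = darrD(3)[OF un[OF U(2) fun_obj[OF Ru X]]] and cv = darrD(3)[OF b]
  note sv = sty[OF v X] and su = sty[OF u X]
  note aF = res2_hom[OF E a w(2)] and aX = res2_hom[OF D a X]
  note FaX = fun_hom[OF F[OF U(2)] aX]
  have "VComp D A (c A (RO D v X)) (FM (\<Phi> A) (VComp E A (ST F v X) (Cmp (Res2 E \<alpha>) (CO F B X)))) =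
     VComp D A (RM D v (c B X)) (Cmp (Res2 D \<alpha>) (FO (\<Phi> B) (CO F B X)))"
    using fun_comp[OF PA aF sv] strict_cell[OF S a w(2)]
      comp_assoc[OF C fun_hom[OF PA aF] fun_hom[OF PA sv] cv] st[OF v X] by simp
  also have "\<dots> = VComp D A (Cmp (Res2 D \<alpha>) X) (RM D u (c B X))" using res2_nat[OF D a w(3)] by simp
  also have "\<dots> = VComp D A (VComp D A (Cmp (Res2 D \<alpha>) X) (c A (RO D u X))) (FM (\<Phi> A) (ST F u X))"
    using st[OF u X] comp_assoc[OF C fun_hom[OF PA su] cu aX] by simp
  also have "\<dots> = VComp D A (c A (RO D v X)) (FM (\<Phi> A) (VComp E A (CM F A (Cmp (Res2 D \<alpha>) X)) (ST F u X)))"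
    using nat[OF U(2) aX] fun_comp[OF PA su FaX] comp_assoc[OF C fun_hom[OF PA su] fun_hom[OF PA FaX] cv] by simp
  finally show "VComp E A (ST F v X) (Cmp (Res2 E \<alpha>) (CO F B X)) =
      VComp E A (CM F A (Cmp (Res2 D \<alpha>) X)) (ST F u X)"
    by (rule darr_eq[OF b comp_hom[OF CE aF sv] comp_hom[OF CE su FaX]])
qed

text \<open>The common form of all strict morphisms below: restriction along functors w K : T K -> S
  K natural in K. The assignments S and T, with their actions on 1-cells and 2-cells, stand for K
  |-> A x K, K |-> K and K |-> [1] x ([1]^(n-1) x K), so D and its single and double shifts are
  treated at once.\<close>

lemma strict_sys_res:
  fixes D D1 D2 :: "('k, 'o, 'm) prederiv" and w :: "'k scat \<Rightarrow> 'k sfunc"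
    and S T :: "'k scat \<Rightarrow> 'k scat" and SN TN :: "'k sntrans \<Rightarrow> 'k sntrans"
  assumes D: "pder D"
    and D1: "\<And>K. Val D1 K = Val D (S K)" "\<And>u. Res D1 u = Res D (SF u)" "\<And>\<alpha>. Res2 D1 \<alpha> = Res2 D (SN \<alpha>)"
    and D2: "\<And>K. Val D2 K = Val D (T K)" "\<And>u. Res D2 u = Res D (TF u)" "\<And>\<alpha>. Res2 D2 \<alpha> = Res2 D (TN \<alpha>)"
    and SF: "\<And>u A B. sfun u A B \<Longrightarrow> sfun (SF u) (S A) (S B)"
    and TF: "\<And>u A B. sfun u A B \<Longrightarrow> sfun (TF u) (T A) (T B)"
    and SN: "\<And>\<alpha> u v A B. snt \<alpha> u v A B \<Longrightarrow> snt (SN \<alpha>) (SF u) (SF v) (S A) (S B)"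
    and TN: "\<And>\<alpha> u v A B. snt \<alpha> u v A B \<Longrightarrow> snt (TN \<alpha>) (TF u) (TF v) (T A) (T B)"
    and w: "\<And>K. small_cat K \<Longrightarrow> sfun (w K) (T K) (S K)"
    and comm: "\<And>u A B. sfun u A B \<Longrightarrow> SF u \<circ>\<^sub>f w A = w B \<circ>\<^sub>f TF u"
    and cell: "\<And>\<alpha> u v A B x. snt \<alpha> u v A B \<Longrightarrow> x \<in> Obj (T A) \<Longrightarrow>
      Cmp (SN \<alpha>) (FO (w A) x) = FM (w B) (Cmp (TN \<alpha>) x)"
  shows "strict_sys D1 D2 (\<lambda>K. Res D (w K))" unfolding strict_sys_def D1 D2
proof (intro conjI allI impI)
  fix A :: "'k scat" assume "small_cat A"
  then show "fun_on (Res D (w A)) (Val D (S A)) (Val D (T A))" by (rule res_fun[OF D w])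
next
  fix u :: "'k sfunc" and A B assume u: "sfun u A B"
  note U = sfunD[OF u]
  show "Res D (TF u) \<circ>\<^sub>f Res D (w B) = Res D (w A) \<circ>\<^sub>f Res D (SF u)"
    using res_comp[OF D TF[OF u] w[OF U(3)]] res_comp[OF D w[OF U(2)] SF[OF u]] comm[OF u] by simp
next
  fix \<alpha> :: "'k sntrans" and u v A B X assume a: "snt \<alpha> u v A B" and X: "X \<in> VObj D (S B)"
  note u = sntD(2)[OF a] and v = sntD(3)[OF a]
  note U = sfunD[OF u]
  have n1: "snt (SN \<alpha> \<rhd> w A) (w B \<circ>\<^sub>f TF u) (w B \<circ>\<^sub>f TF v) (T A) (S B)"
    using snt_rwhisk[OF SN[OF a] w[OF U(2)]] comm[OF u] comm[OF v] by simp
  note n2 = snt_lwhisk[OF TN[OF a] w[OF U(3)]]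
  \<comment> \<open>Naturality of w gives both whiskered cells the same boundary;
    \<open>Res2\<close> turns this equality into the two sides of the claim.\<close>
  have "SN \<alpha> \<rhd> w A = w B \<lhd> TN \<alpha>" by (rule nt_on_eqI[OF sntD(1)[OF n1] sntD(1)[OF n2]])
      (simp add: cell[OF a] nt_on_rwhisk(2)[OF sntD(1)[OF SN[OF a]] sfunD(1)[OF w[OF U(2)]]]
        nt_on_lwhisk(2)[OF sntD(1)[OF TN[OF a]] sfunD(1)[OF w[OF U(3)]]])
  then show "Cmp (Res2 D (TN \<alpha>)) (RO D (w B) X) = RM D (w A) (Cmp (Res2 D (SN \<alpha>)) X)"
    using res2_lwhisk[OF D TN[OF a] w[OF U(3)] X] res2_rwhisk[OF D SN[OF a] w[OF U(2)] X] by simp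
qed

section \<open>Restriction and left Kan extension with parameters\<close>

lemma shift_square:
  assumes u: "sfun u A B" and v: "sfun v J K"
  shows "(u \<times>\<^sub>f id_func K) \<circ>\<^sub>f (id_func A \<times>\<^sub>f v) = (id_func B \<times>\<^sub>f v) \<circ>\<^sub>f (u \<times>\<^sub>f id_func J)"
proof -
  note U = sfunD[OF u] and V = sfunD[OF v]
  show ?thesis using prod_func_comp[OF fun_on_id[OF U(4)] V(1) U(1) fun_on_id[OF V(5)]]
      prod_func_comp[OF U(1) fun_on_id[OF V(4)] fun_on_id[OF U(5)] V(1)]
    by (simp add: comp_id_func[OF U(1)] comp_id_func[OF V(1)])
qed

lemma strict_sys_param:
  fixes D :: "('k, 'o, 'm) prederiv"
  assumes D: "pder D" and u: "sfun u A B"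
  shows "strict_sys (shift D B) (shift D A) (\<lambda>K. Res D (u \<times>\<^sub>f id_func K))"
proof -
  note reg = pder_reg[OF D] and U = sfunD[OF u]
  note sA = shift_sfun[OF reg U(2)] and sB = shift_sfun[OF reg U(3)]
    and nA = shift_snt[OF reg U(2)] and nB = shift_snt[OF reg U(3)]
  show ?thesis
  proof (rule strict_sys_res[OF D shift_sel shift_sel sB sA nB(1) nA(1) sfun_prod[OF reg u sfun_id] shift_square[OF u, symmetric]])
    fix \<alpha> and v w :: "'k sfunc" and J K x assume a: "snt \<alpha> v w J K" and x: "x \<in> Obj (A \<times>\<^sub>c J)"
    then obtain y j where x': "x = Pair y j" "y \<in> Obj A" "j \<in> Obj J" by (auto elim: prod_cat_objE)
    have "Cmp \<alpha> j \<in> Arr K" using in_homD(1)[OF nt_hom[OF sntD(1)[OF a] x'(3)]] .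
    then show "Cmp (cat_times_ntrans B \<alpha>) (FO (u \<times>\<^sub>f id_func J) x) =
        FM (u \<times>\<^sub>f id_func K) (Cmp (cat_times_ntrans A \<alpha>) x)"
      using x' nA(2)[OF a x'(2,3)] nB(2)[OF a fun_obj[OF U(1) x'(2)] x'(3)] fun_id[OF U(1) x'(2)]
        in_homD(1)[OF id_hom[OF U(4) x'(2)]] by (simp add: U)
  qed
qed

lemma res_dmor_eq: "sfun u A B \<Longrightarrow> res_dmor D u = strict_dmor (shift D B) (\<lambda>K. Res D (u \<times>\<^sub>f id_func K))"
  by (simp add: res_dmor_def sfunD)

text \<open>\<open>Mt\<close> says that the mate carries the unit at the restricted object to the
  restricted unit, and by \<open>base_change\<close> the latter is universal. Hence the mate is
  invertible, and its inverse is compatible with the units, as \<open>left_dm\<close>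
  requires.\<close>

lemma lkan_dmor_adj:
  fixes D :: "('k, 'o, 'm) prederiv"
  assumes D: "der D" and u: "sfun u A B"
  shows "dadj (shift D A) (shift D B) (lkan_dmor D u) (res_dmor D u) (\<lambda>K. Cmp (lkan_unit D (u \<times>\<^sub>f id_func K)))"
proof -
  note P = derD(1)[OF D] and reg = derD(2)[OF D] and U = sfunD[OF u]
  note R = res_fun[OF P]
  have uK: "sfun (u \<times>\<^sub>f id_func K) (A \<times>\<^sub>c K) (B \<times>\<^sub>c K)" if "small_cat K" for K
    by (rule sfun_prod[OF reg u sfun_id[OF that]])
  note Av = shift_sfun[OF reg U(2)] and Bv = shift_sfun[OF reg U(3)]
  note PA = pder_shift[OF P U(2)] and PB = pder_shift[OF P U(3)]
  let ?M = "\<lambda>v J K. left_mate (lkan D (u \<times>\<^sub>f id_func K)) (lkan_unit D (u \<times>\<^sub>f id_func K))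
      (lkan D (u \<times>\<^sub>f id_func J)) (lkan_counit D (u \<times>\<^sub>f id_func J)) (Res D (id_func A \<times>\<^sub>f v))
      (Res D (id_func B \<times>\<^sub>f v)) (id_nt (Res D (id_func A \<times>\<^sub>f v) \<circ>\<^sub>f Res D (u \<times>\<^sub>f id_func K)))"
  have str: "Str (lkan_dmor D u) v = inv_nt (?M v J K)" if "sfun v J K" for v J K
    using sfunD[OF that] by (simp add: lkan_dmor_def U Let_def)
  have cpt: "Cpt (lkan_dmor D u) K = lkan D (u \<times>\<^sub>f id_func K)" for K by (simp add: lkan_dmor_def)
  \<comment> \<open>The identity is a cell between two different composites because these are equal
    functors by strict naturality of restriction.\<close>
  have n: "nt_on (id_nt (Res D (id_func A \<times>\<^sub>f v) \<circ>\<^sub>f Res D (u \<times>\<^sub>f id_func K)))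
      (Res D (id_func A \<times>\<^sub>f v) \<circ>\<^sub>f Res D (u \<times>\<^sub>f id_func K))
      (Res D (u \<times>\<^sub>f id_func J) \<circ>\<^sub>f Res D (id_func B \<times>\<^sub>f v)) (Val D (B \<times>\<^sub>c K)) (Val D (A \<times>\<^sub>c J))"
    if v: "sfun v J K" for v J K using nt_on_id[OF fun_on_comp[OF R[OF uK[OF sfunD(3)[OF v]]] R[OF Av[OF v]]]]
      strict_comm[OF strict_sys_param[OF P u] v] by simp
  note M = left_mate[OF lkan_adj[OF D uK] R[OF uK] lkan_adj[OF D uK] R[OF uK] R[OF Av] R[OF Bv] n]
  have Mv: "NSrc (?M v J K) = lkan D (u \<times>\<^sub>f id_func J) \<circ>\<^sub>f Res D (id_func A \<times>\<^sub>f v)"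
      "NTgt (?M v J K) = Res D (id_func B \<times>\<^sub>f v) \<circ>\<^sub>f lkan D (u \<times>\<^sub>f id_func K)"
    if v: "sfun v J K" for v J K
    using M(1,2)[OF sfunD(3)[OF v] sfunD(3)[OF v] sfunD(2)[OF v] sfunD(2)[OF v] v v v] .
  have Mh: "VHom D (B \<times>\<^sub>c J) (Cmp (?M v J K) X)
      (FO (lkan D (u \<times>\<^sub>f id_func J)) (RO D (id_func A \<times>\<^sub>f v) X))
      (RO D (id_func B \<times>\<^sub>f v) (FO (lkan D (u \<times>\<^sub>f id_func K)) X))"
    if v: "sfun v J K" and X: "X \<in> VObj D (A \<times>\<^sub>c K)" for v J K X
    using M(4)[OF sfunD(3)[OF v] sfunD(3)[OF v] sfunD(2)[OF v] sfunD(2)[OF v] v v v X] .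
  note bc = base_change[OF D u _ lkan_uarr[OF D uK]]
  have Mt: "VComp D (A \<times>\<^sub>c J) (RM D (u \<times>\<^sub>f id_func J) (Cmp (?M v J K) X))
      (Cmp (lkan_unit D (u \<times>\<^sub>f id_func J)) (RO D (id_func A \<times>\<^sub>f v) X)) =
      RM D (id_func A \<times>\<^sub>f v) (Cmp (lkan_unit D (u \<times>\<^sub>f id_func K)) X)"
    if v: "sfun v J K" and X: "X \<in> VObj D (A \<times>\<^sub>c K)" for v J K X
  proof -
    note uk = uK[OF sfunD(3)[OF v]]
    note l = lkan_uarr[OF D uk X]
    note w = uarrD[OF l]
    have h: "VHom D (A \<times>\<^sub>c J) (RM D (id_func A \<times>\<^sub>f v) (Cmp (lkan_unit D (u \<times>\<^sub>f id_func K)) X))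
        (RO D (id_func A \<times>\<^sub>f v) X)
        (RO D (id_func A \<times>\<^sub>f v) (RO D (u \<times>\<^sub>f id_func K) (FO (lkan D (u \<times>\<^sub>f id_func K)) X)))"
      by (rule fun_hom[OF R[OF Av[OF v]] w(3)])
    show ?thesis using M(5)[OF sfunD(3)[OF v] sfunD(3)[OF v] sfunD(2)[OF v] sfunD(2)[OF v] v v v X]
        comp_id_left[OF val_cat[OF P sfunD(2)[OF Av[OF v]]] h] w(2) fun_onD[OF R[OF uk]] fun_onD[OF R[OF Av[OF v]]]
      by simp
  qed
  have Mi: "VIso D (B \<times>\<^sub>c J) (Cmp (?M v J K) X)"
    if v: "sfun v J K" and X: "X \<in> VObj D (A \<times>\<^sub>c K)" for v J K X
    by (rule uarr_unique_iso[OF lkan_uarr[OF D uK[OF sfunD(2)[OF v]] fun_obj[OF R[OF Av[OF v]] X]]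
        bc[OF v sfunD(3)[OF v] X] Mh[OF v X] Mt[OF v X]])
  have cmp: "ST (lkan_dmor D u) v X = inv_arr (Val D (B \<times>\<^sub>c J)) (Cmp (?M v J K) X)"
    if v: "sfun v J K" and X: "X \<in> VObj D (A \<times>\<^sub>c K)" for v J K X
    unfolding str[OF v] using Mv[OF v] X fun_onD[OF lkan_fun[OF D uK[OF sfunD(3)[OF v]]]]
      fun_onD[OF lkan_fun[OF D uK[OF sfunD(2)[OF v]]]] by simp
  note inv = inv_arr[OF val_cat[OF P sfunD(3)[OF uK[OF sfunD(2)]]] Mi Mh]
  show ?thesis unfolding res_dmor_eq[OF u]
  proof (rule left_dm[OF PA PB strict_sys_param[OF P u]]; unfold shift_sel cpt)
    show "fun_on (lkan D (u \<times>\<^sub>f id_func K)) (Val D (A \<times>\<^sub>c K)) (Val D (B \<times>\<^sub>c K))" if "small_cat K" for K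
      by (rule lkan_fun[OF D uK[OF that]])
    show "uarr (Val D (B \<times>\<^sub>c K)) (Val D (A \<times>\<^sub>c K)) (Res D (u \<times>\<^sub>f id_func K)) X
        (FO (lkan D (u \<times>\<^sub>f id_func K)) X) (Cmp (lkan_unit D (u \<times>\<^sub>f id_func K)) X)"
      if "small_cat K" "X \<in> VObj D (A \<times>\<^sub>c K)" for K X
      by (rule lkan_uarr[OF D uK[OF that(1)] that(2)])
    show "VComp D (A \<times>\<^sub>c K) (Cmp (lkan_unit D (u \<times>\<^sub>f id_func K)) Y) f =
       VComp D (A \<times>\<^sub>c K) (RM D (u \<times>\<^sub>f id_func K) (FM (lkan D (u \<times>\<^sub>f id_func K)) f))
        (Cmp (lkan_unit D (u \<times>\<^sub>f id_func K)) X)"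
      if "small_cat K" "VHom D (A \<times>\<^sub>c K) f X Y" for K f X Y
      by (rule adjD(6)[OF lkan_adj[OF D uK[OF that(1)]] R[OF uK[OF that(1)]] that(2)])
  next
    fix v :: "'k sfunc" and J K assume v: "sfun v J K"
    show "NSrc (Str (lkan_dmor D u) v) = Res D (id_func B \<times>\<^sub>f v) \<circ>\<^sub>f lkan D (u \<times>\<^sub>f id_func K)"
      "NTgt (Str (lkan_dmor D u) v) = lkan D (u \<times>\<^sub>f id_func J) \<circ>\<^sub>f Res D (id_func A \<times>\<^sub>f v)"
      unfolding str[OF v] using Mv[OF v] by simp_all
    show "ST (lkan_dmor D u) v \<in> extensional (VObj D (A \<times>\<^sub>c K))"
      unfolding str[OF v] using inv_nt_sel(4)[of "?M v J K"] Mv[OF v]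
        fun_onD[OF lkan_fun[OF D uK[OF sfunD(3)[OF v]]]] by simp
    fix X assume X: "X \<in> VObj D (A \<times>\<^sub>c K)"
    note i = inv[OF v v X v X]
    note C = val_cat[OF P sfunD(3)[OF uK[OF sfunD(2)[OF v]]]]
    show "VHom D (B \<times>\<^sub>c J) (ST (lkan_dmor D u) v X)
        (RO D (id_func B \<times>\<^sub>f v) (FO (lkan D (u \<times>\<^sub>f id_func K)) X))
        (FO (lkan D (u \<times>\<^sub>f id_func J)) (RO D (id_func A \<times>\<^sub>f v) X))"
      unfolding cmp[OF v X] by (rule i(1))
    show "VIso D (B \<times>\<^sub>c J) (ST (lkan_dmor D u) v X)"
      unfolding cmp[OF v X] by (rule iso_inv_arr[OF C Mi[OF v X] Mh[OF v X]])
    show "uarr (Val D (B \<times>\<^sub>c J)) (Val D (A \<times>\<^sub>c J)) (Res D (u \<times>\<^sub>f id_func J)) (RO D (id_func A \<times>\<^sub>f v) X)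
        (RO D (id_func B \<times>\<^sub>f v) (FO (lkan D (u \<times>\<^sub>f id_func K)) X))
        (RM D (id_func A \<times>\<^sub>f v) (Cmp (lkan_unit D (u \<times>\<^sub>f id_func K)) X))"
      by (rule bc[OF v sfunD(3)[OF v] X])
    note uj = uK[OF sfunD(2)[OF v]]
    note e = uarrD[OF lkan_uarr[OF D uj fun_obj[OF R[OF Av[OF v]] X]]]
    \<comment> \<open>Restricted along u x J, the inverse still undoes the mate; cancelling it from
      \<open>Mt\<close> gives the law for the structure cell.\<close>
    have "VComp D (A \<times>\<^sub>c J) (RM D (u \<times>\<^sub>f id_func J) (inv_arr (Val D (B \<times>\<^sub>c J)) (Cmp (?M v J K) X)))
       (RM D (u \<times>\<^sub>f id_func J) (Cmp (?M v J K) X)) =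
       VId D (A \<times>\<^sub>c J) (RO D (u \<times>\<^sub>f id_func J) (FO (lkan D (u \<times>\<^sub>f id_func J)) (RO D (id_func A \<times>\<^sub>f v) X)))"
      using fun_comp[OF R[OF uj] Mh[OF v X] i(1)] i(2) fun_id[OF R[OF uj] e(2)] by simp
    from comp_cancel[OF e(5,3) fun_hom[OF R[OF uj] Mh[OF v X]] fun_hom[OF R[OF uj] i(1)] this]
    show "VComp D (A \<times>\<^sub>c J) (RM D (u \<times>\<^sub>f id_func J) (ST (lkan_dmor D u) v X))
        (RM D (id_func A \<times>\<^sub>f v) (Cmp (lkan_unit D (u \<times>\<^sub>f id_func K)) X)) =
       Cmp (lkan_unit D (u \<times>\<^sub>f id_func J)) (RO D (id_func A \<times>\<^sub>f v) X)"
      unfolding cmp[OF v X] Mt[OF v X] .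
  qed
qed

text \<open>Serves morphisms that agree on all small categories but are built differently, as
  happens when the cone is read off two different edges of the cofiber square.\<close>

lemma dadj_cong:
  assumes F: "dadj D E F G \<theta>" and F': "dm D E F'"
    and cpt: "\<And>A. small_cat A \<Longrightarrow> Cpt F' A = Cpt F A"
    and str: "\<And>u A B X. sfun u A B \<Longrightarrow> X \<in> VObj D B \<Longrightarrow> ST F' u X = ST F u X"
  shows "dadj D E F' G \<theta>"
proof -
  note F1 = dadjD[OF F]
  show ?thesis
  proof (rule dadjI[OF F' F1(2)])
    show "uarr (Val E A) (Val D A) (Cpt G A) X (CO F' A X) (\<theta> A X)"
      if "small_cat A" "X \<in> VObj D A" for A X unfolding cpt[OF that(1)] by (rule F1(3)[OF that])
    show "VComp D A (\<theta> A Y) f = VComp D A (CM G A (CM F' A f)) (\<theta> A X)"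
      if "small_cat A" "VHom D A f X Y" for A f X Y unfolding cpt[OF that(1)] by (rule F1(4)[OF that])
    show "VComp D A (CM G A (ST F' u X)) (VComp D A (ST G u (CO F' B X)) (RM D u (\<theta> B X))) =
       \<theta> A (RO D u X)" if "sfun u A B" "X \<in> VObj D B" for u A B X
      unfolding cpt[OF sfunD(3)[OF that(1)]] str[OF that] by (rule F1(5)[OF that])
  qed
qed

section \<open>The unit of the cone, from abstract data\<close>

text \<open>In the application below, \<open>\<Phi>e\<close>, \<open>\<Phi>i\<close>, \<open>\<Phi>1\<close>, \<open>\<Phi>t\<close> are the restrictions along
  \<open>[1] \<rightarrow> \<ulcorner>\<close>, \<open>\<ulcorner> \<rightarrow> \<box>\<close>, the edge \<open>(0,1) \<rightarrow> (1,1)\<close> of \<open>\<box>\<close> and \<open>1 \<in> [1]\<close>, and \<open>\<kappa>\<close> maps the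
  edge \<open>(0,0) \<rightarrow> (1,0)\<close> of a square to the edge \<open>(0,1) \<rightarrow> (1,1)\<close>.\<close>

lemma cone_unit:
  assumes X0: "pder X0" and Y0: "pder Y0" and Q0: "pder Q0" and T0: "pder T0"
    and Se: "strict_sys Y0 X0 \<Phi>e" and Si: "strict_sys Q0 Y0 \<Phi>i"
    and S1: "strict_sys Q0 X0 \<Phi>1" and St: "strict_sys X0 T0 \<Phi>t"
    and Fe: "dm X0 Y0 Fe" and Fi: "dadj Y0 Q0 Fi (strict_dmor Q0 \<Phi>i) \<eta>"
    and Ft: "dadj T0 X0 Ft (strict_dmor X0 \<Phi>t) \<tau>"
    and c: "\<And>A X. small_cat A \<Longrightarrow> X \<in> VObj X0 A \<Longrightarrow>
        VHom X0 A (c A X) (FO (\<Phi>e A) (CO Fe A X)) X \<and> VIso X0 A (c A X)"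
    and cn: "\<And>A f X Y. small_cat A \<Longrightarrow> VHom X0 A f X Y \<Longrightarrow>
        VComp X0 A (c A Y) (FM (\<Phi>e A) (CM Fe A f)) = VComp X0 A f (c A X)"
    and cs: "\<And>u A B X. sfun u A B \<Longrightarrow> X \<in> VObj X0 B \<Longrightarrow>
        VComp X0 A (c A (RO X0 u X)) (FM (\<Phi>e A) (ST Fe u X)) = RM X0 u (c B X)"
    and k: "\<And>A Q. small_cat A \<Longrightarrow> Q \<in> VObj Q0 A \<Longrightarrow>
        VHom X0 A (\<kappa> A Q) (FO (\<Phi>e A) (FO (\<Phi>i A) Q)) (FO (\<Phi>1 A) Q)"
    and kn: "\<And>A f X Y. small_cat A \<Longrightarrow> VHom Q0 A f X Y \<Longrightarrow>
        VComp X0 A (\<kappa> A Y) (FM (\<Phi>e A) (FM (\<Phi>i A) f)) = VComp X0 A (FM (\<Phi>1 A) f) (\<kappa> A X)"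
    and ks: "\<And>u A B Q. sfun u A B \<Longrightarrow> Q \<in> VObj Q0 B \<Longrightarrow>
        RM X0 u (\<kappa> B Q) = \<kappa> A (RO Q0 u Q)"
    and d: "\<And>A V. small_cat A \<Longrightarrow> V \<in> VObj X0 A \<Longrightarrow>
        VHom X0 A (\<delta> A V) (CO Ft A (FO (\<Phi>t A) V)) V \<and>
        VComp T0 A (FM (\<Phi>t A) (\<delta> A V)) (\<tau> A (FO (\<Phi>t A) V)) = VId T0 A (FO (\<Phi>t A) V)"
    and di: "\<And>A X. small_cat A \<Longrightarrow> X \<in> VObj X0 A \<Longrightarrow>
        VIso X0 A (\<delta> A (FO (\<Phi>1 A) (CO Fi A (CO Fe A X))))"
    and a: "\<And>A X. small_cat A \<Longrightarrow> X \<in> VObj X0 A \<Longrightarrow>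
        VHom X0 A (a A X) X (FO (\<Phi>1 A) (CO Fi A (CO Fe A X))) \<and> VComp X0 A (a A X) (c A X) =
        VComp X0 A (\<kappa> A (CO Fi A (CO Fe A X))) (FM (\<Phi>e A) (\<eta> A (CO Fe A X)))"
    and t: "\<And>A X. small_cat A \<Longrightarrow> X \<in> VObj X0 A \<Longrightarrow>
        VComp X0 A (\<delta> A (FO (\<Phi>1 A) (CO Fi A (CO Fe A X)))) (\<theta> A X) = a A X \<and>
        uarr (Val T0 A) (Val X0 A) (Cpt Ft A) X
        (FO (\<Phi>t A) (FO (\<Phi>1 A) (CO Fi A (CO Fe A X)))) (\<theta> A X)"
  shows "dadj X0 T0 (strict_dmor X0 \<Phi>t \<circ>\<^sub>d strict_dmor Q0 \<Phi>1 \<circ>\<^sub>d Fi \<circ>\<^sub>d Fe) Ft \<theta>"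
proof -
  note I = dadjD[OF Fi] and T = dadjD[OF Ft]
  note S1d = dm_strict[OF Q0 X0 S1] and Std = dm_strict[OF X0 T0 St]
  let ?Q = "\<lambda>A X. CO Fi A (CO Fe A X)"
  let ?V = "\<lambda>A X. FO (\<Phi>1 A) (?Q A X)"
  let ?QM = "\<lambda>A f. CM Fi A (CM Fe A f)"
  let ?C = "strict_dmor X0 \<Phi>t \<circ>\<^sub>d strict_dmor Q0 \<Phi>1 \<circ>\<^sub>d Fi \<circ>\<^sub>d Fe"
  note dFi = dm_comp[OF X0 Y0 Q0 Fe I(1)]
  note dF1 = dm_comp[OF X0 Q0 X0 dFi S1d]
  have dC: "dm X0 T0 ?C" by (rule dm_comp[OF X0 X0 T0 dF1 Std])
  have Cobj: "CO ?C A X = FO (\<Phi>t A) (?V A X)" if A: "small_cat A" and X: "X \<in> VObj X0 A" for A X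
    using fun_onD[OF dm_fun[OF Fe A]] fun_onD[OF dm_fun[OF I(1) A]] fun_onD[OF strict_fun[OF S1 A]] X by simp
  have Carr: "CM ?C A f = FM (\<Phi>t A) (FM (\<Phi>1 A) (?QM A f))"
    if A: "small_cat A" and f: "VHom X0 A f X Y" for A f X Y
    using fun_onD[OF dm_fun[OF Fe A]] fun_onD[OF dm_fun[OF I(1) A]] fun_onD[OF strict_fun[OF S1 A]] in_homD(1)[OF f]
    by simp
  have QO: "?Q A X \<in> VObj Q0 A" "?V A X \<in> VObj X0 A"
    if A: "small_cat A" and X: "X \<in> VObj X0 A" for A X
    using fun_obj[OF strict_fun[OF S1 A] fun_obj[OF dm_fun[OF I(1) A] fun_obj[OF dm_fun[OF Fe A] X]]]
      fun_obj[OF dm_fun[OF I(1) A] fun_obj[OF dm_fun[OF Fe A] X]] by auto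
  have Qf: "VHom Q0 A (?QM A f) (?Q A X) (?Q A Y)"
    if A: "small_cat A" and f: "VHom X0 A f X Y" for A f X Y
    by (rule fun_hom[OF dm_fun[OF I(1) A] fun_hom[OF dm_fun[OF Fe A] f]])
  \<comment> \<open>The structure cell of \<open>Fi\<close> after \<open>Fe\<close>; the strict
    morphisms that follow merely apply their functors to it, as \<open>Cstr\<close> records.\<close>
  let ?w = "\<lambda>u A B X. VComp Q0 A (CM Fi A (ST Fe u X)) (ST Fi u (CO Fe B X))"
  have w: "VHom Q0 A (?w u A B X) (RO Q0 u (?Q B X)) (?Q A (RO X0 u X))"
    if u: "sfun u A B" and X: "X \<in> VObj X0 B" for u A B X
    by (rule comp_hom[OF val_cat[OF Q0 sfunD(2)[OF u]] dm_hom(1)[OF I(1) u fun_obj[OF dm_fun[OF Fe sfunD(3)[OF u]] X]]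
        fun_hom[OF dm_fun[OF I(1) sfunD(2)[OF u]] dm_hom(1)[OF Fe u X]]])
  have Cstr: "ST ?C u X = FM (\<Phi>t A) (FM (\<Phi>1 A) (?w u A B X))"
    if u: "sfun u A B" and X: "X \<in> VObj X0 B" for u A B X
  proof -
    note U = sfunD[OF u]
    note q = QO[OF U(3) X]
    note h1 = fun_hom[OF strict_fun[OF S1 U(2)] w[OF u X]]
    have 1: "ST (strict_dmor Q0 \<Phi>1 \<circ>\<^sub>d Fi \<circ>\<^sub>d Fe) u X = FM (\<Phi>1 A) (?w u A B X)"
      using comp_dmor_str(4)[OF dFi S1d u X0 Q0 X0 X] comp_dmor_str(4)[OF Fe I(1) u X0 Y0 Q0 X]
        strict_str[OF Q0 S1 u q(1)] comp_id_right[OF val_cat[OF X0 U(2)] h1]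
        comp_func_app(1)[OF dm_fun[OF Fe U(3)] X, of "Cpt Fi B"] by (simp del: strict_dmor_sel(2))
    have "CO (strict_dmor Q0 \<Phi>1 \<circ>\<^sub>d Fi \<circ>\<^sub>d Fe) B X = ?V B X"
      using fun_onD[OF dm_fun[OF Fe U(3)]] fun_onD[OF dm_fun[OF I(1) U(3)]] X by simp
    then show ?thesis using comp_dmor_str(4)[OF dF1 Std u X0 X0 T0 X] 1 strict_str[OF X0 St u q(2)]
        comp_id_right[OF val_cat[OF T0 U(2)] fun_hom[OF strict_fun[OF St U(2)] h1]]
        strict_app(1)[OF Q0 S1 u q(1)] by (simp del: strict_dmor_sel(2))
  qed
  have tri: "VComp T0 A (FM (\<Phi>t A) (\<delta> A V)) (\<tau> A (FO (\<Phi>t A) V)) = VId T0 A (FO (\<Phi>t A) V)"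
    and dh: "VHom X0 A (\<delta> A V) (CO Ft A (FO (\<Phi>t A) V)) V"
    if "small_cat A" "V \<in> VObj X0 A" for A V using d[OF that] by simp_all
  have un: "uarr (Val X0 A) (Val T0 A) (\<Phi>t A) W (CO Ft A W) (\<tau> A W)"
    if "small_cat A" "W \<in> VObj T0 A" for A W using T(3)[OF that] by simp
  \<comment> \<open>\<delta> is the counit of the adjunction between \<open>Ft\<close> and its
    strict right adjoint, specified only by a triangle identity. Naturality is therefore tested
    after applying \<Phi>t and composing with the universal \<tau>.\<close>
  have dn: "VComp X0 A (\<delta> A V') (CM Ft A (FM (\<Phi>t A) f)) = VComp X0 A f (\<delta> A V)"
    if A: "small_cat A" and f: "VHom X0 A f V V'" for A f V V'
  proof -
    note C = val_cat[OF T0 A] and CX = val_cat[OF X0 A]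
    note V = hom_obj(1)[OF CX f] and V' = hom_obj(2)[OF CX f]
    note P = strict_fun[OF St A]
    note Pf = fun_hom[OF P f]
    note PV = fun_obj[OF P V] and PV' = fun_obj[OF P V']
    note u = un[OF A PV] and u' = un[OF A PV']
    note FPf = fun_hom[OF dm_fun[OF T(1) A] Pf]
    show ?thesis
    proof (rule uarr_eq[OF u comp_hom[OF CX FPf dh[OF A V']] comp_hom[OF CX dh[OF A V] f]])
      have nat: "VComp T0 A (\<tau> A (FO (\<Phi>t A) V')) (FM (\<Phi>t A) f) =
          VComp T0 A (FM (\<Phi>t A) (CM Ft A (FM (\<Phi>t A) f))) (\<tau> A (FO (\<Phi>t A) V))"
        using T(4)[OF A Pf] by simp
      have "VComp T0 A (FM (\<Phi>t A) (VComp X0 A (\<delta> A V') (CM Ft A (FM (\<Phi>t A) f)))) (\<tau> A (FO (\<Phi>t A) V)) =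
          VComp T0 A (FM (\<Phi>t A) (\<delta> A V')) (VComp T0 A (\<tau> A (FO (\<Phi>t A) V')) (FM (\<Phi>t A) f))"
        unfolding nat using fun_comp[OF P FPf dh[OF A V']]
          comp_assoc[OF C uarrD(3)[OF u] fun_hom[OF P FPf] fun_hom[OF P dh[OF A V']]] by simp
      also have "\<dots> = FM (\<Phi>t A) f"
        by (rule comp_cancel[OF C Pf uarrD(3)[OF u'] fun_hom[OF P dh[OF A V']] tri[OF A V']])
      also have "\<dots> = VComp T0 A (FM (\<Phi>t A) (VComp X0 A f (\<delta> A V))) (\<tau> A (FO (\<Phi>t A) V))"
        using fun_comp[OF P dh[OF A V] f] comp_assoc[OF C uarrD(3)[OF u] fun_hom[OF P dh[OF A V]] Pf]
          tri[OF A V] comp_id_right[OF C Pf] by simp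
      finally show "VComp T0 A (FM (\<Phi>t A) (VComp X0 A (\<delta> A V') (CM Ft A (FM (\<Phi>t A) f)))) (\<tau> A (FO (\<Phi>t A) V)) =
         VComp T0 A (FM (\<Phi>t A) (VComp X0 A f (\<delta> A V))) (\<tau> A (FO (\<Phi>t A) V))" .
    qed
  qed
  \<comment> \<open>The same test for restriction along u; the inverse r of the structure cell first
    brings both sides to maps out of a value of \<open>Ft\<close>, where \<tau> is
    universal.\<close>
  have ds: "VComp X0 A (\<delta> A (RO X0 u V)) (ST Ft u (FO (\<Phi>t B) V)) = RM X0 u (\<delta> B V)"
    if u: "sfun u A B" and V: "V \<in> VObj X0 B" for u A B V
  proof -
    note U = sfunD[OF u]
    note C = val_cat[OF T0 U(2)] and CX = val_cat[OF X0 U(2)]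
    note P = strict_fun[OF St U(2)] and PB = strict_fun[OF St U(3)]
    note R = res_fun[OF X0 u] and RT = res_fun[OF T0 u]
    note uV = fun_obj[OF R V] and PV = fun_obj[OF PB V]
    note e = un[OF U(3) PV]
    note ah = strict_app(1)[OF X0 St u V]
    note s = dm_hom[OF T(1) u PV]
    have s1: "VHom X0 A (ST Ft u (FO (\<Phi>t B) V)) (RO X0 u (CO Ft B (FO (\<Phi>t B) V)))
        (CO Ft A (FO (\<Phi>t A) (RO X0 u V)))" using s(1) ah by simp
    note uW = uarrD(2)[OF e]
    have ue0: "VHom T0 A (RM T0 u (\<tau> B (FO (\<Phi>t B) V))) (FO (\<Phi>t A) (RO X0 u V))
        (FO (\<Phi>t A) (RO X0 u (CO Ft B (FO (\<Phi>t B) V))))"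
      using fun_hom[OF RT uarrD(3)[OF e]] ah strict_app(1)[OF X0 St u uW] by simp
    have st: "VComp T0 A (FM (\<Phi>t A) (ST Ft u (FO (\<Phi>t B) V))) (RM T0 u (\<tau> B (FO (\<Phi>t B) V))) =
        \<tau> A (FO (\<Phi>t A) (RO X0 u V))"
      using T(5)[OF u PV] strict_str[OF X0 St u uW] comp_id_left[OF C ue0] ah by (simp del: strict_dmor_sel(2))
    note us = fun_obj[OF P uV]
    obtain r where r: "VHom X0 A r (CO Ft A (FO (\<Phi>t A) (RO X0 u V))) (RO X0 u (CO Ft B (FO (\<Phi>t B) V)))"
      "VComp X0 A r (ST Ft u (FO (\<Phi>t B) V)) = VId X0 A (RO X0 u (CO Ft B (FO (\<Phi>t B) V)))"
      using iso_hom[OF s(2) s1] by blast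
    have eq: "VComp X0 A (RM X0 u (\<delta> B V)) r = \<delta> A (RO X0 u V)"
    proof (rule uarr_eq[OF un[OF U(2) us] comp_hom[OF CX r(1) fun_hom[OF R dh[OF U(3) V]]] dh[OF U(2) uV]])
      have "VComp T0 A (FM (\<Phi>t A) (VComp X0 A (RM X0 u (\<delta> B V)) r)) (\<tau> A (FO (\<Phi>t A) (RO X0 u V))) =
          VComp T0 A (FM (\<Phi>t A) (VComp X0 A (VComp X0 A (RM X0 u (\<delta> B V)) r)
          (ST Ft u (FO (\<Phi>t B) V)))) (RM T0 u (\<tau> B (FO (\<Phi>t B) V)))" unfolding st[symmetric]
        using fun_comp[OF P s1 comp_hom[OF CX r(1) fun_hom[OF R dh[OF U(3) V]]]]
          comp_assoc[OF C ue0 fun_hom[OF P s1] fun_hom[OF P comp_hom[OF CX r(1) fun_hom[OF R dh[OF U(3) V]]]]]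
        by simp
      also have "\<dots> = VComp T0 A (RM T0 u (FM (\<Phi>t B) (\<delta> B V))) (RM T0 u (\<tau> B (FO (\<Phi>t B) V)))"
        using comp_assoc[OF CX s1 r(1) fun_hom[OF R dh[OF U(3) V]]] r(2)
          comp_id_right[OF CX fun_hom[OF R dh[OF U(3) V]]] strict_app(2)[OF X0 St u dh[OF U(3) V]] by simp
      also have "\<dots> = VId T0 A (FO (\<Phi>t A) (RO X0 u V))"
        using fun_comp[OF RT uarrD(3)[OF e] fun_hom[OF PB dh[OF U(3) V]]] tri[OF U(3) V] fun_id[OF RT PV] ah by simp
      finally show "VComp T0 A (FM (\<Phi>t A) (VComp X0 A (RM X0 u (\<delta> B V)) r)) (\<tau> A (FO (\<Phi>t A) (RO X0 u V))) =
          VComp T0 A (FM (\<Phi>t A) (\<delta> A (RO X0 u V))) (\<tau> A (FO (\<Phi>t A) (RO X0 u V)))"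
        using tri[OF U(2) uV] by simp
    qed
    show ?thesis unfolding eq[symmetric]
      using comp_assoc[OF CX s1 r(1) fun_hom[OF R dh[OF U(3) V]]] r(2) comp_id_right[OF CX fun_hom[OF R dh[OF U(3) V]]]
      by simp
  qed
  have ch: "VHom X0 A (c A X) (FO (\<Phi>e A) (CO Fe A X)) X" and ci: "VIso X0 A (c A X)"
    if "small_cat A" "X \<in> VObj X0 A" for A X using c[OF that] by simp_all
  have aah: "VHom X0 A (a A X) X (?V A X)"
    and ac: "VComp X0 A (a A X) (c A X) = VComp X0 A (\<kappa> A (?Q A X)) (FM (\<Phi>e A) (\<eta> A (CO Fe A X)))"
    if "small_cat A" "X \<in> VObj X0 A" for A X using a[OF that] by simp_all
  have td: "VComp X0 A (\<delta> A (?V A X)) (\<theta> A X) = a A X"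
    and tu: "uarr (Val T0 A) (Val X0 A) (Cpt Ft A) X (FO (\<Phi>t A) (?V A X)) (\<theta> A X)"
    if "small_cat A" "X \<in> VObj X0 A" for A X using t[OF that] by simp_all
  have eh: "VHom Y0 A (\<eta> A Y) Y (FO (\<Phi>i A) (CO Fi A Y))"
    if "small_cat A" "Y \<in> VObj Y0 A" for A Y using uarrD(3)[OF I(3)[OF that]] by simp
  \<comment> \<open>a is known only through its composite with the invertible c. After composing
    with c, naturality follows from that of c, \<eta> and \<kappa>.\<close>
  have an: "VComp X0 A (a A Y) f = VComp X0 A (FM (\<Phi>1 A) (?QM A f)) (a A X)"
    if A: "small_cat A" and f: "VHom X0 A f X Y" for A f X Y
  proof -
    note C = val_cat[OF X0 A]
    note X = hom_obj(1)[OF C f] and Y = hom_obj(2)[OF C f]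
    note Pe = strict_fun[OF Se A] and Pi = strict_fun[OF Si A] and P1 = strict_fun[OF S1 A]
    note Ff = fun_hom[OF dm_fun[OF Fe A] f]
    note FX = fun_obj[OF dm_fun[OF Fe A] X] and FY = fun_obj[OF dm_fun[OF Fe A] Y]
    note PFf = fun_hom[OF Pe Ff]
    note eX = fun_hom[OF Pe eh[OF A FX]] and eY = fun_hom[OF Pe eh[OF A FY]]
    note kX = k[OF A QO(1)[OF A X]] and kY = k[OF A QO(1)[OF A Y]]
    note v = fun_hom[OF P1 Qf[OF A f]]
    note pq = fun_hom[OF Pe fun_hom[OF Pi Qf[OF A f]]]
    show ?thesis
    proof (rule iso_cancel_right[OF C comp_hom[OF C f aah[OF A Y]] comp_hom[OF C aah[OF A X] v] ch[OF A X] ci[OF A X]])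
      have "VComp X0 A (VComp X0 A (a A Y) f) (c A X) =
          VComp X0 A (VComp X0 A (a A Y) (c A Y)) (FM (\<Phi>e A) (CM Fe A f))"
        using comp_assoc[OF C ch[OF A X] f aah[OF A Y]] cn[OF A f] comp_assoc[OF C PFf ch[OF A Y] aah[OF A Y]] by simp
      also have "\<dots> = VComp X0 A (\<kappa> A (?Q A Y)) (FM (\<Phi>e A) (VComp Y0 A (\<eta> A (CO Fe A Y)) (CM Fe A f)))"
        using ac[OF A Y] comp_assoc[OF C PFf eY kY] fun_comp[OF Pe Ff eh[OF A FY]] by simp
      also have "\<dots> = VComp X0 A (\<kappa> A (?Q A Y)) (VComp X0 A (FM (\<Phi>e A) (FM (\<Phi>i A) (?QM A f))) (FM (\<Phi>e A) (\<eta> A (CO Fe A X))))"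
        using I(4)[OF A Ff] fun_comp[OF Pe eh[OF A FX] fun_hom[OF Pi Qf[OF A f]]] by simp
      also have "\<dots> = VComp X0 A (FM (\<Phi>1 A) (?QM A f)) (VComp X0 A (a A X) (c A X))"
        using comp_assoc[OF C eX pq kY] kn[OF A Qf[OF A f]] comp_assoc[OF C eX kX v] ac[OF A X] by simp
      also have "\<dots> = VComp X0 A (VComp X0 A (FM (\<Phi>1 A) (?QM A f)) (a A X)) (c A X)"
        using comp_assoc[OF C ch[OF A X] aah[OF A X] v] by simp
      finally show "VComp X0 A (VComp X0 A (a A Y) f) (c A X) =
         VComp X0 A (VComp X0 A (FM (\<Phi>1 A) (?QM A f)) (a A X)) (c A X)" .
    qed
  qed
  \<comment> \<open>Again c is cancelled; what remains combines the structure laws of \<eta>,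
    \<kappa> and c.\<close>
  have as: "VComp X0 A (FM (\<Phi>1 A) (?w u A B X)) (RM X0 u (a B X)) = a A (RO X0 u X)"
    if u: "sfun u A B" and X: "X \<in> VObj X0 B" for u A B X
  proof -
    note U = sfunD[OF u]
    note C = val_cat[OF X0 U(2)] and CY = val_cat[OF Y0 U(2)]
    note R = res_fun[OF X0 u] and RY = res_fun[OF Y0 u] and RQ = res_fun[OF Q0 u]
    note uX = fun_obj[OF R X]
    note Pe = strict_fun[OF Se U(2)] and Pi = strict_fun[OF Si U(2)] and P1 = strict_fun[OF S1 U(2)]
    note PeB = strict_fun[OF Se U(3)] and P1B = strict_fun[OF S1 U(3)] and PiB = strict_fun[OF Si U(3)]
    note FX = fun_obj[OF dm_fun[OF Fe U(3)] X] and FuX = fun_obj[OF dm_fun[OF Fe U(2)] uX]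
    note q = QO(1)[OF U(3) X] and qu = QO(1)[OF U(2) uX]
    note uq = fun_obj[OF RQ q]
    note ww = w[OF u X]
    note ew = strict_app(1)[OF Q0 S1 u q]
    have ua: "VHom X0 A (RM X0 u (a B X)) (RO X0 u X) (FO (\<Phi>1 A) (RO Q0 u (?Q B X)))"
      using fun_hom[OF R aah[OF U(3) X]] ew by simp
    note w1 = fun_hom[OF P1 ww]
    note uc = fun_hom[OF R ch[OF U(3) X]]
    have uci: "VIso X0 A (RM X0 u (c B X))" by (rule fun_iso[OF R ch[OF U(3) X] ci[OF U(3) X]])
    note sE = dm_hom(1)[OF Fe u X] and sI = dm_hom(1)[OF I(1) u FX]
    have ueta: "VHom Y0 A (RM Y0 u (\<eta> B (CO Fe B X))) (RO Y0 u (CO Fe B X))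
        (FO (\<Phi>i A) (RO Q0 u (?Q B X)))" using fun_hom[OF RY eh[OF U(3) FX]] strict_app(1)[OF Q0 Si u q] by simp
    have stI: "VComp Y0 A (FM (\<Phi>i A) (ST Fi u (CO Fe B X))) (RM Y0 u (\<eta> B (CO Fe B X))) =
        \<eta> A (RO Y0 u (CO Fe B X))" using I(5)[OF u FX] strict_str[OF Q0 Si u q] comp_id_left[OF CY ueta]
      by (simp del: strict_dmor_sel(2))
    note Fs = fun_hom[OF dm_fun[OF I(1) U(2)] sE]
    have iw: "VComp Y0 A (FM (\<Phi>i A) (?w u A B X)) (RM Y0 u (\<eta> B (CO Fe B X))) =
        VComp Y0 A (\<eta> A (CO Fe A (RO X0 u X))) (ST Fe u X)"
      using fun_comp[OF Pi sI Fs] comp_assoc[OF CY ueta fun_hom[OF Pi sI] fun_hom[OF Pi Fs]] stI I(4)[OF U(2) sE] by simp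
    have ke: "RM X0 u (VComp X0 B (\<kappa> B (?Q B X)) (FM (\<Phi>e B) (\<eta> B (CO Fe B X)))) =
        VComp X0 A (\<kappa> A (RO Q0 u (?Q B X))) (FM (\<Phi>e A) (RM Y0 u (\<eta> B (CO Fe B X))))"
      using fun_comp[OF R fun_hom[OF PeB eh[OF U(3) FX]] k[OF U(3) q]] ks[OF u q]
        strict_app(2)[OF Y0 Se u eh[OF U(3) FX]] by simp
    note eu = fun_hom[OF Pe ueta] and ku = k[OF U(2) uq] and iwh = fun_hom[OF Pi ww]
    note kq = k[OF U(2) qu] and e2 = fun_hom[OF Pe eh[OF U(2) FuX]] and sE' = fun_hom[OF Pe sE]
    show ?thesis
    proof (rule iso_cancel_right[OF C comp_hom[OF C ua w1] aah[OF U(2) uX] uc uci])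
      have "VComp X0 A (VComp X0 A (FM (\<Phi>1 A) (?w u A B X)) (RM X0 u (a B X))) (RM X0 u (c B X)) =
          VComp X0 A (FM (\<Phi>1 A) (?w u A B X)) (RM X0 u (VComp X0 B (a B X) (c B X)))"
        using comp_assoc[OF C uc ua w1] fun_comp[OF R ch[OF U(3) X] aah[OF U(3) X]] by simp
      also have "\<dots> = VComp X0 A (VComp X0 A (FM (\<Phi>1 A) (?w u A B X)) (\<kappa> A (RO Q0 u (?Q B X))))
          (FM (\<Phi>e A) (RM Y0 u (\<eta> B (CO Fe B X))))"
        using ac[OF U(3) X] ke comp_assoc[OF C eu ku w1] by simp
      also have "\<dots> = VComp X0 A (\<kappa> A (?Q A (RO X0 u X)))
         (FM (\<Phi>e A) (VComp Y0 A (FM (\<Phi>i A) (?w u A B X)) (RM Y0 u (\<eta> B (CO Fe B X)))))"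
        using kn[OF U(2) ww] comp_assoc[OF C eu fun_hom[OF Pe iwh] kq] fun_comp[OF Pe ueta iwh] by simp
      also have "\<dots> = VComp X0 A (VComp X0 A (\<kappa> A (?Q A (RO X0 u X)))
          (FM (\<Phi>e A) (\<eta> A (CO Fe A (RO X0 u X))))) (FM (\<Phi>e A) (ST Fe u X))"
        using iw fun_comp[OF Pe sE eh[OF U(2) FuX]] comp_assoc[OF C sE' e2 kq] by simp
      also have "\<dots> = VComp X0 A (a A (RO X0 u X)) (RM X0 u (c B X))"
        using ac[OF U(2) uX] comp_assoc[OF C sE' ch[OF U(2) uX] aah[OF U(2) uX]] cs[OF u X] by simp
      finally show "VComp X0 A (VComp X0 A (FM (\<Phi>1 A) (?w u A B X)) (RM X0 u (a B X))) (RM X0 u (c B X)) =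
          VComp X0 A (a A (RO X0 u X)) (RM X0 u (c B X))" .
    qed
  qed
  \<comment> \<open>Since \<delta> \<circ> \<theta> = a with \<delta> invertible at the objects in
    question, the laws for \<theta> reduce to those for a and \<delta>.\<close>
  show ?thesis
  proof (rule dadjI[OF dC T(1)])
    fix A X assume A: "small_cat A" and X: "X \<in> VObj X0 A"
    show "uarr (Val T0 A) (Val X0 A) (Cpt Ft A) X (CO ?C A X) (\<theta> A X)"
      unfolding Cobj[OF A X] by (rule tu[OF A X])
  next
    fix A f X Y assume A: "small_cat A" and f: "VHom X0 A f X Y"
    note C = val_cat[OF X0 A]
    note X = hom_obj(1)[OF C f] and Y = hom_obj(2)[OF C f]
    note tX = uarrD(3)[OF tu[OF A X]] and tY = uarrD(3)[OF tu[OF A Y]]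
    note v = fun_hom[OF strict_fun[OF S1 A] Qf[OF A f]]
    note Fv = fun_hom[OF dm_fun[OF T(1) A] fun_hom[OF strict_fun[OF St A] v]]
    note VY = QO(2)[OF A Y] and VX = QO(2)[OF A X]
    show "VComp X0 A (\<theta> A Y) f = VComp X0 A (CM Ft A (CM ?C A f)) (\<theta> A X)" unfolding Carr[OF A f]
      by (rule iso_cancel_left[OF C comp_hom[OF C f tY] comp_hom[OF C tX Fv] dh[OF A VY] di[OF A Y]])
        (use comp_assoc[OF C f tY dh[OF A VY]] td[OF A Y] comp_assoc[OF C tX Fv dh[OF A VY]] dn[OF A v]
          comp_assoc[OF C tX dh[OF A VX] v] td[OF A X] an[OF A f] in simp)
  next
    fix u A B X assume u: "sfun u A B" and X: "X \<in> VObj X0 B"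
    note U = sfunD[OF u]
    note C = val_cat[OF X0 U(2)]
    note R = res_fun[OF X0 u]
    note uX = fun_obj[OF R X]
    note V = QO(2)[OF U(3) X] and Vu = QO(2)[OF U(2) uX] and q = QO(1)[OF U(3) X]
    note uV = fun_obj[OF R V]
    have w1: "VHom X0 A (FM (\<Phi>1 A) (?w u A B X)) (RO X0 u (?V B X)) (?V A (RO X0 u X))"
      using fun_hom[OF strict_fun[OF S1 U(2)] w[OF u X]] strict_app(1)[OF Q0 S1 u q] by simp
    note Fw = fun_hom[OF dm_fun[OF T(1) U(2)] fun_hom[OF strict_fun[OF St U(2)] w1]]
    note PV = fun_obj[OF strict_fun[OF St U(3)] V]
    have s: "VHom X0 A (ST Ft u (FO (\<Phi>t B) (?V B X))) (RO X0 u (CO Ft B (FO (\<Phi>t B) (?V B X))))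
        (CO Ft A (FO (\<Phi>t A) (RO X0 u (?V B X))))"
      using dm_hom(1)[OF T(1) u PV] strict_app(1)[OF X0 St u V] by simp
    note ut = fun_hom[OF R uarrD(3)[OF tu[OF U(3) X]]]
    note st = comp_hom[OF C ut s]
    show "VComp X0 A (CM Ft A (ST ?C u X))
        (VComp X0 A (ST Ft u (CO ?C B X)) (RM X0 u (\<theta> B X))) = \<theta> A (RO X0 u X)"
      unfolding Cstr[OF u X] Cobj[OF U(3) X]
      by (rule iso_cancel_left[OF C comp_hom[OF C st Fw] uarrD(3)[OF tu[OF U(2) uX]] dh[OF U(2) Vu] di[OF U(2) uX]])
        (use comp_assoc[OF C st Fw dh[OF U(2) Vu]] dn[OF U(2) w1] comp_assoc[OF C st dh[OF U(2) uV] w1]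
          comp_assoc[OF C ut s dh[OF U(2) uV]] ds[OF u V] fun_comp[OF R uarrD(3)[OF tu[OF U(3) X]] dh[OF U(3) V]]
          td[OF U(3) X] as[OF u X] td[OF U(2) uX] in simp)
  qed
qed

subsection \<open>Adjunctions of small categories\<close>

definition cat_adj where
  "cat_adj g t \<alpha> \<beta> P Q \<longleftrightarrow> sfun g P Q \<and> sfun t Q P \<and>
     snt \<alpha> (id_func P) (t \<circ>\<^sub>f g) P P \<and> snt \<beta> (g \<circ>\<^sub>f t) (id_func Q) Q Q \<and>
     (\<forall>x\<in>Obj P. Comp Q (Cmp \<beta> (FO g x)) (FM g (Cmp \<alpha> x)) = Id Q (FO g x)) \<and>
     (\<forall>y\<in>Obj Q. Comp P (FM t (Cmp \<beta> y)) (Cmp \<alpha> (FO t y)) = Id P (FO t y))"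

lemma cat_adj_res:
  assumes D: "pder D" and a: "cat_adj g t \<alpha> \<beta> P Q"
  shows "X \<in> VObj D P \<Longrightarrow>
      uarr (Val D Q) (Val D P) (Res D g) X (RO D t X) (Cmp (Res2 D \<alpha>) X)"
    "Y \<in> VObj D Q \<Longrightarrow> darr (Val D P) (Val D Q) (Res D t) Y (RO D g Y) (Cmp (Res2 D \<beta>) Y)"
  using res_adjunction[OF D, of g P Q t \<alpha> \<beta>] a by (auto simp: cat_adj_def)

lemma param_comp:
  assumes "sfun u A B" "sfun v B C" "small_cat K"
  shows "(v \<circ>\<^sub>f u) \<times>\<^sub>f id_func K = (v \<times>\<^sub>f id_func K) \<circ>\<^sub>f (u \<times>\<^sub>f id_func K)"
proof -
  note i = fun_on_id[OF small_cat_is_cat[OF assms(3)]]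
  show ?thesis
    using prod_func_comp[OF sfunD(1)[OF assms(1)] i sfunD(1)[OF assms(2)] i] comp_id_func(1)[OF i] by simp
qed

lemma cat_adj_prod:
  assumes reg: "regular_universe TYPE('k)" and K: "small_cat (K :: 'k scat)" and a: "cat_adj g t \<alpha> \<beta> P Q"
  defines "n \<equiv> id_nt (id_func K)"
  shows "cat_adj (g \<times>\<^sub>f id_func K) (t \<times>\<^sub>f id_func K) (\<alpha> \<times>\<^sub>n n) (\<beta> \<times>\<^sub>n n) (P \<times>\<^sub>c K) (Q \<times>\<^sub>c K)"
proof -
  have g: "sfun g P Q" and t: "sfun t Q P" and al: "snt \<alpha> (id_func P) (t \<circ>\<^sub>f g) P P"
    and be: "snt \<beta> (g \<circ>\<^sub>f t) (id_func Q) Q Q"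
    and t1: "\<And>x. x \<in> Obj P \<Longrightarrow> Comp Q (Cmp \<beta> (FO g x)) (FM g (Cmp \<alpha> x)) = Id Q (FO g x)"
    and t2: "\<And>y. y \<in> Obj Q \<Longrightarrow> Comp P (FM t (Cmp \<beta> y)) (Cmp \<alpha> (FO t y)) = Id P (FO t y)"
    using a by (auto simp: cat_adj_def)
  note G = sfunD[OF g] and T = sfunD[OF t] and KC = small_cat_is_cat[OF K]
  have nn: "snt n (id_func K) (id_func K) K K" unfolding n_def by (rule snt_id[OF sfun_id[OF K]])
  have nk: "Cmp n k = Id K k" if "k \<in> Obj K" for k using that by (simp add: n_def)
  note an = cmp_prod_nt[OF sntD(1)[OF al] sntD(1)[OF nn]] and bn = cmp_prod_nt[OF sntD(1)[OF be] sntD(1)[OF nn]]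
  have aA: "Cmp \<alpha> x \<in> Arr P" if "x \<in> Obj P" for x using in_homD(1)[OF nt_hom[OF sntD(1)[OF al] that]] .
  have bA: "Cmp \<beta> x \<in> Arr Q" if "x \<in> Obj Q" for x using in_homD(1)[OF nt_hom[OF sntD(1)[OF be] that]] .
  show ?thesis unfolding cat_adj_def
  proof (intro conjI ballI)
    show "sfun (g \<times>\<^sub>f id_func K) (P \<times>\<^sub>c K) (Q \<times>\<^sub>c K)" "sfun (t \<times>\<^sub>f id_func K) (Q \<times>\<^sub>c K) (P \<times>\<^sub>c K)"
      by (rule sfun_prod[OF reg g sfun_id[OF K]], rule sfun_prod[OF reg t sfun_id[OF K]])
    show "snt (\<alpha> \<times>\<^sub>n n) (id_func (P \<times>\<^sub>c K)) ((t \<times>\<^sub>f id_func K) \<circ>\<^sub>f (g \<times>\<^sub>f id_func K)) (P \<times>\<^sub>c K) (P \<times>\<^sub>c K)"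
      using snt_prod[OF reg al nn] by (simp add: param_comp[OF g t K] prod_func_id[OF G(4) KC])
    show "snt (\<beta> \<times>\<^sub>n n) ((g \<times>\<^sub>f id_func K) \<circ>\<^sub>f (t \<times>\<^sub>f id_func K)) (id_func (Q \<times>\<^sub>c K)) (Q \<times>\<^sub>c K) (Q \<times>\<^sub>c K)"
      using snt_prod[OF reg be nn] by (simp add: param_comp[OF t g K] prod_func_id[OF G(5) KC])
  next
    fix x assume "x \<in> Obj (P \<times>\<^sub>c K)"
    then obtain p k where x: "x = Pair p k" "p \<in> Obj P" "k \<in> Obj K" by (rule prod_cat_objE)
    note gp = fun_obj[OF G(1) x(2)]
    show "Comp (Q \<times>\<^sub>c K) (Cmp (\<beta> \<times>\<^sub>n n) (FO (g \<times>\<^sub>f id_func K) x)) (FM (g \<times>\<^sub>f id_func K) (Cmp (\<alpha> \<times>\<^sub>n n) x)) =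
        Id (Q \<times>\<^sub>c K) (FO (g \<times>\<^sub>f id_func K) x)"
      using x gp in_homD(1)[OF id_hom[OF KC x(3)]] aA[OF x(2)] comp_id_left[OF KC id_hom[OF KC x(3)]]
      by (simp add: an[OF x(2,3)] bn[OF gp x(3)] G nk t1)
  next
    fix y assume "y \<in> Obj (Q \<times>\<^sub>c K)"
    then obtain q k where y: "y = Pair q k" "q \<in> Obj Q" "k \<in> Obj K" by (rule prod_cat_objE)
    note tq = fun_obj[OF T(1) y(2)]
    show "Comp (P \<times>\<^sub>c K) (FM (t \<times>\<^sub>f id_func K) (Cmp (\<beta> \<times>\<^sub>n n) y)) (Cmp (\<alpha> \<times>\<^sub>n n) (FO (t \<times>\<^sub>f id_func K) y)) =
        Id (P \<times>\<^sub>c K) (FO (t \<times>\<^sub>f id_func K) y)"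
      using y tq in_homD(1)[OF id_hom[OF KC y(3)]] bA[OF y(2)] comp_id_left[OF KC id_hom[OF KC y(3)]]
      by (simp add: bn[OF y(2,3)] an[OF tq y(3)] T nk t2)
  qed
qed

definition thin :: "('o, 'm) cat \<Rightarrow> bool" where
  "thin C \<longleftrightarrow> (\<forall>f g x y. in_hom C f x y \<longrightarrow> in_hom C g x y \<longrightarrow> f = g)"

text \<open>Parallel arrows agree, so the triangle identities are automatic once unit and counit
  have the right boundaries.\<close>

lemma cat_adj_thin:
  assumes P: "thin P" and Q: "thin Q" and g: "sfun g P Q" and t: "sfun t Q P"
    and a: "snt \<alpha> (id_func P) (t \<circ>\<^sub>f g) P P" and b: "snt \<beta> (g \<circ>\<^sub>f t) (id_func Q) Q Q"
  shows "cat_adj g t \<alpha> \<beta> P Q" unfolding cat_adj_def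
proof (intro conjI ballI g t a b)
  note G = sfunD[OF g] and T = sfunD[OF t]
  fix x assume x: "x \<in> Obj P"
  note gx = fun_obj[OF G(1) x]
  have 1: "in_hom P (Cmp \<alpha> x) x (FO t (FO g x))" using nt_hom[OF sntD(1)[OF a] x] x by (simp add: G)
  have 2: "in_hom Q (Cmp \<beta> (FO g x)) (FO g (FO t (FO g x))) (FO g x)"
    using nt_hom[OF sntD(1)[OF b] gx] gx by (simp add: T)
  from comp_hom[OF G(5) fun_hom[OF G(1) 1] 2] id_hom[OF G(5) gx]
  show "Comp Q (Cmp \<beta> (FO g x)) (FM g (Cmp \<alpha> x)) = Id Q (FO g x)" using Q unfolding thin_def by blast
next
  note G = sfunD[OF g] and T = sfunD[OF t]
  fix y assume y: "y \<in> Obj Q"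
  note ty = fun_obj[OF T(1) y]
  have 1: "in_hom Q (Cmp \<beta> y) (FO g (FO t y)) y" using nt_hom[OF sntD(1)[OF b] y] y by (simp add: T)
  have 2: "in_hom P (Cmp \<alpha> (FO t y)) (FO t y) (FO t (FO g (FO t y)))"
    using nt_hom[OF sntD(1)[OF a] ty] ty by (simp add: G)
  from comp_hom[OF T(5) 2 fun_hom[OF T(1) 1]] id_hom[OF T(5) ty]
  show "Comp P (FM t (Cmp \<beta> y)) (Cmp \<alpha> (FO t y)) = Id P (FO t y)" using P unfolding thin_def by blast
qed

lemma fun_on_thin:
  assumes A: "is_cat A" and B: "is_cat B" "thin B"
    and fo: "\<And>x. x \<in> Obj A \<Longrightarrow> fo x \<in> Obj B"
    and fm: "\<And>f x y. in_hom A f x y \<Longrightarrow> in_hom B (fm f) (fo x) (fo y)"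
  shows "fun_on (mk_func A B fo fm) A B"
proof (rule fun_onI[OF A B(1)])
  have eq: "f = g" if "in_hom B f x y" "in_hom B g x y" for f g x y using B(2) that unfolding thin_def by blast
  show "fm (Id A x) = Id B (fo x)" if "x \<in> Obj A" for x
    by (rule eq[OF fm[OF id_hom[OF A that]] id_hom[OF B(1) fo[OF that]]])
  show "fm (Comp A g f) = Comp B (fm g) (fm f)" if "in_hom A f x y" "in_hom A g y z" for f g x y z
    by (rule eq[OF fm[OF comp_hom[OF A that]] comp_hom[OF B(1) fm[OF that(1)] fm[OF that(2)]]])
qed (use fo fm in auto)

lemma func_eq_thin:
  assumes u: "fun_on u A B" and v: "fun_on v A B" and B: "thin B"
    and o: "\<And>x. x \<in> Obj A \<Longrightarrow> FO u x = FO v x"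
  shows "u = v"
proof (rule func_eqI[OF u v o])
  fix f assume "f \<in> Arr A"
  then have f: "in_hom A f (Dom A f) (Cod A f)" by (rule arr_hom)
  note c = hom_obj[OF fun_onD(4)[OF u] f]
  show "FM u f = FM v f" using fun_hom[OF u f] fun_hom[OF v f] o[OF c(1)] o[OF c(2)] B unfolding thin_def by metis
qed

lemma nt_on_thin:
  assumes u: "fun_on u A B" and v: "fun_on v A B" and B: "thin B"
    and t: "\<And>x. x \<in> Obj A \<Longrightarrow> in_hom B (t x) (FO u x) (FO v x)"
  shows "nt_on (mk_ntrans u v t) u v A B"
proof (rule nt_onI[OF u v])
  note U = fun_onD[OF u]
  show "Cmp (mk_ntrans u v t) \<in> extensional (Obj A)" using mk_ntrans_sel(4)[of u] U by simp
  show h: "in_hom B (Cmp (mk_ntrans u v t) x) (FO u x) (FO v x)" if "x \<in> Obj A" for x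
    using t[OF that] that U by simp
  show "Comp B (Cmp (mk_ntrans u v t) y) (FM u f) = Comp B (FM v f) (Cmp (mk_ntrans u v t) x)"
    if f: "in_hom A f x y" for f x y using comp_hom[OF U(5) fun_hom[OF u f] h[OF hom_obj(2)[OF U(4) f]]]
      comp_hom[OF U(5) h[OF hom_obj(1)[OF U(4) f]] fun_hom[OF v f]] B unfolding thin_def by blast
qed simp_all

subsection \<open>The interval, the square and the corner\<close>

lemma poset_cat_hom:
  "in_hom (poset_cat P le) f x y \<longleftrightarrow> f = Pair x y \<and> x \<in> P \<and> y \<in> P \<and> le x y"
  by (auto simp: in_hom_def poset_cat_def)

lemma poset_cat_sel [simp]:
  "Obj (poset_cat P le) = P" "Id (poset_cat P le) x = Pair x x"
  "Comp (poset_cat P le) g f = Pair (pfst f) (psnd g)" by (simp_all add: poset_cat_def)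

lemma poset_cat:
  assumes "\<And>x. x \<in> P \<Longrightarrow> le x x" "\<And>x y z. le x y \<Longrightarrow> le y z \<Longrightarrow> le x z"
  shows "is_cat (poset_cat P le)" "thin (poset_cat P le)"
proof -
  show "thin (poset_cat P le)" by (simp add: thin_def poset_cat_hom)
  show "is_cat (poset_cat P le)" unfolding is_cat_def poset_cat_hom using assms by (auto simp: poset_cat_def)
qed

lemma small_poset:
  assumes reg: "regular_universe TYPE('k)" and fin: "finite (P :: 'k el set)"
    and le: "\<And>x. x \<in> P \<Longrightarrow> le x x" "\<And>x y z. le x y \<Longrightarrow> le y z \<Longrightarrow> le x z"
  shows "small_cat (poset_cat P le)"
proof -
  have "Arr (poset_cat P le) \<subseteq> (\<lambda>(x, y). Pair x y) ` (P \<times> P)" by (auto simp: poset_cat_def)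
  then have "finite (Arr (poset_cat P le))" using fin finite_subset by blast
  then show ?thesis using small_finite[OF reg] fin poset_cat(1)[of P le, OF le] by (simp add: small_cat_def)
qed

lemma interval_obj: "x \<in> Obj interval \<longleftrightarrow> x = Bit False \<or> x = Bit True"
  by (simp add: interval_def)

lemma interval_hom:
  "in_hom interval f x y \<longleftrightarrow> f = Pair x y \<and> x \<in> Obj interval \<and> y \<in> Obj interval \<and> (the_bit x \<longrightarrow> the_bit y)"
  by (simp add: interval_def poset_cat_hom)

lemma interval_id [simp]: "Id interval x = Pair x x" by (simp add: interval_def)

lemma interval_cat: "is_cat interval" "thin interval" unfolding interval_def by (rule poset_cat; auto)+

lemma small_interval: "regular_universe TYPE('k) \<Longrightarrow> small_cat (interval :: 'k scat)"
  unfolding interval_def by (rule small_poset) auto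

lemma thin_prod: "thin A \<Longrightarrow> thin B \<Longrightarrow> thin (A \<times>\<^sub>c B)"
  unfolding thin_def by (auto elim!: prod_cat_homE)

lemma one_thin: "thin one" unfolding one_def by (rule poset_cat) auto

lemma square_thin: "thin square" unfolding square_def by (rule thin_prod[OF interval_cat(2) interval_cat(2)])

lemma square_cat: "is_cat square" unfolding square_def by (rule is_cat_prod[OF interval_cat(1) interval_cat(1)])

lemma small_square: "regular_universe TYPE('k) \<Longrightarrow> small_cat (square :: 'k scat)"
  unfolding square_def by (rule small_cat_prod) (auto intro: small_interval)

lemma full_subcat_hom:
  "in_hom (full_subcat C S) f x y \<longleftrightarrow> in_hom C f x y \<and> x \<in> S \<and> y \<in> S"
  by (auto simp: in_hom_def full_subcat_def)

lemma full_subcat_sel [simp]: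
  "Obj (full_subcat C S) = Obj C \<inter> S" "Id (full_subcat C S) = Id C" "Comp (full_subcat C S) = Comp C"
  by (simp_all add: full_subcat_def)

lemma full_subcat_cat:
  assumes C: "is_cat C"
  shows "is_cat (full_subcat C S)" unfolding is_cat_def full_subcat_hom full_subcat_sel
proof (intro conjI ballI impI)
  let ?S = "full_subcat C S"
  have s: "Dom ?S = Dom C" "Cod ?S = Cod C" "f \<in> Arr ?S \<longleftrightarrow> f \<in> Arr C \<and> Dom C f \<in> S \<and> Cod C f \<in> S" for f
    by (auto simp: full_subcat_def)
  fix f assume "f \<in> Arr ?S"
  then have f: "f \<in> Arr C" "Dom C f \<in> S" "Cod C f \<in> S" using s by auto
  show "Dom ?S f \<in> Obj C \<inter> S" "Cod ?S f \<in> Obj C \<inter> S" using hom_obj[OF C arr_hom[OF f(1)]] f s by auto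
  show "Comp C f (Id C (Dom ?S f)) = f" "Comp C (Id C (Cod ?S f)) f = f" using comp_id[OF C f(1)] s by auto
  fix g assume "g \<in> Arr ?S"
  then have g: "g \<in> Arr C" "Dom C g \<in> S" "Cod C g \<in> S" using s by auto
  {
    assume "Cod ?S f = Dom ?S g"
    then show "in_hom C (Comp C g f) (Dom ?S f) (Cod ?S g)" "Dom ?S f \<in> S" "Cod ?S g \<in> S"
      using comp_hom[OF C arr_hom[OF f(1)]] arr_hom[OF g(1)] f g s by auto
  }
  fix h assume "h \<in> Arr ?S" "Cod ?S f = Dom ?S g \<and> Cod ?S g = Dom ?S h"
  then show "Comp C h (Comp C g f) = Comp C (Comp C h g) f" using f g s by (simp add: cat_simps[OF C])
next
  fix x assume "x \<in> Obj C \<inter> S"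
  then show "in_hom C (Id C x) x x" "x \<in> S" "x \<in> S" using id_hom[OF C] by auto
qed

lemma corner_cat: "is_cat corner" "thin corner"
proof -
  show "is_cat corner" unfolding corner_def by (rule full_subcat_cat[OF square_cat])
  show "thin corner" using square_thin unfolding thin_def corner_def full_subcat_hom by blast
qed

lemma small_corner: "regular_universe TYPE('k) \<Longrightarrow> small_cat (corner :: 'k scat)"
proof -
  assume "regular_universe TYPE('k)"
  then have s: "small (Obj (square :: 'k scat))" "small (Arr (square :: 'k scat))"
    using small_square by (auto simp: small_cat_def)
  have "Obj (corner :: 'k scat) \<subseteq> Obj square" "Arr (corner :: 'k scat) \<subseteq> Arr square"
    by (auto simp: corner_def full_subcat_def)
  then show ?thesis using s small_subset corner_cat(1) by (auto simp: small_cat_def)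
qed

lemma square_obj: "Pair a b \<in> Obj square \<longleftrightarrow> a \<in> Obj interval \<and> b \<in> Obj interval"
  by (simp add: square_def)

lemma square_hom:
  "in_hom square (Pair f g) (Pair a b) (Pair c d) \<longleftrightarrow> in_hom interval f a c \<and> in_hom interval g b d"
  by (simp add: square_def)

lemma square_objE:
  assumes "x \<in> Obj square"
  obtains a b where "x = Pair a b" "a \<in> Obj interval" "b \<in> Obj interval"
  using assms unfolding square_def by (rule prod_cat_objE)

lemma square_homE:
  assumes "in_hom square h x y"
  obtains f g a b c d where "h = Pair f g" "x = Pair a b" "y = Pair c d" "in_hom interval f a c"
    "in_hom interval g b d" using assms unfolding square_def by (rule prod_cat_homE)

lemma corner_obj: "Pair a b \<in> Obj corner \<longleftrightarrow> a \<in> Obj interval \<and> b \<in> Obj interval \<and> \<not> (a = Bit True \<and> b = Bit True)"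
  by (auto simp: corner_def square_obj)

lemma corner_hom:
  "in_hom corner f x y \<longleftrightarrow> in_hom square f x y \<and> x \<noteq> Pair (Bit True) (Bit True) \<and> y \<noteq> Pair (Bit True) (Bit True)"
  by (simp add: corner_def full_subcat_hom)

lemma corner_objE:
  assumes "x \<in> Obj corner"
  obtains "x = Pair (Bit False) (Bit False)" | "x = Pair (Bit True) (Bit False)" | "x = Pair (Bit False) (Bit True)"
proof -
  have "x \<in> Obj square" using assms by (simp add: corner_def)
  then show ?thesis using assms that by (auto elim!: square_objE simp: corner_obj interval_obj)
qed

section \<open>Adjunctions between interval, corner, square and point\<close>

definition corner_proj :: "'k sfunc" where "corner_proj = mk_func corner interval pfst pfst"

definition square_proj :: "'k sfunc" where "square_proj = mk_func square interval pfst pfst"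

definition square_edge :: "'k sfunc" where
  "square_edge = mk_func interval square (\<lambda>a. Pair a (Bit True)) (\<lambda>f. Pair f (Id interval (Bit True)))"

text \<open>The counit of \<open>corner_edge\<close> -| \<open>corner_proj\<close>: the composite
  moves only the vertex (0,1), to (0,0).\<close>

definition corner_counit :: "'k sntrans" where
  "corner_counit = mk_ntrans (corner_edge \<circ>\<^sub>f corner_proj) (id_func corner)
     (\<lambda>x. Pair (Pair (pfst x) (pfst x)) (Pair (Bit False) (psnd x)))"

text \<open>The unit of \<open>square_proj\<close> -| \<open>square_edge\<close>: each vertex (a,b)
  maps to (a,1).\<close>

definition square_unit :: "'k sntrans" where
  "square_unit = mk_ntrans (id_func square) (square_edge \<circ>\<^sub>f square_proj)
     (\<lambda>x. Pair (Pair (pfst x) (pfst x)) (Pair (psnd x) (Bit True)))"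

definition pt_unit :: "'k sntrans" where
  "pt_unit = mk_ntrans (id_func interval) (pt interval (Bit True) \<circ>\<^sub>f bang interval) (\<lambda>x. Pair x (Bit True))"

context
  assumes reg: "regular_universe TYPE('k)"
begin

lemma sfun_corner_edge: "sfun (corner_edge :: 'k sfunc) interval corner" unfolding sfun_def corner_edge_def
  by (auto intro!: fun_on_thin small_interval[OF reg] small_corner[OF reg] interval_cat corner_cat
      simp: corner_obj corner_hom square_hom interval_hom interval_obj)

lemma sfun_corner_incl: "sfun (corner_incl :: 'k sfunc) corner square" unfolding sfun_def corner_incl_def
  by (auto intro!: fun_on_thin small_square[OF reg] small_corner[OF reg] square_cat square_thin corner_cat
      simp: corner_hom) (simp add: corner_def)

lemma sfun_cof_edge: "sfun (cof_edge :: 'k sfunc) interval square" unfolding sfun_def cof_edge_def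
  by (auto intro!: fun_on_thin small_interval[OF reg] small_square[OF reg] interval_cat square_cat square_thin
      simp: square_obj square_hom interval_hom interval_obj)

lemma sfun_corner_proj: "sfun (corner_proj :: 'k sfunc) corner interval" unfolding sfun_def corner_proj_def
  by (auto intro!: fun_on_thin small_interval[OF reg] small_corner[OF reg] interval_cat corner_cat
      elim!: square_homE simp: corner_hom) (auto elim!: corner_objE simp: interval_obj)

lemma sfun_square_proj: "sfun (square_proj :: 'k sfunc) square interval" unfolding sfun_def square_proj_def
  by (auto intro!: fun_on_thin small_interval[OF reg] small_square[OF reg] interval_cat square_cat
      elim!: square_homE square_objE)

lemma sfun_square_edge: "sfun (square_edge :: 'k sfunc) interval square" unfolding sfun_def square_edge_def
  by (auto intro!: fun_on_thin small_interval[OF reg] small_square[OF reg] interval_cat square_cat square_thin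
      simp: square_obj square_hom interval_hom interval_obj)

lemma sfun_pt_interval: "sfun (pt interval (Bit True)) (one :: 'k scat) interval"
  by (rule sfun_pt[OF reg small_interval[OF reg]]) (simp add: interval_obj)

lemma corner_proj_edge: "corner_proj \<circ>\<^sub>f corner_edge = id_func (interval :: 'k scat)"
  by (rule func_eq_thin[OF sfunD(1)[OF sfun_comp[OF sfun_corner_edge sfun_corner_proj]]
        fun_on_id[OF interval_cat(1)] interval_cat(2)])
    (auto simp: corner_edge_def corner_proj_def interval_obj corner_obj)

lemma square_proj_edge: "square_proj \<circ>\<^sub>f square_edge = id_func (interval :: 'k scat)"
  by (rule func_eq_thin[OF sfunD(1)[OF sfun_comp[OF sfun_square_edge sfun_square_proj]]
        fun_on_id[OF interval_cat(1)] interval_cat(2)])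
    (auto simp: square_edge_def square_proj_def interval_obj square_obj)

lemma square_proj_corner: "square_proj \<circ>\<^sub>f (corner_incl \<circ>\<^sub>f corner_edge) = id_func (interval :: 'k scat)"
  by (rule func_eq_thin[OF sfunD(1)[OF sfun_comp[OF sfun_comp[OF sfun_corner_edge sfun_corner_incl] sfun_square_proj]]
        fun_on_id[OF interval_cat(1)] interval_cat(2)])
    (auto simp: corner_edge_def corner_incl_def square_proj_def interval_obj corner_obj square_obj)

lemma bang_pt: "bang interval \<circ>\<^sub>f pt interval (Bit True) = id_func (one :: 'k scat)"
  by (rule func_eq_thin[OF sfunD(1)[OF sfun_comp[OF sfun_pt_interval sfun_bang[OF reg small_interval[OF reg]]]]
        fun_on_id[OF small_cat_is_cat[OF small_one[OF reg]]] one_thin])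
    (auto simp: bang_def pt_def interval_obj)

text \<open>Restriction along \<open>corner_proj\<close> becomes left adjoint, with identity unit,
  to restriction along \<open>corner_edge\<close>. By \<open>uarr_counit_iso\<close> the right Kan
  extension along \<open>corner_edge\<close> is then fully faithful.\<close>

lemma corner_adj: "cat_adj corner_edge corner_proj (id_nt (id_func interval)) corner_counit interval (corner :: 'k scat)"
proof (rule cat_adj_thin[OF interval_cat(2) corner_cat(2) sfun_corner_edge sfun_corner_proj])
  show "snt (id_nt (id_func interval)) (id_func interval) (corner_proj \<circ>\<^sub>f corner_edge) interval (interval :: 'k scat)"
    unfolding corner_proj_edge by (rule snt_id[OF sfun_id[OF small_interval[OF reg]]])
  have "nt_on (corner_counit :: 'k sntrans) (corner_edge \<circ>\<^sub>f corner_proj) (id_func corner) corner corner"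
    unfolding corner_counit_def
    by (rule nt_on_thin[OF sfunD(1)[OF sfun_comp[OF sfun_corner_proj sfun_corner_edge]] fun_on_id[OF corner_cat(1)] corner_cat(2)])
      (erule corner_objE; simp add: corner_proj_def corner_edge_def corner_obj corner_hom square_hom interval_hom interval_obj)
  then show "snt (corner_counit :: 'k sntrans) (corner_edge \<circ>\<^sub>f corner_proj) (id_func corner) corner corner"
    using small_corner[OF reg] by (simp add: snt_def)
qed

text \<open>Maps out of the edge (0,1) -> (1,1) of a square thereby become maps from the square to
  squares that are constant in the second coordinate.\<close>

lemma square_adj: "cat_adj square_proj square_edge square_unit (id_nt (id_func interval)) square (interval :: 'k scat)"
proof (rule cat_adj_thin[OF square_thin interval_cat(2) sfun_square_proj sfun_square_edge])
  show "snt (id_nt (id_func interval)) (square_proj \<circ>\<^sub>f square_edge) (id_func interval) interval (interval :: 'k scat)"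
    unfolding square_proj_edge by (rule snt_id[OF sfun_id[OF small_interval[OF reg]]])
  have "nt_on (square_unit :: 'k sntrans) (id_func square) (square_edge \<circ>\<^sub>f square_proj) square square"
    unfolding square_unit_def
    by (rule nt_on_thin[OF fun_on_id[OF square_cat] sfunD(1)[OF sfun_comp[OF sfun_square_proj sfun_square_edge]] square_thin])
      (erule square_objE; auto simp: square_proj_def square_edge_def square_obj square_hom interval_hom interval_obj)
  then show "snt (square_unit :: 'k sntrans) (id_func square) (square_edge \<circ>\<^sub>f square_proj) square square"
    using small_square[OF reg] by (simp add: snt_def)
qed

text \<open>1 is terminal in [1]. So evaluation at 1 has a right adjoint with identity counit, and
  by \<open>darr_unit_iso\<close> the left Kan extension along 1 is fully faithful.\<close>

lemma pt_adj: "cat_adj (bang interval) (pt interval (Bit True)) pt_unit (id_nt (id_func one)) interval (one :: 'k scat)"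
proof (rule cat_adj_thin[OF interval_cat(2) one_thin sfun_bang[OF reg small_interval[OF reg]] sfun_pt_interval])
  show "snt (id_nt (id_func one)) (bang interval \<circ>\<^sub>f pt interval (Bit True)) (id_func one) one (one :: 'k scat)"
    unfolding bang_pt by (rule snt_id[OF sfun_id[OF small_one[OF reg]]])
  have "nt_on (pt_unit :: 'k sntrans) (id_func interval) (pt interval (Bit True) \<circ>\<^sub>f bang interval) interval interval"
    unfolding pt_unit_def
    by (rule nt_on_thin[OF fun_on_id[OF interval_cat(1)] sfunD(1)[OF sfun_comp[OF sfun_bang[OF reg small_interval[OF reg]] sfun_pt_interval]] interval_cat(2)])
      (auto simp: bang_def pt_def interval_hom interval_obj)
  then show "snt (pt_unit :: 'k sntrans) (id_func interval) (pt interval (Bit True) \<circ>\<^sub>f bang interval) interval interval"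
    using small_interval[OF reg] by (simp add: snt_def)
qed

end

lemma prod_nt_id:
  assumes reg: "regular_universe TYPE('k)" and u: "sfun (u :: 'k sfunc) A B" and v: "sfun v A' B'"
  shows "id_nt u \<times>\<^sub>n id_nt v = id_nt (u \<times>\<^sub>f v)"
proof (rule nt_on_eqI)
  note n = nt_on_prod[OF sntD(1)[OF snt_id[OF u]] sntD(1)[OF snt_id[OF v]]]
  show "nt_on (id_nt u \<times>\<^sub>n id_nt v) (u \<times>\<^sub>f v) (u \<times>\<^sub>f v) (A \<times>\<^sub>c A') (B \<times>\<^sub>c B')" by (rule n)
  show "nt_on (id_nt (u \<times>\<^sub>f v)) (u \<times>\<^sub>f v) (u \<times>\<^sub>f v) (A \<times>\<^sub>c A') (B \<times>\<^sub>c B')"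
    by (rule sntD(1)[OF snt_id[OF sfun_prod[OF reg u v]]])
  show "Cmp (id_nt u \<times>\<^sub>n id_nt v) x = Cmp (id_nt (u \<times>\<^sub>f v)) x" if "x \<in> Obj (A \<times>\<^sub>c A')" for x
    using that by (rule prod_cat_objE)
      (simp add: cmp_prod_nt[OF sntD(1)[OF snt_id[OF u]] sntD(1)[OF snt_id[OF v]]] sfunD[OF u] sfunD[OF v])
qed

subsection \<open>The right adjoint of the cone\<close>

locale ptd_der =
  fixes D :: "('k, 'o, 'm) prederiv"
  assumes der: "der D" and ptd: "pointed D"
begin

abbreviation "eps K \<equiv> corner_edge \<times>\<^sub>f id_func K"
abbreviation "inc K \<equiv> corner_incl \<times>\<^sub>f id_func K"
abbreviation "pro K \<equiv> square_proj \<times>\<^sub>f id_func K"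
abbreviation "edg K \<equiv> square_edge \<times>\<^sub>f id_func K"
abbreviation "pto K \<equiv> pt interval (Bit True) \<times>\<^sub>f id_func K"
abbreviation "VI K \<equiv> Val D (interval \<times>\<^sub>c K)"
abbreviation "VC K \<equiv> Val D (corner \<times>\<^sub>c K)"
abbreviation "VS K \<equiv> Val D (square \<times>\<^sub>c K)"
abbreviation "VT K \<equiv> Val D (one \<times>\<^sub>c K)"
abbreviation "zero_at A X a \<equiv> zero_obj (Val D one) (RO D (pt A a) X)"

lemma reg: "regular_universe TYPE('k)" by (rule derD(2)[OF der])

lemma P: "pder D" by (rule derD(1)[OF der])

lemmas R = res_fun[OF P]

context
  fixes K :: "'k scat"
  assumes K: "small_cat K"
begin

section \<open>Vanishing objects and detection of isomorphisms\<close>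

lemma sf:
  "sfun (eps K) (interval \<times>\<^sub>c K) (corner \<times>\<^sub>c K)" "sfun (inc K) (corner \<times>\<^sub>c K) (square \<times>\<^sub>c K)"
  "sfun (pro K) (square \<times>\<^sub>c K) (interval \<times>\<^sub>c K)" "sfun (edg K) (interval \<times>\<^sub>c K) (square \<times>\<^sub>c K)"
  "sfun (pto K) (one \<times>\<^sub>c K) (interval \<times>\<^sub>c K)"
  by (rule sfun_prod[OF reg _ sfun_id[OF K]], rule sfun_corner_edge[OF reg] sfun_corner_incl[OF reg]
    sfun_square_proj[OF reg] sfun_square_edge[OF reg] sfun_pt_interval[OF reg])+

lemma small_par:
  "small_cat (interval \<times>\<^sub>c K)" "small_cat (corner \<times>\<^sub>c K)" "small_cat (square \<times>\<^sub>c K)" "small_cat (one \<times>\<^sub>c K)"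
  using sfunD(2,3)[OF sf(1)] sfunD(2,3)[OF sf(2)] sfunD(2,3)[OF sf(5)] by auto

lemma cats: "is_cat (VI K)" "is_cat (VC K)" "is_cat (VS K)" "is_cat (VT K)" "is_cat (Val D one)"
  by (rule val_cat[OF P], rule small_par small_one[OF reg])+

text \<open>There is no arrow 1 -> 0 in [1], so the slice over (0, k) is empty and the extension is
  initial there.\<close>

lemma lkan_pt_zero:
  assumes W: "W \<in> Obj (VT K)" and k: "k \<in> Obj K"
  shows "zero_at (interval \<times>\<^sub>c K) (FO (lkan D (pto K)) W) (Pair (Bit False) k)"
proof -
  have b: "Pair (Bit False) k \<in> Obj (interval \<times>\<^sub>c K)" using k by (simp add: interval_obj)
  have "Obj (over_cat (pto K) (Pair (Bit False) k)) = {}"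
    by (auto elim!: over_cat_objE prod_cat_objE prod_cat_homE simp: sfunD[OF sf(5)] pt_def interval_hom)
  then have "initial_obj (Val D one) (RO D (pt (interval \<times>\<^sub>c K) (Pair (Bit False) k)) (FO (lkan D (pto K)) W))"
    by (rule lkan_empty_slice[OF der sf(5) b _ lkan_uarr[OF der sf(5) W]])
  moreover obtain z where "zero_obj (Val D one) z" using ptd by (auto simp: pointed_def)
  ultimately show ?thesis using initial_zero[OF cats(5)] by blast
qed

text \<open>No arrow leads from (0,1) to a vertex (a,0), so the slice under (0,1) is empty: this is
  the zero in the span 0 <- x -> y.\<close>

lemma rkan_eps_zero:
  assumes X: "X \<in> Obj (VI K)" and k: "k \<in> Obj K"
  shows "zero_at (corner \<times>\<^sub>c K) (FO (rkan D (eps K)) X) (Pair (Pair (Bit False) (Bit True)) k)"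
proof -
  let ?b = "Pair (Pair (Bit False) (Bit True)) k"
  have b: "?b \<in> Obj (corner \<times>\<^sub>c K)" using k by (simp add: interval_obj corner_obj)
  have "Obj (under_cat (eps K) ?b) = {}"
  proof (rule ccontr)
    assume "Obj (under_cat (eps K) ?b) \<noteq> {}"
    then obtain a f where a: "a \<in> Obj (interval \<times>\<^sub>c K)" and f: "in_hom (corner \<times>\<^sub>c K) f ?b (FO (eps K) a)"
      by (auto simp: under_cat_def Let_def sfunD[OF sf(1)] sfunD[OF sfun_corner_edge[OF reg]])
    obtain x j where x: "a = Pair x j" "x \<in> Obj interval" "j \<in> Obj K" using a by (rule prod_cat_objE)
    have "FO (eps K) a = Pair (Pair x (Bit False)) j" using x by (simp add: corner_edge_def)
    then show False using f by (auto elim!: prod_cat_homE square_homE simp: corner_hom interval_hom)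
  qed
  then have "terminal_obj (Val D one) (RO D (pt (corner \<times>\<^sub>c K) ?b) (FO (rkan D (eps K)) X))"
    by (rule rkan_empty_slice[OF der sf(1) b _ X])
  moreover obtain z where "zero_obj (Val D one) z" using ptd by (auto simp: pointed_def)
  ultimately show ?thesis using terminal_zero[OF cats(5)] by blast
qed

text \<open>The vertex (0,1) lies in the corner, which is a full subcategory of the square. Its
  slice has the identity as terminal object, and completing to a square does not change the value
  there.\<close>

lemma lkan_inc_zero:
  assumes Y: "Y \<in> Obj (VC K)" and k: "k \<in> Obj K"
    and z: "zero_at (corner \<times>\<^sub>c K) Y (Pair (Pair (Bit False) (Bit True)) k)"
  shows "zero_at (square \<times>\<^sub>c K) (FO (lkan D (inc K)) Y) (Pair (Pair (Bit False) (Bit True)) k)"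
proof -
  \<comment> \<open>\<open>?f\<close> is the identity of the vertex (0,1), written as the pair of
    the identities of 0 and 1.\<close>
  let ?a = "Pair (Bit False) (Bit True) :: 'k el" and ?f = "Pair (Pair (Bit False) (Bit False)) (Pair (Bit True) (Bit True)) :: 'k el"
  let ?S = "over_cat (corner_incl :: 'k sfunc) ?a"
  have a: "?a \<in> Obj square" by (simp add: square_obj interval_obj)
  have f: "in_hom square ?f ?a ?a" by (simp add: square_hom interval_hom interval_obj)
  have incf: "FO (corner_incl :: 'k sfunc) x = x" if "x \<in> Obj corner" for x using that by (simp add: corner_incl_def)
  have inch: "FM (corner_incl :: 'k sfunc) h = h" if "in_hom corner h x y" for h x y
    using in_homD(1)[OF that] by (simp add: corner_incl_def)
  have sel: "Src (corner_incl :: 'k sfunc) = corner" "Tgt (corner_incl :: 'k sfunc) = square" by (simp_all add: corner_incl_def)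
  have t0: "Pair ?a ?f \<in> Obj ?S" using f by (simp add: sel incf corner_obj interval_obj)
  have fin: "\<exists>!h. in_hom ?S h x (Pair ?a ?f)" if x: "x \<in> Obj ?S" for x
  proof -
    obtain c r where c: "x = Pair c r" "c \<in> Obj corner" "in_hom square r (FO corner_incl c) ?a"
      using x by (rule over_cat_objE) (simp add: sel)
    have r: "in_hom square r c ?a" using c(3) incf[OF c(2)] by simp
    have c': "in_hom corner r c ?a" using r c(2) by (auto simp: corner_hom corner_obj)
    have "Comp square ?f (FM corner_incl r) = r"
      using inch[OF c'] comp_id_left[OF square_cat r] by (simp add: square_def)
    then have "in_hom ?S (Pair (Pair x (Pair ?a ?f)) r) x (Pair ?a ?f)" using x t0 c c' by (simp add: sel)
    moreover have "h = Pair (Pair x (Pair ?a ?f)) r" if h: "in_hom ?S h x (Pair ?a ?f)" for h using in_homD(1)[OF h]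
    proof (rule over_cat_arrE)
      fix y y' g assume *: "h = Pair (Pair y y') g" "in_hom (Src corner_incl) g (pfst y) (pfst y')"
      then have "y = x" "y' = Pair ?a ?f" using h by auto
      then have "in_hom corner g c ?a" using * c by (simp add: sel)
      then have "g = r" using c' corner_cat(2) unfolding thin_def by blast
      then show ?thesis using * \<open>y = x\<close> \<open>y' = Pair ?a ?f\<close> by simp
    qed
    ultimately show ?thesis by blast
  qed
  obtain m where "VHom D one m (RO D (pt (corner \<times>\<^sub>c K) (Pair ?a k)) Y)
      (RO D (pt (square \<times>\<^sub>c K) (Pair ?a k)) (FO (lkan D (inc K)) Y))" "VIso D one m"
    using lkan_terminal_slice[OF der sfun_corner_incl[OF reg] K a k lkan_uarr[OF der sf(2) Y] t0 fin] by blast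
  then show ?thesis by (rule zero_transfer[OF cats(5) z])
qed

text \<open>By Der2 it suffices to look at points: at 0 a map between zero objects is invertible,
  and every other point factors through \<open>pto K\<close>.\<close>

lemma iso_interval:
  assumes m: "in_hom (VI K) m X Y" and i: "is_iso (VT K) (RM D (pto K) m)"
    and zX: "\<And>k. k \<in> Obj K \<Longrightarrow> zero_at (interval \<times>\<^sub>c K) X (Pair (Bit False) k)"
    and zY: "\<And>k. k \<in> Obj K \<Longrightarrow> zero_at (interval \<times>\<^sub>c K) Y (Pair (Bit False) k)"
  shows "is_iso (VI K) m"
proof (rule iso_pointwise[OF der small_par(1) m])
  fix x assume x: "x \<in> Obj (interval \<times>\<^sub>c K)"
  then obtain a k where a: "x = Pair a k" "a \<in> Obj interval" "k \<in> Obj K" by (rule prod_cat_objE)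
  note px = sfun_pt[OF reg small_par(1) x]
  show "VIso D one (RM D (pt (interval \<times>\<^sub>c K) x) m)"
  proof (cases "a = Bit False")
    case True
    then show ?thesis using zero_iso[OF cats(5) zX[OF a(3)] zY[OF a(3)]] fun_hom[OF R[OF px] m] a by simp
  next
    case False
    have s: "Pair Star k \<in> Obj (one \<times>\<^sub>c K)" using a by simp
    note ps = sfun_pt[OF reg small_par(4) s]
    have "pto K \<circ>\<^sub>f pt (one \<times>\<^sub>c K) (Pair Star k) = pt (interval \<times>\<^sub>c K) x"
      using comp_pt[OF reg sf(5) s] a False by (simp add: pt_def interval_obj)
    then have "RM D (pt (interval \<times>\<^sub>c K) x) m = RM D (pt (one \<times>\<^sub>c K) (Pair Star k)) (RM D (pto K) m)"
      using res_comp_app(2)[OF P ps sf(5) m] by simp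
    then show ?thesis using fun_iso[OF R[OF ps] fun_hom[OF R[OF sf(5)] m] i] by simp
  qed
qed

text \<open>Der2 again: at (0,1) both sides are zero, and the other vertices of the corner lie on
  the edge \<open>corner_edge\<close>.\<close>

lemma iso_corner:
  assumes m: "in_hom (VC K) m X Y" and i: "is_iso (VI K) (RM D (eps K) m)"
    and zX: "\<And>k. k \<in> Obj K \<Longrightarrow> zero_at (corner \<times>\<^sub>c K) X (Pair (Pair (Bit False) (Bit True)) k)"
    and zY: "\<And>k. k \<in> Obj K \<Longrightarrow> zero_at (corner \<times>\<^sub>c K) Y (Pair (Pair (Bit False) (Bit True)) k)"
  shows "is_iso (VC K) m"
proof (rule iso_pointwise[OF der small_par(2) m])
  fix x assume x: "x \<in> Obj (corner \<times>\<^sub>c K)"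
  then obtain a k where a: "x = Pair a k" "a \<in> Obj corner" "k \<in> Obj K" by (rule prod_cat_objE)
  note px = sfun_pt[OF reg small_par(2) x]
  show "VIso D one (RM D (pt (corner \<times>\<^sub>c K) x) m)"
  proof (cases "a = Pair (Bit False) (Bit True)")
    case True
    then show ?thesis using zero_iso[OF cats(5) zX[OF a(3)] zY[OF a(3)]] fun_hom[OF R[OF px] m] a by simp
  next
    case False
    then obtain b where b: "a = Pair b (Bit False)" "b \<in> Obj interval"
      using a(2) by (auto elim!: corner_objE simp: interval_obj)
    have s: "Pair b k \<in> Obj (interval \<times>\<^sub>c K)" using a b by simp
    note ps = sfun_pt[OF reg small_par(1) s]
    have "eps K \<circ>\<^sub>f pt (interval \<times>\<^sub>c K) (Pair b k) = pt (corner \<times>\<^sub>c K) x"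
      using comp_pt[OF reg sf(1) s] a b by (simp add: corner_edge_def)
    then have "RM D (pt (corner \<times>\<^sub>c K) x) m = RM D (pt (interval \<times>\<^sub>c K) (Pair b k)) (RM D (eps K) m)"
      using res_comp_app(2)[OF P ps sf(1) m] by simp
    then show ?thesis using fun_iso[OF R[OF ps] fun_hom[OF R[OF sf(1)] m] i] by simp
  qed
qed

lemma eps_counit_iso:
  assumes X: "X \<in> Obj (VI K)"
  shows "is_iso (VI K) (Cmp (rkan_counit D (eps K)) X)"
proof (rule uarr_counit_iso[OF _ rkan_darr[OF der sf(1) X]])
  fix Y assume Y: "Y \<in> Obj (VI K)"
  note ad = cat_adj_prod[OF reg K corner_adj[OF reg]]
  \<comment> \<open>The unit of the adjunction is an identity 2-cell, so restriction along the edge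
    has a fully faithful left adjoint, as \<open>uarr_counit_iso\<close> demands.\<close>
  have e: "id_nt (id_func interval) \<times>\<^sub>n id_nt (id_func K) = id_nt (id_func (interval \<times>\<^sub>c K))"
    using prod_nt_id[OF reg sfun_id[OF small_interval[OF reg]] sfun_id[OF K]]
      prod_func_id[OF interval_cat(1) small_cat_is_cat[OF K]] by simp
  have "is_iso (VI K) (Cmp (Res2 D (id_nt (id_func interval) \<times>\<^sub>n id_nt (id_func K))) Y)"
    unfolding e using res2_id[OF P sfun_id[OF small_par(1)] Y] res_id_app(1)[OF P small_par(1) Y]
      iso_id[OF cats(1) Y] by simp
  then show "\<exists>W e. uarr (VC K) (VI K) (Res D (eps K)) Y W e \<and> is_iso (VI K) e"
    using cat_adj_res(1)[OF P ad Y] by blast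
qed

lemma pt_unit_iso:
  assumes W: "W \<in> Obj (VT K)"
  shows "is_iso (VT K) (Cmp (lkan_unit D (pto K)) W)"
proof (rule darr_unit_iso[OF _ lkan_uarr[OF der sf(5) W]])
  fix Y assume Y: "Y \<in> Obj (VT K)"
  note ad = cat_adj_prod[OF reg K pt_adj[OF reg]]
  have e: "id_nt (id_func one) \<times>\<^sub>n id_nt (id_func K) = id_nt (id_func (one \<times>\<^sub>c K))"
    using prod_nt_id[OF reg sfun_id[OF small_one[OF reg]] sfun_id[OF K]]
      prod_func_id[OF small_cat_is_cat[OF small_one[OF reg]] small_cat_is_cat[OF K]] by simp
  have "is_iso (VT K) (Cmp (Res2 D (id_nt (id_func one) \<times>\<^sub>n id_nt (id_func K))) Y)"
    unfolding e using res2_id[OF P sfun_id[OF small_par(4)] Y] res_id_app(1)[OF P small_par(4) Y]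
      iso_id[OF cats(4) Y] by simp
  then show "\<exists>W e. darr (VI K) (VT K) (Res D (pto K)) Y W e \<and> is_iso (VT K) e"
    using cat_adj_res(2)[OF P ad Y] by blast
qed

text \<open>At 1 the counit is invertible by the triangle identity and the invertible unit; at 0
  both sides vanish. So V is recovered from its value at 1.\<close>

lemma pt_counit_iso:
  assumes V: "V \<in> Obj (VI K)" and z: "\<And>k. k \<in> Obj K \<Longrightarrow> zero_at (interval \<times>\<^sub>c K) V (Pair (Bit False) k)"
  shows "is_iso (VI K) (Cmp (lkan_counit D (pto K)) V)"
proof -
  note A = adjD[OF lkan_adj[OF der sf(5)] R[OF sf(5)]]
  note W = fun_obj[OF R[OF sf(5)] V]
  note h = fun_hom[OF R[OF sf(5)] A(5)[OF V]]
  have "is_iso (VT K) (Comp (VT K) (RM D (pto K) (Cmp (lkan_counit D (pto K)) V))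
      (Cmp (lkan_unit D (pto K)) (RO D (pto K) V)))" unfolding A(9)[OF V] by (rule iso_id[OF cats(4) W])
  then have "is_iso (VT K) (RM D (pto K) (Cmp (lkan_counit D (pto K)) V))"
    by (rule iso_comp_right_cancel[OF cats(4) A(4)[OF W] h _ pt_unit_iso[OF W]])
  then show ?thesis by (rule iso_interval[OF A(5)[OF V] _ lkan_pt_zero[OF W] z])
qed

text \<open>An object M vanishing at (0,1) is the extension by zero of its own restriction, since
  the unit \<open>?n\<close> is invertible by \<open>iso_corner\<close>. Maps into M are thus
  determined by their restriction to the edge, where they may be prescribed.\<close>

lemma eps_bij:
  assumes Y: "Y \<in> Obj (VC K)" and M: "M \<in> Obj (VC K)"
    and z: "\<And>k. k \<in> Obj K \<Longrightarrow> zero_at (corner \<times>\<^sub>c K) M (Pair (Pair (Bit False) (Bit True)) k)"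
  shows "in_hom (VI K) h (RO D (eps K) Y) (RO D (eps K) M) \<Longrightarrow>
      \<exists>f. in_hom (VC K) f Y M \<and> RM D (eps K) f = h"
    "in_hom (VC K) f Y M \<Longrightarrow> in_hom (VC K) f' Y M \<Longrightarrow> RM D (eps K) f = RM D (eps K) f' \<Longrightarrow> f = f'"
proof -
  let ?e = "Res D (eps K)" and ?r = "rkan D (eps K)"
  note Re = R[OF sf(1)]
  note A = adjD[OF rkan_adj[OF der sf(1)] rkan_fun[OF der sf(1)]]
  let ?n = "Cmp (rkan_unit D (eps K)) M" and ?c = "Cmp (rkan_counit D (eps K)) (FO ?e M)"
  note eM = fun_obj[OF Re M]
  note d = rkan_darr[OF der sf(1) eM]
  note c = darrD(3)[OF d] and n = A(4)[OF M]
  note en = fun_hom[OF Re n]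
  have tri: "Comp (VI K) ?c (FM ?e ?n) = Id (VI K) (FO ?e M)" by (rule A(8)[OF M])
  have "is_iso (VI K) (FM ?e ?n)"
    by (rule iso_comp_left_cancel[OF cats(1) en c _ eps_counit_iso[OF eM]]) (simp add: tri iso_id[OF cats(1) eM])
  then have ni: "is_iso (VC K) ?n" by (rule iso_corner[OF n _ z rkan_eps_zero[OF eM]])
  have key: "Comp (VI K) ?c (FM ?e (Comp (VC K) ?n f)) = FM ?e f" if f: "in_hom (VC K) f Y M" for f
    using fun_comp[OF Re f n] comp_cancel[OF cats(1) fun_hom[OF Re f] en c tri] by simp
  show "\<exists>f. in_hom (VC K) f Y M \<and> FM ?e f = h" if h: "in_hom (VI K) h (FO ?e Y) (FO ?e M)"
  proof -
    obtain g where g: "in_hom (VC K) g Y (FO ?r (FO ?e M))" "Comp (VI K) ?c (FM ?e g) = h"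
      using darrE[OF d Y h] by blast
    obtain n' where n': "in_hom (VC K) n' (FO ?r (FO ?e M)) M" "Comp (VC K) ?n n' = Id (VC K) (FO ?r (FO ?e M))"
      using iso_hom[OF ni n] by blast
    have f: "in_hom (VC K) (Comp (VC K) n' g) Y M" by (rule comp_hom[OF cats(2) g(1) n'(1)])
    have "FM ?e (Comp (VC K) n' g) = h" using key[OF f] comp_cancel[OF cats(2) g(1) n'(1) n n'(2)] g(2) by simp
    then show ?thesis using f by blast
  qed
  show "f = f'" if f: "in_hom (VC K) f Y M" "in_hom (VC K) f' Y M" and eq: "FM ?e f = FM ?e f'"
  proof (rule iso_cancel_left[OF cats(2) f n ni])
    show "Comp (VC K) ?n f = Comp (VC K) ?n f'"
      by (rule darr_eq[OF d comp_hom[OF cats(2) f(1) n] comp_hom[OF cats(2) f(2) n]])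
        (simp add: key[OF f(1)] key[OF f(2)] eq)
  qed
qed

text \<open>The unit of \<open>square_adj\<close>: it maps a square to the square that is constant
  in the second coordinate on its edge (0,1) -> (1,1).\<close>

abbreviation "cell \<equiv> Cmp (Res2 D (square_unit \<times>\<^sub>n id_nt (id_func K)))"

section \<open>The cofiber square and its universal property\<close>

lemma square_uarr:
  assumes Q: "Q \<in> Obj (VS K)"
  shows "uarr (VI K) (VS K) (Res D (pro K)) Q (RO D (edg K) Q) (cell Q)"
  by (rule cat_adj_res(1)[OF P cat_adj_prod[OF reg K square_adj[OF reg]] Q])

text \<open>The projection retracts the edge (0,0) -> (1,0), so on this edge a square that is
  constant in the second coordinate restricts to its own source.\<close>

lemma pro_inc_eps: "pro K \<circ>\<^sub>f (inc K \<circ>\<^sub>f eps K) = id_func (interval \<times>\<^sub>c K)"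
proof -
  note e = sfun_corner_edge[OF reg] and i = sfun_corner_incl[OF reg] and p = sfun_square_proj[OF reg]
  have "pro K \<circ>\<^sub>f (inc K \<circ>\<^sub>f eps K) = (square_proj \<circ>\<^sub>f (corner_incl \<circ>\<^sub>f corner_edge)) \<times>\<^sub>f id_func K"
    by (simp add: param_comp[OF e i K] param_comp[OF sfun_comp[OF e i] p K])
  then show ?thesis using square_proj_corner[OF reg] prod_func_id[OF interval_cat(1) small_cat_is_cat[OF K]] by simp
qed

lemma eip:
  shows "Z \<in> Obj (VI K) \<Longrightarrow> RO D (eps K) (RO D (inc K) (RO D (pro K) Z)) = Z"
    and "in_hom (VI K) f Z Z' \<Longrightarrow> RM D (eps K) (RM D (inc K) (RM D (pro K) f)) = f"
proof -
  note a = res_comp_app[OF P sf(1,2)] and b = res_comp_app[OF P sfun_comp[OF sf(1,2)] sf(3)]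
  note i = res_id_app[OF P small_par(1)]
  show "RO D (eps K) (RO D (inc K) (RO D (pro K) Z)) = Z" if Z: "Z \<in> Obj (VI K)"
    using a(1)[OF fun_obj[OF R[OF sf(3)] Z]] b(1)[OF Z] i(1)[OF Z] by (simp add: pro_inc_eps)
  show "RM D (eps K) (RM D (inc K) (RM D (pro K) f)) = f" if f: "in_hom (VI K) f Z Z'"
    using a(2)[OF fun_hom[OF R[OF sf(3)] f]] b(2)[OF f] i(2)[OF f] by (simp add: pro_inc_eps)
qed

text \<open>For an arrow X = (x -> y): \<open>Y X\<close> is the span 0 <- x -> y,
  \<open>Q X\<close> the cofiber square and \<open>V X\<close> its edge 0 -> Cf. For a square Z,
  \<open>kap Z\<close> maps the edge (0,0) -> (1,0) to the parallel edge (0,1) -> (1,1).\<close>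

abbreviation "Y X \<equiv> FO (rkan D (eps K)) X"
abbreviation "Q X \<equiv> FO (lkan D (inc K)) (Y X)"
abbreviation "V X \<equiv> RO D (edg K) (Q X)"
abbreviation "kap Z \<equiv> RM D (eps K) (RM D (inc K) (cell Z))"

lemma YQV:
  assumes X: "X \<in> Obj (VI K)"
  shows "Y X \<in> Obj (VC K)" "Q X \<in> Obj (VS K)" "V X \<in> Obj (VI K)"
proof -
  show "Y X \<in> Obj (VC K)" by (rule fun_obj[OF rkan_fun[OF der sf(1)] X])
  then show "Q X \<in> Obj (VS K)" by (rule fun_obj[OF lkan_fun[OF der sf(2)]])
  then show "V X \<in> Obj (VI K)" by (rule fun_obj[OF R[OF sf(4)]])
qed

lemma kap_hom:
  assumes Z: "Z \<in> Obj (VS K)"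
  shows "in_hom (VI K) (kap Z) (RO D (eps K) (RO D (inc K) Z)) (RO D (edg K) Z)"
  using fun_hom[OF R[OF sf(1)] fun_hom[OF R[OF sf(2)] uarrD(3)[OF square_uarr[OF Z]]]]
    eip(1)[OF uarrD(2)[OF square_uarr[OF Z]]] by simp

lemma V_zero:
  assumes X: "X \<in> Obj (VI K)" and k: "k \<in> Obj K"
  shows "zero_at (interval \<times>\<^sub>c K) (V X) (Pair (Bit False) k)"
proof -
  have s: "Pair (Bit False) k \<in> Obj (interval \<times>\<^sub>c K)" using k by (simp add: interval_obj)
  have "edg K \<circ>\<^sub>f pt (interval \<times>\<^sub>c K) (Pair (Bit False) k) = pt (square \<times>\<^sub>c K) (Pair (Pair (Bit False) (Bit True)) k)"
    using comp_pt[OF reg sf(4) s] k by (simp add: square_edge_def interval_obj)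
  then show ?thesis using lkan_inc_zero[OF YQV(1)[OF X] k rkan_eps_zero[OF X k]]
      res_comp_app(1)[OF P sfun_pt[OF reg small_par(1) s] sf(4) YQV(2)[OF X]] by simp
qed

text \<open>The first half of the universal property: a map from \<open>X\<close> to an object vanishing at \<open>0\<close> extends
  over the cofiber square, which is cocartesian.\<close>

lemma edge_universal:
  assumes X: "X \<in> Obj (VI K)" and a: "in_hom (VI K) a X (V X)"
    and ac: "Comp (VI K) a (Cmp (rkan_counit D (eps K)) X) =
      Comp (VI K) (kap (Q X)) (RM D (eps K) (Cmp (lkan_unit D (inc K)) (Y X)))"
    and W: "W \<in> Obj (VI K)" and z: "\<And>k. k \<in> Obj K \<Longrightarrow> zero_at (interval \<times>\<^sub>c K) W (Pair (Bit False) k)"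
  shows "in_hom (VI K) h X W \<Longrightarrow> \<exists>f. in_hom (VI K) f (V X) W \<and> Comp (VI K) f a = h"
    "in_hom (VI K) f (V X) W \<Longrightarrow> in_hom (VI K) f' (V X) W \<Longrightarrow> Comp (VI K) f a = Comp (VI K) f' a \<Longrightarrow> f = f'"
proof -
  note C = cats(1)
  note Re = R[OF sf(1)] and Ri = R[OF sf(2)] and Rp = R[OF sf(3)]
  note yqv = YQV[OF X]
  let ?c = "Cmp (rkan_counit D (eps K)) X" and ?eta = "Cmp (lkan_unit D (inc K)) (Y X)"
  note c = darrD(3)[OF rkan_darr[OF der sf(1) X]]
  \<comment> \<open>The left adjoints of the restrictions along inclusion and projection are
    composed: maps from \<open>V X\<close> to W correspond to maps from the span \<open>Y X\<close>
    to the corner that W induces.\<close>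
  note un = uarr_comp[OF lkan_uarr[OF der sf(2) yqv(1)] square_uarr[OF yqv(2)]]
  let ?e1 = "Comp (VC K) (RM D (inc K) (cell (Q X))) ?eta"
  note eta = uarrD(3)[OF lkan_uarr[OF der sf(2) yqv(1)]]
  note ic = fun_hom[OF Ri uarrD(3)[OF square_uarr[OF yqv(2)]]]
  \<comment> \<open>The corner of the square that is W in both rows; it vanishes at (0,1) because W
    vanishes at 0, so \<open>eps_bij\<close> reduces maps into it to the edge.\<close>
  let ?M = "RO D (inc K) (RO D (pro K) W)"
  have M: "?M \<in> Obj (VC K)" by (rule fun_obj[OF Ri fun_obj[OF Rp W]])
  have zM: "zero_at (corner \<times>\<^sub>c K) ?M (Pair (Pair (Bit False) (Bit True)) k)" if k: "k \<in> Obj K" for k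
  proof -
    have s: "Pair (Pair (Bit False) (Bit True)) k \<in> Obj (corner \<times>\<^sub>c K)" using k by (simp add: corner_obj interval_obj)
    note ps = sfun_pt[OF reg small_par(2) s]
    have "(pro K \<circ>\<^sub>f inc K) \<circ>\<^sub>f pt (corner \<times>\<^sub>c K) (Pair (Pair (Bit False) (Bit True)) k) =
        pt (interval \<times>\<^sub>c K) (Pair (Bit False) k)" using comp_pt[OF reg sfun_comp[OF sf(2,3)] s] k
      by (simp add: corner_incl_def square_proj_def corner_obj interval_obj square_obj)
    then show ?thesis
      using z[OF k] res_comp_app(1)[OF P ps sfun_comp[OF sf(2,3)] W] res_comp_app(1)[OF P sf(2,3) W] by simp
  qed
  have eM: "RO D (eps K) ?M = W" by (rule eip(1)[OF W])
  have pf: "in_hom (VC K) (RM D (inc K) (RM D (pro K) f)) (RO D (inc K) (RO D (pro K) (V X))) ?M"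
    if f: "in_hom (VI K) f (V X) W" for f by (rule fun_hom[OF Ri fun_hom[OF Rp f]])
  note e1 = comp_hom[OF cats(2) eta ic]
  \<comment> \<open>Read on the edge, the correspondence is f |-> f \<circ> a, up to the invertible
    counit.\<close>
  have key: "RM D (eps K) (Comp (VC K) (RM D (inc K) (RM D (pro K) f)) ?e1) =
      Comp (VI K) (Comp (VI K) f a) ?c" if f: "in_hom (VI K) f (V X) W" for f
    using fun_comp[OF Re e1 pf[OF f]] fun_comp[OF Re eta ic] eip(2)[OF f] ac comp_assoc[OF C c a f] by simp
  note ap = comp_func_app[OF Rp]
  show "\<exists>f. in_hom (VI K) f (V X) W \<and> Comp (VI K) f a = h" if h: "in_hom (VI K) h X W"
  proof -
    have "in_hom (VI K) (Comp (VI K) h ?c) (RO D (eps K) (Y X)) (RO D (eps K) ?M)"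
      using comp_hom[OF C c h] eM by simp
    from eps_bij(1)[OF yqv(1) M zM this] obtain g where g: "in_hom (VC K) g (Y X) ?M"
      "RM D (eps K) g = Comp (VI K) h ?c" by blast
    have "in_hom (VC K) g (Y X) (FO (Res D (inc K) \<circ>\<^sub>f Res D (pro K)) W)" using g by (simp add: ap(1)[OF W])
    from uarrE[OF un W this] obtain f where f: "in_hom (VI K) f (V X) W"
      "Comp (VC K) (FM (Res D (inc K) \<circ>\<^sub>f Res D (pro K)) f) ?e1 = g" by blast
    have "Comp (VI K) (Comp (VI K) f a) ?c = Comp (VI K) h ?c"
      using key[OF f(1)] f(2) g(2) by (simp add: ap(2)[OF f(1)])
    then have "Comp (VI K) f a = h" by (rule iso_cancel_right[OF C comp_hom[OF C a f(1)] h c eps_counit_iso[OF X]])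
    then show ?thesis using f by blast
  qed
  show "f = f'" if f: "in_hom (VI K) f (V X) W" "in_hom (VI K) f' (V X) W" and eq: "Comp (VI K) f a = Comp (VI K) f' a"
  proof (rule uarr_eq[OF un f])
    have "Comp (VC K) (RM D (inc K) (RM D (pro K) f)) ?e1 = Comp (VC K) (RM D (inc K) (RM D (pro K) f')) ?e1"
      by (rule eps_bij(2)[OF yqv(1) M zM comp_hom[OF cats(2) e1 pf[OF f(1)]] comp_hom[OF cats(2) e1 pf[OF f(2)]]])
        (simp_all add: key[OF f(1)] key[OF f(2)] eq)
    then show "Comp (VC K) (FM (Res D (inc K) \<circ>\<^sub>f Res D (pro K)) f) ?e1 =
        Comp (VC K) (FM (Res D (inc K) \<circ>\<^sub>f Res D (pro K)) f') ?e1"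
      by (simp add: ap(2)[OF f(1)] ap(2)[OF f(2)])
  qed
qed

text \<open>The second half of the universal property. Objects in the image of
  \<open>lkan D (pto K)\<close> vanish at 0, so \<open>edge_universal\<close> turns maps from X into
  maps from \<open>V X\<close>. Through \<delta> the latter is itself such an extension, and these
  extensions are fully faithful, which leaves maps out of the value at 1.\<close>

lemma cone_universal:
  assumes X: "X \<in> Obj (VI K)" and a: "in_hom (VI K) a X (V X)"
    and ac: "Comp (VI K) a (Cmp (rkan_counit D (eps K)) X) =
      Comp (VI K) (kap (Q X)) (RM D (eps K) (Cmp (lkan_unit D (inc K)) (Y X)))"
  defines "\<delta> \<equiv> Cmp (lkan_counit D (pto K)) (V X)"
  defines "\<theta> \<equiv> Comp (VI K) (inv_arr (VI K) \<delta>) a"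
  shows "Comp (VI K) \<delta> \<theta> = a"
    "uarr (VT K) (VI K) (lkan D (pto K)) X (RO D (pto K) (V X)) \<theta>"
proof -
  note C = cats(1) and CT = cats(4)
  note Rt = R[OF sf(5)] and L = lkan_fun[OF der sf(5)]
  note v = YQV(3)[OF X]
  note A = adjD[OF lkan_adj[OF der sf(5)] Rt]
  have d: "in_hom (VI K) \<delta> (FO (lkan D (pto K)) (RO D (pto K) (V X))) (V X)"
    unfolding \<delta>_def by (rule A(5)[OF v])
  have di: "is_iso (VI K) \<delta>" unfolding \<delta>_def by (rule pt_counit_iso[OF v V_zero[OF X]])
  note i = inv_arr[OF C di d]
  have th: "in_hom (VI K) \<theta> X (FO (lkan D (pto K)) (RO D (pto K) (V X)))"
    unfolding \<theta>_def by (rule comp_hom[OF C a i(1)])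
  show dt: "Comp (VI K) \<delta> \<theta> = a" unfolding \<theta>_def by (rule comp_cancel[OF C a i(1) d i(3)])
  note W0 = fun_obj[OF Rt v]
  note t0 = A(4)[OF W0]
  show "uarr (VT K) (VI K) (lkan D (pto K)) X (RO D (pto K) (V X)) \<theta>"
  proof (rule uarrI[OF L W0 th])
    fix Z h assume Z: "Z \<in> Obj (VT K)" and h: "in_hom (VI K) h X (FO (lkan D (pto K)) Z)"
    note LZ = fun_obj[OF L Z]
    obtain f where f: "in_hom (VI K) f (V X) (FO (lkan D (pto K)) Z)" "Comp (VI K) f a = h"
      using edge_universal(1)[OF X a ac LZ lkan_pt_zero[OF Z] h] by blast
    note fd = comp_hom[OF C d f(1)]
    let ?k = "Comp (VT K) (RM D (pto K) (Comp (VI K) f \<delta>)) (Cmp (lkan_unit D (pto K)) (RO D (pto K) (V X)))"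
    have k: "in_hom (VT K) ?k (RO D (pto K) (V X)) (RO D (pto K) (FO (lkan D (pto K)) Z))"
      by (rule comp_hom[OF CT t0 fun_hom[OF Rt fd]])
    note tZ = A(4)[OF Z]
    note j = inv_arr[OF CT pt_unit_iso[OF Z] tZ]
    \<comment> \<open>\<open>?k\<close> is the transpose of f \<circ> \<delta>; the inverse of the
      unit at Z turns it into the preimage under the fully faithful extension.\<close>
    let ?g = "Comp (VT K) (inv_arr (VT K) (Cmp (lkan_unit D (pto K)) Z)) ?k"
    have g: "in_hom (VT K) ?g (RO D (pto K) (V X)) Z" by (rule comp_hom[OF CT k j(1)])
    have "FM (lkan D (pto K)) ?g = Comp (VI K) f \<delta>"
      by (rule uarr_eq[OF lkan_uarr[OF der sf(5) W0] fun_hom[OF L g] fd])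
        (use A(6)[OF g] comp_cancel[OF CT k j(1) tZ j(3)] in simp)
    then have "Comp (VI K) (FM (lkan D (pto K)) ?g) \<theta> = h" using comp_assoc[OF C th d f(1)] dt f(2) by simp
    then show "\<exists>g. in_hom (VT K) g (RO D (pto K) (V X)) Z \<and> Comp (VI K) (FM (lkan D (pto K)) g) \<theta> = h"
      using g by blast
  next
    fix Z g g' assume g: "in_hom (VT K) g (RO D (pto K) (V X)) Z" "in_hom (VT K) g' (RO D (pto K) (V X)) Z"
      and eq: "Comp (VI K) (FM (lkan D (pto K)) g) \<theta> = Comp (VI K) (FM (lkan D (pto K)) g') \<theta>"
    have Z: "Z \<in> Obj (VT K)" using hom_obj(2)[OF CT g(1)] .
    have h: "in_hom (VI K) (Comp (VI K) (FM (lkan D (pto K)) k) (inv_arr (VI K) \<delta>)) (V X) (FO (lkan D (pto K)) Z)"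
      "Comp (VI K) (Comp (VI K) (FM (lkan D (pto K)) k) (inv_arr (VI K) \<delta>)) a = Comp (VI K) (FM (lkan D (pto K)) k) \<theta>"
      "Comp (VI K) (Comp (VI K) (FM (lkan D (pto K)) k) (inv_arr (VI K) \<delta>)) \<delta> = FM (lkan D (pto K)) k"
      if k: "in_hom (VT K) k (RO D (pto K) (V X)) Z" for k
    proof -
      note Lk = fun_hom[OF L k]
      show "in_hom (VI K) (Comp (VI K) (FM (lkan D (pto K)) k) (inv_arr (VI K) \<delta>)) (V X) (FO (lkan D (pto K)) Z)"
        by (rule comp_hom[OF C i(1) Lk])
      show "Comp (VI K) (Comp (VI K) (FM (lkan D (pto K)) k) (inv_arr (VI K) \<delta>)) a = Comp (VI K) (FM (lkan D (pto K)) k) \<theta>"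
        unfolding \<theta>_def by (rule comp_assoc[OF C a i(1) Lk])
      show "Comp (VI K) (Comp (VI K) (FM (lkan D (pto K)) k) (inv_arr (VI K) \<delta>)) \<delta> = FM (lkan D (pto K)) k"
        using comp_assoc[OF C d i(1) Lk] i(2) comp_id_right[OF C Lk] by simp
    qed
    have e: "Comp (VI K) (FM (lkan D (pto K)) g) (inv_arr (VI K) \<delta>) = Comp (VI K) (FM (lkan D (pto K)) g') (inv_arr (VI K) \<delta>)"
      by (rule edge_universal(2)[OF X a ac fun_obj[OF L Z] lkan_pt_zero[OF Z] h(1)[OF g(1)] h(1)[OF g(2)]])
        (simp_all add: h(2)[OF g(1)] h(2)[OF g(2)] eq)
    have "FM (lkan D (pto K)) g = FM (lkan D (pto K)) g'" using h(3)[OF g(1)] unfolding e h(3)[OF g(2)] by (rule sym)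
    then have "Comp (VT K) (Cmp (lkan_unit D (pto K)) Z) g = Comp (VT K) (Cmp (lkan_unit D (pto K)) Z) g'"
      by (simp only: A(6)[OF g(1)] A(6)[OF g(2)])
    then show "g = g'" by (rule iso_cancel_left[OF CT g A(4)[OF Z] pt_unit_iso[OF Z]])
  qed
qed

end

end

context ptd_der
begin

abbreviation "ivK v \<equiv> id_func interval \<times>\<^sub>f v"
abbreviation "cvK v \<equiv> id_func corner \<times>\<^sub>f v"
abbreviation "ext0 \<equiv> rkan_dmor D corner_edge"
abbreviation "counit0 K \<equiv> Cmp (rkan_counit D (eps K))"

section \<open>Extension by zero and the cone as morphisms of prederivators\<close>

lemma sfv:
  fixes v :: "'k sfunc"
  assumes v: "sfun v J K"
  shows "sfun (ivK v) (interval \<times>\<^sub>c J) (interval \<times>\<^sub>c K)" "sfun (cvK v) (corner \<times>\<^sub>c J) (corner \<times>\<^sub>c K)"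
  by (rule shift_sfun[OF reg _ v], rule small_interval[OF reg] small_corner[OF reg])+

text \<open>The structure cell is the mate of an identity; the last clause is the compatibility with
  counits that \<open>right_dm\<close> asks for.\<close>

lemma ext0_str:
  fixes v :: "'k sfunc"
  assumes v: "sfun v J K"
  defines "s \<equiv> Str ext0 v"
  shows "NSrc s = Res D (cvK v) \<circ>\<^sub>f rkan D (eps K)" "NTgt s = rkan D (eps J) \<circ>\<^sub>f Res D (ivK v)"
    "Cmp s \<in> extensional (Obj (VI K))"
    "X \<in> Obj (VI K) \<Longrightarrow> in_hom (VC J) (Cmp s X) (RO D (cvK v) (Y K X)) (Y J (RO D (ivK v) X))"
    "X \<in> Obj (VI K) \<Longrightarrow> Comp (VI J) (counit0 J (RO D (ivK v) X)) (RM D (eps J) (Cmp s X)) =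
       RM D (ivK v) (counit0 K X)"
proof -
  note V = sfunD[OF v]
  note eJ = sf(1)[OF V(2)] and eK = sf(1)[OF V(3)]
  have n: "nt_on (id_nt (Res D (eps J) \<circ>\<^sub>f Res D (cvK v))) (Res D (eps J) \<circ>\<^sub>f Res D (cvK v))
      (Res D (ivK v) \<circ>\<^sub>f Res D (eps K)) (VC K) (VI J)"
    using nt_on_id[OF fun_on_comp[OF R[OF sfv(2)[OF v]] R[OF eJ]]]
      strict_comm[OF strict_sys_param[OF P sfun_corner_edge[OF reg]] v] by simp
  have s: "s = right_mate (rkan D (eps K)) (rkan_counit D (eps K)) (rkan D (eps J)) (rkan_unit D (eps J))
      (Res D (ivK v)) (Res D (cvK v)) (id_nt (Res D (eps J) \<circ>\<^sub>f Res D (cvK v)))"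
    unfolding s_def using V sfunD(6,7)[OF sfun_corner_edge[OF reg]] by (simp add: rkan_dmor_def Let_def)
  note M = right_mate[OF rkan_adj[OF der eK] R[OF eK] rkan_adj[OF der eJ] R[OF eJ] R[OF sfv(1)[OF v]] R[OF sfv(2)[OF v]] n,
      folded s]
  show "NSrc s = Res D (cvK v) \<circ>\<^sub>f rkan D (eps K)" "NTgt s = rkan D (eps J) \<circ>\<^sub>f Res D (ivK v)"
    "Cmp s \<in> extensional (Obj (VI K))" by (rule M(1), rule M(2), rule M(3))
  show "in_hom (VC J) (Cmp s X) (RO D (cvK v) (Y K X)) (Y J (RO D (ivK v) X))"
    if X: "X \<in> Obj (VI K)" by (rule M(4)[OF X])
  show "Comp (VI J) (counit0 J (RO D (ivK v) X)) (RM D (eps J) (Cmp s X)) = RM D (ivK v) (counit0 K X)"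
    if X: "X \<in> Obj (VI K)"
  proof -
    note c = darrD[OF rkan_darr[OF der eK X]]
    note h = fun_hom[OF R[OF sfv(1)[OF v]] c(3)]
    have "Cmp (id_nt (Res D (eps J) \<circ>\<^sub>f Res D (cvK v))) (Y K X) =
        Id (VI J) (RO D (ivK v) (RO D (eps K) (Y K X)))"
      using c(2) fun_onD(2,3)[OF R[OF eJ]] fun_onD(2,3)[OF R[OF sfv(2)[OF v]]]
        strict_app(1)[OF pder_shift[OF P small_corner[OF reg]] strict_sys_param[OF P sfun_corner_edge[OF reg]] v]
      by simp
    then show ?thesis using M(5)[OF X] comp_id_right[OF cats(1)[OF V(2)] h] by simp
  qed
qed

text \<open>Invertibility of the structure cells takes the place of base change for right Kan
  extensions: on the edge they cancel against invertible counits, and at (0,1) both sides vanish, so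
  \<open>iso_corner\<close> applies.\<close>

lemma dm_ext0: "dm (shift D interval) (shift D corner) ext0"
proof -
  have cpt: "Cpt ext0 K = rkan D (eps K)" for K by (simp add: rkan_dmor_def)
  note PI = pder_shift[OF P small_interval[OF reg]] and PC = pder_shift[OF P small_corner[OF reg]]
  show ?thesis
  proof (rule right_dm[OF PI PC strict_sys_param[OF P sfun_corner_edge[OF reg]],
        where c = counit0]; unfold shift_sel cpt)
    fix A :: "'k scat" assume A: "small_cat A"
    show "fun_on (rkan D (eps A)) (VI A) (VC A)" by (rule rkan_fun[OF der sf(1)[OF A]])
    show "darr (VC A) (VI A) (Res D (eps A)) X (Y A X) (counit0 A X)" if "X \<in> Obj (VI A)" for X
      by (rule rkan_darr[OF der sf(1)[OF A] that])
    show "Comp (VI A) (counit0 A Z) (RM D (eps A) (FM (rkan D (eps A)) f)) = Comp (VI A) f (counit0 A X)"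
      if "in_hom (VI A) f X Z" for f X Z
      by (rule adjD(7)[OF rkan_adj[OF der sf(1)[OF A]] rkan_fun[OF der sf(1)[OF A]] that])
  next
    fix v :: "'k sfunc" and J K assume v: "sfun v J K"
    note s = ext0_str[OF v] and V = sfunD[OF v]
    show "NSrc (Str ext0 v) = Res D (cvK v) \<circ>\<^sub>f rkan D (eps K)" by (rule s(1))
    show "NTgt (Str ext0 v) = rkan D (eps J) \<circ>\<^sub>f Res D (ivK v)" by (rule s(2))
    show "ST ext0 v \<in> extensional (Obj (VI K))" by (rule s(3))
    fix X assume X: "X \<in> Obj (VI K)"
    show "in_hom (VC J) (ST ext0 v X) (RO D (cvK v) (Y K X)) (Y J (RO D (ivK v) X))" by (rule s(4)[OF X])
    show e: "Comp (VI J) (counit0 J (RO D (ivK v) X)) (RM D (eps J) (ST ext0 v X)) = RM D (ivK v) (counit0 K X)"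
      by (rule s(5)[OF X])
    note vX = fun_obj[OF R[OF sfv(1)[OF v]] X]
    note h = s(4)[OF X]
    show "is_iso (VC J) (ST ext0 v X)"
    proof (rule iso_corner[OF V(2) h _ _ rkan_eps_zero[OF V(2) vX]])
      note cK = darrD(3)[OF rkan_darr[OF der sf(1)[OF V(3)] X]]
      note cJ = darrD(3)[OF rkan_darr[OF der sf(1)[OF V(2)] vX]]
      show "is_iso (VI J) (RM D (eps J) (ST ext0 v X))"
        by (rule iso_comp_left_cancel[OF cats(1)[OF V(2)] fun_hom[OF R[OF sf(1)[OF V(2)]] h] cJ _ eps_counit_iso[OF V(2) vX]])
          (simp add: e fun_iso[OF R[OF sfv(1)[OF v]] cK eps_counit_iso[OF V(3) X]])
      fix j assume j: "j \<in> Obj J"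
      let ?x = "Pair (Bit False) (Bit True) :: 'k el"
      have x: "?x \<in> Obj corner" by (simp add: corner_obj interval_obj)
      then have xj: "Pair ?x j \<in> Obj (corner \<times>\<^sub>c J)" using j by simp
      have "cvK v \<circ>\<^sub>f pt (corner \<times>\<^sub>c J) (Pair ?x j) = pt (corner \<times>\<^sub>c K) (Pair ?x (FO v j))"
        using comp_pt[OF reg sfv(2)[OF v] xj] x j V by simp
      then show "zero_at (corner \<times>\<^sub>c J) (RO D (cvK v) (Y K X)) (Pair ?x j)"
        using rkan_eps_zero[OF V(3) X fun_obj[OF V(1) j]]
          res_comp_app(1)[OF P sfun_pt[OF reg small_par(2)[OF V(2)] xj] sfv(2)[OF v] YQV(1)[OF V(3) X]] by simp
    qed
  qed
qed

text \<open>The cone read off the edge (0,1) -> (1,1) instead of (1,0) -> (1,1). Its target vertex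
  is the same, but this edge vanishes at 0 and so carries the universal property.\<close>

abbreviation "cone0 \<equiv> strict_dmor (shift D interval) (\<lambda>K. Res D (pto K)) \<circ>\<^sub>d
  strict_dmor (shift D square) (\<lambda>K. Res D (edg K)) \<circ>\<^sub>d lkan_dmor D corner_incl \<circ>\<^sub>d ext0"
abbreviation "eta0 K \<equiv> Cmp (lkan_unit D (inc K))"
text \<open>The map from (x -> y) to (0 -> Cf) contained in the cofiber square. It starts at the
  restriction of the extension by zero and is carried to X by the inverse counit.\<close>

abbreviation "arr0 K X \<equiv> Comp (VI K) (Comp (VI K) (kap K (Q K X)) (RM D (eps K) (eta0 K (Y K X))))
  (inv_arr (VI K) (counit0 K X))"

lemma arr0:
  assumes K: "small_cat K" and X: "X \<in> Obj (VI K)"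
  shows "in_hom (VI K) (arr0 K X) X (V K X)"
    "Comp (VI K) (arr0 K X) (counit0 K X) = Comp (VI K) (kap K (Q K X)) (RM D (eps K) (eta0 K (Y K X)))"
proof -
  note C = cats(1)[OF K] and y = YQV[OF K X]
  note i = inv_arr[OF C eps_counit_iso[OF K X] darrD(3)[OF rkan_darr[OF der sf(1)[OF K] X]]]
  note h = comp_hom[OF C fun_hom[OF R[OF sf(1)[OF K]] uarrD(3)[OF lkan_uarr[OF der sf(2)[OF K] y(1)]]] kap_hom[OF K y(2)]]
  show "in_hom (VI K) (arr0 K X) X (V K X)" by (rule comp_hom[OF C i(1) h])
  show "Comp (VI K) (arr0 K X) (counit0 K X) = Comp (VI K) (kap K (Q K X)) (RM D (eps K) (eta0 K (Y K X)))"
    using comp_assoc[OF C darrD(3)[OF rkan_darr[OF der sf(1)[OF K] X]] i(1) h] i(2) comp_id_right[OF C h] by simp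
qed

text \<open>An equality of 2-cells lies behind this: the unit of \<open>square_adj\<close> lives on
  the first factor and v acts on the second.\<close>

lemma cell_shift:
  fixes v :: "'k sfunc"
  assumes v: "sfun v J K" and Z: "Z \<in> Obj (VS K)"
  shows "RM D (id_func square \<times>\<^sub>f v) (cell K Z) = cell J (RO D (id_func square \<times>\<^sub>f v) Z)"
proof -
  note V = sfunD[OF v]
  have su: "snt square_unit (id_func square) (square_edge \<circ>\<^sub>f square_proj) square (square :: 'k scat)"
    using square_adj[OF reg] by (simp add: cat_adj_def)
  have c: "snt (square_unit \<times>\<^sub>n id_nt (id_func L)) (id_func square \<times>\<^sub>f id_func L)
      ((square_edge \<circ>\<^sub>f square_proj) \<times>\<^sub>f id_func L) (square \<times>\<^sub>c L) (square \<times>\<^sub>c L)" if "small_cat L" for L :: "'k scat"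
    by (rule snt_prod[OF reg su snt_id[OF sfun_id[OF that]]])
  note sv = shift_sfun[OF reg small_square[OF reg] v]
  note sq = sfun_comp[OF sfun_square_proj[OF reg] sfun_square_edge[OF reg]]
  have eq: "(square_unit \<times>\<^sub>n id_nt (id_func K)) \<rhd> (id_func square \<times>\<^sub>f v) =
      (id_func square \<times>\<^sub>f v) \<lhd> (square_unit \<times>\<^sub>n id_nt (id_func J))"
  proof (rule nt_on_eqI)
    show "nt_on ((square_unit \<times>\<^sub>n id_nt (id_func K)) \<rhd> (id_func square \<times>\<^sub>f v))
        ((id_func square \<times>\<^sub>f id_func K) \<circ>\<^sub>f (id_func square \<times>\<^sub>f v))
        (((square_edge \<circ>\<^sub>f square_proj) \<times>\<^sub>f id_func K) \<circ>\<^sub>f (id_func square \<times>\<^sub>f v)) (square \<times>\<^sub>c J) (square \<times>\<^sub>c K)"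
      by (rule nt_on_rwhisk(1)[OF sntD(1)[OF c[OF V(3)]] sfunD(1)[OF sv]])
    show "nt_on ((id_func square \<times>\<^sub>f v) \<lhd> (square_unit \<times>\<^sub>n id_nt (id_func J)))
        ((id_func square \<times>\<^sub>f id_func K) \<circ>\<^sub>f (id_func square \<times>\<^sub>f v))
        (((square_edge \<circ>\<^sub>f square_proj) \<times>\<^sub>f id_func K) \<circ>\<^sub>f (id_func square \<times>\<^sub>f v)) (square \<times>\<^sub>c J) (square \<times>\<^sub>c K)"
      using nt_on_lwhisk(1)[OF sntD(1)[OF c[OF V(2)]] sfunD(1)[OF sv]]
      unfolding shift_square[OF sq v] shift_square[OF sfun_id[OF small_square[OF reg]] v] .
    fix x assume "x \<in> Obj (square \<times>\<^sub>c J)"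
    then obtain a j where x: "x = Pair a j" "a \<in> Obj square" "j \<in> Obj J" by (rule prod_cat_objE)
    note i = nt_on_id[OF fun_on_id[OF V(4)]] nt_on_id[OF fun_on_id[OF V(5)]]
    have "Cmp square_unit a \<in> Arr (square :: 'k scat)" using in_homD(1)[OF nt_hom[OF sntD(1)[OF su] x(2)]] .
    then show "Cmp ((square_unit \<times>\<^sub>n id_nt (id_func K)) \<rhd> (id_func square \<times>\<^sub>f v)) x =
        Cmp ((id_func square \<times>\<^sub>f v) \<lhd> (square_unit \<times>\<^sub>n id_nt (id_func J))) x"
      using x V nt_on_rwhisk(2)[OF sntD(1)[OF c[OF V(3)]] sfunD(1)[OF sv]]
        nt_on_lwhisk(2)[OF sntD(1)[OF c[OF V(2)]] sfunD(1)[OF sv]]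
        cmp_prod_nt[OF sntD(1)[OF su] i(1)] cmp_prod_nt[OF sntD(1)[OF su] i(2)]
        fun_obj[OF V(1) x(3)] fun_id[OF V(1) x(3)] in_homD(1)[OF id_hom[OF V(4) x(3)]] by simp
  qed
  show ?thesis using res2_rwhisk[OF P c[OF V(3)] sv Z] res2_lwhisk[OF P c[OF V(2)] sv Z] by (simp add: eq)
qed

text \<open>The unit is \<open>arr0\<close> followed by the inverse of the counit \<delta>, the only
  choice with \<delta> \<circ> \<theta> = \<open>arr0\<close>.\<close>

lemma cone0_adj: "\<exists>\<theta>. dadj (shift D interval) (shift D one) cone0 (lkan_dmor D (pt interval (Bit True))) \<theta>"
proof -
  note sh = pder_shift[OF P small_interval[OF reg]] pder_shift[OF P small_corner[OF reg]]
    pder_shift[OF P small_square[OF reg]] pder_shift[OF P small_one[OF reg]]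
  note par = strict_sys_param[OF P]
  have cpt: "Cpt (rkan_dmor D u) K = rkan D (u \<times>\<^sub>f id_func K)" "Cpt (lkan_dmor D u) K = lkan D (u \<times>\<^sub>f id_func K)"
    for u and K :: "'k scat" by (simp_all add: rkan_dmor_def lkan_dmor_def)
  note Fi = lkan_dmor_adj[OF der sfun_corner_incl[OF reg], unfolded res_dmor_eq[OF sfun_corner_incl[OF reg]]]
  note Ft = lkan_dmor_adj[OF der sfun_pt_interval[OF reg], unfolded res_dmor_eq[OF sfun_pt_interval[OF reg]]]
  note strI = strict_app[OF sh(3) par[OF sfun_corner_incl[OF reg]]] and strE = strict_app[OF sh(2) par[OF sfun_corner_edge[OF reg]]]
  show ?thesis
  proof (rule exI, rule cone_unit[OF sh par[OF sfun_corner_edge[OF reg]] par[OF sfun_corner_incl[OF reg]]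
        par[OF sfun_square_edge[OF reg]] par[OF sfun_pt_interval[OF reg]] dm_ext0 Fi Ft,
        where c = counit0 and \<kappa> = kap and \<delta> = "\<lambda>K. Cmp (lkan_counit D (pto K))" and a = arr0
          and \<theta> = "\<lambda>K X. Comp (VI K) (inv_arr (VI K) (Cmp (lkan_counit D (pto K)) (V K X))) (arr0 K X)"];
      unfold shift_sel cpt)
    fix K :: "'k scat" assume K: "small_cat K"
    show "Comp (VI K) (counit0 K Z) (RM D (eps K) (FM (rkan D (eps K)) f)) = Comp (VI K) f (counit0 K X)"
      if "in_hom (VI K) f X Z" for f X Z
      by (rule adjD(7)[OF rkan_adj[OF der sf(1)[OF K]] rkan_fun[OF der sf(1)[OF K]] that])
    show "in_hom (VI K) (kap K Z) (RO D (eps K) (RO D (inc K) Z)) (RO D (edg K) Z)"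
      if "Z \<in> Obj (VS K)" for Z by (rule kap_hom[OF K that])
    show "Comp (VI K) (kap K Z') (RM D (eps K) (RM D (inc K) f)) = Comp (VI K) (RM D (edg K) f) (kap K Z)"
      if f: "in_hom (VS K) f Z Z'" for f Z Z'
    proof -
      note S = cats(3)[OF K] and T = adjD[OF lkan_adj[OF der sf(5)[OF K]] R[OF sf(5)[OF K]]]
      note u = square_uarr[OF K]
      note o = hom_obj[OF S f]
      note ad = cat_adj_prod[OF reg K square_adj[OF reg]]
      have "snt (square_unit \<times>\<^sub>n id_nt (id_func K)) (id_func (square \<times>\<^sub>c K)) (edg K \<circ>\<^sub>f pro K) (square \<times>\<^sub>c K) (square \<times>\<^sub>c K)"
        using ad by (simp add: cat_adj_def)
      \<comment> \<open>Naturality of \<kappa> is naturality of the 2-cell behind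
        \<open>cell\<close>, restricted to the edge.\<close>
      from res2_nat[OF P this f]
      have n: "Comp (VS K) (cell K Z') f = Comp (VS K) (RM D (pro K) (RM D (edg K) f)) (cell K Z)"
        using res_id_app(2)[OF P small_par(3)[OF K] f] res_comp_app(2)[OF P sf(3)[OF K] sf(4)[OF K] f] by simp
      note c = uarrD(3)[OF u[OF o(1)]] uarrD(3)[OF u[OF o(2)]]
      note e = fun_hom[OF R[OF sf(4)[OF K]] f]
      note pe = fun_hom[OF R[OF sf(3)[OF K]] e]
      note Ri = R[OF sf(2)[OF K]] and Re = R[OF sf(1)[OF K]]
      show ?thesis
        using fun_comp[OF Ri f c(2)] fun_comp[OF Ri c(1) pe] fun_comp[OF Re fun_hom[OF Ri f] fun_hom[OF Ri c(2)]]
          fun_comp[OF Re fun_hom[OF Ri c(1)] fun_hom[OF Ri pe]] n eip(2)[OF K e] by simp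
    qed
    note T = adjD[OF lkan_adj[OF der sf(5)[OF K]] R[OF sf(5)[OF K]]]
    show "in_hom (VI K) (Cmp (lkan_counit D (pto K)) W) (FO (lkan D (pto K)) (RO D (pto K) W)) W \<and>
        Comp (VT K) (RM D (pto K) (Cmp (lkan_counit D (pto K)) W)) (Cmp (lkan_unit D (pto K)) (RO D (pto K) W)) =
        Id (VT K) (RO D (pto K) W)" if "W \<in> Obj (VI K)" for W using T(5,9)[OF that] by blast
    fix X assume X: "X \<in> Obj (VI K)"
    show "in_hom (VI K) (counit0 K X) (RO D (eps K) (Y K X)) X \<and> is_iso (VI K) (counit0 K X)"
      using darrD(3)[OF rkan_darr[OF der sf(1)[OF K] X]] eps_counit_iso[OF K X] by blast
    show "is_iso (VI K) (Cmp (lkan_counit D (pto K)) (V K X))"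
      by (rule pt_counit_iso[OF K YQV(3)[OF K X] V_zero[OF K X]])
    note a = arr0[OF K X]
    show "in_hom (VI K) (arr0 K X) X (V K X) \<and>
        Comp (VI K) (arr0 K X) (counit0 K X) = Comp (VI K) (kap K (Q K X)) (RM D (eps K) (eta0 K (Y K X)))"
      using a by blast
    show "Comp (VI K) (Cmp (lkan_counit D (pto K)) (V K X))
        (Comp (VI K) (inv_arr (VI K) (Cmp (lkan_counit D (pto K)) (V K X))) (arr0 K X)) = arr0 K X \<and>
        uarr (VT K) (VI K) (lkan D (pto K)) X (RO D (pto K) (V K X))
        (Comp (VI K) (inv_arr (VI K) (Cmp (lkan_counit D (pto K)) (V K X))) (arr0 K X))"
      using cone_universal[OF K X a] by blast
  next
    fix v :: "'k sfunc" and J K assume v: "sfun v J K"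
    note V = sfunD[OF v]
    show "Comp (VI J) (counit0 J (RO D (ivK v) X)) (RM D (eps J) (ST ext0 v X)) =
       RM D (ivK v) (counit0 K X)" if "X \<in> Obj (VI K)" for X by (rule ext0_str(5)[OF v that])
    fix Z assume Z: "Z \<in> Obj (VS K)"
    note c = uarrD(3)[OF square_uarr[OF V(3) Z]]
    show "RM D (ivK v) (kap K Z) = kap J (RO D (id_func square \<times>\<^sub>f v) Z)"
      using strE(2)[OF v] strI(2)[OF v] c fun_hom[OF R[OF sf(2)[OF V(3)]] c] cell_shift[OF v Z] by simp
  qed
qed

end

subsection \<open>Strict isomorphisms and evaluation\<close>

text \<open>Identity structure cells as a property, stable under composition and parameters, where
  \<open>strict_dmor\<close> is one particular form of record.\<close>

definition sdm :: "('k, 'o, 'm) prederiv \<Rightarrow> ('k, 'p, 'n) prederiv \<Rightarrow> ('k, 'o, 'm, 'p, 'n) dmor \<Rightarrow> bool" where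
  "sdm D E F \<longleftrightarrow> dm D E F \<and> (\<forall>u A B X. sfun u A B \<longrightarrow> X \<in> VObj D B \<longrightarrow>
     ST F u X = VId E A (CO F A (RO D u X)))"

lemma sdmD:
  assumes "sdm D E F"
  shows "dm D E F" "sfun u A B \<Longrightarrow> X \<in> VObj D B \<Longrightarrow>
    ST F u X = VId E A (CO F A (RO D u X))" using assms by (simp_all add: sdm_def)

lemma sdm_strict:
  assumes D: "pder D" and E: "pder E" and S: "strict_sys D E \<Phi>"
  shows "sdm D E (strict_dmor D \<Phi>)" unfolding sdm_def using dm_strict[OF D E S] strict_str[OF D S] by simp

lemma comp_sdm_str:
  assumes D: "pder D" and E: "pder E" and H: "pder H" and F: "dm D E F" and G: "sdm E H G"
    and u: "sfun u A B" and X: "X \<in> VObj D B"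
  shows "ST (G \<circ>\<^sub>d F) u X = CM G A (ST F u X)"
proof -
  note U = sfunD[OF u] and g = sdmD[OF G]
  note FX = fun_obj[OF dm_fun[OF F U(3)] X]
  note h = fun_hom[OF dm_fun[OF g(1) U(2)] dm_hom(1)[OF F u X]]
  show ?thesis
    using comp_dmor_str(4)[OF F g(1) u D E H X] g(2)[OF u FX] comp_id_right[OF val_cat[OF H U(2)] h] by simp
qed

lemma sdm_comp:
  assumes D: "pder D" and E: "pder E" and H: "pder H" and F: "sdm D E F" and G: "sdm E H G"
  shows "sdm D H (G \<circ>\<^sub>d F)" unfolding sdm_def
proof (intro conjI allI impI)
  show "dm D H (G \<circ>\<^sub>d F)" by (rule dm_comp[OF D E H sdmD(1)[OF F] sdmD(1)[OF G]])
  fix u A B X assume u: "sfun u A B" and X: "X \<in> VObj D B"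
  note U = sfunD[OF u]
  note F' = dm_fun[OF sdmD(1)[OF F] U(2)] and G' = dm_fun[OF sdmD(1)[OF G] U(2)]
  note uX = fun_obj[OF res_fun[OF D u] X]
  show "ST (G \<circ>\<^sub>d F) u X = VId H A (CO (G \<circ>\<^sub>d F) A (RO D u X))"
    using comp_sdm_str[OF D E H sdmD(1)[OF F] G u X] sdmD(2)[OF F u X] fun_id[OF G' fun_obj[OF F' uX]]
      comp_func_app(1)[OF F' uX, of "Cpt G A"] by simp
qed

lemma sdm_shift:
  assumes D: "pder D" and F: "sdm D E F" and P: "small_cat P"
  shows "sdm (shift D P) (shift E P) (shift_dmor F P)"
  unfolding sdm_def using dm_shift[OF D sdmD(1)[OF F] P] sdmD(2)[OF F shift_sfun[OF pder_reg[OF D] P]] by simp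

text \<open>Equality of component functors suffices to compare strict morphisms built in different
  ways: the identities form a modification.\<close>

lemma sdm_modi:
  assumes D: "pder D" and E: "pder E" and F: "sdm D E F" and G: "sdm D E G"
    and eq: "\<And>A. small_cat A \<Longrightarrow> Cpt F A = Cpt G A"
  shows "modi D E F G (\<lambda>A X. VId E A (CO F A X))" unfolding modi_def
proof (intro conjI allI impI)
  fix A X assume A: "small_cat A" and X: "X \<in> VObj D A"
  note FX = fun_obj[OF dm_fun[OF sdmD(1)[OF F] A] X]
  show "VHom E A (VId E A (CO F A X)) (CO F A X) (CO G A X)" using id_hom[OF val_cat[OF E A] FX] eq[OF A] by simp
  show "VIso E A (VId E A (CO F A X))" by (rule iso_id[OF val_cat[OF E A] FX])
next
  fix A X Y f assume A: "small_cat A" and f: "VHom D A f X Y"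
  note h = fun_hom[OF dm_fun[OF sdmD(1)[OF F] A] f]
  show "VComp E A (VId E A (CO F A Y)) (CM F A f) = VComp E A (CM G A f) (VId E A (CO F A X))"
    using comp_id_left[OF val_cat[OF E A] h] comp_id_right[OF val_cat[OF E A] h] eq[OF A] by simp
next
  fix u A B X assume u: "sfun u A B" and X: "X \<in> VObj D B"
  note U = sfunD[OF u] and C = val_cat[OF E sfunD(2)[OF u]]
  note f = dm_hom(1)[OF sdmD(1)[OF F] u X] and s = sdmD(2)[OF F u X]
  note FX = fun_obj[OF dm_fun[OF sdmD(1)[OF F] U(3)] X]
  \<comment> \<open>An identity structure cell forces its source and target to be the same
    object.\<close>
  have "RO E u (CO F B X) = CO F A (RO D u X)"
    using in_homD(2)[OF f] in_homD(2)[OF id_hom[OF C hom_obj(2)[OF C f]]] unfolding s by simp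
  then show "VComp E A (ST G u X) (RM E u (VId E B (CO F B X))) =
      VComp E A (VId E A (CO F A (RO D u X))) (ST F u X)"
    using s sdmD(2)[OF G u X] eq[OF U(2)] fun_id[OF res_fun[OF E u] FX] by simp
qed

text \<open>Lets reindexing isomorphisms, such as that of the point times K with K and that of the
  cube with its factorisation, enter chains of adjunctions.\<close>

lemma dadj_strict_inverse:
  assumes D: "pder D" and E: "pder E" and S: "strict_sys D E \<Phi>" and T: "strict_sys E D \<Psi>"
    and 1: "\<And>A. small_cat A \<Longrightarrow> \<Psi> A \<circ>\<^sub>f \<Phi> A = id_func (Val D A)"
    and 2: "\<And>A. small_cat A \<Longrightarrow> \<Phi> A \<circ>\<^sub>f \<Psi> A = id_func (Val E A)"
  shows "dadj D E (strict_dmor D \<Phi>) (strict_dmor E \<Psi>) (\<lambda>A. VId D A)"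
proof -
  note f = strict_fun[OF S] and g = strict_fun[OF T]
  have gf: "FO (\<Psi> A) (FO (\<Phi> A) X) = X" if "small_cat A" "X \<in> VObj D A" for A X
    using comp_func_app(1)[OF f[OF that(1)] that(2), of "\<Psi> A"] 1[OF that(1)] that by simp
  have gfm: "FM (\<Psi> A) (FM (\<Phi> A) h) = h" if "small_cat A" "VHom D A h X Y" for A h X Y
    using comp_func_app(2)[OF f[OF that(1)] that(2), of "\<Psi> A"] 1[OF that(1)] in_homD(1)[OF that(2)] by simp
  have fg: "FO (\<Phi> A) (FO (\<Psi> A) X) = X" if "small_cat A" "X \<in> VObj E A" for A X
    using comp_func_app(1)[OF g[OF that(1)] that(2), of "\<Phi> A"] 2[OF that(1)] that by simp
  have fgm: "FM (\<Phi> A) (FM (\<Psi> A) h) = h" if "small_cat A" "VHom E A h X Y" for A h X Y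
    using comp_func_app(2)[OF g[OF that(1)] that(2), of "\<Phi> A"] 2[OF that(1)] in_homD(1)[OF that(2)] by simp
  show ?thesis
  proof (rule dadjI[OF dm_strict[OF D E S] dm_strict[OF E D T]]; unfold strict_dmor_sel(1))
    fix A X assume A: "small_cat A" and X: "X \<in> VObj D A"
    note C = val_cat[OF D A]
    show "uarr (Val E A) (Val D A) (\<Psi> A) X (FO (\<Phi> A) X) (VId D A X)"
    proof (rule uarrI[OF g[OF A] fun_obj[OF f[OF A] X]])
      show "VHom D A (VId D A X) X (FO (\<Psi> A) (FO (\<Phi> A) X))" using id_hom[OF C X] gf[OF A X] by simp
      fix Z h assume Z: "Z \<in> VObj E A" and h: "VHom D A h X (FO (\<Psi> A) Z)"
      have "VHom E A (FM (\<Phi> A) h) (FO (\<Phi> A) X) Z" using fun_hom[OF f[OF A] h] fg[OF A Z] by simp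
      moreover have "VComp D A (FM (\<Psi> A) (FM (\<Phi> A) h)) (VId D A X) = h"
        using gfm[OF A h] comp_id_right[OF C h] by simp
      ultimately show "\<exists>k. VHom E A k (FO (\<Phi> A) X) Z \<and> VComp D A (FM (\<Psi> A) k) (VId D A X) = h"
        by blast
    next
      fix Z k k' assume k: "VHom E A k (FO (\<Phi> A) X) Z" and k': "VHom E A k' (FO (\<Phi> A) X) Z"
        and eq: "VComp D A (FM (\<Psi> A) k) (VId D A X) = VComp D A (FM (\<Psi> A) k') (VId D A X)"
      have "FM (\<Psi> A) k = FM (\<Psi> A) k'"
        using eq comp_id_right[OF C fun_hom[OF g[OF A] k]] comp_id_right[OF C fun_hom[OF g[OF A] k']] gf[OF A X] by simp
      then show "k = k'" using fgm[OF A k] fgm[OF A k'] by (metis (no_types))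
    qed
  next
    fix A h X Y assume A: "small_cat A" and h: "VHom D A h X Y"
    show "VComp D A (VId D A Y) h = VComp D A (FM (\<Psi> A) (FM (\<Phi> A) h)) (VId D A X)"
      using gfm[OF A h] comp_id_left[OF val_cat[OF D A] h] comp_id_right[OF val_cat[OF D A] h] by simp
  next
    fix u A B X assume u: "sfun u A B" and X: "X \<in> VObj D B"
    note U = sfunD[OF u] and C = val_cat[OF D sfunD(2)[OF u]]
    note uX = fun_obj[OF res_fun[OF D u] X]
    note fX = fun_obj[OF f[OF U(3)] X]
    have e: "FO (\<Psi> A) (RO E u (FO (\<Phi> B) X)) = RO D u X"
      using strict_app(1)[OF D S u X] gf[OF U(2) uX] by simp
    note i = id_hom[OF C uX]
    have 1: "FM (\<Psi> A) (ST (strict_dmor D \<Phi>) u X) = VId D A (RO D u X)"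
      using strict_str[OF D S u X] fun_id[OF g[OF U(2)] fun_obj[OF f[OF U(2)] uX]] gf[OF U(2) uX] by simp
    have 2: "ST (strict_dmor E \<Psi>) u (FO (\<Phi> B) X) = VId D A (RO D u X)"
      using strict_str[OF E T u fX] e by simp
    show "VComp D A (FM (\<Psi> A) (ST (strict_dmor D \<Phi>) u X))
        (VComp D A (ST (strict_dmor E \<Psi>) u (FO (\<Phi> B) X)) (RM D u (VId D B X))) = VId D A (RO D u X)"
      unfolding 1 2 fun_id[OF res_fun[OF D u] X] using comp_id_left[OF C i] by simp
  qed
qed

section \<open>Evaluation at an object, and the point as a parameter\<close>

definition slot :: "'k scat \<Rightarrow> 'k el \<Rightarrow> 'k scat \<Rightarrow> 'k sfunc" where
  "slot A a K = mk_func K (A \<times>\<^sub>c K) (Pair a) (Pair (Id A a))"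

text \<open>Shifting by the point yields D only up to isomorphism, since
  \<open>one \<times>\<^sub>c K\<close> is not K; \<open>unslot\<close> and
  \<open>slot one Star\<close> are the two directions.\<close>

definition unslot :: "'k scat \<Rightarrow> 'k sfunc" where
  "unslot K = mk_func (one \<times>\<^sub>c K) K psnd psnd"

lemma ev_dmor_eq: "ev_dmor D A a = strict_dmor (shift D A) (\<lambda>K. Res D (slot A a K))"
  by (simp add: ev_dmor_def slot_def)

lemma sfun_slot:
  assumes reg: "regular_universe TYPE('k)" and A: "small_cat (A :: 'k scat)" and a: "a \<in> Obj A" and K: "small_cat K"
  shows "sfun (slot A a K) K (A \<times>\<^sub>c K)"
proof -
  note C = small_cat_is_cat[OF A]
  have i: "in_hom A (Id A a) a a" "Id A a \<in> Arr A" "Comp A (Id A a) (Id A a) = Id A a"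
    using id_hom[OF C a] comp_id_left[OF C id_hom[OF C a]] by (auto simp: in_hom_def)
  show ?thesis unfolding sfun_def slot_def
  proof (intro conjI fun_onI)
    show "small_cat (A \<times>\<^sub>c K)" by (rule small_cat_prod[OF reg A K])
    then show "is_cat (A \<times>\<^sub>c K)" by (rule small_cat_is_cat)
  qed (use i a K in \<open>simp_all add: small_cat_is_cat\<close>)
qed

lemma sfun_unslot:
  assumes reg: "regular_universe TYPE('k)" and K: "small_cat (K :: 'k scat)"
  shows "sfun (unslot K) (one \<times>\<^sub>c K) K" unfolding sfun_def unslot_def
proof (intro conjI fun_onI)
  show "small_cat (one \<times>\<^sub>c K)" by (rule small_cat_prod[OF reg small_one[OF reg] K])
  then show "is_cat (one \<times>\<^sub>c K)" by (rule small_cat_is_cat)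
qed (use K in \<open>auto elim!: prod_cat_objE prod_cat_homE simp: small_cat_is_cat\<close>)

lemma slot_nat:
  assumes A: "small_cat A" and a: "a \<in> Obj A" and v: "sfun v J K"
  shows "(id_func A \<times>\<^sub>f v) \<circ>\<^sub>f slot A a J = slot A a K \<circ>\<^sub>f v"
proof -
  note V = sfunD[OF v] and C = small_cat_is_cat[OF A]
  note reg' = in_homD(1)[OF id_hom[OF C a]]
  show ?thesis unfolding comp_func_def mk_func_def
    using V a reg' fun_obj[OF V(1)] fun_arr[OF V(1)] by (auto simp: slot_def intro!: ext simp: restrict_def)
qed

lemma slot_sys:
  fixes D :: "('k, 'o, 'm) prederiv"
  assumes D: "pder D" and A: "small_cat A" and a: "a \<in> Obj A"
  shows "strict_sys (shift D A) D (\<lambda>K. Res D (slot A a K))"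
proof -
  note reg = pder_reg[OF D]
  show ?thesis
  proof (rule strict_sys_res[where S = "\<lambda>K. A \<times>\<^sub>c K" and T = "\<lambda>K. K" and TF = "\<lambda>u. u" and TN = "\<lambda>\<alpha>. \<alpha>", OF D shift_sel refl refl refl
        shift_sfun[OF reg A] _ shift_snt(1)[OF reg A] _ sfun_slot[OF reg A a] slot_nat[OF A a]])
    fix \<alpha> and u v :: "'k sfunc" and J K x assume al: "snt \<alpha> u v J K" and x: "x \<in> Obj J"
    show "Cmp (cat_times_ntrans A \<alpha>) (FO (slot A a J) x) = FM (slot A a K) (Cmp \<alpha> x)"
      using x shift_snt(2)[OF reg A al a x] in_homD(1)[OF nt_hom[OF sntD(1)[OF al] x]] by (simp add: slot_def)
  qed
qed

lemma unslot_sys: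
  fixes D :: "('k, 'o, 'm) prederiv"
  assumes D: "pder D"
  shows "strict_sys D (shift D one) (\<lambda>K. Res D (unslot K))"
proof -
  note reg = pder_reg[OF D]
  note o = small_one[OF reg]
  show ?thesis
  proof (rule strict_sys_res[where T = "\<lambda>K. one \<times>\<^sub>c K" and S = "\<lambda>K. K" and SF = "\<lambda>u. u" and SN = "\<lambda>\<alpha>. \<alpha>", OF D refl refl refl shift_sel
        _ shift_sfun[OF reg o] _ shift_snt(1)[OF reg o] sfun_unslot[OF reg]])
    fix v :: "'k sfunc" and J K assume v: "sfun v J K"
    note V = sfunD[OF v]
    show "v \<circ>\<^sub>f unslot J = unslot K \<circ>\<^sub>f (id_func one \<times>\<^sub>f v)"
    proof (rule func_eqI[of _ "one \<times>\<^sub>c J" K])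
      show "fun_on (v \<circ>\<^sub>f unslot J) (one \<times>\<^sub>c J) K"
        by (rule fun_on_comp[OF sfunD(1)[OF sfun_unslot[OF reg V(2)]] V(1)])
      show "fun_on (unslot K \<circ>\<^sub>f (id_func one \<times>\<^sub>f v)) (one \<times>\<^sub>c J) K"
        by (rule fun_on_comp[OF sfunD(1)[OF shift_sfun[OF reg o v]] sfunD(1)[OF sfun_unslot[OF reg V(3)]]])
    qed (use V fun_obj[OF V(1)] fun_arr[OF V(1)] in \<open>auto elim!: prod_cat_objE prod_cat_arrE simp: unslot_def\<close>)
  next
    fix \<alpha> and v w :: "'k sfunc" and J K x assume al: "snt \<alpha> v w J K" and x: "x \<in> Obj (one \<times>\<^sub>c J)"
    then obtain j where j: "x = Pair Star j" "j \<in> Obj J" by (auto elim: prod_cat_objE)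
    show "Cmp \<alpha> (FO (unslot J) x) = FM (unslot K) (Cmp (cat_times_ntrans one \<alpha>) x)"
      using j shift_snt(2)[OF reg o al _ j(2)] in_homD(1)[OF nt_hom[OF sntD(1)[OF al] j(2)]] by (simp add: unslot_def)
  qed
qed

lemma slot_unslot:
  assumes reg: "regular_universe TYPE('k)" and K: "small_cat (K :: 'k scat)"
  shows "unslot K \<circ>\<^sub>f slot one Star K = id_func K" "slot one Star K \<circ>\<^sub>f unslot K = id_func (one \<times>\<^sub>c K)"
proof -
  note s = sfun_slot[OF reg small_one[OF reg] _ K, of Star] and t = sfun_unslot[OF reg K]
  show "unslot K \<circ>\<^sub>f slot one Star K = id_func K"
    by (rule func_eqI[OF fun_on_comp[OF sfunD(1)[OF s] sfunD(1)[OF t]] fun_on_id[OF small_cat_is_cat[OF K]]])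
      (simp_all add: slot_def unslot_def)
  show "slot one Star K \<circ>\<^sub>f unslot K = id_func (one \<times>\<^sub>c K)"
    by (rule func_eqI[OF fun_on_comp[OF sfunD(1)[OF t] sfunD(1)[OF s]] fun_on_id[OF sfunD(4)[OF t]]])
      (auto elim!: prod_cat_objE prod_cat_arrE simp: slot_def unslot_def)
qed

context ptd_der
begin

section \<open>The chain cone -| extension by zero -| evaluation at 1\<close>

text \<open>\<open>cyl\<close> sends \<open>x\<close> to \<open>0 \<rightarrow> x\<close>. It is right adjoint to the cone and left adjoint to evaluation at \<open>1\<close>.\<close>

abbreviation "cyl \<equiv> lkan_dmor D (pt interval (Bit True)) \<circ>\<^sub>d strict_dmor D (\<lambda>K. Res D (unslot K))"
abbreviation "ev1 \<equiv> strict_dmor (shift D one) (\<lambda>K. Res D (slot one Star K)) \<circ>\<^sub>d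
  strict_dmor (shift D interval) (\<lambda>K. Res D (pto K))"

lemma slot_dadj:
  "dadj (shift D one) D (strict_dmor (shift D one) (\<lambda>K. Res D (slot one Star K))) (strict_dmor D (\<lambda>K. Res D (unslot K)))
    (\<lambda>A. VId (shift D one) A)"
  "dadj D (shift D one) (strict_dmor D (\<lambda>K. Res D (unslot K))) (strict_dmor (shift D one) (\<lambda>K. Res D (slot one Star K)))
    (\<lambda>A. VId D A)"
proof -
  note o = small_one[OF reg]
  note S = slot_sys[OF P o, of Star, simplified] and T = unslot_sys[OF P]
  note s = sfun_slot[OF reg o, of Star, simplified] and t = sfun_unslot[OF reg]
  have e: "Res D (unslot A) \<circ>\<^sub>f Res D (slot one Star A) = id_func (Val (shift D one) A)"
    "Res D (slot one Star A) \<circ>\<^sub>f Res D (unslot A) = id_func (Val D A)" if A: "small_cat A" for A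
    using slot_unslot[OF reg A] res_comp[OF P s[OF A] t[OF A]] res_comp[OF P t[OF A] s[OF A]]
      res_id[OF P A] res_id[OF P small_cat_prod[OF reg o A]] by simp_all
  show "dadj (shift D one) D (strict_dmor (shift D one) (\<lambda>K. Res D (slot one Star K))) (strict_dmor D (\<lambda>K. Res D (unslot K)))
    (\<lambda>A. VId (shift D one) A)" by (rule dadj_strict_inverse[OF pder_shift[OF P o] P S T e])
  show "dadj D (shift D one) (strict_dmor D (\<lambda>K. Res D (unslot K))) (strict_dmor (shift D one) (\<lambda>K. Res D (slot one Star K)))
    (\<lambda>A. VId D A)" by (rule dadj_strict_inverse[OF P pder_shift[OF P o] T S e(2,1)])
qed

lemma cyl_ev1: "\<exists>\<theta>. dadj D (shift D interval) cyl ev1 \<theta>"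
  using dadj_comp[OF P pder_shift[OF P small_one[OF reg]] pder_shift[OF P small_interval[OF reg]] slot_dadj(2)
    lkan_dmor_adj[OF der sfun_pt_interval[OF reg], unfolded res_dmor_eq[OF sfun_pt_interval[OF reg]]]] by blast

lemma sdm_ev1: "sdm (shift D interval) D ev1"
  using sdm_comp[OF pder_shift[OF P small_interval[OF reg]] pder_shift[OF P small_one[OF reg]] P
    sdm_strict[OF pder_shift[OF P small_interval[OF reg]] pder_shift[OF P small_one[OF reg]]
      strict_sys_param[OF P sfun_pt_interval[OF reg]]]
    sdm_strict[OF pder_shift[OF P small_one[OF reg]] P slot_sys[OF P small_one[OF reg]]], of Star] by simp

lemma ev1_cpt:
  assumes K: "small_cat K"
  shows "Cpt ev1 K = Res D (slot interval (Bit True) K)"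
proof -
  note s = sfun_slot[OF reg small_one[OF reg] _ K, of Star, simplified]
  have "slot interval (Bit True) K = pto K \<circ>\<^sub>f slot one Star K"
    by (rule func_eqI[OF sfunD(1)[OF sfun_slot[OF reg small_interval[OF reg] _ K]] sfunD(1)[OF sfun_comp[OF s sf(5)[OF K]]]])
      (simp_all add: interval_obj slot_def pt_def)
  then show ?thesis using res_comp[OF P s sf(5)[OF K]] by simp
qed

text \<open>The known right adjoint belongs to \<open>cone0\<close>, while \<open>cone\<close> is
  defined through the edge (1,0) -> (1,1). Both evaluate at the vertex (1,1), so after the common
  part \<open>?T\<close> they apply equal functors, and by strictness of these factors the structure
  cells agree too.\<close>

lemma cone_cyl: "\<exists>\<theta>. dadj (shift D interval) D (cone D) cyl \<theta>"
proof -
  note PI = pder_shift[OF P small_interval[OF reg]] and PC = pder_shift[OF P small_corner[OF reg]]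
    and PS = pder_shift[OF P small_square[OF reg]] and PO = pder_shift[OF P small_one[OF reg]]
  have tI: "Bit True \<in> Obj (interval :: 'k scat)" and st: "Star \<in> Obj (one :: 'k scat)" by (simp_all add: interval_obj)
  let ?T = "lkan_dmor D corner_incl \<circ>\<^sub>d ext0"
  let ?s = "strict_dmor (shift D one) (\<lambda>K. Res D (slot one Star K))"
    and ?p = "strict_dmor (shift D interval) (\<lambda>K. Res D (pto K))"
    and ?e = "strict_dmor (shift D square) (\<lambda>K. Res D (edg K))"
    and ?f = "strict_dmor (shift D square) (\<lambda>K. Res D (cof_edge \<times>\<^sub>f id_func K))"
    and ?v = "strict_dmor (shift D interval) (\<lambda>K. Res D (slot interval (Bit True) K))"
  obtain \<theta> where th: "dadj (shift D interval) (shift D one) cone0 (lkan_dmor D (pt interval (Bit True))) \<theta>"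
    using cone0_adj by blast
  note ad = dadj_comp[OF PI PO P th slot_dadj(1)]
  have T: "dm (shift D interval) (shift D square) ?T"
    by (rule dm_comp[OF PI PC PS dm_ext0 dadjD(1)[OF lkan_dmor_adj[OF der sfun_corner_incl[OF reg]]]])
  have se: "sdm (shift D square) (shift D interval) ?e"
    by (rule sdm_strict[OF PS PI strict_sys_param[OF P sfun_square_edge[OF reg]]])
  have sc: "sdm (shift D square) (shift D interval) ?f"
    by (rule sdm_strict[OF PS PI strict_sys_param[OF P sfun_cof_edge[OF reg]]])
  have sp: "sdm (shift D interval) (shift D one) ?p"
    by (rule sdm_strict[OF PI PO strict_sys_param[OF P sfun_pt_interval[OF reg]]])
  have ss: "sdm (shift D one) D ?s" by (rule sdm_strict[OF PO P slot_sys[OF P small_one[OF reg] st]])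
  have sv: "sdm (shift D interval) D ?v" by (rule sdm_strict[OF PI P slot_sys[OF P small_interval[OF reg] tI]])
  have cone: "cone D = ?v \<circ>\<^sub>d ?f \<circ>\<^sub>d ?T"
    by (simp add: cone_def cof_def ev_dmor_eq res_dmor_eq[OF sfun_cof_edge[OF reg]])
  note T1 = dm_comp[OF PI PS PI T sdmD(1)[OF sc]] and T2 = dm_comp[OF PI PS PI T sdmD(1)[OF se]]
  note T3 = dm_comp[OF PI PI PO T2 sdmD(1)[OF sp]]
  \<comment> \<open>Both routes from K to the square times K insert the vertex (1,1).\<close>
  have key: "Res D (slot interval (Bit True) K) \<circ>\<^sub>f Res D (cof_edge \<times>\<^sub>f id_func K) =
      Res D (slot one Star K) \<circ>\<^sub>f Res D (pto K) \<circ>\<^sub>f Res D (edg K)" if K: "small_cat K" for K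
  proof -
    note s = sfun_slot[OF reg small_one[OF reg] st K] and t = sfun_slot[OF reg small_interval[OF reg] tI K]
    note c = sfun_prod[OF reg sfun_cof_edge[OF reg] sfun_id[OF K]]
    have i: "Pair (Bit True) (Bit True) \<in> Arr (interval :: 'k scat)"
      using in_homD(1)[OF id_hom[OF interval_cat(1) tI]] by simp
    have "(cof_edge \<times>\<^sub>f id_func K) \<circ>\<^sub>f slot interval (Bit True) K = edg K \<circ>\<^sub>f pto K \<circ>\<^sub>f slot one Star K"
      by (rule func_eqI[OF sfunD(1)[OF sfun_comp[OF t c]] sfunD(1)[OF sfun_comp[OF sfun_comp[OF s sf(5)[OF K]] sf(4)[OF K]]]])
        (simp_all add: slot_def pt_def cof_edge_def square_edge_def interval_obj i)
    then show ?thesis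
      using res_comp[OF P t c] res_comp[OF P sfun_comp[OF s sf(5)[OF K]] sf(4)[OF K]] res_comp[OF P s sf(5)[OF K]]
        comp_func_assoc[OF R[OF sf(4)[OF K]] R[OF sf(5)[OF K]] R[OF s]] by simp
  qed
  have ka: "RM D (slot interval (Bit True) K) (RM D (cof_edge \<times>\<^sub>f id_func K) f) =
      RM D (slot one Star K) (RM D (pto K) (RM D (edg K) f))"
    if K: "small_cat K" and f: "in_hom (VS K) f X Z" for K f X Z
  proof -
    note c = sfun_prod[OF reg sfun_cof_edge[OF reg] sfun_id[OF K]]
    show ?thesis using arg_cong[where f = "\<lambda>F. FM F f", OF key[OF K]]
      by (simp add: comp_func_app(2)[OF R[OF c] f] comp_func_app(2)[OF R[OF sf(4)[OF K]] f]
        comp_func_app(2)[OF fun_on_comp[OF R[OF sf(4)[OF K]] R[OF sf(5)[OF K]]] f])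
  qed
  have "dadj (shift D interval) D (cone D) cyl
    (\<lambda>A X. VComp (shift D interval) A (CM (lkan_dmor D (pt interval (Bit True))) A
      (VId (shift D one) A (CO cone0 A X))) (\<theta> A X))"
  proof (rule dadj_cong[OF ad])
    show "dm (shift D interval) D (cone D)" unfolding cone by (rule dm_comp[OF PI PI P T1 sdmD(1)[OF sv]])
    show "Cpt (cone D) K = Cpt (?s \<circ>\<^sub>d cone0) K" if K: "small_cat K" for K
    proof -
      note s = R[OF sfun_slot[OF reg small_one[OF reg] st K]] and t = R[OF sfun_slot[OF reg small_interval[OF reg] tI K]]
      note c = R[OF sfun_prod[OF reg sfun_cof_edge[OF reg] sfun_id[OF K]]]
      note T' = dm_fun[OF T K, unfolded shift_sel comp_dmor_cpt]
      note e = R[OF sf(4)[OF K]] and p = R[OF sf(5)[OF K]]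
      show ?thesis unfolding cone comp_dmor_cpt strict_dmor_sel
        unfolding comp_func_assoc[OF T' c t, symmetric] key[OF K]
        unfolding comp_func_assoc[OF T' fun_on_comp[OF e p] s] comp_func_assoc[OF T' e p] ..
    qed
    fix u :: "'k sfunc" and A B X assume u: "sfun u A B" and X: "X \<in> VObj (shift D interval) B"
    note U = sfunD[OF u]
    show "ST (cone D) u X = ST (?s \<circ>\<^sub>d cone0) u X"
      unfolding cone comp_sdm_str[OF PI PI P T1 sv u X] comp_sdm_str[OF PI PS PI T sc u X]
        comp_sdm_str[OF PI PO P T3 ss u X] comp_sdm_str[OF PI PI PO T2 sp u X] comp_sdm_str[OF PI PS PI T se u X]
        strict_dmor_sel by (rule ka[OF U(2) dm_hom(1)[OF T u X, unfolded shift_sel]])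
  qed
  then show ?thesis by blast
qed

end

text \<open>Conjugating the commutation squares by the inverses gives strictness of the inverse
  family, so for \<open>split_func\<close> only functoriality and the two inverse laws are verified
  by hand.\<close>

lemma strict_sys_inverse:
  assumes D: "pder D" and E: "pder E" and S: "strict_sys D E \<Phi>"
    and g: "\<And>A. small_cat A \<Longrightarrow> fun_on (\<Psi> A) (Val E A) (Val D A)"
    and 1: "\<And>A. small_cat A \<Longrightarrow> \<Psi> A \<circ>\<^sub>f \<Phi> A = id_func (Val D A)"
    and 2: "\<And>A. small_cat A \<Longrightarrow> \<Phi> A \<circ>\<^sub>f \<Psi> A = id_func (Val E A)"
  shows "strict_sys E D \<Psi>" unfolding strict_sys_def
proof (intro conjI allI impI)
  note f = strict_fun[OF S]
  show "fun_on (\<Psi> A) (Val E A) (Val D A)" if "small_cat A" for A by (rule g[OF that])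
  show "Res D u \<circ>\<^sub>f \<Psi> B = \<Psi> A \<circ>\<^sub>f Res E u" if u: "sfun u A B" for u A B
  proof -
    note U = sfunD[OF u] and r = res_fun[OF D u] and s = res_fun[OF E u]
    note rg = fun_on_comp[OF g[OF U(3)] r]
    have "Res D u \<circ>\<^sub>f \<Psi> B = (\<Psi> A \<circ>\<^sub>f \<Phi> A) \<circ>\<^sub>f (Res D u \<circ>\<^sub>f \<Psi> B)"
      unfolding 1[OF U(2)] comp_id_func(2)[OF rg] ..
    also have "\<dots> = \<Psi> A \<circ>\<^sub>f ((\<Phi> A \<circ>\<^sub>f Res D u) \<circ>\<^sub>f \<Psi> B)"
      unfolding comp_func_assoc[OF rg f[OF U(2)] g[OF U(2)]] comp_func_assoc[OF g[OF U(3)] r f[OF U(2)]] ..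
    also have "\<dots> = \<Psi> A \<circ>\<^sub>f (Res E u \<circ>\<^sub>f (\<Phi> B \<circ>\<^sub>f \<Psi> B))"
      unfolding strict_comm[OF S u, symmetric] comp_func_assoc[OF g[OF U(3)] f[OF U(3)] s] ..
    also have "\<dots> = \<Psi> A \<circ>\<^sub>f Res E u" unfolding 2[OF U(3)] comp_id_func(1)[OF s] ..
    finally show ?thesis .
  qed
  fix \<alpha> u v A B X assume al: "snt \<alpha> u v A B" and X: "X \<in> VObj E B"
  note U = sfunD[OF sntD(2)[OF al]]
  note gX = fun_obj[OF g[OF U(3)] X]
  note h = res2_hom[OF D al gX]
  have "FM (\<Psi> A) (FM (\<Phi> A) (Cmp (Res2 D \<alpha>) (FO (\<Psi> B) X))) = Cmp (Res2 D \<alpha>) (FO (\<Psi> B) X)"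
    using comp_func_app(2)[OF f[OF U(2)] h, of "\<Psi> A"] 1[OF U(2)] in_homD(1)[OF h] by simp
  moreover have "FO (\<Phi> B) (FO (\<Psi> B) X) = X"
    using comp_func_app(1)[OF g[OF U(3)] X, of "\<Phi> B"] 2[OF U(3)] X by simp
  ultimately show "Cmp (Res2 D \<alpha>) (FO (\<Psi> B) X) = FM (\<Psi> A) (Cmp (Res2 E \<alpha>) X)"
    using strict_cell[OF S al gX] by simp
qed

subsection \<open>Cubes\<close>

lemma cube_obj: "x \<in> Obj (cube n) \<longleftrightarrow> (\<exists>xs. x = Vec xs \<and> length xs = n)"
  by (auto simp: cube_def)

lemma cube_hom: "in_hom (cube n) f x y \<longleftrightarrow> f = Pair x y \<and> x \<in> Obj (cube n) \<and> y \<in> Obj (cube n) \<and>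
    list_all2 (\<le>) (the_vec x) (the_vec y)" by (auto simp: cube_def poset_cat_hom)

lemma cube_sel [simp]: "Id (cube n) x = Pair x x" "Comp (cube n) g f = Pair (pfst f) (psnd g)"
  by (simp_all add: cube_def)

lemma interval_comp [simp]: "Comp interval g f = Pair (pfst f) (psnd g)" by (simp add: interval_def)

lemma small_cube:
  assumes "regular_universe TYPE('k)"
  shows "small_cat (cube n :: 'k scat)" unfolding cube_def
proof (rule small_poset[OF assms])
  show "finite (Vec ` {xs. length xs = n} :: 'k el set)"
    using finite_lists_length_eq[of "UNIV :: bool set" n] by simp
  fix x y z :: "'k el"
  show "list_all2 (\<le>) (the_vec x) (the_vec x)" by (simp add: list_all2_refl)
  show "list_all2 (\<le>) (the_vec x) (the_vec z)"
    if "list_all2 (\<le>) (the_vec x) (the_vec y)" "list_all2 (\<le>) (the_vec y) (the_vec z)"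
    by (rule list_all2_trans[OF _ that]) (rule order_trans)
qed

text \<open>Coordinates are counted from 1 and list positions from 0, so coordinate i is the entry
  at position i - 1: the one left out between \<open>take (i - 1)\<close> and
  \<open>drop i\<close>.\<close>

definition del_coord :: "nat \<Rightarrow> 'k el \<Rightarrow> 'k el" where
  "del_coord i x = Vec (take (i - 1) (the_vec x) @ drop i (the_vec x))"

definition nth_coord :: "nat \<Rightarrow> 'k el \<Rightarrow> 'k el" where
  "nth_coord i x = Bit (the_vec x ! (i - 1))"

section \<open>Coordinate i as a factor of the cube\<close>

context
  fixes n i :: nat
  assumes i: "1 \<le> i" "i \<le> n"
begin

lemma insert_coord_obj: "b \<in> Obj interval \<Longrightarrow> x \<in> Obj (cube (n - 1)) \<Longrightarrow> insert_coord i b x \<in> Obj (cube n)"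
  using i by (auto simp: cube_obj insert_coord_def)

lemma insert_coord_hom:
  assumes "in_hom interval f a b" "in_hom (cube (n - 1)) g x y"
  shows "in_hom (cube n) (Pair (insert_coord i (pfst f) (pfst g)) (insert_coord i (psnd f) (psnd g)))
    (insert_coord i a x) (insert_coord i b y)" using assms insert_coord_obj[of a x] insert_coord_obj[of b y]
  by (auto simp: cube_hom interval_hom insert_coord_def intro!: list_all2_appendI list_all2_takeI list_all2_dropI)

lemma del_coord_obj: "x \<in> Obj (cube n) \<Longrightarrow> del_coord i x \<in> Obj (cube (n - 1))"
  using i by (auto simp: cube_obj del_coord_def)

lemma nth_coord_obj: "nth_coord i x \<in> Obj interval" by (simp add: nth_coord_def interval_obj)

lemma del_coord_hom:
  assumes "in_hom (cube n) f x y"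
  shows "in_hom (cube (n - 1)) (Pair (del_coord i (pfst f)) (del_coord i (psnd f))) (del_coord i x) (del_coord i y)"
    "in_hom interval (Pair (nth_coord i (pfst f)) (nth_coord i (psnd f))) (nth_coord i x) (nth_coord i y)"
proof -
  have l: "list_all2 (\<le>) (the_vec x) (the_vec y)" "length (the_vec x) = n" "f = Pair x y"
    "x \<in> Obj (cube n)" "y \<in> Obj (cube n)" using assms by (auto simp: cube_hom cube_obj)
  show "in_hom (cube (n - 1)) (Pair (del_coord i (pfst f)) (del_coord i (psnd f))) (del_coord i x) (del_coord i y)"
    using l del_coord_obj[OF l(4)] del_coord_obj[OF l(5)]
    by (auto simp: cube_hom del_coord_def intro!: list_all2_appendI list_all2_takeI list_all2_dropI)
  show "in_hom interval (Pair (nth_coord i (pfst f)) (nth_coord i (psnd f))) (nth_coord i x) (nth_coord i y)"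
    using l list_all2_nthD[OF l(1), of "i - 1"] i nth_coord_obj by (auto simp: interval_hom nth_coord_def interval_obj)
qed

lemma insert_del: "x \<in> Obj (cube n) \<Longrightarrow> insert_coord i (nth_coord i x) (del_coord i x) = x"
proof -
  assume "x \<in> Obj (cube n)"
  then obtain xs where x: "x = Vec xs" "length xs = n" by (auto simp: cube_obj)
  have "xs = take (i - 1) xs @ xs ! (i - 1) # drop i xs" using id_take_nth_drop[of "i - 1" xs] i x by simp
  then show ?thesis using i x by (simp add: insert_coord_def del_coord_def nth_coord_def)
qed

lemma del_insert:
  assumes "b \<in> Obj interval" "x \<in> Obj (cube (n - 1))"
  shows "nth_coord i (insert_coord i b x) = b" "del_coord i (insert_coord i b x) = x"
proof -
  obtain xs where x: "x = Vec xs" "length xs = n - 1" using assms(2) by (auto simp: cube_obj)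
  have l: "length (take (i - 1) xs) = i - 1" using i x(2) by simp
  show "nth_coord i (insert_coord i b x) = b" using assms(1) x nth_append_length[of "take (i - 1) xs", unfolded l]
    by (auto simp: nth_coord_def insert_coord_def interval_obj)
  show "del_coord i (insert_coord i b x) = x" using i x l by (simp add: del_coord_def insert_coord_def)
qed

text \<open>The inverse of \<open>coord_func n i K\<close>: coordinate i becomes the first
  factor.\<close>

definition split_func :: "'k scat \<Rightarrow> 'k sfunc" where
  "split_func K = mk_func (cube n \<times>\<^sub>c K) (interval \<times>\<^sub>c (cube (n - 1) \<times>\<^sub>c K))
     (\<lambda>p. Pair (nth_coord i (pfst p)) (Pair (del_coord i (pfst p)) (psnd p)))
     (\<lambda>f. Pair (Pair (nth_coord i (pfst (pfst f))) (nth_coord i (psnd (pfst f))))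
      (Pair (Pair (del_coord i (pfst (pfst f))) (del_coord i (psnd (pfst f)))) (psnd f)))"

context
  fixes K :: "'k scat"
  assumes reg: "regular_universe TYPE('k)" and K: "small_cat K"
begin

lemma coord_small: "small_cat (cube n \<times>\<^sub>c K)" "small_cat (interval \<times>\<^sub>c (cube (n - 1) \<times>\<^sub>c K))"
  by (intro small_cat_prod[OF reg] small_cube[OF reg] small_interval[OF reg] K)+

lemma sfun_coord: "sfun (coord_func n i K) (interval \<times>\<^sub>c (cube (n - 1) \<times>\<^sub>c K)) (cube n \<times>\<^sub>c K)"
  unfolding sfun_def coord_func_def
proof (intro conjI coord_small fun_onI coord_small[THEN small_cat_is_cat])
  show "Pair (insert_coord i (pfst x) (pfst (psnd x))) (psnd (psnd x)) \<in> Obj (cube n \<times>\<^sub>c K)"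
    if "x \<in> Obj (interval \<times>\<^sub>c (cube (n - 1) \<times>\<^sub>c K))" for x
    using that by (auto elim!: prod_cat_objE intro: insert_coord_obj)
  show "in_hom (cube n \<times>\<^sub>c K)
      (Pair (Pair (insert_coord i (pfst (pfst f)) (pfst (pfst (psnd f)))) (insert_coord i (psnd (pfst f)) (psnd (pfst (psnd f)))))
      (psnd (psnd f))) (Pair (insert_coord i (pfst x) (pfst (psnd x))) (psnd (psnd x)))
      (Pair (insert_coord i (pfst y) (pfst (psnd y))) (psnd (psnd y)))"
    if "in_hom (interval \<times>\<^sub>c (cube (n - 1) \<times>\<^sub>c K)) f x y" for f x y
    using that by (auto elim!: prod_cat_homE intro: insert_coord_hom)
qed (auto elim!: prod_cat_objE prod_cat_homE)

lemma sfun_split: "sfun (split_func K) (cube n \<times>\<^sub>c K) (interval \<times>\<^sub>c (cube (n - 1) \<times>\<^sub>c K))"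
  unfolding sfun_def split_func_def
proof (intro conjI coord_small fun_onI coord_small[THEN small_cat_is_cat])
  show "Pair (nth_coord i (pfst x)) (Pair (del_coord i (pfst x)) (psnd x)) \<in> Obj (interval \<times>\<^sub>c (cube (n - 1) \<times>\<^sub>c K))"
    if "x \<in> Obj (cube n \<times>\<^sub>c K)" for x
    using that nth_coord_obj del_coord_obj by (auto elim!: prod_cat_objE)
  show "in_hom (interval \<times>\<^sub>c (cube (n - 1) \<times>\<^sub>c K))
      (Pair (Pair (nth_coord i (pfst (pfst f))) (nth_coord i (psnd (pfst f))))
      (Pair (Pair (del_coord i (pfst (pfst f))) (del_coord i (psnd (pfst f)))) (psnd f)))
      (Pair (nth_coord i (pfst x)) (Pair (del_coord i (pfst x)) (psnd x)))
      (Pair (nth_coord i (pfst y)) (Pair (del_coord i (pfst y)) (psnd y)))"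
    if "in_hom (cube n \<times>\<^sub>c K) f x y" for f x y using that del_coord_hom by (auto elim!: prod_cat_homE)
qed (auto elim!: prod_cat_objE prod_cat_homE)

lemma coord_split: "coord_func n i K \<circ>\<^sub>f split_func K = id_func (cube n \<times>\<^sub>c K)"
proof (rule func_eqI[OF fun_on_comp[OF sfunD(1)[OF sfun_split] sfunD(1)[OF sfun_coord]]
      fun_on_id[OF coord_small(1)[THEN small_cat_is_cat]]])
  note o = fun_obj[OF sfunD(1)[OF sfun_split]] and a = fun_arr[OF sfunD(1)[OF sfun_split]]
  fix x assume x: "x \<in> Obj (cube n \<times>\<^sub>c K)"
  show "FO (coord_func n i K \<circ>\<^sub>f split_func K) x = FO (id_func (cube n \<times>\<^sub>c K)) x"
    using x o[OF x] by (auto elim!: prod_cat_objE simp: insert_del split_func_def coord_func_def)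
next
  note a = fun_arr[OF sfunD(1)[OF sfun_split]]
  fix f assume f: "f \<in> Arr (cube n \<times>\<^sub>c K)"
  then obtain g h where g: "f = Pair g h" "g \<in> Arr (cube n)" "h \<in> Arr K" by (rule prod_cat_arrE)
  have "in_hom (cube n) g (Dom (cube n) g) (Cod (cube n) g)" by (rule arr_hom[OF g(2)])
  then obtain x y where "g = Pair x y" "x \<in> Obj (cube n)" "y \<in> Obj (cube n)" by (auto simp: cube_hom)
  then show "FM (coord_func n i K \<circ>\<^sub>f split_func K) f = FM (id_func (cube n \<times>\<^sub>c K)) f"
    using f g a[OF f] by (simp add: insert_del split_func_def coord_func_def)
qed

lemma split_coord: "split_func K \<circ>\<^sub>f coord_func n i K = id_func (interval \<times>\<^sub>c (cube (n - 1) \<times>\<^sub>c K))"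
proof (rule func_eqI[OF fun_on_comp[OF sfunD(1)[OF sfun_coord] sfunD(1)[OF sfun_split]]
      fun_on_id[OF coord_small(2)[THEN small_cat_is_cat]]])
  note o = fun_obj[OF sfunD(1)[OF sfun_coord]]
  fix x assume x: "x \<in> Obj (interval \<times>\<^sub>c (cube (n - 1) \<times>\<^sub>c K))"
  show "FO (split_func K \<circ>\<^sub>f coord_func n i K) x = FO (id_func (interval \<times>\<^sub>c (cube (n - 1) \<times>\<^sub>c K))) x"
    using x o[OF x] by (auto elim!: prod_cat_objE simp: del_insert split_func_def coord_func_def)
next
  note a = fun_arr[OF sfunD(1)[OF sfun_coord]]
  fix f assume f: "f \<in> Arr (interval \<times>\<^sub>c (cube (n - 1) \<times>\<^sub>c K))"
  then obtain e g h where g: "f = Pair e (Pair g h)" "e \<in> Arr interval" "g \<in> Arr (cube (n - 1))" "h \<in> Arr K"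
    by (auto elim!: prod_cat_arrE)
  obtain b c x y where "e = Pair b c" "b \<in> Obj interval" "c \<in> Obj interval" "g = Pair x y"
    "x \<in> Obj (cube (n - 1))" "y \<in> Obj (cube (n - 1))"
    using arr_hom[OF g(2)] arr_hom[OF g(3)] by (auto simp: cube_hom interval_hom)
  then show "FM (split_func K \<circ>\<^sub>f coord_func n i K) f = FM (id_func (interval \<times>\<^sub>c (cube (n - 1) \<times>\<^sub>c K))) f"
    using f g a[OF f] by (simp add: del_insert split_func_def coord_func_def)
qed

end

text \<open>The target is a double shift because its value at K is D at [1] x ([1]^(n-1) x K), the
  form in which the cone with parameters [1]^(n-1) takes its argument.\<close>

lemma coord_sys:
  fixes D :: "('k, 'o, 'm) prederiv"
  assumes D: "pder D"
  shows "strict_sys (shift D (cube n)) (shift (shift D interval) (cube (n - 1))) (\<lambda>K. Res D (coord_func n i K))"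
proof -
  note reg = pder_reg[OF D]
  note N = small_cube[OF reg, of n] and I = small_interval[OF reg] and M = small_cube[OF reg, of "n - 1"]
  note sN = shift_sfun[OF reg N] and sM = shift_sfun[OF reg M] and sI = shift_sfun[OF reg I]
  note tN = shift_snt[OF reg N] and tM = shift_snt[OF reg M] and tI = shift_snt[OF reg I]
  have A: "e \<in> Arr interval \<Longrightarrow> \<exists>b c. e = Pair b c \<and> b \<in> Obj interval \<and> c \<in> Obj interval"
    "g \<in> Arr (cube m) \<Longrightarrow> \<exists>x y. g = Pair x y \<and> x \<in> Obj (cube m) \<and> y \<in> Obj (cube m)" for e g :: "'k el" and m
    using arr_hom[of e interval] arr_hom[of g "cube m"] by (auto simp: cube_hom interval_hom)
  show ?thesis
  proof (rule strict_sys_res[where S = "\<lambda>K. cube n \<times>\<^sub>c K" and T = "\<lambda>K. interval \<times>\<^sub>c (cube (n - 1) \<times>\<^sub>c K)"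
        and SF = "\<lambda>u. id_func (cube n) \<times>\<^sub>f u" and TF = "\<lambda>u. id_func interval \<times>\<^sub>f id_func (cube (n - 1)) \<times>\<^sub>f u"
        and SN = "cat_times_ntrans (cube n)" and TN = "\<lambda>\<alpha>. cat_times_ntrans interval (cat_times_ntrans (cube (n - 1)) \<alpha>)",
        OF D]; (unfold shift_sel)?; (rule refl sN tN(1))?; assumption?)
    fix u v :: "'k sfunc" and A B K :: "'k scat" and \<alpha>
    show "sfun u A B \<Longrightarrow> sfun (id_func interval \<times>\<^sub>f id_func (cube (n - 1)) \<times>\<^sub>f u)
        (interval \<times>\<^sub>c cube (n - 1) \<times>\<^sub>c A) (interval \<times>\<^sub>c cube (n - 1) \<times>\<^sub>c B)" by (rule sI[OF sM])
    show "snt \<alpha> u v A B \<Longrightarrow> snt (cat_times_ntrans interval (cat_times_ntrans (cube (n - 1)) \<alpha>))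
        (id_func interval \<times>\<^sub>f id_func (cube (n - 1)) \<times>\<^sub>f u) (id_func interval \<times>\<^sub>f id_func (cube (n - 1)) \<times>\<^sub>f v)
        (interval \<times>\<^sub>c cube (n - 1) \<times>\<^sub>c A) (interval \<times>\<^sub>c cube (n - 1) \<times>\<^sub>c B)" by (rule tI(1)[OF tM(1)])
    show "small_cat K \<Longrightarrow> sfun (coord_func n i K) (interval \<times>\<^sub>c cube (n - 1) \<times>\<^sub>c K) (cube n \<times>\<^sub>c K)"
      by (rule sfun_coord[OF reg])
  next
    fix u :: "'k sfunc" and A B assume u: "sfun u A B"
    note U = sfunD[OF u] and a = fun_arr[OF sfunD(1)[OF sfun_coord[OF reg]]]
    show "(id_func (cube n) \<times>\<^sub>f u) \<circ>\<^sub>f coord_func n i A =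
        coord_func n i B \<circ>\<^sub>f (id_func interval \<times>\<^sub>f id_func (cube (n - 1)) \<times>\<^sub>f u)"
    proof (rule func_eqI[OF fun_on_comp[OF sfunD(1)[OF sfun_coord[OF reg U(2)]] sfunD(1)[OF sN[OF u]]]
          fun_on_comp[OF sfunD(1)[OF sI[OF sM[OF u]]] sfunD(1)[OF sfun_coord[OF reg U(3)]]]])
      fix x assume "x \<in> Obj (interval \<times>\<^sub>c cube (n - 1) \<times>\<^sub>c A)"
      then show "FO ((id_func (cube n) \<times>\<^sub>f u) \<circ>\<^sub>f coord_func n i A) x =
          FO (coord_func n i B \<circ>\<^sub>f (id_func interval \<times>\<^sub>f id_func (cube (n - 1)) \<times>\<^sub>f u)) x"
        using U fun_obj[OF U(1)] by (auto elim!: prod_cat_objE simp: coord_func_def insert_coord_obj[simplified])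
    next
      fix f assume f: "f \<in> Arr (interval \<times>\<^sub>c cube (n - 1) \<times>\<^sub>c A)"
      then obtain e g h where g: "f = Pair e (Pair g h)" "e \<in> Arr interval" "g \<in> Arr (cube (n - 1))" "h \<in> Arr A"
        by (auto elim!: prod_cat_arrE)
      show "FM ((id_func (cube n) \<times>\<^sub>f u) \<circ>\<^sub>f coord_func n i A) f =
          FM (coord_func n i B \<circ>\<^sub>f (id_func interval \<times>\<^sub>f id_func (cube (n - 1)) \<times>\<^sub>f u)) f"
        using f g U fun_arr[OF U(1)] a[OF U(2) f] by (simp add: coord_func_def)
    qed
  next
    fix \<alpha> and u v :: "'k sfunc" and A B x
    assume al: "snt \<alpha> u v A B" and x: "x \<in> Obj (interval \<times>\<^sub>c cube (n - 1) \<times>\<^sub>c A)"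
    then obtain b y a where y: "x = Pair b (Pair y a)" "b \<in> Obj interval" "y \<in> Obj (cube (n - 1))" "a \<in> Obj A"
      by (auto elim!: prod_cat_objE)
    have "Pair b b \<in> Arr interval" "Pair y y \<in> Arr (cube (n - 1))" "Cmp \<alpha> a \<in> Arr B"
      using in_homD(1)[OF id_hom[OF small_cat_is_cat[OF I] y(2)]] in_homD(1)[OF id_hom[OF small_cat_is_cat[OF M] y(3)]]
        in_homD(1)[OF nt_hom[OF sntD(1)[OF al] y(4)]] by simp_all
    then show "Cmp (cat_times_ntrans (cube n) \<alpha>) (FO (coord_func n i A) x) =
        FM (coord_func n i B) (Cmp (cat_times_ntrans interval (cat_times_ntrans (cube (n - 1)) \<alpha>)) x)"
      using y tN(2)[OF al insert_coord_obj[OF y(2,3)] y(4)] tM(2)[OF al y(3,4)] tI(2)[OF tM(1)[OF al] y(2)]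
      by (simp add: coord_func_def)
  qed
qed

end

text \<open>Cut the list at positions i - 1 and j - 2 into p, q, r; both sides are then p, b, q, b,
  r. The bound on j ensures that the second cut lies within the list.\<close>

lemma insert_coord_swap:
  assumes ij: "1 \<le> i" "i < j" and l: "j \<le> length (the_vec x) + 2"
  shows "insert_coord j b (insert_coord i b x) = insert_coord i b (insert_coord (j - 1) b x)"
proof -
  \<comment> \<open>The middle piece has length j - 1 - i, written \<open>j - Suc i\<close>: the
    distance between the cuts at i - 1 and j - 2.\<close>
  define p q r where "p = take (i - 1) (the_vec x)" and "q = take (j - Suc i) (drop (i - 1) (the_vec x))"
    and "r = drop (j - Suc i) (drop (i - 1) (the_vec x))"
  have x: "the_vec x = p @ q @ r" unfolding p_def q_def r_def by (simp only: append_take_drop_id)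
  have "i - 1 = length p" "j - 1 = Suc (length p + length q)" "j - 1 - 1 = length p + length q"
    using ij l by (auto simp: p_def q_def)
  then show ?thesis by (simp add: insert_coord_def x)
qed

context ptd_der
begin

section \<open>Faces, cylinders and cones of cubes\<close>

abbreviation "coord n i \<equiv> strict_dmor (shift D (cube n)) (\<lambda>K. Res D (coord_func n i K))"
abbreviation "split n i \<equiv> strict_dmor (shift (shift D interval) (cube (n - 1))) (\<lambda>K. Res D (split_func n i K))"
abbreviation "cyl_at n i \<equiv> split n i \<circ>\<^sub>d shift_dmor cyl (cube (n - 1))"
abbreviation "face_at n i \<equiv> shift_dmor ev1 (cube (n - 1)) \<circ>\<^sub>d coord n i"

lemmas cubeP = pder_shift[OF P small_cube[OF reg]]
  and intP = pder_shift[OF pder_shift[OF P small_interval[OF reg]] small_cube[OF reg]]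

text \<open>Both directions are recorded: the reindexing is a factor of the left adjoint in the
  adjunction for the cone, and of the right adjoint in the one for the face.\<close>

lemma coord_dadj:
  assumes i: "1 \<le> i" "i \<le> n"
  shows "dadj (shift D (cube n)) (shift (shift D interval) (cube (n - 1))) (coord n i) (split n i)
      (\<lambda>K. VId (shift D (cube n)) K)"
    "dadj (shift (shift D interval) (cube (n - 1))) (shift D (cube n)) (split n i) (coord n i)
      (\<lambda>K. VId (shift (shift D interval) (cube (n - 1))) K)"
proof -
  note S = coord_sys[OF i P]
  note c = sfun_coord[OF i reg] and s = sfun_split[OF i reg]
  have f: "fun_on (Res D (split_func n i K)) (Val (shift (shift D interval) (cube (n - 1))) K) (Val (shift D (cube n)) K)"
    if "small_cat K" for K using R[OF s[OF that]] by simp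
  have 1: "Res D (split_func n i K) \<circ>\<^sub>f Res D (coord_func n i K) = id_func (Val (shift D (cube n)) K)" if K: "small_cat K" for K
    using res_comp[OF P s[OF K] c[OF K]] coord_split[OF i reg K] res_id[OF P sfunD(2)[OF s[OF K]]] by simp
  have 2: "Res D (coord_func n i K) \<circ>\<^sub>f Res D (split_func n i K) = id_func (Val (shift (shift D interval) (cube (n - 1))) K)"
    if K: "small_cat K" for K
    using res_comp[OF P c[OF K] s[OF K]] split_coord[OF i reg K] res_id[OF P sfunD(2)[OF c[OF K]]] by simp
  note T = strict_sys_inverse[OF cubeP intP S f 1 2]
  show "dadj (shift D (cube n)) (shift (shift D interval) (cube (n - 1))) (coord n i) (split n i)
      (\<lambda>K. VId (shift D (cube n)) K)" by (rule dadj_strict_inverse[OF cubeP intP S T 1 2])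
  show "dadj (shift (shift D interval) (cube (n - 1))) (shift D (cube n)) (split n i) (coord n i)
      (\<lambda>K. VId (shift (shift D interval) (cube (n - 1))) K)"
    by (rule dadj_strict_inverse[OF intP cubeP T S 2 1])
qed

text \<open>The adjunctions for the interval pass to the parameters [1]^(n-1) by
  \<open>dadj_shift\<close> and are composed with the reindexing of coordinate i.\<close>

lemma cone_at_adj:
  assumes i: "1 \<le> i" "i \<le> n"
  shows "\<exists>\<theta>. dadj (shift D (cube n)) (shift D (cube (n - 1))) (cone_at D n i) (cyl_at n i) \<theta>"
    "\<exists>\<theta>. dadj (shift D (cube (n - 1))) (shift D (cube n)) (cyl_at n i) (face_at n i) \<theta>"
proof -
  note PI = pder_shift[OF P small_interval[OF reg]] and N = small_cube[OF reg, of "n - 1"]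
  obtain \<theta> where "dadj (shift D interval) D (cone D) cyl \<theta>" using cone_cyl by blast
  from dadj_comp[OF cubeP intP cubeP coord_dadj(1)[OF i] dadj_shift[OF PI this P N]]
  show "\<exists>\<theta>. dadj (shift D (cube n)) (shift D (cube (n - 1))) (cone_at D n i) (cyl_at n i) \<theta>"
    unfolding cone_at_def by blast
  obtain \<theta>' where "dadj D (shift D interval) cyl ev1 \<theta>'" using cyl_ev1 by blast
  from dadj_comp[OF cubeP intP cubeP dadj_shift[OF P this PI N] coord_dadj(2)[OF i]]
  show "\<exists>\<theta>. dadj (shift D (cube (n - 1))) (shift D (cube n)) (cyl_at n i) (face_at n i) \<theta>" by blast
qed

lemma sdm_face_at:
  assumes i: "1 \<le> i" "i \<le> n"
  shows "sdm (shift D (cube n)) (shift D (cube (n - 1))) (face_at n i)"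
  by (rule sdm_comp[OF cubeP intP cubeP sdm_strict[OF cubeP intP coord_sys[OF i P]]
      sdm_shift[OF pder_shift[OF P small_interval[OF reg]] sdm_ev1 small_cube[OF reg]]])

text \<open>The face d_i of the overview, times K.\<close>

abbreviation "face n i K \<equiv> coord_func n i K \<circ>\<^sub>f slot interval (Bit True) (cube (n - 1) \<times>\<^sub>c K)"

lemma face_at_cpt:
  fixes K :: "'k scat"
  assumes i: "1 \<le> i" "i \<le> n" and K: "small_cat K"
  shows "sfun (face n i K) (cube (n - 1) \<times>\<^sub>c K) (cube n \<times>\<^sub>c K)" "Cpt (face_at n i) K = Res D (face n i K)"
proof -
  note L = small_cat_prod[OF reg small_cube[OF reg] K, of "n - 1"]
  have s: "sfun (slot interval (Bit True) (cube (n - 1) \<times>\<^sub>c K)) (cube (n - 1) \<times>\<^sub>c K) (interval \<times>\<^sub>c (cube (n - 1) \<times>\<^sub>c K))"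
    by (rule sfun_slot[OF reg small_interval[OF reg] _ L]) (simp add: interval_obj)
  note c = sfun_coord[OF i reg K]
  show "sfun (face n i K) (cube (n - 1) \<times>\<^sub>c K) (cube n \<times>\<^sub>c K)" by (rule sfun_comp[OF s c])
  show "Cpt (face_at n i) K = Res D (face n i K)" using ev1_cpt[OF L] res_comp[OF P s c] by simp
qed

lemma face_app:
  fixes K :: "'k scat"
  assumes i: "1 \<le> i" "i \<le> n" and K: "small_cat K"
  shows "y \<in> Obj (cube (n - 1)) \<Longrightarrow> k \<in> Obj K \<Longrightarrow> FO (face n i K) (Pair y k) = Pair (insert_coord i (Bit True) y) k"
    "Pair y z \<in> Arr (cube (n - 1)) \<Longrightarrow> h \<in> Arr K \<Longrightarrow>
      FM (face n i K) (Pair (Pair y z) h) = Pair (Pair (insert_coord i (Bit True) y) (insert_coord i (Bit True) z)) h"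
proof -
  have t: "Bit True \<in> Obj (interval :: 'k scat)" by (simp add: interval_obj)
  have "Pair (Bit True) (Bit True) \<in> Arr (interval :: 'k scat)"
    using in_homD(1)[OF id_hom[OF interval_cat(1) t]] by simp
  then show "y \<in> Obj (cube (n - 1)) \<Longrightarrow> k \<in> Obj K \<Longrightarrow> FO (face n i K) (Pair y k) = Pair (insert_coord i (Bit True) y) k"
    "Pair y z \<in> Arr (cube (n - 1)) \<Longrightarrow> h \<in> Arr K \<Longrightarrow>
      FM (face n i K) (Pair (Pair y z) h) = Pair (Pair (insert_coord i (Bit True) y) (insert_coord i (Bit True) z)) h"
    using t by (simp_all add: slot_def coord_func_def)
qed

text \<open>The cubical identity d_j d_i = d_i d_(j-1) for i < j, which is
  \<open>insert_coord_swap\<close> on vertices and on the two ends of each arrow. Restriction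
  reverses the order of the factors.\<close>

lemma face_swap:
  fixes K :: "'k scat"
  assumes K: "small_cat K" and ij: "1 \<le> i" "i < j" "j \<le> n"
  shows "face n j K \<circ>\<^sub>f face (n - 1) i K = face n i K \<circ>\<^sub>f face (n - 1) (j - 1) K"
proof -
  have b: "1 \<le> j" "j \<le> n" "i \<le> n - 1" "i \<le> n" "1 \<le> j - 1" "j - 1 \<le> n - 1" using ij by auto
  note s = face_at_cpt(1)[OF b(1,2) K] face_at_cpt(1)[OF ij(1) b(3) K] face_at_cpt(1)[OF ij(1) b(4) K]
    face_at_cpt(1)[OF b(5,6) K]
  note f = fun_on_comp[OF sfunD(1)[OF s(2)] sfunD(1)[OF s(1)]] and g = fun_on_comp[OF sfunD(1)[OF s(4)] sfunD(1)[OF s(3)]]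
  note o = face_app(1)[OF b(1,2) K] face_app(1)[OF ij(1) b(3) K] face_app(1)[OF ij(1) b(4) K] face_app(1)[OF b(5,6) K]
  note a = face_app(2)[OF b(1,2) K] face_app(2)[OF ij(1) b(3) K] face_app(2)[OF ij(1) b(4) K] face_app(2)[OF b(5,6) K]
  have sw: "insert_coord j (Bit True) (insert_coord i (Bit True) y) = insert_coord i (Bit True) (insert_coord (j - 1) (Bit True) y)"
    if "y \<in> Obj (cube (n - 1 - 1))" for y :: "'k el"
    using that ij by (intro insert_coord_swap[OF ij(1,2)]) (auto simp: cube_obj)
  show ?thesis
  proof (rule func_eqI[OF f g])
    fix x assume x: "x \<in> Obj (cube (n - 1 - 1) \<times>\<^sub>c K)"
    then obtain y k where y: "x = Pair y k" "y \<in> Obj (cube (n - 1 - 1))" "k \<in> Obj K" by (rule prod_cat_objE)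
    note c = fun_obj[OF sfunD(1)[OF s(2)] x] fun_obj[OF sfunD(1)[OF s(4)] x]
    show "FO (face n j K \<circ>\<^sub>f face (n - 1) i K) x = FO (face n i K \<circ>\<^sub>f face (n - 1) (j - 1) K) x"
      unfolding comp_func_app(1)[OF sfunD(1)[OF s(2)] x] comp_func_app(1)[OF sfunD(1)[OF s(4)] x]
      using c y(1) unfolding y(1) o(2)[OF y(2,3)] o(4)[OF y(2,3)] prod_cat_obj
      using o(1)[OF _ y(3)] o(3)[OF _ y(3)] sw[OF y(2)] by (elim conjE) (simp only:)
  next
    fix h assume h: "h \<in> Arr (cube (n - 1 - 1) \<times>\<^sub>c K)"
    then obtain g k where g: "h = Pair g k" "g \<in> Arr (cube (n - 1 - 1))" "k \<in> Arr K" by (rule prod_cat_arrE)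
    obtain y z where y: "g = Pair y z" "y \<in> Obj (cube (n - 1 - 1))" "z \<in> Obj (cube (n - 1 - 1))"
      using arr_hom[OF g(2)] by (auto simp: cube_hom)
    note g' = g(2)[unfolded y(1)]
    note c = fun_arr[OF sfunD(1)[OF s(2)] h] fun_arr[OF sfunD(1)[OF s(4)] h]
    show "FM (face n j K \<circ>\<^sub>f face (n - 1) i K) h = FM (face n i K \<circ>\<^sub>f face (n - 1) (j - 1) K) h"
      unfolding comp_func_app(2)[OF sfunD(1)[OF s(2)] arr_hom[OF h]] comp_func_app(2)[OF sfunD(1)[OF s(4)] arr_hom[OF h]]
      using c unfolding g(1) y(1) a(2)[OF g' g(3)] a(4)[OF g' g(3)] prod_cat_arr
      using a(1)[OF _ g(3)] a(3)[OF _ g(3)] sw[OF y(2)] sw[OF y(3)] by (elim conjE) (simp only:)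
  qed
qed

lemma cone_swap:
  assumes ij: "1 \<le> i" "i < j" "j \<le> n"
  shows "isomorphic_dmor (shift D (cube n)) (shift D (cube (n - 2)))
    (cone_at D (n - 1) i \<circ>\<^sub>d cone_at D n j) (cone_at D (n - 1) (j - 1) \<circ>\<^sub>d cone_at D n i)"
proof -
  have b: "1 \<le> j" "j \<le> n" "i \<le> n - 1" "i \<le> n" "1 \<le> j - 1" "j - 1 \<le> n - 1" using ij by auto
  let ?A = "shift D (cube n)" and ?B = "shift D (cube (n - 1))" and ?C = "shift D (cube (n - 1 - 1))"
  note AB = cubeP[of n] cubeP[of "n - 1"] cubeP[of "n - 1 - 1"]
  have ex: "\<exists>\<theta> \<theta>'. dadj ?A ?C (cone_at D (n - 1) k \<circ>\<^sub>d cone_at D n l) (cyl_at n l \<circ>\<^sub>d cyl_at (n - 1) k) \<theta> \<and>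
      dadj ?C ?A (cyl_at n l \<circ>\<^sub>d cyl_at (n - 1) k) (face_at (n - 1) k \<circ>\<^sub>d face_at n l) \<theta>'"
    if l: "1 \<le> l" "l \<le> n" and k: "1 \<le> k" "k \<le> n - 1" for k l
  proof -
    obtain t1 t2 t3 t4 where t: "dadj ?A ?B (cone_at D n l) (cyl_at n l) t1"
      "dadj ?B ?C (cone_at D (n - 1) k) (cyl_at (n - 1) k) t2"
      "dadj ?B ?A (cyl_at n l) (face_at n l) t3" "dadj ?C ?B (cyl_at (n - 1) k) (face_at (n - 1) k) t4"
      using cone_at_adj[OF l] cone_at_adj[OF k] by blast
    show ?thesis using dadj_comp[OF AB t(1,2)] dadj_comp[OF AB(3,2,1) t(4,3)] by blast
  qed
  have fs: "sdm ?A ?C (face_at (n - 1) k \<circ>\<^sub>d face_at n l)"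
    if l: "1 \<le> l" "l \<le> n" and k: "1 \<le> k" "k \<le> n - 1" for k l
    by (rule sdm_comp[OF AB sdm_face_at[OF l] sdm_face_at[OF k]])
  obtain \<theta>1 \<theta>2 where 1: "dadj ?A ?C (cone_at D (n - 1) i \<circ>\<^sub>d cone_at D n j) (cyl_at n j \<circ>\<^sub>d cyl_at (n - 1) i) \<theta>1"
    "dadj ?C ?A (cyl_at n j \<circ>\<^sub>d cyl_at (n - 1) i) (face_at (n - 1) i \<circ>\<^sub>d face_at n j) \<theta>2"
    using ex[OF b(1,2) ij(1) b(3)] by blast
  obtain \<theta>3 \<theta>4 where 2: "dadj ?A ?C (cone_at D (n - 1) (j - 1) \<circ>\<^sub>d cone_at D n i) (cyl_at n i \<circ>\<^sub>d cyl_at (n - 1) (j - 1)) \<theta>3"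
    "dadj ?C ?A (cyl_at n i \<circ>\<^sub>d cyl_at (n - 1) (j - 1)) (face_at (n - 1) (j - 1) \<circ>\<^sub>d face_at n i) \<theta>4"
    using ex[OF ij(1) b(4,5,6)] by blast
  have "Cpt (face_at (n - 1) (j - 1) \<circ>\<^sub>d face_at n i) K = Cpt (face_at (n - 1) i \<circ>\<^sub>d face_at n j) K" if K: "small_cat K" for K
    unfolding comp_dmor_cpt[of "face_at (n - 1) k" "face_at n l" for k l]
      face_at_cpt(2)[OF b(1,2) K] face_at_cpt(2)[OF ij(1) b(3) K] face_at_cpt(2)[OF ij(1) b(4) K] face_at_cpt(2)[OF b(5,6) K]
      res_comp[OF P face_at_cpt(1)[OF b(5,6) K] face_at_cpt(1)[OF ij(1) b(4) K], symmetric]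
      res_comp[OF P face_at_cpt(1)[OF ij(1) b(3) K] face_at_cpt(1)[OF b(1,2) K], symmetric]
      face_swap[OF K ij] ..
  \<comment> \<open>The composites of face restrictions have equal components but are built
    differently; the identities compare them.\<close>
  note m = sdm_modi[OF AB(1,3) fs[OF ij(1) b(4,5,6)] fs[OF b(1,2) ij(1) b(3)] this]
  \<comment> \<open>Now both composites of \<open>cyl_at\<close> are left adjoints of the same
    composite of faces.\<close>
  note a = dadj_iso_right[OF AB(3,1) 2(2) sdmD(1)[OF fs[OF b(1,2) ij(1) b(3)]] m]
  obtain \<psi> where p: "modi ?C ?A (cyl_at n i \<circ>\<^sub>d cyl_at (n - 1) (j - 1)) (cyl_at n j \<circ>\<^sub>d cyl_at (n - 1) i) \<psi>"
    using dadj_unique[OF AB(3,1) a 1(2)] by blast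
  \<comment> \<open>One level up: the isomorphism of the \<open>cyl_at\<close> composites makes both
    composites of cones left adjoints of the same morphism.\<close>
  note c = dadj_iso_right[OF AB(1,3) 2(1) dadjD(2)[OF 1(1)] p]
  obtain \<chi> where "modi ?A ?C (cone_at D (n - 1) i \<circ>\<^sub>d cone_at D n j) (cone_at D (n - 1) (j - 1) \<circ>\<^sub>d cone_at D n i) \<chi>"
    using dadj_unique[OF AB(1,3) 1(1) c] by blast
  from modi_isomorphic[OF AB(1,3) dadjD(1)[OF 1(1)] dadjD(1)[OF 2(1)] this]
  \<comment> \<open>The composites end at dimension n - 1 - 1, which is rewritten to n - 2.\<close>
  show ?thesis by (simp add: diff_diff_left numeral_2_eq_2)
qed

end

theorem corollary8p15:
  fixes D :: "('k, 'o, 'm) prederiv" and n i j :: nat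
  assumes "regular_universe TYPE('k)"
    and "derivator D" and "pointed D"
    and "1 \<le> i" and "i < j" and "j \<le> n"
  shows "isomorphic_dmor (shift D (cube n)) (shift D (cube (n - 2)))
           (cone_at D (n - 1) i \<circ>\<^sub>d cone_at D n j)
           (cone_at D (n - 1) (j - 1) \<circ>\<^sub>d cone_at D n i)"
  by (rule ptd_der.cone_swap[OF ptd_der.intro assms(4-6)]) (use assms in \<open>simp_all add: der_def\<close>)

end
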